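(* Let $H$ be a quasi-Hopf algebra over a field $k$ with bijective antipode, let $\mathbf A\in{}^H_H\mathcal{YD}$ be the Yetter-Drinfeld module described in the context (with underlying vector space $H$), and let $\mathrm{CF}(H):=\mathrm{Hom}_H(\mathbf A,k)$, where $k$ is the trivial left $H$-module. Then the vector space $\mathrm{CF}(H)$ is an algebra with respect to the multiplication $\star$ given by $$\langle\xi\star\zeta,a\rangle=\langle\xi,\ \phi_1\overline\phi_{1(1)}a_{(1)}\overline{\mathbf f}_1S(\overline\phi_3)\rangle\,\langle\zeta,\ \phi_2\overline\phi_{1(2)}a_{(2)}\overline{\mathbf f}_2S(\phi_3\overline\phi_2)\rangle$$ for $\xi,\zeta\in\mathrm{CF}(H)$ and $a\in\mathbf A$. The algebra $\mathrm{CF}(H)$ is isomorphic to the endomorphism algebra of the Yetter-Drinfeld $H$-module $\mathbf A$.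
   Context: Conventions. $k$ is a field, $\otimes=\otimes_k$. For a $k$-algebra $A$, $x\in A^{\otimes n}$ is written $x=x_1\otimes\cdots\otimes x_n$ (summation understood), $x^{-1}=\overline x_1\otimes\cdots\otimes\overline x_n$ if invertible. Algebras are associative and unital. A quasi-Hopf algebra is $(H,\Delta,\epsilon,\phi,S,\alpha,\beta)$ with $H$ a $k$-algebra, algebra maps $\Delta:H\to H\otimes H$ ($\Delta(h)=h_{(1)}\otimes h_{(2)}$), $\epsilon:H\to k$, an invertible $\phi\in H^{\otimes3}$, an anti-algebra map $S$ and $\alpha,\beta\in H$ such that for all $h$: $h_{(1)}\otimes\Delta(h_{(2)})=\phi(\Delta(h_{(1)})\otimes h_{(2)})\phi^{-1}$; $\epsilon(h_{(1)})h_{(2)}=h=h_{(1)}\epsilon(h_{(2)})$; $(\mathrm{id}\otimes\mathrm{id}\otimes\Delta)(\phi)(\Delta\otimes\mathrm{id}\otimes\mathrm{id})(\phi)=(1\otimes\phi)(\mathrm{id}\otimes\Delta\otimes\mathrm{id})(\phi)(\phi\otimes1)$; $(\mathrm{id}\otimes\epsilon\otimes\mathrm{id})(\phi)=1\otimes1$; $S(h_{(1)})\alpha h_{(2)}=\epsilon(h)\alpha$, $h_{(1)}\beta S(h_{(2)})=\epsilon(h)\beta$; $\phi_1\beta S(\phi_2)\alpha\phi_3=1=S(\overline\phi_1)\alpha\overline\phi_2\beta S(\overline\phi_3)$; and (standing) $\epsilon(\alpha)=\epsilon(\beta)=1$. $\overline S=S^{-1}$. $\Delta(h_{(1)})\otimes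 h_{(2)}=h_{(1,1)}\otimes h_{(1,2)}\otimes h_{(2)}$; $\Delta^{\mathrm{cop}}(h)=h_{(2)}\otimes h_{(1)}$. Elements: $p^R=\overline\phi_1\otimes\overline\phi_2\beta S(\overline\phi_3)$; $\mathbf a=S(\overline\phi_1\phi_2)\alpha\overline\phi_2\phi_{3(1)}\otimes S(\phi_1)\alpha\overline\phi_3\phi_{3(2)}$; $\mathbf f=(S\otimes S)(\Delta^{\mathrm{cop}}(p^R_1))\cdot\mathbf a\cdot\Delta(p^R_2)$ (invertible); $\chi=(\phi\otimes1)(\Delta\otimes\mathrm{id}\otimes\mathrm{id})(\phi^{-1})$; $\omega=(1\otimes1\otimes1\otimes\overline{\mathbf f}_2\otimes\overline{\mathbf f}_1)(\mathrm{id}\otimes\Delta\otimes S\otimes S)(\chi)(\phi\otimes1\otimes1)\in H^{\otimes5}$. An object of ${}^H_H\mathcal{YD}$ (Yetter-Drinfeld module, of the second kind) is a left $H$-module $V$ with a linear map $\delta_V:V\to H\otimes V$, $v\mapsto v_{[-1]}\otimes v_{[0]}$, satisfying $v_{[-1]}\otimes v_{[0][-1]}\otimes v_{[0][0]}=\omega_1(v_{[-1]})_{(1)}\omega_5\otimes\omega_2(v_{[-1]})_{(2)}\omega_4\otimes\omega_3v_{[0]}$, $\epsilon(v_{[-1]})v_{[0]}=v$, $\delta_V(hv)=h_{(1,1)}v_{[-1]}S(h_{(2)})\otimes h_{(1,2)}v_{[0]}$; morphisms are linear maps preserving action and coaction. $\mathbf A$ is the vector space $H$ with the action $h\triangleright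 a=h_{(1)}aS(h_{(2)})$ and the coaction $\delta_{\mathbf A}(a)=\phi_1\overline\phi_{1(1)}a_{(1)}\overline{\mathbf f}_1S(\overline\phi_3)\otimes\phi_2\overline\phi_{1(2)}a_{(2)}\overline{\mathbf f}_2S(\phi_3\overline\phi_2)$. Equivalently $\mathbf A=R(k)$, where $R$ is the right adjoint of the forgetful functor ${}^H_H\mathcal{YD}\to{}_H\mathcal M$. *)

theory Defs
  imports Complex_Main "HOL-Library.Function_Algebras"
begin

text \<open>
  The type variables 'a, 'b, 'h, ... carry vector spaces over the field type 'k, with explicit scalar
  multiplications.  A tensor product of n spaces is described by the predicate L singling out the
  multilinear forms among all functions from the n-fold product type to 'k: \<open>linear_form s\<close> for
  one factor, and \<open>mlin_form s L\<close> for one more factor on the left.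

  The pure tensor of x is the evaluation at x of multilinear forms, and the tensor product is the
  set of all finite sums of pure tensors; this is the embedding of the tensor product of A and B in
  the dual of Bil(A,B;k).  Since 'k is a field it is injective, i.e. this is the usual tensor
  product: its universal property is \<open>tsum_sum_list\<close> below.  Functionals are extended by 0 to
  functions that are not multilinear, so that equality of tensors is equality in HOL.
\<close>

definition linear_form :: "('k::field \<Rightarrow> 'a::ab_group_add \<Rightarrow> 'a) \<Rightarrow> ('a \<Rightarrow> 'k) \<Rightarrow> bool" where
  "linear_form s f \<longleftrightarrow> Vector_Spaces.linear s (*) f"

definition mlin_form :: "('k::field \<Rightarrow> 'a::ab_group_add \<Rightarrow> 'a) \<Rightarrow> (('x \<Rightarrow> 'k) \<Rightarrow> bool) \<Rightarrow>
    ('a \<times> 'x \<Rightarrow> 'k) \<Rightarrow> bool" where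
  "mlin_form s L f \<longleftrightarrow> (\<forall>x. linear_form s (\<lambda>a. f (a, x))) \<and> (\<forall>a. L (\<lambda>x. f (a, x)))"

definition pten :: "(('x \<Rightarrow> 'k::field) \<Rightarrow> bool) \<Rightarrow> 'x \<Rightarrow> (('x \<Rightarrow> 'k) \<Rightarrow> 'k)" where
  "pten L x = (\<lambda>f. if L f then f x else 0)"

definition tprod :: "(('x \<Rightarrow> 'k::field) \<Rightarrow> bool) \<Rightarrow> (('x \<Rightarrow> 'k) \<Rightarrow> 'k) set" where
  "tprod L = range (\<lambda>xs. \<Sum>x\<leftarrow>xs. pten L x)"

text \<open>
  Sweedler-type sums: \<open>tsum L T (\<lambda>(x, y). F x y)\<close> is the sum of the values of F over a
  representation of T as a sum of pure tensors, written in the literature as F applied to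
  the components of T, summation understood.  It is only used for multilinear F, where it does not
  depend on the representation.
\<close>

definition tsum :: "(('x \<Rightarrow> 'k::field) \<Rightarrow> bool) \<Rightarrow> (('x \<Rightarrow> 'k) \<Rightarrow> 'k) \<Rightarrow> ('x \<Rightarrow> 'w::comm_monoid_add) \<Rightarrow> 'w" where
  "tsum L T F = (\<Sum>x\<leftarrow>(SOME xs. T = (\<Sum>x\<leftarrow>xs. pten L x)). F x)"

definition fscale :: "('k \<Rightarrow> 'b \<Rightarrow> 'b) \<Rightarrow> 'k \<Rightarrow> ('a \<Rightarrow> 'b) \<Rightarrow> ('a \<Rightarrow> 'b)" where
  "fscale s c f = (\<lambda>x. s c (f x))"

abbreviation tscale :: "'k::field \<Rightarrow> ('f \<Rightarrow> 'k) \<Rightarrow> ('f \<Rightarrow> 'k)" where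
  "tscale \<equiv> fscale (*)"

lemma vector_space_fscale:
  assumes "vector_space s"
  shows "vector_space (fscale s)"
proof -
  interpret vector_space s by fact
  show ?thesis
    by unfold_locales (simp_all add: fscale_def fun_eq_iff scale_right_distrib scale_left_distrib)
qed

lemma vector_space_mult: "vector_space ((*) :: 'k::field \<Rightarrow> 'k \<Rightarrow> 'k)"
  by unfold_locales (simp_all add: algebra_simps)

lemma linear_forms_separate:
  assumes "vector_space s" and "\<And>g. linear_form s g \<Longrightarrow> g v = g w"
  shows "v = w"
proof (rule ccontr)
  assume "v \<noteq> w"
  interpret vs: vector_space s by fact
  interpret p: vector_space_pair s "(*)"
    by (rule vector_space_pair.intro[OF assms(1) vector_space_mult])
  have "vs.independent {v - w}" using \<open>v \<noteq> w\<close> by simp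
  from p.linear_independent_extend[OF this, of "\<lambda>_. 1"]
  obtain g where g: "Vector_Spaces.linear s (*) g" "g (v - w) = 1" by auto
  then interpret g: Vector_Spaces.linear s "(*)" g by simp
  show False using assms(2)[of g] g by (simp add: linear_form_def g.diff)
qed

lemma sum_list_pten: "L f \<Longrightarrow> (\<Sum>x\<leftarrow>xs. pten L x) f = (\<Sum>x\<leftarrow>xs. f x)"
  by (induction xs) (simp_all add: pten_def)

text \<open>The universal property.  Its hypothesis on F says that F is multilinear with values in the
  vector space 'w, tested against the linear forms on 'w.\<close>

lemma tsum_sum_list:
  fixes F :: "'x \<Rightarrow> 'w::ab_group_add"
  assumes "vector_space s" and "\<And>g. linear_form s g \<Longrightarrow> L (\<lambda>x. g (F x))"
  shows "tsum L (\<Sum>x\<leftarrow>xs. pten L x) F = (\<Sum>x\<leftarrow>xs. F x)"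
proof -
  define ys where "ys = (SOME ys. (\<Sum>x\<leftarrow>xs. pten L x) = (\<Sum>x\<leftarrow>ys. pten L x))"
  have ys: "(\<Sum>x\<leftarrow>xs. pten L x) = (\<Sum>x\<leftarrow>ys. pten L x)"
    unfolding ys_def by (rule someI[of _ xs]) simp
  have "(\<Sum>x\<leftarrow>ys. F x) = (\<Sum>x\<leftarrow>xs. F x)"
  proof (rule linear_forms_separate[OF assms(1)])
    fix g assume g: "linear_form s g"
    then interpret g: Vector_Spaces.linear s "(*)" g by (simp add: linear_form_def)
    have *: "g (\<Sum>x\<leftarrow>zs. F x) = (\<Sum>x\<leftarrow>zs. pten L x) (\<lambda>x. g (F x))" for zs
      unfolding sum_list_pten[of L "\<lambda>x. g (F x)", OF assms(2)[OF g]]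
      by (induction zs) (simp_all add: g.add)
    show "g (\<Sum>x\<leftarrow>ys. F x) = g (\<Sum>x\<leftarrow>xs. F x)" unfolding * ys ..
  qed
  then show ?thesis unfolding tsum_def ys_def by simp
qed

text \<open>Componentwise multiplication on tuples, inducing the algebra structure on tensor powers.\<close>

instantiation prod :: (times, times) times
begin
definition times_prod_def: "x * y = (fst x * fst y, snd x * snd y)"
instance ..
end

instantiation prod :: (one, one) one
begin
definition one_prod_def: "1 = (1, 1)"
instance ..
end

definition tone :: "(('x::one \<Rightarrow> 'k::field) \<Rightarrow> bool) \<Rightarrow> (('x \<Rightarrow> 'k) \<Rightarrow> 'k)" where
  "tone L = pten L 1"

definition tmul :: "(('x::times \<Rightarrow> 'k::field) \<Rightarrow> bool) \<Rightarrow>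
    (('x \<Rightarrow> 'k) \<Rightarrow> 'k) \<Rightarrow> (('x \<Rightarrow> 'k) \<Rightarrow> 'k) \<Rightarrow> (('x \<Rightarrow> 'k) \<Rightarrow> 'k)" where
  "tmul L T U = tsum L T (\<lambda>x. tsum L U (\<lambda>y. pten L (x * y)))"

definition is_tinv :: "(('x::{times, one} \<Rightarrow> 'k::field) \<Rightarrow> bool) \<Rightarrow>
    (('x \<Rightarrow> 'k) \<Rightarrow> 'k) \<Rightarrow> (('x \<Rightarrow> 'k) \<Rightarrow> 'k) \<Rightarrow> bool" where
  "is_tinv L T U \<longleftrightarrow> U \<in> tprod L \<and> tmul L T U = tone L \<and> tmul L U T = tone L"

definition tinv :: "(('x::{times, one} \<Rightarrow> 'k::field) \<Rightarrow> bool) \<Rightarrow>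
    (('x \<Rightarrow> 'k) \<Rightarrow> 'k) \<Rightarrow> (('x \<Rightarrow> 'k) \<Rightarrow> 'k)" where
  "tinv L T = (THE U. is_tinv L T U)"

locale k_algebra = vector_space scale
  for scale :: "'k::field \<Rightarrow> 'h::ring_1 \<Rightarrow> 'h" +
  assumes scale_mult_left: "scale c (x * y) = scale c x * y"
    and scale_mult_right: "scale c (x * y) = x * scale c y"

text \<open>Associative unital algebras carried by a subspace A of an ambient vector space.\<close>

locale algebra_on = vector_space s
  for s :: "'k::field \<Rightarrow> 'a::ab_group_add \<Rightarrow> 'a" +
  fixes A :: "'a set" and mult :: "'a \<Rightarrow> 'a \<Rightarrow> 'a" and e :: 'a
  assumes subspace: "subspace A"
    and mult_closed: "\<lbrakk>x \<in> A; y \<in> A\<rbrakk> \<Longrightarrow> mult x y \<in> A"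
    and unit_closed: "e \<in> A"
    and mult_add_left: "\<lbrakk>x \<in> A; y \<in> A; z \<in> A\<rbrakk> \<Longrightarrow> mult (x + y) z = mult x z + mult y z"
    and mult_add_right: "\<lbrakk>x \<in> A; y \<in> A; z \<in> A\<rbrakk> \<Longrightarrow> mult x (y + z) = mult x y + mult x z"
    and mult_scale_left: "\<lbrakk>x \<in> A; y \<in> A\<rbrakk> \<Longrightarrow> mult (s c x) y = s c (mult x y)"
    and mult_scale_right: "\<lbrakk>x \<in> A; y \<in> A\<rbrakk> \<Longrightarrow> mult x (s c y) = s c (mult x y)"
    and mult_assoc: "\<lbrakk>x \<in> A; y \<in> A; z \<in> A\<rbrakk> \<Longrightarrow> mult (mult x y) z = mult x (mult y z)"
    and unit_left: "x \<in> A \<Longrightarrow> mult e x = x"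
    and unit_right: "x \<in> A \<Longrightarrow> mult x e = x"

definition algebra_iso ::
  "('k \<Rightarrow> 'a::ab_group_add \<Rightarrow> 'a) \<Rightarrow> 'a set \<Rightarrow> ('a \<Rightarrow> 'a \<Rightarrow> 'a) \<Rightarrow> 'a \<Rightarrow>
   ('k \<Rightarrow> 'b::ab_group_add \<Rightarrow> 'b) \<Rightarrow> 'b set \<Rightarrow> ('b \<Rightarrow> 'b \<Rightarrow> 'b) \<Rightarrow> 'b \<Rightarrow> ('a \<Rightarrow> 'b) \<Rightarrow> bool" where
  "algebra_iso s A mult e s' A' mult' e' \<Phi> \<longleftrightarrow>
     bij_betw \<Phi> A A' \<and>
     (\<forall>x\<in>A. \<forall>y\<in>A. \<Phi> (x + y) = \<Phi> x + \<Phi> y) \<and>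
     (\<forall>c. \<forall>x\<in>A. \<Phi> (s c x) = s' c (\<Phi> x)) \<and>
     (\<forall>x\<in>A. \<forall>y\<in>A. \<Phi> (mult x y) = mult' (\<Phi> x) (\<Phi> y)) \<and>
     \<Phi> e = e'"

definition module_homs :: "('k::field \<Rightarrow> 'v::ab_group_add \<Rightarrow> 'v) \<Rightarrow> ('h \<Rightarrow> 'v \<Rightarrow> 'v) \<Rightarrow>
    ('k \<Rightarrow> 'w::ab_group_add \<Rightarrow> 'w) \<Rightarrow> ('h \<Rightarrow> 'w \<Rightarrow> 'w) \<Rightarrow> ('v \<Rightarrow> 'w) set" where
  "module_homs sV act sW act' =
     {f. Vector_Spaces.linear sV sW f \<and> (\<forall>h v. f (act h v) = act' h (f v))}"

locale quasi_hopf_data = k_algebra scale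
  for scale :: "'k::field \<Rightarrow> 'h::ring_1 \<Rightarrow> 'h" +
  fixes \<Delta> :: "'h \<Rightarrow> (('h \<times> 'h \<Rightarrow> 'k) \<Rightarrow> 'k)"
    and \<epsilon> :: "'h \<Rightarrow> 'k"
    and \<phi> :: "('h \<times> 'h \<times> 'h \<Rightarrow> 'k) \<Rightarrow> 'k"
    and S :: "'h \<Rightarrow> 'h"
    and \<alpha> \<beta> :: 'h
begin

abbreviation H2 :: "('h \<times> 'h \<Rightarrow> 'k) \<Rightarrow> bool" where
  "H2 \<equiv> mlin_form scale (linear_form scale)"
abbreviation H3 :: "('h \<times> 'h \<times> 'h \<Rightarrow> 'k) \<Rightarrow> bool" where
  "H3 \<equiv> mlin_form scale H2"
abbreviation H4 :: "('h \<times> 'h \<times> 'h \<times> 'h \<Rightarrow> 'k) \<Rightarrow> bool" where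
  "H4 \<equiv> mlin_form scale H3"
abbreviation H5 :: "('h \<times> 'h \<times> 'h \<times> 'h \<times> 'h \<Rightarrow> 'k) \<Rightarrow> bool" where
  "H5 \<equiv> mlin_form scale H4"

text \<open>
  \<open>aa\<close> and \<open>ff\<close> are the elements of the second tensor power usually written in bold face a and f,
  and \<open>ffi\<close> is the inverse of the latter.  Bound variables x1, x2, x3 are the components of
  \<open>\<phi>\<close>, y1, y2, y3 those of its inverse \<open>\<phi>i\<close>, and u1, u2 those of a comultiplication.
  \<open>A_act\<close> and \<open>A_coact\<close> make 'h into the Yetter-Drinfeld module A, the value at k of the right
  adjoint of the functor forgetting coactions.
\<close>

definition \<phi>i :: "('h \<times> 'h \<times> 'h \<Rightarrow> 'k) \<Rightarrow> 'k" where
  "\<phi>i = tinv H3 \<phi>"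

definition pR :: "('h \<times> 'h \<Rightarrow> 'k) \<Rightarrow> 'k" where
  "pR = tsum H3 \<phi>i (\<lambda>(y1, y2, y3). pten H2 (y1, y2 * \<beta> * S y3))"

definition aa :: "('h \<times> 'h \<Rightarrow> 'k) \<Rightarrow> 'k" where
  "aa = tsum H3 \<phi> (\<lambda>(x1, x2, x3). tsum H3 \<phi>i (\<lambda>(y1, y2, y3). tsum H2 (\<Delta> x3) (\<lambda>(u1, u2).
     pten H2 (S (y1 * x2) * \<alpha> * y2 * u1, S x1 * \<alpha> * y3 * u2))))"

definition ff :: "('h \<times> 'h \<Rightarrow> 'k) \<Rightarrow> 'k" where
  "ff = tsum H2 pR (\<lambda>(p1, p2).
     tmul H2 (tmul H2 (tsum H2 (\<Delta> p1) (\<lambda>(u1, u2). pten H2 (S u2, S u1))) aa) (\<Delta> p2))"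

definition ffi :: "('h \<times> 'h \<Rightarrow> 'k) \<Rightarrow> 'k" where
  "ffi = tinv H2 ff"

definition \<chi> :: "('h \<times> 'h \<times> 'h \<times> 'h \<Rightarrow> 'k) \<Rightarrow> 'k" where
  "\<chi> = tmul H4 (tsum H3 \<phi> (\<lambda>(x1, x2, x3). pten H4 (x1, x2, x3, 1)))
     (tsum H3 \<phi>i (\<lambda>(y1, y2, y3). tsum H2 (\<Delta> y1) (\<lambda>(u1, u2). pten H4 (u1, u2, y2, y3))))"

definition \<omega> :: "('h \<times> 'h \<times> 'h \<times> 'h \<times> 'h \<Rightarrow> 'k) \<Rightarrow> 'k" where
  "\<omega> = tmul H5 (tmul H5
     (tsum H2 ffi (\<lambda>(g1, g2). pten H5 (1, 1, 1, g2, g1)))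
     (tsum H4 \<chi> (\<lambda>(c1, c2, c3, c4). tsum H2 (\<Delta> c2) (\<lambda>(u1, u2).
        pten H5 (c1, u1, u2, S c3, S c4)))))
     (tsum H3 \<phi> (\<lambda>(x1, x2, x3). pten H5 (x1, x2, x3, 1, 1)))"

definition triv_act :: "'h \<Rightarrow> 'k \<Rightarrow> 'k" where
  "triv_act h c = \<epsilon> h * c"

definition A_act :: "'h \<Rightarrow> 'h \<Rightarrow> 'h" where
  "A_act h a = tsum H2 (\<Delta> h) (\<lambda>(h1, h2). h1 * a * S h2)"

definition A_coact :: "'h \<Rightarrow> (('h \<times> 'h \<Rightarrow> 'k) \<Rightarrow> 'k)" where
  "A_coact a = tsum H3 \<phi> (\<lambda>(x1, x2, x3). tsum H3 \<phi>i (\<lambda>(y1, y2, y3). tsum H2 (\<Delta> y1) (\<lambda>(u1, u2).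
     tsum H2 (\<Delta> a) (\<lambda>(a1, a2). tsum H2 ffi (\<lambda>(g1, g2).
       pten H2 (x1 * u1 * a1 * g1 * S y3, x2 * u2 * a2 * g2 * S (x3 * y2)))))))"

definition CF :: "('h \<Rightarrow> 'k) set" where
  "CF = module_homs scale A_act (*) triv_act"

definition star :: "('h \<Rightarrow> 'k) \<Rightarrow> ('h \<Rightarrow> 'k) \<Rightarrow> ('h \<Rightarrow> 'k)" where
  "star \<xi> \<zeta> = (\<lambda>a.
     tsum H3 \<phi> (\<lambda>(x1, x2, x3). tsum H3 \<phi>i (\<lambda>(y1, y2, y3). tsum H2 (\<Delta> y1) (\<lambda>(u1, u2).
     tsum H2 (\<Delta> a) (\<lambda>(a1, a2). tsum H2 ffi (\<lambda>(g1, g2).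
       \<xi> (x1 * u1 * a1 * g1 * S y3) * \<zeta> (x2 * u2 * a2 * g2 * S (x3 * y2))))))))"

definition yd_homs :: "('k \<Rightarrow> 'v::ab_group_add \<Rightarrow> 'v) \<Rightarrow> ('h \<Rightarrow> 'v \<Rightarrow> 'v) \<Rightarrow> ('v \<Rightarrow> (('h \<times> 'v \<Rightarrow> 'k) \<Rightarrow> 'k)) \<Rightarrow>
    ('k \<Rightarrow> 'w::ab_group_add \<Rightarrow> 'w) \<Rightarrow> ('h \<Rightarrow> 'w \<Rightarrow> 'w) \<Rightarrow> ('w \<Rightarrow> (('h \<times> 'w \<Rightarrow> 'k) \<Rightarrow> 'k)) \<Rightarrow>
    ('v \<Rightarrow> 'w) set" where
  "yd_homs sV act coact sW act' coact' =
     {f \<in> module_homs sV act sW act'.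
        \<forall>v. coact' (f v) = tsum (mlin_form scale (linear_form sV)) (coact v)
                             (\<lambda>(h, u). pten (mlin_form scale (linear_form sW)) (h, f u))}"

end

locale quasi_hopf_algebra = quasi_hopf_data scale \<Delta> \<epsilon> \<phi> S \<alpha> \<beta>
  for scale :: "'k::field \<Rightarrow> 'h::ring_1 \<Rightarrow> 'h" and \<Delta> \<epsilon> \<phi> S \<alpha> \<beta> +
  assumes comult_in: "\<Delta> h \<in> tprod H2"
    and comult_linear: "Vector_Spaces.linear scale tscale \<Delta>"
    and comult_mult: "\<Delta> (g * h) = tmul H2 (\<Delta> g) (\<Delta> h)"
    and comult_one: "\<Delta> 1 = tone H2"
    and counit_linear: "linear_form scale \<epsilon>"
    and counit_mult: "\<epsilon> (g * h) = \<epsilon> g * \<epsilon> h"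
    and counit_one: "\<epsilon> 1 = 1"
    and assoc_in: "\<phi> \<in> tprod H3"
    and assoc_invertible: "\<exists>U. is_tinv H3 \<phi> U"
    and antipode_linear: "Vector_Spaces.linear scale scale S"
    and antipode_mult: "S (g * h) = S h * S g"
    and antipode_one: "S 1 = 1"
    and quasi_coassoc:
      "tsum H2 (\<Delta> h) (\<lambda>(h1, h2). tsum H2 (\<Delta> h2) (\<lambda>(u1, u2). pten H3 (h1, u1, u2))) =
       tmul H3 (tmul H3 \<phi>
         (tsum H2 (\<Delta> h) (\<lambda>(h1, h2). tsum H2 (\<Delta> h1) (\<lambda>(u1, u2). pten H3 (u1, u2, h2))))) \<phi>i"
    and counit_left: "tsum H2 (\<Delta> h) (\<lambda>(h1, h2). scale (\<epsilon> h1) h2) = h"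
    and counit_right: "tsum H2 (\<Delta> h) (\<lambda>(h1, h2). scale (\<epsilon> h2) h1) = h"
    and pentagon:
      "tmul H4
         (tsum H3 \<phi> (\<lambda>(x1, x2, x3). tsum H2 (\<Delta> x3) (\<lambda>(u1, u2). pten H4 (x1, x2, u1, u2))))
         (tsum H3 \<phi> (\<lambda>(x1, x2, x3). tsum H2 (\<Delta> x1) (\<lambda>(u1, u2). pten H4 (u1, u2, x2, x3)))) =
       tmul H4 (tmul H4
         (tsum H3 \<phi> (\<lambda>(x1, x2, x3). pten H4 (1, x1, x2, x3)))
         (tsum H3 \<phi> (\<lambda>(x1, x2, x3). tsum H2 (\<Delta> x2) (\<lambda>(u1, u2). pten H4 (x1, u1, u2, x3)))))
         (tsum H3 \<phi> (\<lambda>(x1, x2, x3). pten H4 (x1, x2, x3, 1)))"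
    and assoc_counit:
      "tsum H3 \<phi> (\<lambda>(x1, x2, x3). pten H2 (scale (\<epsilon> x2) x1, x3)) = tone H2"
    and antipode_alpha: "tsum H2 (\<Delta> h) (\<lambda>(h1, h2). S h1 * \<alpha> * h2) = scale (\<epsilon> h) \<alpha>"
    and antipode_beta: "tsum H2 (\<Delta> h) (\<lambda>(h1, h2). h1 * \<beta> * S h2) = scale (\<epsilon> h) \<beta>"
    and assoc_antipode:
      "tsum H3 \<phi> (\<lambda>(x1, x2, x3). x1 * \<beta> * S x2 * \<alpha> * x3) = 1"
    and assoc_inv_antipode:
      "tsum H3 \<phi>i (\<lambda>(y1, y2, y3). S y1 * \<alpha> * y2 * \<beta> * S y3) = 1"
    and counit_alpha: "\<epsilon> \<alpha> = 1"
    and counit_beta: "\<epsilon> \<beta> = 1"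

locale yd_module = quasi_hopf_algebra scale \<Delta> \<epsilon> \<phi> S \<alpha> \<beta> + V: vector_space sV
  for scale :: "'k::field \<Rightarrow> 'h::ring_1 \<Rightarrow> 'h" and \<Delta> \<epsilon> \<phi> S \<alpha> \<beta>
    and sV :: "'k \<Rightarrow> 'v::ab_group_add \<Rightarrow> 'v" +
  fixes act :: "'h \<Rightarrow> 'v \<Rightarrow> 'v"
    and coact :: "'v \<Rightarrow> (('h \<times> 'v \<Rightarrow> 'k) \<Rightarrow> 'k)"
  assumes act_linear_left: "Vector_Spaces.linear scale sV (\<lambda>h. act h v)"
    and act_linear_right: "Vector_Spaces.linear sV sV (act h)"
    and act_one: "act 1 v = v"
    and act_mult: "act (g * h) v = act g (act h v)"
    and coact_in: "coact v \<in> tprod (mlin_form scale (linear_form sV))"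
    and coact_linear: "Vector_Spaces.linear sV tscale coact"
    and coact_coassoc:
      "tsum (mlin_form scale (linear_form sV)) (coact v) (\<lambda>(x, w).
         tsum (mlin_form scale (linear_form sV)) (coact w) (\<lambda>(y, u).
           pten (mlin_form scale (mlin_form scale (linear_form sV))) (x, y, u))) =
       tsum (mlin_form scale (linear_form sV)) (coact v) (\<lambda>(x, w).
         tsum H2 (\<Delta> x) (\<lambda>(x1, x2). tsum H5 \<omega> (\<lambda>(o1, o2, o3, o4, o5).
           pten (mlin_form scale (mlin_form scale (linear_form sV)))
             (o1 * x1 * o5, o2 * x2 * o4, act o3 w))))"
    and coact_counit:
      "tsum (mlin_form scale (linear_form sV)) (coact v) (\<lambda>(x, w). sV (\<epsilon> x) w) = v"
    and coact_act:
      "coact (act h v) =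
       tsum H2 (\<Delta> h) (\<lambda>(h1, h2). tsum H2 (\<Delta> h1) (\<lambda>(u1, u2).
         tsum (mlin_form scale (linear_form sV)) (coact v) (\<lambda>(x, w).
           pten (mlin_form scale (linear_form sV)) (u1 * x * S h2, act u2 w))))"

end

theory Submission
  imports Defs
begin

text \<open>
  Elements of tensor powers of H are functionals on multilinear forms, so the forms on a power of H
  are a right module over tensor powers of H in many commuting ways, and the axioms of H become
  identities between operators on forms.  Every coherence statement needed then follows from the
  pentagon by rebracketing.

  The element f enters through the uniqueness of duals.  The comultiplication followed by the
  antipode, with the element a and its counterpart for \<open>\<beta>\<close>, is a dual of the diagonal
  action of H on forms in two variables, and so is the diagonal action of the antipode itself.
  The comparison map between the two duals is multiplication by f; hence f is invertible and
  intertwines the two actions.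

  Since S is bijective and \<open>x1 * \<beta> * S x2 * \<alpha> * x3 = 1\<close>, summed over the
  components of \<open>\<phi>\<close>, H is generated by \<open>\<beta>\<close> under left multiplication and right
  multiplication by antipodes.  Equivariant identities, such as the coassociativity and the
  counitality of \<open>a \<mapsto> \<Delta> a * ffi\<close>, therefore only have to be checked at
  \<open>\<beta>\<close>, and they make A a Yetter-Drinfeld module.

  Finally, R being right adjoint to the forgetful functor, endomorphisms f of A = R(k) correspond to
  H-linear forms \<open>\<epsilon> \<circ> f\<close>, with inverse taking \<open>\<xi>\<close> to the map that contracts
  the second factor of the coaction with \<open>\<xi>\<close>; composition of endomorphisms becomes the
  product of CF.
\<close>

section \<open>Multilinear forms and tensors\<close>

text \<open>The lack of coassociativity shapes the proof: in Sweedler notation every manipulation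
  drags along components of \<open>\<phi>\<close>, and the formulas for f and its inverse are too
  long to compute with. Both are avoided. Identities are proved once for arbitrary commuting right
  actions \<open>j1, j2, ...\<close> of H on arbitrary forms, called strands: \<open>conv\<close>
  brackets two strands, \<open>PHI\<close> and \<open>CHI\<close> rebracket them. They are then
  instantiated with left multiplications on chosen tensor factors and right multiplications by
  antipodes, whence the numbered families of pullbacks. Forms being a right module, a product of
  tensors acts with its left factor first.

  Of the inverse g of f, once it is known as a comparison map, three facts carry the rest:
  \<open>\<Delta> (h * a) * g = \<Delta> h * \<Delta> a * g\<close>; right multiplication of a by
  \<open>S h\<close> becomes right multiplication of \<open>\<Delta> a * g\<close> by
  \<open>S h2\<close> and \<open>S h1\<close> in its two factors; and
  \<open>\<Delta> \<beta> * g\<close> is Drinfeld's element \<delta>. The first two are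
  equivariance, the third is the value at \<open>\<beta>\<close>.\<close>

definition form_space :: "(('x \<Rightarrow> 'k::field) \<Rightarrow> bool) \<Rightarrow> bool" where
  "form_space L \<longleftrightarrow> L (\<lambda>x. 0) \<and> (\<forall>f g. L f \<longrightarrow> L g \<longrightarrow> L (\<lambda>x. f x + g x)) \<and>
     (\<forall>c f. L f \<longrightarrow> L (\<lambda>x. c * f x))"

lemma form_spaceD:
  assumes "form_space L"
  shows "L (\<lambda>x. 0)" "L f \<Longrightarrow> L g \<Longrightarrow> L (\<lambda>x. f x + g x)" "L f \<Longrightarrow> L (\<lambda>x. c * f x)"
  using assms unfolding form_space_def by blast+

lemma form_space_sum_list: "form_space L \<Longrightarrow> (\<And>y. L (\<lambda>x. F x y)) \<Longrightarrow> L (\<lambda>x. \<Sum>y\<leftarrow>ys. F x y)"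
proof (induction ys)
  case (Cons y ys)
  then show ?case using form_spaceD(2)[of L "\<lambda>x. F x y" "\<lambda>x. \<Sum>y\<leftarrow>ys. F x y"] by simp
qed (simp add: form_spaceD)

lemma linear_form_iff:
  assumes "vector_space s"
  shows "linear_form s f \<longleftrightarrow> (\<forall>a b. f (a + b) = f a + f b) \<and> (\<forall>c a. f (s c a) = c * f a)"
proof -
  interpret vector_space_pair s "(*)"
    by (rule vector_space_pair.intro[OF assms vector_space_mult])
  show ?thesis unfolding linear_form_def linear_iff Vector_Spaces.linear_iff using assms vector_space_mult by auto
qed

lemma form_space_linear_form: "vector_space s \<Longrightarrow> form_space (linear_form s)"
  by (auto simp: form_space_def linear_form_iff algebra_simps)

lemma form_space_mlin_form: "vector_space s \<Longrightarrow> form_space L \<Longrightarrow> form_space (mlin_form s L)"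
  using form_space_linear_form[of s] unfolding form_space_def mlin_form_def by auto

lemma pten_in_tprod: "pten L x \<in> tprod L"
  unfolding tprod_def by (rule range_eqI[of _ _ "[x]"]) simp

lemma tprod_0: "(0 :: ('x \<Rightarrow> 'k::field) \<Rightarrow> 'k) \<in> tprod L"
  unfolding tprod_def by (rule range_eqI[of _ _ "[]"]) simp

lemma tprod_add: "T \<in> tprod L \<Longrightarrow> U \<in> tprod L \<Longrightarrow> T + U \<in> tprod L"
proof -
  assume "T \<in> tprod L" "U \<in> tprod L"
  then obtain xs ys where "T = (\<Sum>x\<leftarrow>xs. pten L x)" "U = (\<Sum>x\<leftarrow>ys. pten L x)"
    by (auto simp: tprod_def simp del: plus_fun_apply)
  then have "T + U = (\<Sum>x\<leftarrow>xs @ ys. pten L x)" by (simp del: plus_fun_apply)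
  then show ?thesis unfolding tprod_def by blast
qed

lemma tsum_obtain:
  assumes "T \<in> tprod L"
  obtains xs where "T = (\<Sum>x\<leftarrow>xs. pten L x)" "tsum L T F = (\<Sum>x\<leftarrow>xs. F x)"
proof -
  have "\<exists>xs. T = (\<Sum>x\<leftarrow>xs. pten L x)" using assms by (auto simp: tprod_def)
  from someI_ex[OF this] show ?thesis using that unfolding tsum_def by blast
qed

lemma tprod_obtain:
  assumes "T \<in> tprod L"
  obtains xs where "\<And>f. L f \<Longrightarrow> T f = (\<Sum>x\<leftarrow>xs. f x)"
proof -
  obtain xs where "T = (\<Sum>x\<leftarrow>xs. pten L x)" using assms by (auto simp: tprod_def)
  then show ?thesis using that sum_list_pten[of L] by blast
qed

lemma sum_list_fun_apply: "(\<Sum>x\<leftarrow>xs. F x) f = (\<Sum>x\<leftarrow>xs. F x f)"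
  by (induction xs) simp_all

lemma tprod_outside: "T \<in> tprod L \<Longrightarrow> \<not> L f \<Longrightarrow> T f = 0"
  by (auto simp: tprod_def sum_list_fun_apply pten_def)

text \<open>Tensors vanish on functions that are not multilinear, so equality is decided on forms.
  Through this, identities between operators on forms become identities of tensors.\<close>

lemma tprod_ext: "T \<in> tprod L \<Longrightarrow> U \<in> tprod L \<Longrightarrow> (\<And>f. L f \<Longrightarrow> T f = U f) \<Longrightarrow> T = U"
  by (rule ext) (metis tprod_outside)

lemma tsum_apply: "T \<in> tprod L \<Longrightarrow> L (\<lambda>x. F x f) \<Longrightarrow> tsum L T F f = T (\<lambda>x. F x f)"
  by (rule tsum_obtain[of T L F]) (simp_all add: sum_list_fun_apply[of F] sum_list_pten)

lemma tsum_in_tprod: "T \<in> tprod L \<Longrightarrow> (\<And>x. F x \<in> tprod L') \<Longrightarrow> tsum L T F \<in> tprod L'"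
proof (rule tsum_obtain[of T L F])
  fix xs assume "\<And>x. F x \<in> tprod L'" "tsum L T F = sum_list (map F xs)"
  moreover have "(\<Sum>x\<leftarrow>xs. F x) \<in> tprod L'" if "\<And>x. F x \<in> tprod L'"
    by (induction xs) (simp_all add: tprod_0 tprod_add that del: plus_fun_apply zero_fun_apply)
  ultimately show ?thesis by simp
qed

lemma tsum_scalar: "T \<in> tprod L \<Longrightarrow> L F \<Longrightarrow> tsum L T F = T F"
  by (rule tsum_obtain[of T L F]) (simp_all add: sum_list_pten)

lemma linear_form_tsum:
  assumes "T \<in> tprod L" "vector_space s" "linear_form s g" "L (\<lambda>x. g (F x))"
  shows "g (tsum L T F) = T (\<lambda>x. g (F x))"
proof -
  interpret Vector_Spaces.linear s "(*)" g using assms(3) by (simp add: linear_form_def)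
  have "g (\<Sum>x\<leftarrow>xs. F x) = (\<Sum>x\<leftarrow>xs. g (F x))" for xs
    by (induction xs) (simp_all add: zero add)
  then show ?thesis
    by (rule_tac tsum_obtain[OF assms(1), of F]) (simp add: sum_list_pten[of L, OF assms(4)])
qed

lemma tprod_eval_add: "T \<in> tprod L \<Longrightarrow> form_space L \<Longrightarrow> L f \<Longrightarrow> L g \<Longrightarrow> T (\<lambda>x. f x + g x) = T f + T g"
  by (erule tprod_obtain) (simp add: form_spaceD sum_list_addf)

lemma tprod_eval_scale: "T \<in> tprod L \<Longrightarrow> form_space L \<Longrightarrow> L f \<Longrightarrow> T (\<lambda>x. c * f x) = c * T f"
  by (erule tprod_obtain) (simp add: form_spaceD sum_list_const_mult)

text \<open>A tensor is a finite sum of evaluations, so applying it to a family of forms gives a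
  finite sum of forms.\<close>

lemma form_space_eval:
  assumes "U \<in> tprod M" "form_space L" "\<And>y. L (\<lambda>x. F x y)" "\<And>x. M (F x)"
  shows "L (\<lambda>x. U (F x))"
proof -
  obtain ys where "\<And>f. M f \<Longrightarrow> U f = (\<Sum>y\<leftarrow>ys. f y)" by (rule tprod_obtain[OF assms(1)]) blast
  then show ?thesis using form_space_sum_list[OF assms(2), of F ys] assms by simp
qed

lemma tprod_Fubini:
  assumes "T \<in> tprod L" "U \<in> tprod M" "form_space L" "form_space M"
    and "\<And>y. L (\<lambda>x. F x y)" "\<And>x. M (F x)"
  shows "T (\<lambda>x. U (F x)) = U (\<lambda>y. T (\<lambda>x. F x y))"
proof -
  obtain ys where ys: "\<And>f. M f \<Longrightarrow> U f = (\<Sum>y\<leftarrow>ys. f y)" by (rule tprod_obtain[OF assms(2)]) blast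
  obtain xs where xs: "\<And>f. L f \<Longrightarrow> T f = (\<Sum>x\<leftarrow>xs. f x)" by (rule tprod_obtain[OF assms(1)]) blast
  have "T (\<lambda>x. U (F x)) = (\<Sum>x\<leftarrow>xs. \<Sum>y\<leftarrow>ys. F x y)"
    using form_space_eval[OF assms(2,3,5,6)] assms(6) by (simp add: xs ys)
  moreover have "U (\<lambda>y. T (\<lambda>x. F x y)) = (\<Sum>y\<leftarrow>ys. \<Sum>x\<leftarrow>xs. F x y)"
    using form_space_eval[OF assms(1,4,6,5)] assms(5) by (simp add: xs ys)
  moreover have "(\<Sum>x\<leftarrow>xs. \<Sum>y\<leftarrow>ys. F x y) = (\<Sum>y\<leftarrow>ys. \<Sum>x\<leftarrow>xs. F x y)"
    by (induction xs) (simp_all add: sum_list_addf)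
  ultimately show ?thesis by simp
qed

instance prod :: (semigroup_mult, semigroup_mult) semigroup_mult
  by standard (simp add: times_prod_def mult.assoc)

instance prod :: (monoid_mult, monoid_mult) monoid_mult
  by standard (simp_all add: times_prod_def one_prod_def)

lemma times_Pair [simp]: "(a, b) * (c, d) = (a * c, b * d)"
  by (simp add: times_prod_def)

section \<open>Right representations on spaces of forms\<close>

text \<open>The forms are a subset of a function type, so linearity is demanded on members of
  \<open>L\<close>; the values of \<open>p\<close> at other functions are left open.\<close>

definition lop :: "(('x \<Rightarrow> 'k::field) \<Rightarrow> bool) \<Rightarrow> (('y \<Rightarrow> 'k) \<Rightarrow> bool) \<Rightarrow> (('x \<Rightarrow> 'k) \<Rightarrow> 'y \<Rightarrow> 'k) \<Rightarrow> bool" where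
  "lop L L' p \<longleftrightarrow> (\<forall>f. L f \<longrightarrow> L' (p f)) \<and>
     (\<forall>f g. L f \<longrightarrow> L g \<longrightarrow> p (\<lambda>x. f x + g x) = (\<lambda>y. p f y + p g y)) \<and>
     (\<forall>c f. L f \<longrightarrow> p (\<lambda>x. c * f x) = (\<lambda>y. c * p f y))"

lemma lopD:
  assumes "lop L L' p"
  shows "L f \<Longrightarrow> L' (p f)"
    and "L f \<Longrightarrow> L g \<Longrightarrow> p (\<lambda>x. f x + g x) = (\<lambda>y. p f y + p g y)"
    and "L f \<Longrightarrow> p (\<lambda>x. c * f x) = (\<lambda>y. c * p f y)"
  using assms by (auto simp: lop_def)

lemma lop_comp: "lop L L' p \<Longrightarrow> lop L' L'' q \<Longrightarrow> lop L L'' (\<lambda>f. q (p f))"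
  by (auto simp: lop_def)

lemma lop_zero: "lop L L' p \<Longrightarrow> L f \<Longrightarrow> p (\<lambda>x. 0) = (\<lambda>y. 0)"
  using lopD(3)[of L L' p f 0] by simp

text \<open>Both sides are the same finite sum over a representation of \<open>T\<close>, once both
  families are known to be multilinear in y.\<close>

lemma lop_eval:
  assumes "lop L L' p" "T \<in> tprod M" "form_space L" "\<And>y. L (F y)" "\<And>x. M (\<lambda>y. F y x)"
    "M (\<lambda>y. p (F y) z)"
  shows "p (\<lambda>x. T (\<lambda>y. F y x)) z = T (\<lambda>y. p (F y) z)"
proof -
  note fsp = form_spaceD[OF assms(3)] and pD = lopD[OF assms(1)]
  obtain ys where ys: "\<And>f. M f \<Longrightarrow> T f = (\<Sum>y\<leftarrow>ys. f y)" by (rule tprod_obtain[OF assms(2)]) blast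
  have *: "L (\<lambda>x. \<Sum>y\<leftarrow>ys. F y x) \<and> p (\<lambda>x. \<Sum>y\<leftarrow>ys. F y x) = (\<lambda>z. \<Sum>y\<leftarrow>ys. p (F y) z)" for ys
  proof (induction ys)
    case Nil
    show ?case using lop_zero[OF assms(1)] fsp(1) assms(4) by auto
  next
    case (Cons y ys)
    then show ?case
      using pD(2)[OF assms(4)[of y], of "\<lambda>x. \<Sum>y\<leftarrow>ys. F y x"]
        fsp(2)[OF assms(4)[of y], of "\<lambda>x. \<Sum>y\<leftarrow>ys. F y x"] by simp
  qed
  show ?thesis using *[of ys] by (simp add: ys assms(5,6))
qed

definition comm :: "(('x \<Rightarrow> 'k) \<Rightarrow> bool) \<Rightarrow> ('y \<Rightarrow> ('x \<Rightarrow> 'k) \<Rightarrow> ('x \<Rightarrow> 'k)) \<Rightarrow> ('z \<Rightarrow> ('x \<Rightarrow> 'k) \<Rightarrow> ('x \<Rightarrow> 'k)) \<Rightarrow> bool" where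
  "comm L P Q \<longleftrightarrow> (\<forall>y z f. L f \<longrightarrow> P y (Q z f) = Q z (P y f))"

lemma commD: "comm L P Q \<Longrightarrow> L f \<Longrightarrow> P y (Q z f) = Q z (P y f)"
  by (simp add: comm_def)

lemma comm_sym: "comm L P Q \<Longrightarrow> comm L Q P"
  by (simp add: comm_def)

definition lfun :: "(('x \<Rightarrow> 'k::field) \<Rightarrow> bool) \<Rightarrow> (('x \<Rightarrow> 'k) \<Rightarrow> 'k) \<Rightarrow> bool" where
  "lfun L N \<longleftrightarrow> (\<forall>f g. L f \<longrightarrow> L g \<longrightarrow> N (\<lambda>x. f x + g x) = N f + N g) \<and>
     (\<forall>c f. L f \<longrightarrow> N (\<lambda>x. c * f x) = c * N f)"

lemma lfun_apply: "lfun L (\<lambda>f. f x)"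
  by (simp add: lfun_def)

lemma lfun_lop: "lop L L' p \<Longrightarrow> lfun L' N \<Longrightarrow> lfun L (\<lambda>f. N (p f))"
  by (simp add: lfun_def lop_def)

lemma lfun_lop_apply: "lop L L' p \<Longrightarrow> lfun L (\<lambda>f. p f x)"
  by (simp add: lfun_def lop_def)

lemma lfun_iff_lop: "lfun L N \<longleftrightarrow> lop L (\<lambda>_. True) (\<lambda>f (_::unit). N f)"
  by (simp add: lfun_def lop_def fun_eq_iff)

lemma lfun_tprod: "T \<in> tprod L \<Longrightarrow> form_space L \<Longrightarrow> lfun L T"
  by (simp add: lfun_def tprod_eval_add tprod_eval_scale)

text \<open>Right representations, on the forms singled out by \<open>L\<close>, of the tensor power whose
  multilinear forms are singled out by \<open>M\<close>, given on pure tensors.  Multilinearity is tested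
  against all linear functionals so that it survives the composition with linear operators.\<close>

definition rrep :: "(('x \<Rightarrow> 'k::field) \<Rightarrow> bool) \<Rightarrow> (('y::{times, one} \<Rightarrow> 'k) \<Rightarrow> bool) \<Rightarrow>
    ('y \<Rightarrow> ('x \<Rightarrow> 'k) \<Rightarrow> ('x \<Rightarrow> 'k)) \<Rightarrow> bool" where
  "rrep L M P \<longleftrightarrow> form_space L \<and> form_space M \<and> (\<forall>y. lop L L (P y)) \<and>
     (\<forall>f N. L f \<longrightarrow> lfun L N \<longrightarrow> M (\<lambda>y. N (P y f))) \<and> (\<forall>f. L f \<longrightarrow> P 1 f = f) \<and>
     (\<forall>y z f. L f \<longrightarrow> P (y * z) f = P z (P y f))"

lemma rrepD:
  assumes "rrep L M P"
  shows "form_space L" "form_space M" "lop L L (P y)" "L f \<Longrightarrow> L (P y f)" "L f \<Longrightarrow> M (\<lambda>y. P y f x)"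
    "L f \<Longrightarrow> P 1 f = f" "L f \<Longrightarrow> P (y * z) f = P z (P y f)"
    "L f \<Longrightarrow> lfun L N \<Longrightarrow> M (\<lambda>y. N (P y f))"
    "L f \<Longrightarrow> lop L L' p \<Longrightarrow> M (\<lambda>y. p (P y f) x')"
proof -
  have 8: "L f \<Longrightarrow> lfun L N \<Longrightarrow> M (\<lambda>y. N (P y f))" for N using assms by (simp add: rrep_def)
  show "L f \<Longrightarrow> lfun L N \<Longrightarrow> M (\<lambda>y. N (P y f))" by (rule 8)
  show "L f \<Longrightarrow> M (\<lambda>y. P y f x)" by (rule 8[OF _ lfun_apply])
  show "L f \<Longrightarrow> lop L L' p \<Longrightarrow> M (\<lambda>y. p (P y f) x')" by (rule 8[OF _ lfun_lop_apply])
qed (use assms in \<open>auto simp: rrep_def lop_def\<close>)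

definition rpair :: "('y \<Rightarrow> ('x \<Rightarrow> 'k) \<Rightarrow> ('x \<Rightarrow> 'k)) \<Rightarrow> ('z \<Rightarrow> ('x \<Rightarrow> 'k) \<Rightarrow> ('x \<Rightarrow> 'k)) \<Rightarrow>
    'y \<times> 'z \<Rightarrow> ('x \<Rightarrow> 'k) \<Rightarrow> ('x \<Rightarrow> 'k)" where
  "rpair P Q = (\<lambda>(y, z) f. P y (Q z f))"

lemma rpair_apply [simp]: "rpair P Q y f = P (fst y) (Q (snd y) f)"
  by (simp add: rpair_def case_prod_unfold)

definition tact :: "(('y \<Rightarrow> 'k) \<Rightarrow> 'k) \<Rightarrow> ('y \<Rightarrow> ('x \<Rightarrow> 'k) \<Rightarrow> ('x \<Rightarrow> 'k)) \<Rightarrow> ('x \<Rightarrow> 'k) \<Rightarrow> ('x \<Rightarrow> 'k)" where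
  "tact T P f = (\<lambda>x. T (\<lambda>y. P y f x))"

lemma comm_rpair:
  "comm L P R \<Longrightarrow> comm L Q R \<Longrightarrow> rrep L M Q \<Longrightarrow> comm L (rpair P Q) R"
  using rrepD(4)[of L M Q] by (auto simp: comm_def)

lemma rrep_rpair:
  assumes "rrep L (linear_form s) P" "rrep L M Q" "comm L P Q" "vector_space s"
  shows "rrep L (mlin_form s M) (rpair P Q)"
proof -
  note P = rrepD[OF assms(1)] and Q = rrepD[OF assms(2)]
  have "form_space (mlin_form s M)" by (rule form_space_mlin_form[OF assms(4) Q(2)])
  moreover have "lop L L (rpair P Q y)" for y
    using lop_comp[OF Q(3) P(3)] by (simp add: rpair_def case_prod_unfold)
  moreover have "rpair P Q 1 f = f" if "L f" for f by (simp add: one_prod_def P(6) Q(6) that)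
  moreover have "rpair P Q (y * z) f = rpair P Q z (rpair P Q y f)" if "L f" for y z f
    by (simp add: times_prod_def P(4,7) Q(4,7) that commD[OF assms(3)])
  moreover have "mlin_form s M (\<lambda>y. N (rpair P Q y f))" if "L f" "lfun L N" for N f
    unfolding mlin_form_def rpair_apply fst_conv snd_conv
    using P(8)[OF Q(4)[OF that(1)] that(2)] Q(8)[OF that(1) lfun_lop[OF P(3) that(2)]] by blast
  ultimately show ?thesis using P(1) by (simp add: rrep_def del: rpair_apply)
qed

lemma tact_closed: "rrep L M P \<Longrightarrow> T \<in> tprod M \<Longrightarrow> L f \<Longrightarrow> L (tact T P f)"
  unfolding tact_def by (rule form_space_eval[of T M L "\<lambda>x y. P y f x"]) (use rrepD[of L M P] in auto)

lemma lop_tact: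
  assumes "rrep L M P" "T \<in> tprod M"
  shows "lop L L (tact T P)"
proof -
  have "P y (\<lambda>x. f x + g x) = (\<lambda>x. P y f x + P y g x)" "P y (\<lambda>x. c * f x) = (\<lambda>x. c * P y f x)"
    if "L f" "L g" for y f g c
    using lopD[OF rrepD(3)[OF assms(1), of y]] that by blast+
  then show ?thesis
    unfolding lop_def
    using tact_closed[OF assms] rrepD(5)[OF assms(1)] tprod_eval_add[OF assms(2) rrepD(2)[OF assms(1)]]
      tprod_eval_scale[OF assms(2) rrepD(2)[OF assms(1)]]
    by (simp add: tact_def)
qed

lemma lop_tact_eval:
  assumes "rrep L M P" "T \<in> tprod M" "lop L L' p" "L f"
  shows "p (tact T P f) = (\<lambda>x. T (\<lambda>y. p (P y f) x))"
  unfolding tact_def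
  by (rule ext, rule lop_eval[OF assms(3,2) rrepD(1)[OF assms(1)], where F = "\<lambda>y. P y f"])
    (use rrepD[OF assms(1)] assms(3,4) in auto)

lemma lop_tact_intertwine:
  assumes "rrep L M P" "T \<in> tprod M" "lop L L' p" "L f" "\<And>y. p (P y f) = P' y (p f)"
  shows "p (tact T P f) = tact T P' (p f)"
  using lop_tact_eval[OF assms(1-4)] by (simp add: tact_def assms(5))

lemma comm_tact:
  assumes "rrep L M P" "\<And>h. T h \<in> tprod M" "\<And>y. lop L L (Q y)" "comm L P Q"
  shows "comm L (\<lambda>h. tact (T h) P) Q"
  unfolding comm_def
proof (intro allI impI)
  fix y z f assume f: "L f"
  show "tact (T y) P (Q z f) = Q z (tact (T y) P f)"
    by (rule sym, rule lop_tact_intertwine[OF assms(1-3) f]) (rule commD[OF assms(4) f, symmetric])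
qed

section \<open>Products and inverses of tensors\<close>

definition mult_stable :: "(('y::times \<Rightarrow> 'k::field) \<Rightarrow> bool) \<Rightarrow> bool" where
  "mult_stable M \<longleftrightarrow> (\<forall>f y. M f \<longrightarrow> M (\<lambda>x. f (x * y)) \<and> M (\<lambda>x. f (y * x)))"

lemma mult_stableD:
  assumes "mult_stable M"
  shows "M f \<Longrightarrow> M (\<lambda>x. f (x * y))" "M f \<Longrightarrow> M (\<lambda>x. f (y * x))"
  using assms by (auto simp: mult_stable_def)

lemma mult_stable_mlin_form:
  assumes "mult_stable (linear_form s)" "mult_stable M"
  shows "mult_stable (mlin_form s M)"
  using assms unfolding mult_stable_def mlin_form_def by auto

lemma tmul_apply:
  assumes "mult_stable M" "T \<in> tprod M" "U \<in> tprod M" "M f" "form_space M"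
  shows "tmul M T U f = T (\<lambda>x. U (\<lambda>y. f (x * y)))"
proof -
  have "tsum M U (\<lambda>y. pten M (x * y)) f = U (\<lambda>y. f (x * y))" for x
    using tsum_apply[OF assms(3), of "\<lambda>y. pten M (x * y)" f] mult_stableD[OF assms(1,4)] assms(4)
    by (simp add: pten_def)
  moreover have "M (\<lambda>x. U (\<lambda>y. f (x * y)))"
    by (rule form_space_eval[OF assms(3,5)]) (use mult_stableD[OF assms(1,4)] in auto)
  ultimately show ?thesis
    unfolding tmul_def
    using tsum_apply[OF assms(2), of "\<lambda>x. tsum M U (\<lambda>y. pten M (x * y))" f] by simp
qed

lemma tmul_in_tprod: "T \<in> tprod M \<Longrightarrow> U \<in> tprod M \<Longrightarrow> tmul M T U \<in> tprod M"
  unfolding tmul_def by (intro tsum_in_tprod pten_in_tprod)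

lemma tone_in_tprod: "tone M \<in> tprod M"
  unfolding tone_def by (rule pten_in_tprod)

lemma tone_apply: "M f \<Longrightarrow> tone M f = f 1"
  by (simp add: tone_def pten_def)

text \<open>The usual argument \<open>V = U * T * V = U\<close>, carried out under a form. It gives
  the definite description in \<open>tinv\<close> its meaning.\<close>

lemma is_tinv_unique:
  fixes M :: "('y::monoid_mult \<Rightarrow> 'k::field) \<Rightarrow> bool"
  assumes M: "mult_stable M" "form_space M" and T: "T \<in> tprod M"
    and U: "is_tinv M T U" and V: "is_tinv M T V"
  shows "U = V"
proof (rule tprod_ext)
  show UV: "U \<in> tprod M" "V \<in> tprod M" using U V by (auto simp: is_tinv_def)
  fix f assume f: "M f"
  note ap = tmul_apply[OF M(1) _ _ _ M(2)]
  note stab = mult_stableD[OF M(1)]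
  have cl: "M (\<lambda>x. T (\<lambda>y. f (x * y)))" if "T \<in> tprod M" "M f" for T f
    by (rule form_space_eval[OF that(1) M(2)]) (use stab that in auto)
  have 1: "T (\<lambda>y. V (\<lambda>z. f (x * y * z))) = f x" for x
  proof -
    have "T (\<lambda>y. V (\<lambda>z. f (x * y * z))) = tmul M T V (\<lambda>y. f (x * y))"
      using ap[OF T UV(2), of "\<lambda>y. f (x * y)"] stab(2)[OF f] by (simp add: mult.assoc)
    also have "\<dots> = f x" using V stab(2)[OF f, of x] by (simp add: is_tinv_def tone_apply)
    finally show ?thesis .
  qed
  have "V f = tmul M U T (\<lambda>x. V (\<lambda>z. f (x * z)))"
    using U cl[OF UV(2) f] by (simp add: is_tinv_def tone_apply)
  also have "\<dots> = U f"
    using ap[OF UV(1) T cl[OF UV(2) f]] by (simp add: 1)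
  finally show "U f = V f" by simp
qed

lemma tinv_eqI:
  fixes M :: "('y::monoid_mult \<Rightarrow> 'k::field) \<Rightarrow> bool"
  assumes "mult_stable M" "form_space M" "T \<in> tprod M" "is_tinv M T U"
  shows "tinv M T = U"
  unfolding tinv_def using is_tinv_unique[OF assms(1-3)] assms(4) by blast

text \<open>In a right module the left factor acts first; the two orders of summation agree by
  Fubini. The reversal is the reason why all axioms appear below with their factors read from the
  inside outwards.\<close>

lemma tact_tmul:
  assumes "rrep L M P" "mult_stable M" "T \<in> tprod M" "U \<in> tprod M" "L f"
  shows "tact (tmul M T U) P f = tact U P (tact T P f)"
proof
  fix x
  have 1: "tact U P (tact T P f) x = U (\<lambda>z. T (\<lambda>y. P (y * z) f x))"
  proof -
    have "P z (tact T P f) x = T (\<lambda>y. P (y * z) f x)" for z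
      unfolding lop_tact_eval[OF assms(1,3) rrepD(3)[OF assms(1)] assms(5)]
      by (simp add: rrepD(7)[OF assms(1,5)])
    then show ?thesis by (simp add: tact_def[of U])
  qed
  have M: "M (\<lambda>y. P y f x)" by (rule rrepD(5)[OF assms(1,5)])
  note st = mult_stableD[OF assms(2) M]
  show "tact (tmul M T U) P f x = tact U P (tact T P f) x"
    unfolding 1 unfolding tact_def
    using tmul_apply[OF assms(2,3,4) M rrepD(2)[OF assms(1)]]
      tprod_Fubini[OF assms(3,4) rrepD(2)[OF assms(1)] rrepD(2)[OF assms(1)] st] by simp
qed

text \<open>Translates an element given by a Sweedler sum into an operator: it is enough to know how
  each summand acts.\<close>

lemma tact_tsum:
  assumes "rrep L M R" "T \<in> tprod M" "L f" "\<And>y x. F y (\<lambda>z. P z f x) = R y f x"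
  shows "tact (tsum M T F) P f = tact T R f"
  using tsum_apply[OF assms(2), of F] rrepD(5)[OF assms(1,3)] by (simp add: tact_def assms(4))

lemma tact_tone: "rrep L M P \<Longrightarrow> L f \<Longrightarrow> tact (tone M) P f = f"
  using rrepD(5,6)[of L M P f] by (simp add: tact_def tone_apply)

section \<open>Actions by pullback\<close>

definition pull :: "('h \<Rightarrow> 'x \<Rightarrow> 'x) \<Rightarrow> 'h \<Rightarrow> ('x \<Rightarrow> 'k) \<Rightarrow> ('x \<Rightarrow> 'k)" where
  "pull m h f = (\<lambda>x. f (m h x))"

lemma comm_pull: "(\<And>g h x. m' h (m g x) = m g (m' h x)) \<Longrightarrow> comm L (pull m) (pull m')"
  by (simp add: comm_def pull_def)

definition fst_act :: "('h \<Rightarrow> 'x \<Rightarrow> 'x) \<Rightarrow> 'h \<Rightarrow> 'x \<times> 'y \<Rightarrow> 'x \<times> 'y" where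
  "fst_act m h = (\<lambda>(x, y). (m h x, y))"
definition snd_act :: "('h \<Rightarrow> 'y \<Rightarrow> 'y) \<Rightarrow> 'h \<Rightarrow> 'x \<times> 'y \<Rightarrow> 'x \<times> 'y" where
  "snd_act m h = (\<lambda>(x, y). (x, m h y))"

lemma fst_act_apply [simp]: "fst_act m h (x, y) = (m h x, y)"
  by (simp add: fst_act_def)
lemma snd_act_apply [simp]: "snd_act m h (x, y) = (x, m h y)"
  by (simp add: snd_act_def)

text \<open>Linearity in h at every argument x already means
  \<open>P (a + b) f = P a f + P b f\<close> as functions, and this equation can be put under any
  linear functional \<open>N\<close>.\<close>

lemma rrep_linI:
  assumes "vector_space s" "form_space L" "\<And>h. lop L L (P h)"
    and "\<And>f x. L f \<Longrightarrow> linear_form s (\<lambda>h. P h f x)"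
    and "\<And>f. L f \<Longrightarrow> P 1 f = f" "\<And>y z f. L f \<Longrightarrow> P (y * z) f = P z (P y f)"
  shows "rrep L (linear_form s) P"
  unfolding rrep_def
proof (intro conjI allI impI)
  fix f N assume f: "L f" and N: "lfun L N"
  note [simp] = linear_form_iff[OF assms(1)]
  have "P (a + b) f = (\<lambda>x. P a f x + P b f x)" "P (s c a) f = (\<lambda>x. c * P a f x)" for a b c
    using assms(4)[OF f] by (auto simp: fun_eq_iff)
  then show "linear_form s (\<lambda>y. N (P y f))"
    using N f lopD(1)[OF assms(3) f] by (simp add: lfun_def)
qed (use assms form_space_linear_form in auto)

lemma lop_pull: "(\<And>f. L f \<Longrightarrow> L (\<lambda>x. f (m h x))) \<Longrightarrow> lop L L (pull m h)"
  by (simp add: lop_def pull_def)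

section \<open>Reassociation of commuting actions\<close>

context quasi_hopf_algebra
begin

abbreviation H1 :: "('h \<Rightarrow> 'k) \<Rightarrow> bool" where
  "H1 \<equiv> linear_form scale"

abbreviation ract :: "(('x \<Rightarrow> 'k) \<Rightarrow> bool) \<Rightarrow> ('h \<Rightarrow> ('x \<Rightarrow> 'k) \<Rightarrow> ('x \<Rightarrow> 'k)) \<Rightarrow> bool" where
  "ract L j \<equiv> rrep L H1 j"

lemma H1_iff: "H1 f \<longleftrightarrow> (\<forall>a b. f (a + b) = f a + f b) \<and> (\<forall>c a. f (scale c a) = c * f a)"
  by (rule linear_form_iff) (rule vector_space_axioms)

lemma form_space_H [simp]: "form_space H1" "form_space H2" "form_space H3" "form_space H4"
  by (simp_all add: form_space_mlin_form form_space_linear_form vector_space_axioms)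

lemma mult_stable_H [simp]: "mult_stable H1" "mult_stable H2" "mult_stable H3" "mult_stable H4"
proof -
  show 1: "mult_stable H1"
    by (simp add: mult_stable_def H1_iff distrib_left distrib_right
        scale_mult_left[symmetric] scale_mult_right[symmetric])
  show "mult_stable H2" "mult_stable H3" "mult_stable H4"
    by (intro mult_stable_mlin_form 1)+
qed

lemma phii_is_tinv: "is_tinv H3 \<phi> \<phi>i"
proof -
  obtain U where "is_tinv H3 \<phi> U" using assoc_invertible by blast
  then show ?thesis using tinv_eqI[OF _ _ assoc_in, of U] by (simp add: \<phi>i_def)
qed

lemma phii_in: "\<phi>i \<in> tprod H3"
  using phii_is_tinv by (simp add: is_tinv_def)

lemma comult_add: "\<Delta> (g + h) = (\<lambda>f. \<Delta> g f + \<Delta> h f)"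
  and comult_scale: "\<Delta> (scale c h) = (\<lambda>f. c * \<Delta> h f)"
proof -
  interpret D: Vector_Spaces.linear scale tscale \<Delta> by (rule comult_linear)
  show "\<Delta> (g + h) = (\<lambda>f. \<Delta> g f + \<Delta> h f)" by (simp add: D.add fun_eq_iff)
  show "\<Delta> (scale c h) = (\<lambda>f. c * \<Delta> h f)" by (simp add: D.scale fun_eq_iff fscale_def)
qed

section \<open>Diagonal actions and the action of the associator\<close>

definition conv :: "('h \<Rightarrow> ('x \<Rightarrow> 'k) \<Rightarrow> ('x \<Rightarrow> 'k)) \<Rightarrow> ('h \<Rightarrow> ('x \<Rightarrow> 'k) \<Rightarrow> ('x \<Rightarrow> 'k)) \<Rightarrow>
    'h \<Rightarrow> ('x \<Rightarrow> 'k) \<Rightarrow> ('x \<Rightarrow> 'k)" where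
  "conv j j' h = tact (\<Delta> h) (rpair j j')"

definition PHI :: "(('h \<times> 'h \<times> 'h \<Rightarrow> 'k) \<Rightarrow> 'k) \<Rightarrow> ('h \<Rightarrow> ('x \<Rightarrow> 'k) \<Rightarrow> ('x \<Rightarrow> 'k)) \<Rightarrow>
    ('h \<Rightarrow> ('x \<Rightarrow> 'k) \<Rightarrow> ('x \<Rightarrow> 'k)) \<Rightarrow> ('h \<Rightarrow> ('x \<Rightarrow> 'k) \<Rightarrow> ('x \<Rightarrow> 'k)) \<Rightarrow> ('x \<Rightarrow> 'k) \<Rightarrow> ('x \<Rightarrow> 'k)" where
  "PHI T j1 j2 j3 = tact T (rpair j1 (rpair j2 j3))"

lemma rrep2: "ract L j \<Longrightarrow> ract L j' \<Longrightarrow> comm L j j' \<Longrightarrow> rrep L H2 (rpair j j')"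
  by (rule rrep_rpair) (auto intro: vector_space_axioms)

lemma rrep3:
  assumes "ract L j1" "ract L j2" "ract L j3" "comm L j1 j2" "comm L j1 j3" "comm L j2 j3"
  shows "rrep L H3 (rpair j1 (rpair j2 j3))"
  by (rule rrep_rpair[OF assms(1) rrep2[OF assms(2,3,6)] _ vector_space_axioms])
    (rule comm_sym, rule comm_rpair, use assms comm_sym in auto)

lemma rrep4:
  assumes "ract L j1" "ract L j2" "ract L j3" "ract L j4" "comm L j1 j2" "comm L j1 j3" "comm L j1 j4"
    "comm L j2 j3" "comm L j2 j4" "comm L j3 j4"
  shows "rrep L H4 (rpair j1 (rpair j2 (rpair j3 j4)))"
proof (rule rrep_rpair[OF assms(1) rrep3[OF assms(2-4,8-10)] _ vector_space_axioms])
  show "comm L j1 (rpair j2 (rpair j3 j4))"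
    by (rule comm_sym, rule comm_rpair[OF _ _ rrep2[of L j3 j4]], use assms comm_sym in \<open>auto intro!: comm_rpair\<close>)
qed

lemma ract_conv:
  assumes "ract L j" "ract L j'" "comm L j j'"
  shows "ract L (conv j j')"
proof (rule rrep_linI)
  note P = rrep2[OF assms]
  show "vector_space scale" by (rule vector_space_axioms)
  show "form_space L" using assms by (simp add: rrep_def)
  show "lop L L (conv j j' h)" for h unfolding conv_def by (rule lop_tact[OF P comult_in])
  fix f assume f: "L f"
  show "H1 (\<lambda>h. conv j j' h f x)" for x
    by (simp add: conv_def tact_def H1_iff comult_add comult_scale)
  show "conv j j' 1 f = f" unfolding conv_def comult_one by (rule tact_tone[OF P f])
  show "conv j j' (y * z) f = conv j j' z (conv j j' y f)" for y z
    unfolding conv_def comult_mult using P f comult_in by (simp add: tact_tmul)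
qed

lemma comm_conv:
  assumes "ract L j" "ract L j'" "comm L j j'" "ract L k" "comm L j k" "comm L j' k"
  shows "comm L (conv j j') k" "comm L k (conv j j')"
proof -
  show "comm L (conv j j') k"
    unfolding conv_def
    by (rule comm_tact[OF rrep2[OF assms(1-3)] comult_in rrepD(3)[OF assms(4)]])
      (rule comm_rpair[OF assms(5,6,2)])
  then show "comm L k (conv j j')" by (rule comm_sym)
qed

lemma conv_eval:
  assumes "ract L j" "ract L j'" "comm L j j'" "lop L L' p" "L f"
  shows "p (conv j j' h f) x = \<Delta> h (\<lambda>(u1, u2). p (j u1 (j' u2 f)) x)"
  unfolding conv_def
  by (subst lop_tact_eval[OF rrep2[OF assms(1-3)] comult_in assms(4,5)])
    (auto intro!: arg_cong[of _ _ "\<Delta> h"])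

lemma conv_apply: "conv j j' h f x = \<Delta> h (\<lambda>(u1, u2). j u1 (j' u2 f) x)"
  by (auto simp: conv_def tact_def intro!: arg_cong[of _ _ "\<Delta> h"])

lemma PHI_apply: "PHI T j1 j2 j3 f x = T (\<lambda>(x1, x2, x3). j1 x1 (j2 x2 (j3 x3 f)) x)"
  by (auto simp: PHI_def tact_def intro!: arg_cong[of _ _ T])

definition cact :: "(('x \<Rightarrow> 'k) \<Rightarrow> bool) \<Rightarrow> ('h \<Rightarrow> ('x \<Rightarrow> 'k) \<Rightarrow> ('x \<Rightarrow> 'k)) list \<Rightarrow> bool" where
  "cact L js \<longleftrightarrow> (\<forall>j\<in>set js. ract L j) \<and> sorted_wrt (comm L) js"

lemma lop_PHI:
  assumes "cact L [j1, j2, j3]" "T \<in> tprod H3"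
  shows "lop L L (PHI T j1 j2 j3)"
  unfolding PHI_def by (rule lop_tact[OF rrep3 assms(2)]) (use assms(1) in \<open>auto simp: cact_def\<close>)

lemma PHI_closed: "cact L [j1, j2, j3] \<Longrightarrow> T \<in> tprod H3 \<Longrightarrow> L f \<Longrightarrow> L (PHI T j1 j2 j3 f)"
  using lopD(1)[OF lop_PHI] by blast

lemma PHI_eval:
  assumes "cact L [j1, j2, j3]" "T \<in> tprod H3" "lop L L' p" "L f"
  shows "p (PHI T j1 j2 j3 f) x = T (\<lambda>(x1, x2, x3). p (j1 x1 (j2 x2 (j3 x3 f))) x)"
  unfolding PHI_def
  by (subst lop_tact_eval[OF rrep3 assms(2-4)])
    (use assms(1) in \<open>auto simp: cact_def intro!: arg_cong[of _ _ T]\<close>)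

lemma PHI_inverse:
  assumes "cact L [j1, j2, j3]" "L f"
  shows "PHI \<phi> j1 j2 j3 (PHI \<phi>i j1 j2 j3 f) = f" "PHI \<phi>i j1 j2 j3 (PHI \<phi> j1 j2 j3 f) = f"
proof -
  have P: "rrep L H3 (rpair j1 (rpair j2 j3))" by (rule rrep3) (use assms in \<open>auto simp: cact_def\<close>)
  note 1 = tact_tmul[OF P _ phii_in assoc_in assms(2), symmetric]
    tact_tmul[OF P _ assoc_in phii_in assms(2), symmetric]
  show "PHI \<phi> j1 j2 j3 (PHI \<phi>i j1 j2 j3 f) = f" "PHI \<phi>i j1 j2 j3 (PHI \<phi> j1 j2 j3 f) = f"
    using phii_is_tinv tact_tone[OF P assms(2)] unfolding PHI_def by (simp_all add: 1 is_tinv_def)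
qed

text \<open>The operator \<open>p\<close> may lead to forms in a different number of variables. This
  is how reassociations on different tensor powers are related.\<close>

lemma PHI_intertwine:
  assumes "cact L [j1, j2, j3]" "T \<in> tprod H3" "lop L L' p" "L f"
    and "\<And>h f. L f \<Longrightarrow> p (j1 h f) = k1 h (p f)" "\<And>h f. L f \<Longrightarrow> p (j2 h f) = k2 h (p f)"
    "\<And>h f. L f \<Longrightarrow> p (j3 h f) = k3 h (p f)"
  shows "p (PHI T j1 j2 j3 f) = PHI T k1 k2 k3 (p f)"
proof
  fix x
  have c: "L f \<Longrightarrow> L (j2 h f)" "L f \<Longrightarrow> L (j3 h f)" for h f
    using assms(1) rrepD(4)[of L H1] by (auto simp: cact_def)
  show "p (PHI T j1 j2 j3 f) x = PHI T k1 k2 k3 (p f) x"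
    unfolding PHI_apply[of T k1 k2 k3] PHI_eval[OF assms(1-4)]
    by (simp add: assms(4-7) c)
qed

lemma conv_intertwine:
  assumes "ract L j" "ract L j'" "comm L j j'" "lop L L' p" "L f"
    and "\<And>h f. L f \<Longrightarrow> p (j h f) = k h (p f)" "\<And>h f. L f \<Longrightarrow> p (j' h f) = k' h (p f)"
  shows "p (conv j j' h f) = conv k k' h (p f)"
proof
  fix x
  show "p (conv j j' h f) x = conv k k' h (p f) x"
    unfolding conv_apply[of k k'] conv_eval[OF assms(1-5)]
    using rrepD(4)[OF assms(2,5)] by (simp add: assms(5-7))
qed

text \<open>Writing digits for strands, 1(23) for \<open>conv j1 (conv j2 j3)\<close> and (12)3 for
  \<open>conv (conv j1 j2) j3\<close>: the operator of \<open>\<phi>\<close> carries the action of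
  1(23) to that of (12)3, and the operator of \<open>\<phi>i\<close> goes back.\<close>

lemma quasi_coassoc_act:
  assumes "cact L [j1, j2, j3]" "L f"
  shows "conv (conv j1 j2) j3 h (PHI \<phi> j1 j2 j3 f) = PHI \<phi> j1 j2 j3 (conv j1 (conv j2 j3) h f)"
    and "conv j1 (conv j2 j3) h (PHI \<phi>i j1 j2 j3 f) = PHI \<phi>i j1 j2 j3 (conv (conv j1 j2) j3 h f)"
proof -
  let ?P = "rpair j1 (rpair j2 j3)"
  let ?A = "tsum H2 (\<Delta> h) (\<lambda>(h1, h2). tsum H2 (\<Delta> h2) (\<lambda>(u1, u2). pten H3 (h1, u1, u2)))"
  let ?B = "tsum H2 (\<Delta> h) (\<lambda>(h1, h2). tsum H2 (\<Delta> h1) (\<lambda>(u1, u2). pten H3 (u1, u2, h2)))"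
  have j: "ract L j1" "ract L j2" "ract L j3" "comm L j1 j2" "comm L j1 j3" "comm L j2 j3"
    using assms(1) by (auto simp: cact_def)
  have P: "rrep L H3 ?P" by (rule rrep3) (use j in auto)
  have AB: "?A \<in> tprod H3" "?B \<in> tprod H3"
    by (auto intro!: tsum_in_tprod comult_in pten_in_tprod split: prod.split)
  have A: "tact ?A ?P f = conv j1 (conv j2 j3) h f" if f: "L f" for f
    unfolding conv_def[of j1]
  proof (rule tact_tsum[where L = L, OF _ comult_in f]; clarsimp?)
    show "rrep L H2 (rpair j1 (conv j2 j3))"
      by (rule rrep2[OF j(1) ract_conv[OF j(2,3,6)] comm_conv(2)[OF j(2,3,6,1) comm_sym[OF j(4)] comm_sym[OF j(5)]]])
    fix h1 h2 x
    have G: "H3 (\<lambda>y. ?P y f x)" by (rule rrepD(5)[OF P f])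
    then have "H2 (\<lambda>u. ?P (h1, fst u, snd u) f x)" by (simp add: mlin_form_def)
    then show "tsum H2 (\<Delta> h2) (\<lambda>(u1, u2). pten H3 (h1, u1, u2))
        (\<lambda>y. j1 (fst y) (j2 (fst (snd y)) (j3 (snd (snd y)) f)) x) = j1 h1 (conv j2 j3 h2 f) x"
      unfolding conv_eval[OF j(2,3,6) rrepD(3)[OF j(1)] f]
      by (subst tsum_apply[OF comult_in]) (simp_all add: pten_def G[simplified] case_prod_unfold)
  qed
  have B: "tact ?B ?P f = conv (conv j1 j2) j3 h f" if f: "L f" for f
    unfolding conv_def[of "conv j1 j2"]
  proof (rule tact_tsum[where L = L, OF _ comult_in f]; clarsimp?)
    show "rrep L H2 (rpair (conv j1 j2) j3)"
      by (rule rrep2[OF ract_conv[OF j(1,2,4)] j(3) comm_conv(1)[OF j(1,2,4,3,5,6)]])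
    fix h1 h2 x
    have G: "H3 (\<lambda>y. ?P y f x)" by (rule rrepD(5)[OF P f])
    then have "H2 (\<lambda>u. ?P (fst u, snd u, h2) f x)" by (simp add: mlin_form_def)
    then show "tsum H2 (\<Delta> h1) (\<lambda>(u1, u2). pten H3 (u1, u2, h2))
        (\<lambda>y. j1 (fst y) (j2 (fst (snd y)) (j3 (snd (snd y)) f)) x) = conv j1 j2 h1 (j3 h2 f) x"
      unfolding conv_apply
      by (subst tsum_apply[OF comult_in]) (simp_all add: pten_def G[simplified] case_prod_unfold)
  qed
  have PHIL: "L (PHI T j1 j2 j3 f)" if "T \<in> tprod H3" "L f" for T f
    using PHI_closed[OF assms(1)] that .
  \<comment> \<open>The left factor \<open>\<phi>\<close> of the conjugation acts first, hence
    innermost.\<close>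
  have main: "conv j1 (conv j2 j3) h f = PHI \<phi>i j1 j2 j3 (conv (conv j1 j2) j3 h (PHI \<phi> j1 j2 j3 f))"
    if f: "L f" for f
  proof -
    have "tact ?A ?P f = tact (tmul H3 (tmul H3 \<phi> ?B) \<phi>i) ?P f"
      by (simp only: quasi_coassoc)
    also have "\<dots> = tact \<phi>i ?P (tact ?B ?P (tact \<phi> ?P f))"
      using AB f by (simp add: tact_tmul[OF P] assoc_in phii_in tmul_in_tprod)
    finally show ?thesis using f PHIL[OF assoc_in f] by (simp add: A B PHI_def)
  qed
  have cL: "L (conv j1 (conv j2 j3) h f)" "L (conv (conv j1 j2) j3 h f)" if "L f" for f
    unfolding A[OF that, symmetric] B[OF that, symmetric] using tact_closed[OF P] AB that by blast+
  show "conv (conv j1 j2) j3 h (PHI \<phi> j1 j2 j3 f) = PHI \<phi> j1 j2 j3 (conv j1 (conv j2 j3) h f)"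
    using main assms cL PHIL[OF assoc_in] by (simp add: PHI_inverse)
  show "conv j1 (conv j2 j3) h (PHI \<phi>i j1 j2 j3 f) = PHI \<phi>i j1 j2 j3 (conv (conv j1 j2) j3 h f)"
    using main PHIL[OF phii_in] assms by (simp add: PHI_inverse)
qed

text \<open>In each of the five factors either one component is split by the comultiplication, which
  doubles a strand, or one component is 1, which makes a strand disappear. The factors are
  identified one by one and then composed in reverse order.\<close>

lemma pentagon_act:
  assumes "cact L [j1, j2, j3, j4]" "L f"
  shows "PHI \<phi> (conv j1 j2) j3 j4 (PHI \<phi> j1 j2 (conv j3 j4) f) =
    PHI \<phi> j1 j2 j3 (PHI \<phi> j1 (conv j2 j3) j4 (PHI \<phi> j2 j3 j4 f))"
proof -
  let ?P = "rpair j1 (rpair j2 (rpair j3 j4))"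
  let ?A = "tsum H3 \<phi> (\<lambda>(x1, x2, x3). tsum H2 (\<Delta> x3) (\<lambda>(u1, u2). pten H4 (x1, x2, u1, u2)))"
  let ?B = "tsum H3 \<phi> (\<lambda>(x1, x2, x3). tsum H2 (\<Delta> x1) (\<lambda>(u1, u2). pten H4 (u1, u2, x2, x3)))"
  let ?C = "tsum H3 \<phi> (\<lambda>(x1, x2, x3). pten H4 (1, x1, x2, x3))"
  let ?D = "tsum H3 \<phi> (\<lambda>(x1, x2, x3). tsum H2 (\<Delta> x2) (\<lambda>(u1, u2). pten H4 (x1, u1, u2, x3)))"
  let ?E = "tsum H3 \<phi> (\<lambda>(x1, x2, x3). pten H4 (x1, x2, x3, 1))"
  have j: "ract L j1" "ract L j2" "ract L j3" "ract L j4" "comm L j1 j2" "comm L j1 j3" "comm L j1 j4"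
    "comm L j2 j3" "comm L j2 j4" "comm L j3 j4"
    using assms(1) by (auto simp: cact_def)
  note js = j(5-10)[THEN comm_sym]
  have P: "rrep L H4 ?P" by (rule rrep4) (use j in auto)
  have in4: "?A \<in> tprod H4" "?B \<in> tprod H4" "?C \<in> tprod H4" "?D \<in> tprod H4" "?E \<in> tprod H4"
    by (auto intro!: tsum_in_tprod comult_in assoc_in pten_in_tprod split: prod.split)
  have cL: "L (j1 h f)" "L (j2 h f)" "L (j3 h f)" "L (j4 h f)" if "L f" for h f
    using j(1-4)[THEN rrepD(4)] that by blast+
  have A: "tact ?A ?P f = PHI \<phi> j1 j2 (conv j3 j4) f" if f: "L f" for f
    unfolding PHI_def
  proof (rule tact_tsum[where L = L, OF _ assoc_in f]; clarsimp?)
    show "rrep L H3 (rpair j1 (rpair j2 (conv j3 j4)))"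
      by (intro rrep3 ract_conv comm_conv) (use j js in auto)
    fix x1 x2 x3 x
    have G: "H4 (\<lambda>y. ?P y f x)" by (rule rrepD(5)[OF P f])
    then have "H2 (\<lambda>u. ?P (x1, x2, fst u, snd u) f x)" by (simp add: mlin_form_def)
    then show "tsum H2 (\<Delta> x3) (\<lambda>(u1, u2). pten H4 (x1, x2, u1, u2))
        (\<lambda>y. j1 (fst y) (j2 (fst (snd y)) (j3 (fst (snd (snd y))) (j4 (snd (snd (snd y))) f))) x) = j1 x1 (j2 x2 (conv j3 j4 x3 f)) x"
      unfolding conv_eval[OF j(3,4,10) lop_comp[OF rrepD(3)[OF j(2)] rrepD(3)[OF j(1)]] f]
      by (subst tsum_apply[OF comult_in]) (simp_all add: pten_def G[simplified] case_prod_unfold)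
  qed
  have B: "tact ?B ?P f = PHI \<phi> (conv j1 j2) j3 j4 f" if f: "L f" for f
    unfolding PHI_def
  proof (rule tact_tsum[where L = L, OF _ assoc_in f]; clarsimp?)
    show "rrep L H3 (rpair (conv j1 j2) (rpair j3 j4))"
      by (intro rrep3 ract_conv comm_conv) (use j js in auto)
    fix x1 x2 x3 x
    have G: "H4 (\<lambda>y. ?P y f x)" by (rule rrepD(5)[OF P f])
    then have "H2 (\<lambda>u. ?P (fst u, snd u, x2, x3) f x)" by (simp add: mlin_form_def)
    then show "tsum H2 (\<Delta> x1) (\<lambda>(u1, u2). pten H4 (u1, u2, x2, x3))
        (\<lambda>y. j1 (fst y) (j2 (fst (snd y)) (j3 (fst (snd (snd y))) (j4 (snd (snd (snd y))) f))) x) = conv j1 j2 x1 (j3 x2 (j4 x3 f)) x"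
      unfolding conv_apply
      by (subst tsum_apply[OF comult_in]) (simp_all add: pten_def G[simplified] case_prod_unfold)
  qed
  have C: "tact ?C ?P f = PHI \<phi> j2 j3 j4 f" if f: "L f" for f
    unfolding PHI_def
  proof (rule tact_tsum[where L = L, OF _ assoc_in f]; clarsimp?)
    show "rrep L H3 (rpair j2 (rpair j3 j4))"
      by (intro rrep3 ract_conv comm_conv) (use j js in auto)
    fix x1 x2 x3 x
    have G: "H4 (\<lambda>y. ?P y f x)" by (rule rrepD(5)[OF P f])
    then show "pten H4 (1, x1, x2, x3)
        (\<lambda>y. j1 (fst y) (j2 (fst (snd y)) (j3 (fst (snd (snd y))) (j4 (snd (snd (snd y))) f))) x) = j2 x1 (j3 x2 (j4 x3 f)) x"
      by (simp add: pten_def rrepD(6)[OF j(1)] f cL)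
  qed
  have D: "tact ?D ?P f = PHI \<phi> j1 (conv j2 j3) j4 f" if f: "L f" for f
    unfolding PHI_def
  proof (rule tact_tsum[where L = L, OF _ assoc_in f]; clarsimp?)
    show "rrep L H3 (rpair j1 (rpair (conv j2 j3) j4))"
      by (intro rrep3 ract_conv comm_conv) (use j js in auto)
    fix x1 x2 x3 x
    have G: "H4 (\<lambda>y. ?P y f x)" by (rule rrepD(5)[OF P f])
    then have "H2 (\<lambda>u. ?P (x1, fst u, snd u, x3) f x)" by (simp add: mlin_form_def)
    then show "tsum H2 (\<Delta> x2) (\<lambda>(u1, u2). pten H4 (x1, u1, u2, x3))
        (\<lambda>y. j1 (fst y) (j2 (fst (snd y)) (j3 (fst (snd (snd y))) (j4 (snd (snd (snd y))) f))) x) = j1 x1 (conv j2 j3 x2 (j4 x3 f)) x"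
      unfolding conv_eval[OF j(2,3,8) rrepD(3)[OF j(1)] cL(4)[OF f]]
      by (subst tsum_apply[OF comult_in]) (simp_all add: pten_def G[simplified] case_prod_unfold)
  qed
  have E: "tact ?E ?P f = PHI \<phi> j1 j2 j3 f" if f: "L f" for f
    unfolding PHI_def
  proof (rule tact_tsum[where L = L, OF _ assoc_in f]; clarsimp?)
    show "rrep L H3 (rpair j1 (rpair j2 j3))"
      by (intro rrep3 ract_conv comm_conv) (use j js in auto)
    fix x1 x2 x3 x
    have G: "H4 (\<lambda>y. ?P y f x)" by (rule rrepD(5)[OF P f])
    then show "pten H4 (x1, x2, x3, 1)
        (\<lambda>y. j1 (fst y) (j2 (fst (snd y)) (j3 (fst (snd (snd y))) (j4 (snd (snd (snd y))) f))) x) = j1 x1 (j2 x2 (j3 x3 f)) x"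
      by (simp add: pten_def rrepD(6)[OF j(4)] f cL)
  qed
  have "tact (tmul H4 ?A ?B) ?P f = tact (tmul H4 (tmul H4 ?C ?D) ?E) ?P f"
    by (simp only: pentagon)
  then have "tact ?B ?P (tact ?A ?P f) = tact ?E ?P (tact ?D ?P (tact ?C ?P f))"
    using in4 assms(2) by (simp add: tact_tmul[OF P] tmul_in_tprod)
  moreover have "L (tact ?A ?P f)" "L (tact ?C ?P f)" "L (tact ?D ?P (tact ?C ?P f))"
    using tact_closed[OF P] in4 assms(2) by blast+
  ultimately show ?thesis using assms(2) by (simp add: A B C D E)
qed

section \<open>Trivial actions and the counit axioms\<close>

definition eps :: "'h \<Rightarrow> ('x \<Rightarrow> 'k) \<Rightarrow> ('x \<Rightarrow> 'k)" where
  "eps h f = (\<lambda>x. \<epsilon> h * f x)"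

lemma ract_eps: "form_space L \<Longrightarrow> ract L eps"
  using counit_linear
  by (intro rrep_linI vector_space_axioms)
    (auto simp: eps_def lop_def form_spaceD(3) counit_one counit_mult H1_iff distrib_left distrib_right mult.assoc mult.left_commute)

lemma comm_eps: "(\<And>y. lop L L (P y)) \<Longrightarrow> comm L P eps" "(\<And>y. lop L L (P y)) \<Longrightarrow> comm L eps P"
  using lopD(3)[of L L] by (auto simp: comm_def eps_def)

lemma comm_eps_eps: "comm L eps eps"
  by (auto simp: comm_def eps_def algebra_simps)

lemma conv_eps_left:
  assumes "ract L j" "L f"
  shows "conv eps j h f = j h f"
proof
  fix x
  have 1: "H1 (\<lambda>h. j h f x)" by (rule rrepD(5)[OF assms])
  have "ract L eps" by (rule ract_eps[OF rrepD(1)[OF assms(1)]])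
  from rrepD(5)[OF rrep2[OF this assms(1) comm_eps(2)[OF rrepD(3)[OF assms(1)]]] assms(2), of x]
  have 2: "H2 (\<lambda>(a, b). j (scale (\<epsilon> a) b) f x)"
    using 1 by (simp add: H1_iff eps_def case_prod_unfold)
  have "\<Delta> h (\<lambda>(a, b). j (scale (\<epsilon> a) b) f x) = j h f x"
    using linear_form_tsum[OF comult_in vector_space_axioms 1, of "\<lambda>(a, b). scale (\<epsilon> a) b" h] 2
    by (simp add: counit_left[unfolded case_prod_unfold] case_prod_unfold)
  then show "conv eps j h f x = j h f x"
    using 1 by (simp add: conv_apply H1_iff eps_def)
qed

lemma conv_eps_right:
  assumes "ract L j" "L f"
  shows "conv j eps h f = j h f"
proof
  fix x
  have 1: "H1 (\<lambda>h. j h f x)" by (rule rrepD(5)[OF assms])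
  have 3: "j h (eps k f) x = \<epsilon> k * j h f x" for h k
    using lopD(3)[OF rrepD(3)[OF assms(1)] assms(2)] by (simp add: eps_def)
  have "ract L eps" by (rule ract_eps[OF rrepD(1)[OF assms(1)]])
  from rrepD(5)[OF rrep2[OF assms(1) this comm_eps(1)[OF rrepD(3)[OF assms(1)]]] assms(2), of x]
  have 2: "H2 (\<lambda>(a, b). j (scale (\<epsilon> b) a) f x)"
    using 1 by (simp add: H1_iff 3 case_prod_unfold)
  have "\<Delta> h (\<lambda>(a, b). j (scale (\<epsilon> b) a) f x) = j h f x"
    using linear_form_tsum[OF comult_in vector_space_axioms 1, of "\<lambda>(a, b). scale (\<epsilon> b) a" h] 2
    by (simp add: counit_right[unfolded case_prod_unfold] case_prod_unfold)
  then show "conv j eps h f x = j h f x"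
    using 1 by (simp add: conv_apply H1_iff 3)
qed

lemma PHI_eps_middle:
  assumes "ract L j1" "ract L j3" "comm L j1 j3" "L f"
  shows "PHI \<phi> j1 eps j3 f = f"
proof
  fix x
  note R = rrep2[OF assms(1-3)]
  have G: "H2 (\<lambda>y. rpair j1 j3 y f x)" by (rule rrepD(5)[OF R assms(4)])
  have e: "ract L eps" by (rule ract_eps[OF rrepD(1)[OF assms(1)]])
  note l = rrepD(3)[OF assms(1)] rrepD(3)[OF assms(2)]
  have R3: "rrep L H3 (rpair j1 (rpair eps j3))"
    using assms e by (intro rrep3 comm_eps l) auto
  have H: "H1 (\<lambda>a. j1 a (j3 b f) x)" for b
    by (intro rrepD(5)[OF assms(1)] rrepD(4)[OF assms(2)] assms(4))
  have 3: "j1 (scale (\<epsilon> k) a) (j3 b f) x = j1 a (eps k (j3 b f)) x" for a b k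
    using lopD(3)[OF l(1) rrepD(4)[OF assms(2,4)]] H by (simp add: eps_def H1_iff)
  have "tsum H3 \<phi> (\<lambda>(x1, x2, x3). pten H2 (scale (\<epsilon> x2) x1, x3)) (\<lambda>y. rpair j1 j3 y f x) =
      PHI \<phi> j1 eps j3 f x"
    unfolding PHI_apply
    using rrepD(5)[OF R3 assms(4), of x]
    by (subst tsum_apply[OF assoc_in]) (simp_all add: pten_def G[simplified] 3 case_prod_unfold)
  then show "PHI \<phi> j1 eps j3 f x = f x"
    using rrepD(6)[OF R assms(4)] tone_apply[of H2, OF G] by (simp add: assoc_counit)
qed

lemma cact_simps [simp]:
  "cact L []" "cact L (j # js) \<longleftrightarrow> ract L j \<and> (\<forall>k\<in>set js. comm L j k) \<and> cact L js"
  by (auto simp: cact_def)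

lemma conv_simps:
  "ract L j \<Longrightarrow> ract L j' \<Longrightarrow> comm L j j' \<Longrightarrow> ract L (conv j j')"
  "ract L j \<Longrightarrow> ract L j' \<Longrightarrow> comm L j j' \<Longrightarrow> ract L k \<Longrightarrow> comm L j k \<Longrightarrow> comm L j' k \<Longrightarrow> comm L (conv j j') k"
  "ract L j \<Longrightarrow> ract L j' \<Longrightarrow> comm L j j' \<Longrightarrow> ract L k \<Longrightarrow> comm L j k \<Longrightarrow> comm L j' k \<Longrightarrow> comm L k (conv j j')"
  by (simp_all add: ract_conv comm_conv)

lemma PHI_cong:
  assumes "cact L [j1, j2, j3]" "T \<in> tprod H3" "L f"
    and "\<And>h f. L f \<Longrightarrow> j1 h f = k1 h f" "\<And>h f. L f \<Longrightarrow> j2 h f = k2 h f" "\<And>h f. L f \<Longrightarrow> j3 h f = k3 h f"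
  shows "PHI T j1 j2 j3 f = PHI T k1 k2 k3 f"
  by (rule PHI_intertwine[OF assms(1,2) _ assms(3), where p = "\<lambda>f. f" and L' = L])
    (simp_all add: lop_def assms)

lemma PHI_comm:
  assumes "cact L [j1, j2, j3]" "T \<in> tprod H3" "L f" "ract L k" "comm L j1 k" "comm L j2 k" "comm L j3 k"
  shows "k h (PHI T j1 j2 j3 f) = PHI T j1 j2 j3 (k h f)"
  by (rule PHI_intertwine[OF assms(1,2) rrepD(3)[OF assms(4)] assms(3)])
    (simp_all add: commD[OF assms(5)] commD[OF assms(6)] commD[OF assms(7)])

lemma PHI_PHI_comm:
  assumes "cact L [j1, j2, j3]" "T \<in> tprod H3" "cact L [k1, k2, k3]" "U \<in> tprod H3" "L f"
    "\<forall>j\<in>{j1, j2, j3}. \<forall>k\<in>{k1, k2, k3}. comm L j k"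
  shows "PHI T j1 j2 j3 (PHI U k1 k2 k3 f) = PHI U k1 k2 k3 (PHI T j1 j2 j3 f)"
  by (rule PHI_intertwine[OF assms(3,4) lop_PHI[OF assms(1,2)] assms(5)])
    (use assms PHI_comm[OF assms(1,2), symmetric] in auto)

lemma PHI_phii_eqI:
  assumes "cact L [j1, j2, j3]" "L f" "PHI \<phi> j1 j2 j3 f = g"
  shows "PHI \<phi>i j1 j2 j3 g = f"
  using PHI_inverse(2)[OF assms(1,2)] assms(3) by simp

lemma PHI_phi_eqI:
  assumes "cact L [j1, j2, j3]" "L f" "PHI \<phi>i j1 j2 j3 f = g"
  shows "PHI \<phi> j1 j2 j3 g = f"
  using PHI_inverse(1)[OF assms(1,2)] assms(3) by simp

lemma pentagon_inv_act:
  assumes "cact L [j1, j2, j3, j4]" "L f"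
  shows "PHI \<phi>i j1 j2 (conv j3 j4) (PHI \<phi>i (conv j1 j2) j3 j4 f) =
    PHI \<phi>i j2 j3 j4 (PHI \<phi>i j1 (conv j2 j3) j4 (PHI \<phi>i j1 j2 j3 f))"
proof -
  have js: "comm L k j" if "comm L j k" for j k :: "'h \<Rightarrow> ('a \<Rightarrow> 'k) \<Rightarrow> 'a \<Rightarrow> 'k"
    using that by (rule comm_sym)
  have c: "cact L [j1, j2, conv j3 j4]" "cact L [conv j1 j2, j3, j4]" "cact L [j2, j3, j4]"
    "cact L [j1, conv j2 j3, j4]" "cact L [j1, j2, j3]"
    using assms(1) by (simp_all add: conv_simps js)
  define f1 where "f1 = PHI \<phi>i j1 j2 j3 f"
  define f2 where "f2 = PHI \<phi>i j1 (conv j2 j3) j4 f1"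
  define f3 where "f3 = PHI \<phi>i j2 j3 j4 f2"
  have L1: "L f1" unfolding f1_def by (rule PHI_closed[OF c(5) phii_in, OF assms(2)])
  have L2: "L f2" unfolding f2_def by (rule PHI_closed[OF c(4) phii_in, OF L1])
  have L3: "L f3" unfolding f3_def by (rule PHI_closed[OF c(3) phii_in, OF L2])
  note i = PHI_inverse(1)[OF c(3), OF L2, folded f3_def] PHI_inverse(1)[OF c(4), OF L1, folded f2_def]
    PHI_inverse(1)[OF c(5), OF assms(2), folded f1_def]
  have "PHI \<phi> (conv j1 j2) j3 j4 (PHI \<phi> j1 j2 (conv j3 j4) f3) = f"
    unfolding pentagon_act[OF assms(1), OF L3] i ..
  from PHI_phii_eqI[OF c(2), OF PHI_closed[OF c(1) assoc_in, OF L3] this]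
  have "PHI \<phi>i j1 j2 (conv j3 j4) (PHI \<phi>i (conv j1 j2) j3 j4 f) = f3"
    using PHI_inverse(2)[OF c(1), OF L3] by simp
  then show ?thesis unfolding f1_def f2_def f3_def .
qed

lemma PHI_phii_id:
  assumes "cact L [j1, j2, j3]" "L f" "\<And>f. L f \<Longrightarrow> PHI \<phi> j1 j2 j3 f = f"
  shows "PHI \<phi>i j1 j2 j3 f = f"
  by (rule PHI_phii_eqI[OF assms(1,2), OF assms(3)[OF assms(2)]])

lemma cact_eps:
  assumes "cact L [j1, j2]"
  shows "cact L [eps, j1, j2]" "cact L [j1, eps, j2]" "cact L [j1, j2, eps]"
    "cact L [eps, eps, j1, j2]" "cact L [j1, j2, eps, eps]" "cact L [eps, eps, j1]" "cact L [j1, eps, eps]"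
proof -
  have "form_space L" using assms rrepD(1) by auto
  then show "cact L [eps, j1, j2]" "cact L [j1, eps, j2]" "cact L [j1, j2, eps]"
    "cact L [eps, eps, j1, j2]" "cact L [j1, j2, eps, eps]" "cact L [eps, eps, j1]" "cact L [j1, eps, eps]"
    using assms by (auto simp: comm_eps_eps intro!: ract_eps comm_eps rrepD(3))
qed

lemma PHI_eps_mid:
  assumes "cact L [j1, j2]" "L f"
  shows "PHI \<phi> j1 eps j2 f = f" "PHI \<phi>i j1 eps j2 f = f"
proof -
  have 1: "PHI \<phi> j1 eps j2 f = f" if "L f" for f
    by (rule PHI_eps_middle[of L]) (use assms that in auto)
  then show "PHI \<phi> j1 eps j2 f = f" by (simp add: assms)
  show "PHI \<phi>i j1 eps j2 f = f" by (rule PHI_phii_id[OF cact_eps(2)[OF assms(1)], OF assms(2) 1])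
qed

text \<open>The axiom normalises the middle component of \<open>\<phi>\<close>. With the trivial
  action as the first two strands of the pentagon, all other factors are the identity and the
  operator equals its own square; being invertible, it is the identity.\<close>

lemma PHI_eps_left:
  assumes "cact L [j1, j2]" "L f"
  shows "PHI \<phi> eps j1 j2 f = f" "PHI \<phi>i eps j1 j2 f = f"
proof -
  note c = cact_eps[OF assms(1)]
  have e: "ract L eps" and j: "ract L j1" "ract L j2" using c(1) by auto
  have js: "comm L k j" if "comm L j k" for j k :: "'h \<Rightarrow> ('a \<Rightarrow> 'k) \<Rightarrow> 'a \<Rightarrow> 'k"
    using that by (rule comm_sym)
  have cc: "cact L [eps, eps, conv j1 j2]" "cact L [conv eps eps, j1, j2]" "cact L [eps, conv eps j1, j2]"
    using c(4) by (simp_all add: conv_simps js)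
  have 1: "PHI \<phi> eps j1 j2 f = f" if f: "L f" for f
  proof -
    have L: "L (PHI \<phi> eps j1 j2 f)" using PHI_closed[OF c(1) assoc_in, OF f] .
    have s1: "PHI \<phi> eps eps (conv j1 j2) f = f"
      by (rule PHI_eps_middle[of L]) (use cc f in auto)
    have s2: "PHI \<phi> (conv eps eps) j1 j2 f = PHI \<phi> eps j1 j2 f"
      by (rule PHI_cong[OF cc(2) assoc_in, OF f]) (simp_all add: conv_eps_left[OF e])
    have s3: "PHI \<phi> eps eps j1 g = g" if "L g" for g
      by (rule PHI_eps_middle[of L]) (use c(6) that in auto)
    have s4: "PHI \<phi> eps (conv eps j1) j2 g = PHI \<phi> eps j1 j2 g" if "L g" for g
      by (rule PHI_cong[OF cc(3) assoc_in, OF that]) (simp_all add: conv_eps_left[OF j(1)])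
    have "PHI \<phi> eps j1 j2 f = PHI \<phi> (conv eps eps) j1 j2 (PHI \<phi> eps eps (conv j1 j2) f)"
      unfolding s1 s2 ..
    also have "\<dots> = PHI \<phi> eps j1 j2 (PHI \<phi> eps j1 j2 f)"
      unfolding pentagon_act[OF c(4), OF f] s4[OF L] by (rule s3[OF PHI_closed[OF c(1) assoc_in, OF L]])
    finally have "PHI \<phi> eps j1 j2 (PHI \<phi> eps j1 j2 f) = PHI \<phi> eps j1 j2 f" by simp
    then show ?thesis using PHI_inverse(2)[OF c(1)] f L by metis
  qed
  then show "PHI \<phi> eps j1 j2 f = f" by (simp add: assms)
  show "PHI \<phi>i eps j1 j2 f = f" by (rule PHI_phii_id[OF c(1), OF assms(2) 1])
qed

text \<open>The pentagon with trivial third and fourth strand; again an invertible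
  idempotent.\<close>

lemma PHI_eps_right:
  assumes "cact L [j1, j2]" "L f"
  shows "PHI \<phi> j1 j2 eps f = f" "PHI \<phi>i j1 j2 eps f = f"
proof -
  note c = cact_eps[OF assms(1)]
  have e: "ract L eps" and j: "ract L j1" "ract L j2" using c(1) by auto
  have js: "comm L k j" if "comm L j k" for j k :: "'h \<Rightarrow> ('a \<Rightarrow> 'k) \<Rightarrow> 'a \<Rightarrow> 'k"
    using that by (rule comm_sym)
  have cc: "cact L [j1, j2, conv eps eps]" "cact L [conv j1 j2, eps, eps]" "cact L [j1, conv j2 eps, eps]"
    "cact L [j2, eps, eps]"
    using c(5) by (simp_all add: conv_simps js)
  have 1: "PHI \<phi> j1 j2 eps f = f" if f: "L f" for f
  proof -
    have L: "L (PHI \<phi> j1 j2 eps f)" using PHI_closed[OF c(3) assoc_in, OF f] .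
    have s1: "PHI \<phi> (conv j1 j2) eps eps g = g" if "L g" for g
      by (rule PHI_eps_middle[of L]) (use cc that in auto)
    have s2: "PHI \<phi> j1 j2 (conv eps eps) f = PHI \<phi> j1 j2 eps f"
      by (rule PHI_cong[OF cc(1) assoc_in, OF f]) (simp_all add: conv_eps_left[OF e])
    have s3: "PHI \<phi> j2 eps eps f = f"
      by (rule PHI_eps_middle[of L]) (use cc(4) f in auto)
    have s4: "PHI \<phi> j1 (conv j2 eps) eps f = PHI \<phi> j1 j2 eps f"
      by (rule PHI_cong[OF cc(3) assoc_in, OF f]) (simp_all add: conv_eps_right[OF j(2)])
    have "PHI \<phi> j1 j2 eps f = PHI \<phi> (conv j1 j2) eps eps (PHI \<phi> j1 j2 (conv eps eps) f)"
      unfolding s2 by (rule s1[OF L, symmetric])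
    also have "\<dots> = PHI \<phi> j1 j2 eps (PHI \<phi> j1 j2 eps f)"
      unfolding pentagon_act[OF c(5), OF f] s3 s4 ..
    finally have "PHI \<phi> j1 j2 eps (PHI \<phi> j1 j2 eps f) = PHI \<phi> j1 j2 eps f" by simp
    then show ?thesis using PHI_inverse(2)[OF c(3)] f L by metis
  qed
  then show "PHI \<phi> j1 j2 eps f = f" by (simp add: assms)
  show "PHI \<phi>i j1 j2 eps f = f" by (rule PHI_phii_id[OF c(3), OF assms(2) 1])
qed

section \<open>Rebracketing of four strands\<close>

definition CHI :: "('h \<Rightarrow> ('x \<Rightarrow> 'k) \<Rightarrow> ('x \<Rightarrow> 'k)) \<Rightarrow> ('h \<Rightarrow> ('x \<Rightarrow> 'k) \<Rightarrow> ('x \<Rightarrow> 'k)) \<Rightarrow>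
    ('h \<Rightarrow> ('x \<Rightarrow> 'k) \<Rightarrow> ('x \<Rightarrow> 'k)) \<Rightarrow> ('h \<Rightarrow> ('x \<Rightarrow> 'k) \<Rightarrow> ('x \<Rightarrow> 'k)) \<Rightarrow> ('x \<Rightarrow> 'k) \<Rightarrow> ('x \<Rightarrow> 'k)" where
  "CHI j1 j2 j3 j4 f = PHI \<phi>i (conv j1 j2) j3 j4 (PHI \<phi> j1 j2 j3 f)"

definition CHIi :: "('h \<Rightarrow> ('x \<Rightarrow> 'k) \<Rightarrow> ('x \<Rightarrow> 'k)) \<Rightarrow> ('h \<Rightarrow> ('x \<Rightarrow> 'k) \<Rightarrow> ('x \<Rightarrow> 'k)) \<Rightarrow>
    ('h \<Rightarrow> ('x \<Rightarrow> 'k) \<Rightarrow> ('x \<Rightarrow> 'k)) \<Rightarrow> ('h \<Rightarrow> ('x \<Rightarrow> 'k) \<Rightarrow> ('x \<Rightarrow> 'k)) \<Rightarrow> ('x \<Rightarrow> 'k) \<Rightarrow> ('x \<Rightarrow> 'k)" where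
  "CHIi j1 j2 j3 j4 f = PHI \<phi>i j1 j2 j3 (PHI \<phi> (conv j1 j2) j3 j4 f)"

lemma cact_conv:
  assumes "cact L [j1, j2, j3, j4]"
  shows "cact L [conv j1 j2, j3, j4]" "cact L [j1, conv j2 j3, j4]" "cact L [j1, j2, conv j3 j4]"
    "cact L [j1, j2, j3]" "cact L [j2, j3, j4]" "cact L [j1, conv j2 j3]"
    "cact L [conv (conv j1 j2) (conv j3 j4)]"
proof -
  have js: "comm L k j" if "comm L j k" for j k :: "'h \<Rightarrow> ('a \<Rightarrow> 'k) \<Rightarrow> 'a \<Rightarrow> 'k"
    using that by (rule comm_sym)
  show "cact L [conv j1 j2, j3, j4]" "cact L [j1, conv j2 j3, j4]" "cact L [j1, j2, conv j3 j4]"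
    "cact L [j1, j2, j3]" "cact L [j2, j3, j4]" "cact L [j1, conv j2 j3]"
    "cact L [conv (conv j1 j2) (conv j3 j4)]"
    using assms by (simp_all add: conv_simps js)
qed

lemma lop_CHI: "cact L [j1, j2, j3, j4] \<Longrightarrow> lop L L (CHI j1 j2 j3 j4)"
  unfolding CHI_def
  by (rule lop_comp[OF lop_PHI[OF cact_conv(4) assoc_in] lop_PHI[OF cact_conv(1) phii_in]])

lemma lop_CHIi: "cact L [j1, j2, j3, j4] \<Longrightarrow> lop L L (CHIi j1 j2 j3 j4)"
  unfolding CHIi_def
  by (rule lop_comp[OF lop_PHI[OF cact_conv(1) assoc_in] lop_PHI[OF cact_conv(4) phii_in]])

lemma CHI_inverse:
  assumes "cact L [j1, j2, j3, j4]" "L f"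
  shows "CHIi j1 j2 j3 j4 (CHI j1 j2 j3 j4 f) = f" "CHI j1 j2 j3 j4 (CHIi j1 j2 j3 j4 f) = f"
proof -
  note c = cact_conv[OF assms(1)]
  show "CHIi j1 j2 j3 j4 (CHI j1 j2 j3 j4 f) = f"
    unfolding CHI_def CHIi_def PHI_inverse(1)[OF c(1), OF PHI_closed[OF c(4) assoc_in, OF assms(2)]]
    by (rule PHI_inverse(2)[OF c(4), OF assms(2)])
  show "CHI j1 j2 j3 j4 (CHIi j1 j2 j3 j4 f) = f"
    unfolding CHI_def CHIi_def PHI_inverse(1)[OF c(4), OF PHI_closed[OF c(1) assoc_in, OF assms(2)]]
    by (rule PHI_inverse(2)[OF c(1), OF assms(2)])
qed

text \<open>The pentagon rewrites \<chi> as the product of the factors (id \<otimes> \<Delta>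
  \<otimes> id)(\<phi>^-1), 1 \<otimes> \<phi>^-1 and (id \<otimes> id \<otimes> \<Delta>)(\<phi>).
  The first contains strands 2 and 3 as the bracket 23, so it drops out on forms where 23 acts
  trivially.\<close>

lemma CHI_alt:
  assumes "cact L [j1, j2, j3, j4]" "L f"
  shows "CHI j1 j2 j3 j4 f = PHI \<phi> j1 j2 (conv j3 j4) (PHI \<phi>i j2 j3 j4 (PHI \<phi>i j1 (conv j2 j3) j4 f))"
proof -
  note c = cact_conv[OF assms(1)]
  define f1 where "f1 = PHI \<phi>i j1 (conv j2 j3) j4 f"
  define f2 where "f2 = PHI \<phi>i j2 j3 j4 f1"
  have L1: "L f1" unfolding f1_def by (rule PHI_closed[OF c(2) phii_in, OF assms(2)])
  have L2: "L f2" unfolding f2_def by (rule PHI_closed[OF c(5) phii_in, OF L1])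
  note i = PHI_inverse(1)[OF c(5), OF L1, folded f2_def] PHI_inverse(1)[OF c(2), OF assms(2), folded f1_def]
  show ?thesis
    unfolding CHI_def f1_def[symmetric] f2_def[symmetric]
    by (rule PHI_phii_eqI[OF c(1), OF PHI_closed[OF c(3) assoc_in, OF L2]])
      (simp only: pentagon_act[OF assms(1), OF L2] i)
qed

lemma CHIi_alt:
  assumes "cact L [j1, j2, j3, j4]" "L f"
  shows "CHIi j1 j2 j3 j4 f = PHI \<phi> j1 (conv j2 j3) j4 (PHI \<phi> j2 j3 j4 (PHI \<phi>i j1 j2 (conv j3 j4) f))"
proof -
  note c = cact_conv[OF assms(1)]
  define f1 where "f1 = PHI \<phi>i j1 j2 (conv j3 j4) f"
  have L1: "L f1" unfolding f1_def by (rule PHI_closed[OF c(3) phii_in, OF assms(2)])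
  note i = PHI_inverse(1)[OF c(3), OF assms(2), folded f1_def]
  show ?thesis
    unfolding CHIi_def f1_def[symmetric]
    by (rule PHI_phii_eqI[OF c(4), OF PHI_closed[OF c(2) assoc_in, OF PHI_closed[OF c(5) assoc_in, OF L1]]])
      (simp only: pentagon_act[OF assms(1), OF L1, symmetric] i)
qed

lemma CHI_intertwine:
  assumes "cact L [j1, j2, j3, j4]" "lop L L' p" "L f"
    and "\<And>h f. L f \<Longrightarrow> p (j1 h f) = k1 h (p f)" "\<And>h f. L f \<Longrightarrow> p (j2 h f) = k2 h (p f)"
    "\<And>h f. L f \<Longrightarrow> p (j3 h f) = k3 h (p f)" "\<And>h f. L f \<Longrightarrow> p (j4 h f) = k4 h (p f)"
  shows "p (CHI j1 j2 j3 j4 f) = CHI k1 k2 k3 k4 (p f)"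
    and "p (CHIi j1 j2 j3 j4 f) = CHIi k1 k2 k3 k4 (p f)"
proof -
  note c = cact_conv[OF assms(1)]
  have j: "ract L j1" "ract L j2" "comm L j1 j2" using assms(1) by auto
  note k = conv_intertwine[OF j assms(2), OF _ assms(4,5)]
  note L = PHI_closed[OF c(4) assoc_in, OF assms(3)] PHI_closed[OF c(1) assoc_in, OF assms(3)]
  have 1: "p (PHI T j1 j2 j3 f) = PHI T k1 k2 k3 (p f)" if "T \<in> tprod H3" "L f" for T f
    by (rule PHI_intertwine[OF c(4) that(1) assms(2), OF that(2) assms(4-6)])
  have 2: "p (PHI T (conv j1 j2) j3 j4 f) = PHI T (conv k1 k2) k3 k4 (p f)" if "T \<in> tprod H3" "L f" for T f
    by (rule PHI_intertwine[OF c(1) that(1) assms(2), OF that(2) k assms(6,7)])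
  show "p (CHI j1 j2 j3 j4 f) = CHI k1 k2 k3 k4 (p f)"
    unfolding CHI_def 2[OF phii_in L(1)] 1[OF assoc_in assms(3)] ..
  show "p (CHIi j1 j2 j3 j4 f) = CHIi k1 k2 k3 k4 (p f)"
    unfolding CHIi_def 1[OF phii_in L(2)] 2[OF assoc_in assms(3)] ..
qed

text \<open>\<open>CHI\<close> carries the bracketing (1(23))4 to (12)(34), by way of
  ((12)3)4.\<close>

lemma CHI_conv:
  assumes "cact L [j1, j2, j3, j4]" "L f"
  shows "conv (conv j1 j2) (conv j3 j4) h (CHI j1 j2 j3 j4 f) =
      CHI j1 j2 j3 j4 (conv (conv j1 (conv j2 j3)) j4 h f)"
    and "CHIi j1 j2 j3 j4 (conv (conv j1 j2) (conv j3 j4) h f) =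
      conv (conv j1 (conv j2 j3)) j4 h (CHIi j1 j2 j3 j4 f)"
proof -
  note c = cact_conv[OF assms(1)]
  have js: "comm L k j" if "comm L j k" for j k :: "'h \<Rightarrow> ('a \<Rightarrow> 'k) \<Rightarrow> 'a \<Rightarrow> 'k"
    using that by (rule comm_sym)
  have j: "ract L (conv j1 (conv j2 j3))" "ract L j4" "comm L (conv j1 (conv j2 j3)) j4"
    "ract L (conv (conv j1 j2) (conv j3 j4))"
    using assms(1) by (simp_all add: conv_simps js)
  have 1: "conv (conv j1 j2) (conv j3 j4) h (CHI j1 j2 j3 j4 f) =
      CHI j1 j2 j3 j4 (conv (conv j1 (conv j2 j3)) j4 h f)" if f: "L f" for f
  proof -
    note L = PHI_closed[OF c(4) assoc_in, OF f]
    have "PHI \<phi> j1 j2 j3 (conv (conv j1 (conv j2 j3)) j4 h f) = conv (conv (conv j1 j2) j3) j4 h (PHI \<phi> j1 j2 j3 f)"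
      by (rule conv_intertwine[OF j(1-3) lop_PHI[OF c(4) assoc_in], OF f])
        (use quasi_coassoc_act(1)[OF c(4)] PHI_comm[OF c(4) assoc_in] assms(1) in auto)
    then show ?thesis unfolding CHI_def quasi_coassoc_act(2)[OF c(1), OF L] by simp
  qed
  show "conv (conv j1 j2) (conv j3 j4) h (CHI j1 j2 j3 j4 f) =
      CHI j1 j2 j3 j4 (conv (conv j1 (conv j2 j3)) j4 h f)" by (rule 1[OF assms(2)])
  have L: "L (CHIi j1 j2 j3 j4 f)" by (rule lopD(1)[OF lop_CHIi[OF assms(1)], OF assms(2)])
  have "L (conv (conv j1 (conv j2 j3)) j4 h (CHIi j1 j2 j3 j4 f))"
    by (rule rrepD(4)[OF ract_conv[OF j(1-3)], OF L])
  from CHI_inverse(1)[OF assms(1), OF this]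
  show "CHIi j1 j2 j3 j4 (conv (conv j1 j2) (conv j3 j4) h f) =
      conv (conv j1 (conv j2 j3)) j4 h (CHIi j1 j2 j3 j4 f)"
    unfolding 1[OF L, symmetric] CHI_inverse(2)[OF assms] by simp
qed

text \<open>Naturality of reassociation: \<open>PHI \<phi> a b c\<close> intertwines the two
  bracketings of a, b, c and commutes with d and e, so it passes through any operator in which a, b,
  c occur as one bracketed strand.\<close>

lemma PHI_shift_left:
  assumes "cact L [a, b, c, d, e]" "T \<in> tprod H3" "L f"
  shows "PHI \<phi> a b c (PHI T (conv a (conv b c)) d e f) = PHI T (conv (conv a b) c) d e (PHI \<phi> a b c f)"
    and "PHI \<phi>i a b c (PHI T (conv (conv a b) c) d e f) = PHI T (conv a (conv b c)) d e (PHI \<phi>i a b c f)"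
proof -
  have js: "comm L k j" if "comm L j k" for j k :: "'h \<Rightarrow> ('a \<Rightarrow> 'k) \<Rightarrow> 'a \<Rightarrow> 'k"
    using that by (rule comm_sym)
  have c: "cact L [a, b, c]" "cact L [conv a (conv b c), d, e]" "cact L [conv (conv a b) c, d, e]"
    using assms(1) by (simp_all add: conv_simps js)
  note k = PHI_comm[OF c(1), symmetric]
  show "PHI \<phi> a b c (PHI T (conv a (conv b c)) d e f) = PHI T (conv (conv a b) c) d e (PHI \<phi> a b c f)"
    by (rule PHI_intertwine[OF c(2) assms(2) lop_PHI[OF c(1) assoc_in], OF assms(3)])
      (use assms(1) quasi_coassoc_act(1)[OF c(1)] k[OF assoc_in] in auto)
  show "PHI \<phi>i a b c (PHI T (conv (conv a b) c) d e f) = PHI T (conv a (conv b c)) d e (PHI \<phi>i a b c f)"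
    by (rule PHI_intertwine[OF c(3) assms(2) lop_PHI[OF c(1) phii_in], OF assms(3)])
      (use assms(1) quasi_coassoc_act(2)[OF c(1)] k[OF phii_in] in auto)
qed

lemma PHI_shift_mid:
  assumes "cact L [a, b, c, d, e]" "T \<in> tprod H3" "L f"
  shows "PHI \<phi> b c d (PHI T a (conv b (conv c d)) e f) = PHI T a (conv (conv b c) d) e (PHI \<phi> b c d f)"
proof -
  have js: "comm L k j" if "comm L j k" for j k :: "'h \<Rightarrow> ('a \<Rightarrow> 'k) \<Rightarrow> 'a \<Rightarrow> 'k"
    using that by (rule comm_sym)
  have c: "cact L [b, c, d]" "cact L [a, conv b (conv c d), e]"
    using assms(1) by (simp_all add: conv_simps js)
  note k = PHI_comm[OF c(1), symmetric]
  show ?thesis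
    by (rule PHI_intertwine[OF c(2) assms(2) lop_PHI[OF c(1) assoc_in], OF assms(3)])
      (use assms(1) quasi_coassoc_act(1)[OF c(1)] k[OF assoc_in] js in auto)
qed

lemma PHI_shift_right:
  assumes "cact L [a, b, c, d, e]" "T \<in> tprod H3" "L f"
  shows "PHI \<phi> c d e (PHI T a b (conv c (conv d e)) f) = PHI T a b (conv (conv c d) e) (PHI \<phi> c d e f)"
    and "PHI \<phi>i c d e (PHI T a b (conv (conv c d) e) f) = PHI T a b (conv c (conv d e)) (PHI \<phi>i c d e f)"
proof -
  have js: "comm L k j" if "comm L j k" for j k :: "'h \<Rightarrow> ('a \<Rightarrow> 'k) \<Rightarrow> 'a \<Rightarrow> 'k"
    using that by (rule comm_sym)
  have c: "cact L [c, d, e]" "cact L [a, b, conv c (conv d e)]" "cact L [a, b, conv (conv c d) e]"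
    using assms(1) by (simp_all add: conv_simps js)
  note k = PHI_comm[OF c(1), symmetric]
  show "PHI \<phi> c d e (PHI T a b (conv c (conv d e)) f) = PHI T a b (conv (conv c d) e) (PHI \<phi> c d e f)"
    by (rule PHI_intertwine[OF c(2) assms(2) lop_PHI[OF c(1) assoc_in], OF assms(3)])
      (use assms(1) quasi_coassoc_act(1)[OF c(1)] k[OF assoc_in] js in auto)
  show "PHI \<phi>i c d e (PHI T a b (conv (conv c d) e) f) = PHI T a b (conv c (conv d e)) (PHI \<phi>i c d e f)"
    by (rule PHI_intertwine[OF c(3) assms(2) lop_PHI[OF c(1) phii_in], OF assms(3)])
      (use assms(1) quasi_coassoc_act(2)[OF c(1)] k[OF phii_in] js in auto)
qed

notation conv (infixl "\<star>" 70)

section \<open>Coherence, absorption and zigzag identities\<close>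

text \<open>Coherence for the two ways of rebracketing \<open>(1(23))((45)6)\<close> to \<open>(1((2(34))5))6\<close>.\<close>

lemma CHI_coherence:
  assumes "cact L [j1, j2, j3, j4, j5, j6]" and F: "L F"
  shows "CHI j1 (j2 \<star> j3) (j4 \<star> j5) j6 (CHI j2 j3 j4 j5 F) =
    PHI \<phi>i j1 j2 j3 (PHI \<phi> j4 j5 j6 (CHI (j1 \<star> j2) j3 j4 (j5 \<star> j6)
      (PHI \<phi> j1 j2 (j3 \<star> j4) (CHI j1 (j2 \<star> (j3 \<star> j4)) j5 j6 F))))"
proof -
  have j: "ract L j1" "ract L j2" "ract L j3" "ract L j4" "ract L j5" "ract L j6"
    and jc: "comm L j1 j2" "comm L j1 j3" "comm L j1 j4" "comm L j1 j5" "comm L j1 j6"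
      "comm L j2 j3" "comm L j2 j4" "comm L j2 j5" "comm L j2 j6" "comm L j3 j4" "comm L j3 j5"
      "comm L j3 j6" "comm L j4 j5" "comm L j4 j6" "comm L j5 j6"
    using assms(1) by simp_all
  note jjs = j jc jc[THEN comm_sym] conv_simps
  have c4: "cact L [(j1 \<star> j2) \<star> j3, j4, j5, j6]" "cact L [j1, j2, j3, j4]" "cact L [j1, j2 \<star> j3, j4, j5]"
    and c5: "cact L [j1, j2, j3 \<star> j4, j5, j6]" "cact L [j1 \<star> j2, j3, j4, j5, j6]"
      "cact L [j1, j2, j3, j4 \<star> j5, j6]" "cact L [j1, j2, j3, j4, j5]"
    and c3: "cact L [j4, j5, j6]" "cact L [j1, j2, j3]" "cact L [j2, j3, j4]"
      "cact L [j1, (j2 \<star> j3) \<star> j4, j5]" "cact L [j1, j2 \<star> (j3 \<star> j4), j5]" "cact L [j1, j2, j3 \<star> j4]"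
      "cact L [j1 \<star> j2, j3, j4]" "cact L [(j1 \<star> j2) \<star> j3, j4, j5]"
      "cact L [(j1 \<star> j2) \<star> j3, j4 \<star> j5, j6]" "cact L [j1, j2 \<star> j3, j4]"
      "cact L [j2 \<star> j3, j4, j5]" "cact L [j1 \<star> (j2 \<star> j3), j4, j5]" "cact L [j1, j2 \<star> j3, j4 \<star> j5]"
    by (simp_all add: jjs)
  define R where "R = PHI \<phi> j1 (j2 \<star> (j3 \<star> j4)) j5 F"
  define K1 where "K1 = PHI \<phi> j1 j2 (j3 \<star> j4) R"
  define K where "K = PHI \<phi> (j1 \<star> j2) j3 j4 K1"
  define M where "M = PHI \<phi>i ((j1 \<star> j2) \<star> j3) j4 j5 K"
  define E where "E = PHI \<phi> j2 j3 j4 F"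
  define E2 where "E2 = PHI \<phi>i (j2 \<star> j3) j4 j5 E"
  have L: "L R" unfolding R_def by (rule PHI_closed[OF c3(5) assoc_in, OF F])
  have L1: "L K1" unfolding K1_def by (rule PHI_closed[OF c3(6) assoc_in, OF L])
  have LK: "L K" unfolding K_def by (rule PHI_closed[OF c3(7) assoc_in, OF L1])
  have LM: "L M" unfolding M_def by (rule PHI_closed[OF c3(8) phii_in, OF LK])
  have LM': "L (PHI \<phi>i ((j1 \<star> j2) \<star> j3) (j4 \<star> j5) j6 M)" by (rule PHI_closed[OF c3(9) phii_in, OF LM])
  have LE: "L E" unfolding E_def by (rule PHI_closed[OF c3(3) assoc_in, OF F])
  have LE2: "L E2" unfolding E2_def by (rule PHI_closed[OF c3(11) phii_in, OF LE])
  \<comment> \<open>By naturality the two inverse associators are moved outside the three operators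
    of \<open>\<phi>\<close>, which are collected in \<open>K\<close>.\<close>
  have e1: "CHI (j1 \<star> j2) j3 j4 (j5 \<star> j6) (PHI \<phi> j1 j2 (j3 \<star> j4) (CHI j1 (j2 \<star> (j3 \<star> j4)) j5 j6 F)) =
    PHI \<phi>i ((j1 \<star> j2) \<star> j3) j4 (j5 \<star> j6) (PHI \<phi>i (((j1 \<star> j2) \<star> j3) \<star> j4) j5 j6 K)"
    unfolding CHI_def[of "j1 \<star> j2"] CHI_def[of j1] R_def[symmetric]
    unfolding PHI_shift_left(1)[OF c5(1) phii_in, OF L] K1_def[symmetric]
    unfolding PHI_shift_left(1)[OF c5(2) phii_in, OF L1] K_def ..
  \<comment> \<open>Three pentagons follow: in the strands (12)3, 4, 5, 6, then in 1, 2, 3, 4, and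
    in 1, 23, 4, 5. Between them naturality brings the operators into position.\<close>
  have e2: "PHI \<phi> j4 j5 j6 (PHI \<phi>i ((j1 \<star> j2) \<star> j3) j4 (j5 \<star> j6) (PHI \<phi>i (((j1 \<star> j2) \<star> j3) \<star> j4) j5 j6 K)) =
      PHI \<phi>i ((j1 \<star> j2) \<star> j3) (j4 \<star> j5) j6 M"
    unfolding pentagon_inv_act[OF c4(1), OF LK] M_def[symmetric] by (rule PHI_inverse(1)[OF c3(1), OF LM'])
  have e3: "PHI \<phi>i j1 j2 j3 (PHI \<phi>i ((j1 \<star> j2) \<star> j3) (j4 \<star> j5) j6 M) =
      PHI \<phi>i (j1 \<star> (j2 \<star> j3)) (j4 \<star> j5) j6 (PHI \<phi>i j1 j2 j3 M)"
    by (rule PHI_shift_left(2)[OF c5(3) phii_in, OF LM])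
  have e4: "PHI \<phi>i j1 j2 j3 M = PHI \<phi>i (j1 \<star> (j2 \<star> j3)) j4 j5 (PHI \<phi>i j1 j2 j3 K)"
    unfolding M_def by (rule PHI_shift_left(2)[OF c5(4) phii_in, OF LK])
  have e5: "PHI \<phi>i j1 j2 j3 K = PHI \<phi> j1 (j2 \<star> j3) j4 (PHI \<phi> j2 j3 j4 R)"
    by (rule PHI_phii_eqI[OF c3(2), OF PHI_closed[OF c3(10) assoc_in, OF PHI_closed[OF c3(3) assoc_in, OF L]]])
      (unfold K_def K1_def, rule pentagon_act[OF c4(2), OF L, symmetric])
  have e6: "PHI \<phi> j2 j3 j4 R = PHI \<phi> j1 ((j2 \<star> j3) \<star> j4) j5 E"
    unfolding R_def E_def by (rule PHI_shift_mid[OF c5(4) assoc_in, OF F])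
  have e7: "PHI \<phi>i (j1 \<star> (j2 \<star> j3)) j4 j5 (PHI \<phi> j1 (j2 \<star> j3) j4 (PHI \<phi> j1 ((j2 \<star> j3) \<star> j4) j5 E)) =
      PHI \<phi> j1 (j2 \<star> j3) (j4 \<star> j5) E2"
  proof -
    have "PHI \<phi> (j2 \<star> j3) j4 j5 E2 = E" unfolding E2_def by (rule PHI_inverse(1)[OF c3(11), OF LE])
    with pentagon_act[OF c4(3), OF LE2] have
      "PHI \<phi> (j1 \<star> (j2 \<star> j3)) j4 j5 (PHI \<phi> j1 (j2 \<star> j3) (j4 \<star> j5) E2) =
      PHI \<phi> j1 (j2 \<star> j3) j4 (PHI \<phi> j1 ((j2 \<star> j3) \<star> j4) j5 E)" by simp
    from PHI_phii_eqI[OF c3(12), OF PHI_closed[OF c3(13) assoc_in, OF LE2], OF this] show ?thesis .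
  qed
  show ?thesis unfolding e1 e2 e3 e4 e5 e6 e7 by (simp add: CHI_def E2_def E_def)
qed

text \<open>Triviality is known on the single form \<open>f\<close>. If it concerns the outer
  strand, that strand is first commuted past the other one to reach \<open>f\<close>; then the
  counit axiom applies.\<close>

lemma absorb_conv:
  assumes "cact L [a, b]" "L f"
  shows "(\<And>h. a h f = eps h f) \<Longrightarrow> (a \<star> b) h f = b h f" "(\<And>h. b h f = eps h f) \<Longrightarrow> (a \<star> b) h f = a h f"
proof -
  have j: "ract L a" "ract L b" "comm L a b" using assms(1) by auto
  show "(a \<star> b) h f = a h f" if "\<And>h. b h f = eps h f"
  proof -
    have "(a \<star> b) h f = (a \<star> eps) h f" by (rule ext) (simp add: conv_apply that)
    then show ?thesis using conv_eps_right[OF j(1), OF assms(2)] by simp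
  qed
  show "(a \<star> b) h f = b h f" if "\<And>h. a h f = eps h f"
  proof -
    have "eps x (b y f) = a x (b y f)" for x y
      using commD[OF j(3), OF assms(2), of x y] lopD(3)[OF rrepD(3)[OF j(2)], OF assms(2)] that
      by (simp add: eps_def)
    then have "(a \<star> b) h f = (eps \<star> b) h f" by (intro ext) (simp add: conv_apply)
    then show ?thesis using conv_eps_left[OF j(2), OF assms(2)] by simp
  qed
qed

text \<open>The strands agree on the single form \<open>f\<close>, so each in turn is commuted
  inwards to \<open>f\<close> and exchanged there. The mixed triples in the hypotheses provide the
  commutations at the intermediate stages.\<close>

lemma PHI_form_cong:
  assumes "cact L [j1, j2, j3]" "L f" "cact L [k1, k2, k3]"
    "\<And>h. j1 h f = k1 h f" "\<And>h. j2 h f = k2 h f" "\<And>h. j3 h f = k3 h f" "cact L [k1, j2, j3]" "cact L [k1, k2, j3]"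
  shows "PHI T j1 j2 j3 f = PHI T k1 k2 k3 f"
proof -
  have cl: "ract L j \<Longrightarrow> L (j h f)" for j h using rrepD(4)[of L H1 j] assms(2) by blast
  have "j1 x1 (j2 x2 (j3 x3 f)) = k1 x1 (k2 x2 (k3 x3 f))" for x1 x2 x3
  proof -
    have c: "comm L j1 j2" "comm L j1 j3" "comm L j2 j3" "comm L k1 j2" "comm L k1 j3" "comm L k2 j3"
      and r: "ract L j1" "ract L j2" "ract L j3" "ract L k1" "ract L k2" "ract L k3"
      using assms by auto
    have 1: "j1 x1 (j2 x2 (j3 x3 f)) = j2 x2 (j3 x3 (k1 x1 f))"
      using commD[OF c(1), of "j3 x3 f"] commD[OF c(2), OF assms(2)] cl r assms(4) by simp
    have 2: "j2 x2 (j3 x3 (k1 x1 f)) = k1 x1 (j2 x2 (j3 x3 f))"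
      using commD[OF c(4), of "j3 x3 f"] commD[OF c(5), OF assms(2)] cl r by simp
    have 3: "j2 x2 (j3 x3 f) = k2 x2 (k3 x3 f)"
      using commD[OF c(3), OF assms(2)] assms(5) commD[OF c(6), OF assms(2)] assms(6) by simp
    show ?thesis using trans[OF 1 2] unfolding 3 .
  qed
  then show ?thesis by (simp add: PHI_apply fun_eq_iff)
qed

lemma PHI_absorb_form:
  assumes "cact L [j1, j2, j3]" "L f" "\<phi>x \<in> {\<phi>, \<phi>i}"
  shows "(\<And>h. j1 h f = eps h f) \<Longrightarrow> PHI \<phi>x j1 j2 j3 f = f"
    "(\<And>h. j2 h f = eps h f) \<Longrightarrow> PHI \<phi>x j1 j2 j3 f = f"
    "(\<And>h. j3 h f = eps h f) \<Longrightarrow> PHI \<phi>x j1 j2 j3 f = f"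
proof -
  have c: "cact L [j1, j2]" "cact L [j2, j3]" "cact L [j1, j3]" using assms(1) by auto
  note e = cact_eps[OF c(1)] cact_eps[OF c(2)] cact_eps[OF c(3)]
  show "PHI \<phi>x j1 j2 j3 f = f" if "\<And>h. j1 h f = eps h f"
    using PHI_form_cong[OF assms(1,2), of eps j2 j3 \<phi>x] that e PHI_eps_left[OF c(2), OF assms(2)] assms(3) by auto
  show "PHI \<phi>x j1 j2 j3 f = f" if "\<And>h. j2 h f = eps h f"
    using PHI_form_cong[OF assms(1,2), of j1 eps j3 \<phi>x] that e PHI_eps_mid[OF c(3), OF assms(2)] assms by auto
  show "PHI \<phi>x j1 j2 j3 f = f" if "\<And>h. j3 h f = eps h f"
    using PHI_form_cong[OF assms(1,2), of j1 j2 eps \<phi>x] that e PHI_eps_right[OF c(1), OF assms(2)] assms by auto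
qed

section \<open>Functionals invariant under a strand\<close>

definition absorbs :: "(('x \<Rightarrow> 'k) \<Rightarrow> bool) \<Rightarrow> (('x \<Rightarrow> 'k) \<Rightarrow> 'k) \<Rightarrow> ('h \<Rightarrow> ('x \<Rightarrow> 'k) \<Rightarrow> ('x \<Rightarrow> 'k)) \<Rightarrow> bool" where
  "absorbs L N j \<longleftrightarrow> (\<forall>h f. L f \<longrightarrow> N (j h f) = \<epsilon> h * N f)"

lemma absorbsD: "absorbs L N j \<Longrightarrow> L f \<Longrightarrow> N (j h f) = \<epsilon> h * N f"
  by (simp add: absorbs_def)

lemma absorbs_comp:
  "absorbs L N j \<Longrightarrow> (\<And>f. L f \<Longrightarrow> L (p f)) \<Longrightarrow> (\<And>h f. L f \<Longrightarrow> p (j h f) = j h (p f)) \<Longrightarrow> absorbs L (\<lambda>f. N (p f)) j"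
  by (simp add: absorbs_def)

text \<open>Now the strands agree under \<open>N\<close>, so each in turn is commuted outwards to
  \<open>N\<close> and exchanged there.\<close>

lemma PHI_functional_cong:
  assumes "cact L [j1, j2, j3]" "T \<in> tprod H3" "cact L [k1, k2, k3]" "lfun L N" "L f"
    "\<And>h f. L f \<Longrightarrow> N (j1 h f) = N (k1 h f)" "\<And>h f. L f \<Longrightarrow> N (j2 h f) = N (k2 h f)"
    "\<And>h f. L f \<Longrightarrow> N (j3 h f) = N (k3 h f)" "cact L [k1, j2, j3]" "cact L [k1, k2, j3]"
  shows "N (PHI T j1 j2 j3 f) = N (PHI T k1 k2 k3 f)"
proof -
  have cl: "ract L j \<Longrightarrow> L f \<Longrightarrow> L (j h f)" for j h f using rrepD(4)[of L H1 j] by blast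
  have "N (j1 x1 (j2 x2 (j3 x3 f))) = N (k1 x1 (k2 x2 (k3 x3 f)))" for x1 x2 x3
  proof -
    have c: "comm L j1 j2" "comm L j1 j3" "comm L j2 j3" "comm L k1 j2" "comm L k1 j3" "comm L k2 j3"
      "comm L k1 k2" "comm L k1 k3" "comm L k2 k3"
      and r: "ract L j1" "ract L j2" "ract L j3" "ract L k1" "ract L k2" "ract L k3"
      using assms by auto
    have cf: "L (j1 h f)" "L (j2 h f)" "L (j3 h f)" "L (k1 h f)" "L (k2 h f)" "L (k3 h f)" if "L f" for h f
      using cl[OF r(1) that] cl[OF r(2) that] cl[OF r(3) that] cl[OF r(4) that] cl[OF r(5) that] cl[OF r(6) that]
      by auto
    have 1: "N (j1 x1 (j2 x2 (j3 x3 f))) = N (k1 x1 (j2 x2 (j3 x3 f)))"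
      by (rule assms(6)[OF cf(2)[OF cf(3)[OF assms(5)]]])
    have 2: "k1 x1 (j2 x2 (j3 x3 f)) = j2 x2 (k1 x1 (j3 x3 f))"
      by (rule commD[OF c(4)]) (rule cf(3)[OF assms(5)])
    have 3: "N (j2 x2 (k1 x1 (j3 x3 f))) = N (k2 x2 (k1 x1 (j3 x3 f)))"
      by (rule assms(7)[OF cf(4)[OF cf(3)[OF assms(5)]]])
    have 4: "k2 x2 (k1 x1 (j3 x3 f)) = j3 x3 (k2 x2 (k1 x1 f))"
      unfolding commD[OF c(5), OF assms(5)] by (rule commD[OF c(6), OF cf(4)[OF assms(5)]])
    have 5: "N (j3 x3 (k2 x2 (k1 x1 f))) = N (k3 x3 (k2 x2 (k1 x1 f)))"
      by (rule assms(8)[OF cf(5)[OF cf(4)[OF assms(5)]]])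
    have 6: "k2 x2 (k1 x1 f) = k1 x1 (k2 x2 f)" by (rule commD[OF c(7), OF assms(5), symmetric])
    have 7: "k3 x3 (k1 x1 (k2 x2 f)) = k1 x1 (k3 x3 (k2 x2 f))"
      by (rule commD[OF c(8), OF cf(5)[OF assms(5)], symmetric])
    have 8: "k3 x3 (k2 x2 f) = k2 x2 (k3 x3 f)" by (rule commD[OF c(9), OF assms(5), symmetric])
    from 1[unfolded 2 3 4 5] show ?thesis unfolding 6 7 8 .
  qed
  then have *: "(\<lambda>(x1, x2, x3). N (j1 x1 (j2 x2 (j3 x3 f)))) = (\<lambda>(x1, x2, x3). N (k1 x1 (k2 x2 (k3 x3 f))))"
    by auto
  have p: "lop L (\<lambda>_. True) (\<lambda>f (_::unit). N f)" using assms(4) by (simp add: lfun_iff_lop)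
  show ?thesis
    using PHI_eval[OF assms(1,2) p, OF assms(5)] PHI_eval[OF assms(3,2) p, OF assms(5)] * by simp
qed

lemma PHI_absorb_functional:
  assumes "cact L [j1, j2, j3]" "lfun L N" "L f" "\<phi>x \<in> {\<phi>, \<phi>i}"
  shows "absorbs L N j1 \<Longrightarrow> N (PHI \<phi>x j1 j2 j3 f) = N f"
    "absorbs L N j2 \<Longrightarrow> N (PHI \<phi>x j1 j2 j3 f) = N f"
    "absorbs L N j3 \<Longrightarrow> N (PHI \<phi>x j1 j2 j3 f) = N f"
proof -
  have c: "cact L [j1, j2]" "cact L [j2, j3]" "cact L [j1, j3]" using assms(1) by auto
  note e = cact_eps[OF c(1)] cact_eps[OF c(2)] cact_eps[OF c(3)]
  have T: "\<phi>x \<in> tprod H3" using assms(4) assoc_in phii_in by auto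
  have N: "N (j h f) = N (eps h f)" if "absorbs L N j" "L f" for j h f
    using that assms(2) by (simp add: eps_def absorbs_def lfun_def)
  show "N (PHI \<phi>x j1 j2 j3 f) = N f" if "absorbs L N j1"
    using PHI_functional_cong[OF assms(1) T e(8) assms(2), OF assms(3)] N that e assms(1)
      PHI_eps_left[OF c(2), OF assms(3)] assms(4) by auto
  show "N (PHI \<phi>x j1 j2 j3 f) = N f" if "absorbs L N j2"
    using PHI_functional_cong[OF assms(1) T e(16) assms(2), OF assms(3)] N that e assms(1)
      PHI_eps_mid[OF c(3), OF assms(3)] assms(4) by auto
  show "N (PHI \<phi>x j1 j2 j3 f) = N f" if "absorbs L N j3"
    using PHI_functional_cong[OF assms(1) T e(3) assms(2), OF assms(3)] N that e assms(1)
      PHI_eps_right[OF c(1), OF assms(3)] assms(4) by auto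
qed

lemma absorbs_conv:
  assumes "cact L [a, b]" "lfun L N" "L f"
  shows "absorbs L N a \<Longrightarrow> N ((a \<star> b) h f) = N (b h f)" "absorbs L N b \<Longrightarrow> N ((a \<star> b) h f) = N (a h f)"
proof -
  have j: "ract L a" "ract L b" "comm L a b" using assms(1) by auto
  have p: "lop L (\<lambda>_. True) (\<lambda>f (_::unit). N f)" using assms(2) by (simp add: lfun_iff_lop)
  have L: "L (a h f)" "L (b h f)" for h
    by (rule rrepD(4)[OF j(1), OF assms(3)] rrepD(4)[OF j(2), OF assms(3)])+
  have e: "ract L eps" by (rule ract_eps[OF rrepD(1)[OF j(1)]])
  have N: "N (eps h f) = \<epsilon> h * N f" if "L f" for h f
    using assms(2) that by (simp add: eps_def lfun_def)
  have ab: "N ((a \<star> b) h f) = \<Delta> h (\<lambda>(u1, u2). N (a u1 (b u2 f)))"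
    using conv_eval[OF j p assms(3)] by simp
  show "N ((a \<star> b) h f) = N (b h f)" if a: "absorbs L N a"
  proof -
    have "N ((eps \<star> b) h f) = \<Delta> h (\<lambda>(u1, u2). N (eps u1 (b u2 f)))"
      using conv_eval[OF e j(2) comm_eps(2)[OF rrepD(3)[OF j(2)]] p, OF assms(3)] by simp
    moreover have "(\<lambda>(u1, u2). N (eps u1 (b u2 f))) = (\<lambda>(u1, u2). N (a u1 (b u2 f)))"
      using absorbsD[OF a] L N by auto
    ultimately show ?thesis using ab conv_eps_left[OF j(2), OF assms(3)] by simp
  qed
  show "N ((a \<star> b) h f) = N (a h f)" if b: "absorbs L N b"
  proof -
    have c: "comm L a eps" by (rule comm_eps(1)[OF rrepD(3)[OF j(1)]])
    have "N ((a \<star> eps) h f) = \<Delta> h (\<lambda>(u1, u2). N (a u1 (eps u2 f)))"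
      using conv_eval[OF j(1) e c p, OF assms(3)] by simp
    moreover have "N (a u1 (eps u2 f)) = N (a u1 (b u2 f))" for u1 u2
      using absorbsD[OF b] L N commD[OF c, OF assms(3)] commD[OF j(3), OF assms(3)] by simp
    ultimately show ?thesis using ab conv_eps_right[OF j(1), OF assms(3)] by simp
  qed
qed

text \<open>The two zigzag identities for a tensor product of two dual pairs.  The form \<open>e\<close> evaluates
  and the functional \<open>N\<close> coevaluates the strands \<open>1, 4, 5\<close> and \<open>2, 3, 6\<close>.\<close>

lemma zigzag_left:
  assumes "cact L [j1, j2, j3, j4, j5, j6]" and e: "L e" and N: "lfun L N"
    and e45: "\<And>h. (j4 \<star> j5) h e = eps h e" and e36: "\<And>h. (j3 \<star> j6) h e = eps h e"
    and N23: "absorbs L N (j2 \<star> j3)" and N14: "absorbs L N (j1 \<star> j4)"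
  shows "N (CHIi j1 j2 j3 j4 (PHI \<phi> (j1 \<star> j2) (j3 \<star> j4) (j5 \<star> j6) (CHI j3 j4 j5 j6 e))) =
    N (PHI \<phi> j1 j4 j5 (PHI \<phi> j2 j3 j6 e))"
proof -
  have j: "ract L j1" "ract L j2" "ract L j3" "ract L j4" "ract L j5" "ract L j6"
    and jc: "comm L j1 j2" "comm L j1 j3" "comm L j1 j4" "comm L j1 j5" "comm L j1 j6"
      "comm L j2 j3" "comm L j2 j4" "comm L j2 j5" "comm L j2 j6" "comm L j3 j4" "comm L j3 j5"
      "comm L j3 j6" "comm L j4 j5" "comm L j4 j6" "comm L j5 j6"
    using assms(1) by simp_all
  note jjs = j jc jc[THEN comm_sym] conv_simps
  have c4: "cact L [j3, j4, j5, j6]" "cact L [j1 \<star> j2, j3, j4, j5 \<star> j6]" "cact L [j1, j2, j3, j6]"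
      "cact L [j1, j4, j5, j6]"
    and c5: "cact L [j1 \<star> j2, j3, j4, j5, j6]" "cact L [j1, j2, j3, j4, j5 \<star> j6]"
    and c3: "cact L [j4, j5, j6]" "cact L [j3, j4 \<star> j5, j6]" "cact L [j1 \<star> j2, j3, j4 \<star> (j5 \<star> j6)]"
      "cact L [j1 \<star> j2, j3, (j4 \<star> j5) \<star> j6]" "cact L [j1 \<star> j2, j3, j6]" "cact L [j1 \<star> (j2 \<star> j3), j4, j5 \<star> j6]"
      "cact L [j1, j4, j5 \<star> j6]" "cact L [j1, j2, j3]" "cact L [j1, j2, j3 \<star> j6]" "cact L [j1, j2 \<star> j3, j6]"
      "cact L [j2, j3, j6]" "cact L [j1 \<star> j4, j5, j6]" "cact L [j1, j4 \<star> j5, j6]" "cact L [j1, j4, j5]"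
    and c2: "cact L [j4 \<star> j5, j6]" "cact L [j1, j2 \<star> j3]"
    and r: "ract L (j4 \<star> j5)" "comm L j2 (j4 \<star> j5)" "comm L j3 (j4 \<star> j5)" "comm L j6 (j4 \<star> j5)"
      "ract L (j2 \<star> j3)" "comm L j1 (j2 \<star> j3)" "comm L j4 (j2 \<star> j3)" "comm L (j4 \<star> j5) (j2 \<star> j3)" "comm L j6 (j2 \<star> j3)" "comm L j5 (j2 \<star> j3)"
    by (simp_all add: jjs)
  define E where "E = PHI \<phi>i j4 j5 j6 e"
  define E1 where "E1 = PHI \<phi> (j1 \<star> j2) j3 j6 e"
  define M where "M = PHI \<phi> j1 (j2 \<star> j3) j6 (PHI \<phi> j2 j3 j6 e)"
  have LE: "L E" unfolding E_def by (rule PHI_closed[OF c3(1) phii_in, OF e])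
  have LE1: "L E1" unfolding E1_def by (rule PHI_closed[OF c3(5) assoc_in, OF e])
  have LQ: "L (PHI \<phi> j2 j3 j6 e)" by (rule PHI_closed[OF c3(11) assoc_in, OF e])
  have LM: "L M" unfolding M_def by (rule PHI_closed[OF c3(10) assoc_in, OF LQ])
  \<comment> \<open>Triviality of 36 on \<open>e\<close> removes one factor from the pentagon in the
    strands 1, 2, 3, 6.\<close>
  have M1: "PHI \<phi>i j1 j2 j3 E1 = M"
  proof -
    have "PHI \<phi> j1 j2 (j3 \<star> j6) e = e"
      by (rule PHI_absorb_form(3)[OF c3(9), OF e _ e36]) simp
    then have "PHI \<phi> j1 j2 j3 M = E1" using pentagon_act[OF c4(3), OF e] by (simp add: M_def E1_def)
    then show ?thesis by (rule PHI_phii_eqI[OF c3(8), OF LM])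
  qed
  have LQM: "L (PHI \<phi>i j4 j5 j6 M)" by (rule PHI_closed[OF c3(1) phii_in, OF LM])
  have LQE1: "L (PHI \<phi>i j4 j5 j6 E1)" by (rule PHI_closed[OF c3(1) phii_in, OF LE1])
  \<comment> \<open>In the second expression for \<open>CHI\<close> the innermost factor has 45 as
    its middle strand and fixes \<open>e\<close>.\<close>
  have "CHI j3 j4 j5 j6 e = PHI \<phi> j3 j4 (j5 \<star> j6) E"
    unfolding CHI_alt[OF c4(1), OF e] E_def
    using PHI_absorb_form(2)[OF c3(2), OF e _ e45, of \<phi>i] by simp
  then have e1: "CHIi j1 j2 j3 j4 (PHI \<phi> (j1 \<star> j2) (j3 \<star> j4) (j5 \<star> j6) (CHI j3 j4 j5 j6 e)) =
    PHI \<phi>i j1 j2 j3 (PHI \<phi> ((j1 \<star> j2) \<star> j3) j4 (j5 \<star> j6) (PHI \<phi> (j1 \<star> j2) j3 (j4 \<star> (j5 \<star> j6)) E))"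
    unfolding CHIi_def using pentagon_act[OF c4(2), OF LE] by simp
  have e2: "PHI \<phi> (j1 \<star> j2) j3 (j4 \<star> (j5 \<star> j6)) E = PHI \<phi>i j4 j5 j6 (PHI \<phi> (j1 \<star> j2) j3 ((j4 \<star> j5) \<star> j6) e)"
    unfolding E_def by (rule PHI_shift_right(2)[OF c5(1) assoc_in, OF e, symmetric])
  have e3: "PHI \<phi> (j1 \<star> j2) j3 ((j4 \<star> j5) \<star> j6) e = E1"
    unfolding E1_def
    by (rule PHI_form_cong[OF c3(4), OF e c3(5)]) (use absorb_conv(1)[OF c2(1), OF e e45] c3 in auto)
  have e4: "PHI \<phi>i j1 j2 j3 (PHI \<phi> ((j1 \<star> j2) \<star> j3) j4 (j5 \<star> j6) (PHI \<phi>i j4 j5 j6 E1)) =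
      PHI \<phi> (j1 \<star> (j2 \<star> j3)) j4 (j5 \<star> j6) (PHI \<phi>i j1 j2 j3 (PHI \<phi>i j4 j5 j6 E1))"
    by (rule PHI_shift_left(2)[OF c5(2) assoc_in, OF LQE1])
  have e5: "PHI \<phi>i j1 j2 j3 (PHI \<phi>i j4 j5 j6 E1) = PHI \<phi>i j4 j5 j6 M"
    unfolding M1[symmetric] by (rule PHI_PHI_comm[OF c3(8) phii_in c3(1) phii_in, OF LE1]) (simp add: jjs)
  have 1: "N (CHIi j1 j2 j3 j4 (PHI \<phi> (j1 \<star> j2) (j3 \<star> j4) (j5 \<star> j6) (CHI j3 j4 j5 j6 e))) =
    N (PHI \<phi> (j1 \<star> (j2 \<star> j3)) j4 (j5 \<star> j6) (PHI \<phi>i j4 j5 j6 M))" unfolding e1 e2 e3 e4 e5 ..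
  \<comment> \<open>Invariance of \<open>N\<close> under 23 reduces the bracket 1(23) to 1.\<close>
  have 2: "N (PHI \<phi> (j1 \<star> (j2 \<star> j3)) j4 (j5 \<star> j6) (PHI \<phi>i j4 j5 j6 M)) = N (PHI \<phi> j1 j4 (j5 \<star> j6) (PHI \<phi>i j4 j5 j6 M))"
    by (rule PHI_functional_cong[OF c3(6) assoc_in c3(7) N, OF LQM])
      (use absorbs_conv(2)[OF c2(2) N, OF _ N23] c3 in auto)
  \<comment> \<open>The pentagon in the strands 1, 4, 5, 6; its factor containing the bracket 14 is
    absorbed by \<open>N\<close>.\<close>
  have 3: "N (PHI \<phi> j1 j4 (j5 \<star> j6) (PHI \<phi>i j4 j5 j6 M)) = N (PHI \<phi> j1 j4 j5 (PHI \<phi> j1 (j4 \<star> j5) j6 M))"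
  proof -
    have L: "L (PHI \<phi> j1 j4 (j5 \<star> j6) (PHI \<phi>i j4 j5 j6 M))" by (rule PHI_closed[OF c3(7) assoc_in, OF LQM])
    show ?thesis
      using pentagon_act[OF c4(4), OF LQM] PHI_inverse(1)[OF c3(1), OF LM]
        PHI_absorb_functional(1)[OF c3(12) N, OF L _ N14, of \<phi>] by simp
  qed
  let ?N = "\<lambda>f. N (PHI \<phi> j1 j4 j5 (PHI \<phi> j1 (j4 \<star> j5) j6 f))"
  have lop: "lop L L (\<lambda>f. PHI \<phi> j1 j4 j5 (PHI \<phi> j1 (j4 \<star> j5) j6 f))"
    by (rule lop_comp[OF lop_PHI[OF c3(13) assoc_in] lop_PHI[OF c3(14) assoc_in]])
  \<comment> \<open>The operators inside \<open>?N\<close> involve strands 1, 4, 5, 6, which commute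
    with 23, so the invariance of \<open>N\<close> survives. It removes the outer factor of
    \<open>M\<close>.\<close>
  have "absorbs L ?N (j2 \<star> j3)"
  proof (rule absorbs_comp[OF N23])
    fix h f assume f: "L f"
    show "L (PHI \<phi> j1 j4 j5 (PHI \<phi> j1 (j4 \<star> j5) j6 f))" by (rule lopD(1)[OF lop, OF f])
    show "PHI \<phi> j1 j4 j5 (PHI \<phi> j1 (j4 \<star> j5) j6 ((j2 \<star> j3) h f)) =
        (j2 \<star> j3) h (PHI \<phi> j1 j4 j5 (PHI \<phi> j1 (j4 \<star> j5) j6 f))"
      unfolding PHI_comm[OF c3(13) assoc_in, OF f r(5,6,8,9), symmetric]
      by (rule PHI_comm[OF c3(14) assoc_in, OF PHI_closed[OF c3(13) assoc_in, OF f] r(5,6,7,10), symmetric])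
  qed
  then have 4: "?N M = ?N (PHI \<phi> j2 j3 j6 e)"
    unfolding M_def by (rule PHI_absorb_functional(2)[OF c3(10) lfun_lop[OF lop N], OF LQ, rotated]) simp
  \<comment> \<open>The bracket 45 commutes with the strands 2, 3, 6, so it is still trivial on this
    form.\<close>
  have "(j4 \<star> j5) h (PHI \<phi> j2 j3 j6 e) = eps h (PHI \<phi> j2 j3 j6 e)" for h
    unfolding PHI_comm[OF c3(11) assoc_in, OF e r(1-4)] e45
    using lopD(3)[OF lop_PHI[OF c3(11) assoc_in], OF e] by (simp add: eps_def)
  then have "PHI \<phi> j1 (j4 \<star> j5) j6 (PHI \<phi> j2 j3 j6 e) = PHI \<phi> j2 j3 j6 e"
    using PHI_absorb_form(2)[OF c3(13), OF LQ, of \<phi>] by simp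
  then show ?thesis using 1 2 3 4 by simp
qed

lemma zigzag_right:
  assumes "cact L [j1, j2, j3, j4, j5, j6]" and e: "L e" and N: "lfun L N"
    and e23: "\<And>h. (j2 \<star> j3) h e = eps h e" and e14: "\<And>h. (j1 \<star> j4) h e = eps h e"
    and N45: "absorbs L N (j4 \<star> j5)" and N36: "absorbs L N (j3 \<star> j6)"
  shows "N (CHIi j3 j4 j5 j6 (PHI \<phi>i (j1 \<star> j2) (j3 \<star> j4) (j5 \<star> j6) (CHI j1 j2 j3 j4 e))) =
    N (PHI \<phi>i j2 j3 j6 (PHI \<phi>i j1 j4 j5 e))"
proof -
  have j: "ract L j1" "ract L j2" "ract L j3" "ract L j4" "ract L j5" "ract L j6"
    and jc: "comm L j1 j2" "comm L j1 j3" "comm L j1 j4" "comm L j1 j5" "comm L j1 j6"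
      "comm L j2 j3" "comm L j2 j4" "comm L j2 j5" "comm L j2 j6" "comm L j3 j4" "comm L j3 j5"
      "comm L j3 j6" "comm L j4 j5" "comm L j4 j6" "comm L j5 j6"
    using assms(1) by simp_all
  note jjs = j jc jc[THEN comm_sym] conv_simps
  have c4: "cact L [j3, j4, j5, j6]" "cact L [j1 \<star> j2, j3, j4, j5 \<star> j6]" "cact L [j1, j2, j3, j6]"
      "cact L [j1, j4, j5, j6]"
    and c5: "cact L [j1 \<star> j2, j3, j4, j5, j6]" "cact L [j1, j2, j3, j4, j5 \<star> j6]"
    and c3: "cact L [j4, j5, j6]" "cact L [j3, j4 \<star> j5, j6]" "cact L [j1 \<star> j2, (j3 \<star> j4), (j5 \<star> j6)]"
      "cact L [j1 \<star> j2, j3, (j4 \<star> j5) \<star> j6]" "cact L [j1 \<star> j2, j3, j6]" "cact L [j1 \<star> (j2 \<star> j3), j4, j5 \<star> j6]"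
      "cact L [j1, j4, j5 \<star> j6]" "cact L [j1, j2, j3]" "cact L [j1, j2, j3 \<star> j6]" "cact L [j1, j2 \<star> j3, j6]"
      "cact L [j2, j3, j6]" "cact L [j1 \<star> j4, j5, j6]" "cact L [j1, j4 \<star> j5, j6]" "cact L [j1, j4, j5]"
      "cact L [j1 \<star> j2, j3, j4]" "cact L [(j1 \<star> j2) \<star> j3, j4, j5 \<star> j6]" "cact L [j3, j4, j5 \<star> j6]"
      "cact L [j1 \<star> j2, j3, j4 \<star> (j5 \<star> j6)]"
    and c2: "cact L [j4 \<star> j5, j6]" "cact L [j1, j2 \<star> j3]"
    and r: "ract L (j4 \<star> j5)" "comm L j2 (j4 \<star> j5)" "comm L j3 (j4 \<star> j5)" "comm L j6 (j4 \<star> j5)"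
      "comm L j1 (j4 \<star> j5)" "comm L (j2 \<star> j3) (j4 \<star> j5)"
      "ract L (j2 \<star> j3)" "comm L j1 (j2 \<star> j3)" "comm L j4 (j2 \<star> j3)" "comm L j5 (j2 \<star> j3)"
    by (simp_all add: jjs)
  define H where "H = PHI \<phi> j1 j2 j3 e"
  define E1 where "E1 = PHI \<phi>i j1 j4 (j5 \<star> j6) e"
  define E2 where "E2 = PHI \<phi>i j1 j4 j5 e"
  define M where "M = PHI \<phi>i j1 (j4 \<star> j5) j6 E2"
  have LH: "L H" unfolding H_def by (rule PHI_closed[OF c3(8) assoc_in, OF e])
  have LE1: "L E1" unfolding E1_def by (rule PHI_closed[OF c3(7) phii_in, OF e])
  have LE2: "L E2" unfolding E2_def by (rule PHI_closed[OF c3(14) phii_in, OF e])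
  have LM: "L M" unfolding M_def by (rule PHI_closed[OF c3(13) phii_in, OF LE2])
  have LPM: "L (PHI \<phi> j1 j2 j3 M)" by (rule PHI_closed[OF c3(8) assoc_in, OF LM])
  have LPE1: "L (PHI \<phi> j1 j2 j3 E1)" by (rule PHI_closed[OF c3(8) assoc_in, OF LE1])
  \<comment> \<open>Here it is 14 whose triviality on \<open>e\<close> shortens the pentagon, in the
    strands 1, 4, 5, 6.\<close>
  have M1: "PHI \<phi> j4 j5 j6 E1 = M"
  proof -
    have "PHI \<phi>i (j1 \<star> j4) j5 j6 e = e"
      by (rule PHI_absorb_form(1)[OF c3(12), OF e _ e14]) simp
    then have "PHI \<phi>i j4 j5 j6 M = E1" using pentagon_inv_act[OF c4(4), OF e] by (simp add: M_def E1_def E2_def)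
    then show ?thesis by (rule PHI_phi_eqI[OF c3(1), OF LM])
  qed
  have L1: "L (PHI \<phi>i (j1 \<star> j2) (j3 \<star> j4) (j5 \<star> j6) (CHI j1 j2 j3 j4 e))"
    unfolding CHI_def H_def[symmetric]
    by (rule PHI_closed[OF c3(3) phii_in, OF PHI_closed[OF c3(15) phii_in, OF LH]])
  note L2 = PHI_closed[OF c3(1) assoc_in, OF PHI_closed[OF c3(17) phii_in, OF L1]]
  \<comment> \<open>The second expression for \<open>CHIi\<close> ends with a factor whose middle
    strand is 45, and \<open>N\<close> absorbs it.\<close>
  have 1: "N (CHIi j3 j4 j5 j6 (PHI \<phi>i (j1 \<star> j2) (j3 \<star> j4) (j5 \<star> j6) (CHI j1 j2 j3 j4 e))) =
    N (PHI \<phi> j4 j5 j6 (PHI \<phi>i j3 j4 (j5 \<star> j6) (PHI \<phi>i (j1 \<star> j2) (j3 \<star> j4) (j5 \<star> j6) (CHI j1 j2 j3 j4 e))))"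
    unfolding CHIi_alt[OF c4(1), OF L1]
    by (rule PHI_absorb_functional(2)[OF c3(2) N, OF L2 _ N45]) simp
  have e1: "PHI \<phi>i j3 j4 (j5 \<star> j6) (PHI \<phi>i (j1 \<star> j2) (j3 \<star> j4) (j5 \<star> j6) (CHI j1 j2 j3 j4 e)) =
     PHI \<phi>i (j1 \<star> j2) j3 (j4 \<star> (j5 \<star> j6)) (PHI \<phi>i ((j1 \<star> j2) \<star> j3) j4 (j5 \<star> j6) H)"
    unfolding CHI_def H_def[symmetric] by (rule pentagon_inv_act[OF c4(2), OF LH, symmetric])
  have e2: "PHI \<phi>i ((j1 \<star> j2) \<star> j3) j4 (j5 \<star> j6) H = PHI \<phi> j1 j2 j3 (PHI \<phi>i (j1 \<star> (j2 \<star> j3)) j4 (j5 \<star> j6) e)"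
    unfolding H_def by (rule PHI_shift_left(1)[OF c5(2) phii_in, OF e, symmetric])
  have e3: "PHI \<phi>i (j1 \<star> (j2 \<star> j3)) j4 (j5 \<star> j6) e = E1"
    unfolding E1_def
    by (rule PHI_form_cong[OF c3(6), OF e c3(7)]) (use absorb_conv(2)[OF c2(2), OF e e23] c3 in auto)
  have e4: "PHI \<phi> j4 j5 j6 (PHI \<phi>i (j1 \<star> j2) j3 (j4 \<star> (j5 \<star> j6)) (PHI \<phi> j1 j2 j3 E1)) =
      PHI \<phi>i (j1 \<star> j2) j3 ((j4 \<star> j5) \<star> j6) (PHI \<phi> j4 j5 j6 (PHI \<phi> j1 j2 j3 E1))"
    by (rule PHI_shift_right(1)[OF c5(1) phii_in, OF LPE1])
  have e5: "PHI \<phi> j4 j5 j6 (PHI \<phi> j1 j2 j3 E1) = PHI \<phi> j1 j2 j3 M"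
    unfolding M1[symmetric] by (rule PHI_PHI_comm[OF c3(1) assoc_in c3(8) assoc_in, OF LE1]) (simp add: jjs)
  have 2: "N (PHI \<phi> j4 j5 j6 (PHI \<phi>i j3 j4 (j5 \<star> j6) (PHI \<phi>i (j1 \<star> j2) (j3 \<star> j4) (j5 \<star> j6) (CHI j1 j2 j3 j4 e)))) =
      N (PHI \<phi>i (j1 \<star> j2) j3 ((j4 \<star> j5) \<star> j6) (PHI \<phi> j1 j2 j3 M))" unfolding e1 e2 e3 e4 e5 ..
  have 3: "N (PHI \<phi>i (j1 \<star> j2) j3 ((j4 \<star> j5) \<star> j6) (PHI \<phi> j1 j2 j3 M)) = N (PHI \<phi>i (j1 \<star> j2) j3 j6 (PHI \<phi> j1 j2 j3 M))"
    by (rule PHI_functional_cong[OF c3(4) phii_in c3(5) N, OF LPM])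
      (use absorbs_conv(1)[OF c2(1) N, OF _ N45] c3 in auto)
  \<comment> \<open>The pentagon in the strands 1, 2, 3, 6, shortened by the invariance of
    \<open>N\<close> under 36.\<close>
  have 4: "N (PHI \<phi>i (j1 \<star> j2) j3 j6 (PHI \<phi> j1 j2 j3 M)) = N (PHI \<phi>i j2 j3 j6 (PHI \<phi>i j1 (j2 \<star> j3) j6 M))"
  proof -
    have L: "L (PHI \<phi>i (j1 \<star> j2) j3 j6 (PHI \<phi> j1 j2 j3 M))" by (rule PHI_closed[OF c3(5) phii_in, OF LPM])
    show ?thesis
      using pentagon_inv_act[OF c4(3), OF LPM] PHI_inverse(2)[OF c3(8), OF LM]
        PHI_absorb_functional(3)[OF c3(9) N, OF L _ N36, of \<phi>i] by simp
  qed
  let ?N = "\<lambda>f. N (PHI \<phi>i j2 j3 j6 (PHI \<phi>i j1 (j2 \<star> j3) j6 f))"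
  have lop: "lop L L (\<lambda>f. PHI \<phi>i j2 j3 j6 (PHI \<phi>i j1 (j2 \<star> j3) j6 f))"
    by (rule lop_comp[OF lop_PHI[OF c3(10) phii_in] lop_PHI[OF c3(11) phii_in]])
  have "absorbs L ?N (j4 \<star> j5)"
  proof (rule absorbs_comp[OF N45])
    fix h f assume f: "L f"
    show "L (PHI \<phi>i j2 j3 j6 (PHI \<phi>i j1 (j2 \<star> j3) j6 f))" by (rule lopD(1)[OF lop, OF f])
    show "PHI \<phi>i j2 j3 j6 (PHI \<phi>i j1 (j2 \<star> j3) j6 ((j4 \<star> j5) h f)) =
        (j4 \<star> j5) h (PHI \<phi>i j2 j3 j6 (PHI \<phi>i j1 (j2 \<star> j3) j6 f))"
      unfolding PHI_comm[OF c3(10) phii_in, OF f r(1,5,6,4), symmetric]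
      by (rule PHI_comm[OF c3(11) phii_in, OF PHI_closed[OF c3(10) phii_in, OF f] r(1,2,3,4), symmetric])
  qed
  then have 5: "?N M = ?N E2"
    unfolding M_def by (rule PHI_absorb_functional(2)[OF c3(13) lfun_lop[OF lop N], OF LE2, rotated]) simp
  have "(j2 \<star> j3) h E2 = eps h E2" for h
    unfolding E2_def PHI_comm[OF c3(14) phii_in, OF e r(7,8,9,10)] e23
    using lopD(3)[OF lop_PHI[OF c3(14) phii_in], OF e] by (simp add: eps_def)
  then have "PHI \<phi>i j1 (j2 \<star> j3) j6 E2 = E2"
    using PHI_absorb_form(2)[OF c3(10), OF LE2, of \<phi>i] by simp
  then show ?thesis using 1 2 3 4 5 by (simp add: E2_def)
qed

section \<open>Uniqueness of duals\<close>

text \<open>Multilinear families of forms (\<open>lfam\<close>) and linear families of operators (\<open>rfam\<close>), with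
  multilinearity again tested against all linear functionals.\<close>

definition lfam :: "(('x \<Rightarrow> 'k) \<Rightarrow> bool) \<Rightarrow> (('y \<Rightarrow> 'k) \<Rightarrow> bool) \<Rightarrow> ('y \<Rightarrow> 'x \<Rightarrow> 'k) \<Rightarrow> bool" where
  "lfam L M F \<longleftrightarrow> form_space L \<and> form_space M \<and> (\<forall>y. L (F y)) \<and> (\<forall>N. lfun L N \<longrightarrow> M (\<lambda>y. N (F y)))"

lemma lfamD:
  assumes "lfam L M F"
  shows "form_space L" "form_space M" "L (F y)" "M (\<lambda>y. F y x)"
    "lop L L' p \<Longrightarrow> M (\<lambda>y. p (F y) x')"
  using assms lfun_apply[of L] lfun_lop_apply[of L L' p x'] by (auto simp: lfam_def)

lemma lfam_eval:
  assumes "lfam L M F" "T \<in> tprod M" "lop L L' p"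
  shows "p (\<lambda>x. T (\<lambda>y. F y x)) = (\<lambda>x. T (\<lambda>y. p (F y) x))"
  by (rule ext, rule lop_eval[OF assms(3,2) lfamD(1)[OF assms(1)], where F = F])
    (rule lfamD(3)[OF assms(1)], rule lfamD(4)[OF assms(1)], rule lfamD(5)[OF assms(1,3)])

lemma lfam_closed: "lfam L M F \<Longrightarrow> T \<in> tprod M \<Longrightarrow> L (\<lambda>x. T (\<lambda>y. F y x))"
  by (rule form_space_eval[of T M L "\<lambda>x y. F y x"]) (use lfamD[of L M F] in auto)

definition rfam :: "(('x \<Rightarrow> 'k) \<Rightarrow> bool) \<Rightarrow> ('h \<Rightarrow> ('x \<Rightarrow> 'k) \<Rightarrow> ('x \<Rightarrow> 'k)) \<Rightarrow> bool" where
  "rfam L P \<longleftrightarrow> form_space L \<and> (\<forall>h. lop L L (P h)) \<and> (\<forall>f N. L f \<longrightarrow> lfun L N \<longrightarrow> H1 (\<lambda>h. N (P h f)))"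

lemma rfamD:
  assumes "rfam L P"
  shows "form_space L" "lop L L (P h)" "L f \<Longrightarrow> lfun L N \<Longrightarrow> H1 (\<lambda>h. N (P h f))" "L f \<Longrightarrow> L (P h f)"
  using assms by (auto simp: rfam_def lop_def)

lemma rfam_ract: "ract L j \<Longrightarrow> rfam L j"
  by (simp add: rfam_def rrep_def)

lemma rfam_lop:
  assumes "rfam L P" "lop L L p"
  shows "rfam L (\<lambda>h f. p (P h f))" "rfam L (\<lambda>h f. P h (p f))"
proof -
  note P = rfamD[OF assms(1)]
  show "rfam L (\<lambda>h f. p (P h f))"
    unfolding rfam_def
    using P(1) lop_comp[OF P(2) assms(2)] P(3)[OF _ lfun_lop[OF assms(2)]] by blast
  show "rfam L (\<lambda>h f. P h (p f))"
    unfolding rfam_def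
    using P(1) lop_comp[OF assms(2) P(2)] P(3)[OF lopD(1)[OF assms(2)]] by blast
qed

text \<open>Words in elements and fixed operators are multilinear in the elements: for each slot,
  the operators applied after it become part of the test functional.\<close>

lemma lfam_snoc2:
  assumes "rfam L P1" "rfam L P2" "L f"
  shows "lfam L H2 (\<lambda>(y1, y2). P2 y2 (P1 y1 f))"
  unfolding lfam_def mlin_form_def
proof (intro conjI allI impI)
  note P1 = rfamD[OF assms(1)] and P2 = rfamD[OF assms(2)]
  show "L (case y of (y1, y2) \<Rightarrow> P2 y2 (P1 y1 f))" for y
    by (simp add: P1(4) P2(4) assms(3) split: prod.split)
  fix N assume N: "lfun L N"
  show "H1 (\<lambda>a. N (case (a, x) of (y1, y2) \<Rightarrow> P2 y2 (P1 y1 f)))" for x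
    using P1(3)[OF assms(3) lfun_lop[OF P2(2) N]] by simp
  show "H1 (\<lambda>x. N (case (a, x) of (y1, y2) \<Rightarrow> P2 y2 (P1 y1 f)))" for a
    using P2(3)[OF P1(4)[OF assms(3)] N] by simp
qed (use rfamD[OF assms(1)] in \<open>simp_all flip: mlin_form_def\<close>)

lemma lfam_snoc3:
  assumes "rfam L P1" "rfam L P2" "rfam L P3" "L f"
  shows "lfam L H3 (\<lambda>(y1, y2, y3). P3 y3 (P2 y2 (P1 y1 f)))"
  unfolding lfam_def
proof (intro conjI allI impI)
  note P1 = rfamD[OF assms(1)] and P2 = rfamD[OF assms(2)] and P3 = rfamD[OF assms(3)]
  show "L (case y of (y1, y2, y3) \<Rightarrow> P3 y3 (P2 y2 (P1 y1 f)))" for y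
    by (simp add: P1(4) P2(4) P3(4) assms(4) split: prod.split)
  fix N assume N: "lfun L N"
  have 1: "H1 (\<lambda>a. N (P3 z (P2 y (P1 a f))))" for y z
    by (rule P1(3)[OF assms(4) lfun_lop[OF P2(2) lfun_lop[OF P3(2) N]]])
  have 2: "H2 (\<lambda>y. N (case y of (y2, y3) \<Rightarrow> P3 y3 (P2 y2 (P1 a f))))" for a
    using lfam_snoc2[OF assms(2,3) P1(4)[OF assms(4), of a]] N by (simp add: lfam_def)
  show "H3 (\<lambda>y. N (case y of (y1, y2, y3) \<Rightarrow> P3 y3 (P2 y2 (P1 y1 f))))"
    unfolding mlin_form_def[of scale H2] using 1 2 by (simp add: case_prod_unfold)
qed (use rfamD[OF assms(1)] in simp_all)

lemma lfam_snoc4: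
  assumes "rfam L P1" "rfam L P2" "rfam L P3" "rfam L P4" "L f"
  shows "lfam L H4 (\<lambda>(y1, y2, y3, y4). P4 y4 (P3 y3 (P2 y2 (P1 y1 f))))"
  unfolding lfam_def
proof (intro conjI allI impI)
  note P1 = rfamD[OF assms(1)] and P2 = rfamD[OF assms(2)] and P3 = rfamD[OF assms(3)] and P4 = rfamD[OF assms(4)]
  show "L (case y of (y1, y2, y3, y4) \<Rightarrow> P4 y4 (P3 y3 (P2 y2 (P1 y1 f))))" for y
    by (simp add: P1(4) P2(4) P3(4) P4(4) assms(5) split: prod.split)
  fix N assume N: "lfun L N"
  have 1: "H1 (\<lambda>a. N (P4 w (P3 z (P2 y (P1 a f)))))" for y z w
    by (rule P1(3)[OF assms(5) lfun_lop[OF P2(2) lfun_lop[OF P3(2) lfun_lop[OF P4(2) N]]]])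
  have 2: "H3 (\<lambda>y. N (case y of (y2, y3, y4) \<Rightarrow> P4 y4 (P3 y3 (P2 y2 (P1 a f)))))" for a
    using lfam_snoc3[OF assms(2,3,4) P1(4)[OF assms(5), of a]] N by (simp add: lfam_def)
  show "H4 (\<lambda>y. N (case y of (y1, y2, y3, y4) \<Rightarrow> P4 y4 (P3 y3 (P2 y2 (P1 y1 f)))))"
    unfolding mlin_form_def[of scale H3] using 1 2 by (simp add: case_prod_unfold)
qed (use rfamD[OF assms(1)] in simp_all)

section \<open>Left multiplications and right multiplications by antipodes\<close>

definition mact :: "(('x \<Rightarrow> 'k) \<Rightarrow> bool) \<Rightarrow> ('h \<Rightarrow> 'x \<Rightarrow> 'x) \<Rightarrow> bool" where
  "mact L m \<longleftrightarrow> (\<forall>f h. L f \<longrightarrow> L (\<lambda>x. f (m h x))) \<and> (\<forall>f x. L f \<longrightarrow> H1 (\<lambda>h. f (m h x))) \<and>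
     (\<forall>x. m 1 x = x) \<and> (\<forall>g h x. m (g * h) x = m g (m h x))"

lemma ract_pull: "form_space L \<Longrightarrow> mact L m \<Longrightarrow> ract L (pull m)"
  by (intro rrep_linI vector_space_axioms lop_pull) (auto simp: mact_def pull_def)

definition lm :: "'h \<Rightarrow> 'h \<Rightarrow> 'h" where "lm h x = h * x"
definition rm :: "'h \<Rightarrow> 'h \<Rightarrow> 'h" where "rm h x = x * S h"

lemma S_add [simp]: "S (a + b) = S a + S b" and S_scale [simp]: "S (scale c a) = scale c (S a)"
proof -
  interpret Vector_Spaces.linear scale scale S by (rule antipode_linear)
  show "S (a + b) = S a + S b" "S (scale c a) = scale c (S a)" by (simp_all add: add scale)
qed

lemma mact_lm [simp]: "mact H1 lm"
  by (simp add: mact_def lm_def H1_iff distrib_left distrib_right mult.assoc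
      scale_mult_left[symmetric] scale_mult_right[symmetric])

lemma mact_rm [simp]: "mact H1 rm"
  by (simp add: mact_def rm_def H1_iff distrib_left distrib_right mult.assoc antipode_one antipode_mult
      scale_mult_left[symmetric] scale_mult_right[symmetric])

lemma mact_fst [simp]: "mact H1 m \<Longrightarrow> mact (mlin_form scale M) (fst_act m)"
  by (auto simp: mact_def mlin_form_def)

lemma mact_snd [simp]: "mact M m \<Longrightarrow> mact (mlin_form scale M) (snd_act m)"
  by (auto simp: mact_def mlin_form_def)

text \<open>\<open>dual L j \<sigma> a b\<close> says that \<open>\<sigma>\<close> is a dual of the right action j, where a and b play the
  roles of \<open>\<alpha>\<close> and \<open>\<beta>\<close>; every right action has the dual given by the antipode (\<open>dual_antipode\<close>).
  \<open>dcomp\<close> is the comparison map between two duals of the same action.\<close>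

definition dual :: "(('x \<Rightarrow> 'k) \<Rightarrow> bool) \<Rightarrow> ('h \<Rightarrow> ('x \<Rightarrow> 'k) \<Rightarrow> ('x \<Rightarrow> 'k)) \<Rightarrow> ('h \<Rightarrow> ('x \<Rightarrow> 'k) \<Rightarrow> ('x \<Rightarrow> 'k)) \<Rightarrow>
    (('x \<Rightarrow> 'k) \<Rightarrow> ('x \<Rightarrow> 'k)) \<Rightarrow> (('x \<Rightarrow> 'k) \<Rightarrow> ('x \<Rightarrow> 'k)) \<Rightarrow> bool" where
  "dual L j \<sigma> a b \<longleftrightarrow> rfam L \<sigma> \<and> lop L L a \<and> lop L L b \<and>
     (\<forall>g h f. L f \<longrightarrow> \<sigma> (g * h) f = \<sigma> g (\<sigma> h f)) \<and> (\<forall>f. L f \<longrightarrow> \<sigma> 1 f = f) \<and>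
     (\<forall>h f. L f \<longrightarrow> (\<lambda>x. \<Delta> h (\<lambda>(h1, h2). j h2 (a (\<sigma> h1 f)) x)) = eps h (a f)) \<and>
     (\<forall>h f. L f \<longrightarrow> (\<lambda>x. \<Delta> h (\<lambda>(h1, h2). \<sigma> h2 (b (j h1 f)) x)) = eps h (b f)) \<and>
     (\<forall>f. L f \<longrightarrow> (\<lambda>x. \<phi> (\<lambda>(x1, x2, x3). j x3 (a (\<sigma> x2 (b (j x1 f)))) x)) = f) \<and>
     (\<forall>f. L f \<longrightarrow> (\<lambda>x. \<phi>i (\<lambda>(y1, y2, y3). \<sigma> y3 (b (j y2 (a (\<sigma> y1 f)))) x)) = f)"

definition dcomp :: "('h \<Rightarrow> ('x \<Rightarrow> 'k) \<Rightarrow> ('x \<Rightarrow> 'k)) \<Rightarrow> ('h \<Rightarrow> ('x \<Rightarrow> 'k) \<Rightarrow> ('x \<Rightarrow> 'k)) \<Rightarrow>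
    (('x \<Rightarrow> 'k) \<Rightarrow> ('x \<Rightarrow> 'k)) \<Rightarrow> (('x \<Rightarrow> 'k) \<Rightarrow> ('x \<Rightarrow> 'k)) \<Rightarrow> ('h \<Rightarrow> ('x \<Rightarrow> 'k) \<Rightarrow> ('x \<Rightarrow> 'k)) \<Rightarrow>
    ('x \<Rightarrow> 'k) \<Rightarrow> ('x \<Rightarrow> 'k)" where
  "dcomp j \<sigma>' a' b \<sigma> f = (\<lambda>x. \<phi>i (\<lambda>(y1, y2, y3). \<sigma> y3 (b (j y2 (a' (\<sigma>' y1 f)))) x))"

lemma dualD:
  assumes "dual L j \<sigma> a b"
  shows "rfam L \<sigma>" "lop L L a" "lop L L b" "L f \<Longrightarrow> \<sigma> (g * h) f = \<sigma> g (\<sigma> h f)" "L f \<Longrightarrow> \<sigma> 1 f = f"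
    "L f \<Longrightarrow> (\<lambda>x. \<Delta> h (\<lambda>(h1, h2). j h2 (a (\<sigma> h1 f)) x)) = eps h (a f)"
    "L f \<Longrightarrow> (\<lambda>x. \<Delta> h (\<lambda>(h1, h2). \<sigma> h2 (b (j h1 f)) x)) = eps h (b f)"
    "L f \<Longrightarrow> (\<lambda>x. \<phi> (\<lambda>(x1, x2, x3). j x3 (a (\<sigma> x2 (b (j x1 f)))) x)) = f"
    "L f \<Longrightarrow> (\<lambda>x. \<phi>i (\<lambda>(y1, y2, y3). \<sigma> y3 (b (j y2 (a (\<sigma> y1 f)))) x)) = f"
  using assms by (auto simp: dual_def)

lemma lfam_case3: "lfam L M (\<lambda>(a, b, c). F a b c) \<Longrightarrow> M (\<lambda>(a, b, c). F a b c x)"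
  using lfamD(4)[of L M "\<lambda>(a, b, c). F a b c" x] by (simp add: case_prod_unfold)

lemma lfam_dcomp:
  assumes "ract L j" "dual L j \<sigma> a b" "dual L j \<sigma>' a' b'" "L f"
  shows "lfam L H3 (\<lambda>(y1, y2, y3). \<sigma> y3 (b (j y2 (a' (\<sigma>' y1 f)))))"
proof -
  note d = dualD[OF assms(2)] and d' = dualD[OF assms(3)]
  show ?thesis
    using lfam_snoc3[OF rfam_lop(1)[OF d'(1,2)] rfam_lop(1)[OF rfam_ract[OF assms(1)] d(3)] d(1), OF assms(4)] .
qed

lemma lop_dcomp:
  assumes "ract L j" "dual L j \<sigma> a b" "dual L j \<sigma>' a' b'"
  shows "lop L L (dcomp j \<sigma>' a' b \<sigma>)"
proof -
  note d = dualD[OF assms(2)] and d' = dualD[OF assms(3)]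
  note F = lfam_dcomp[OF assms]
  have dc: "dcomp j \<sigma>' a' b \<sigma> f x = \<phi>i (\<lambda>y. (\<lambda>(y1, y2, y3). \<sigma> y3 (b (j y2 (a' (\<sigma>' y1 f))))) y x)" for f x
    by (simp add: dcomp_def case_prod_unfold)
  have p: "lop L L (\<lambda>f. \<sigma> y3 (b (j y2 (a' (\<sigma>' y1 f)))))" for y1 y2 y3
    by (rule lop_comp[OF lop_comp[OF lop_comp[OF lop_comp[OF rfamD(2)[OF d'(1)] d'(2)]
      rrepD(3)[OF assms(1)]] d(3)] rfamD(2)[OF d(1)]])
  show ?thesis
    unfolding lop_def
  proof (intro conjI allI impI)
    fix f assume f: "L f"
    show "L (dcomp j \<sigma>' a' b \<sigma> f)"
      using lfam_closed[OF F[OF f] phii_in] unfolding dc[abs_def] .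
    show "dcomp j \<sigma>' a' b \<sigma> (\<lambda>x. c * f x) = (\<lambda>y. c * dcomp j \<sigma>' a' b \<sigma> f y)" for c
      unfolding dc[abs_def]
      using tprod_eval_scale[OF phii_in form_space_H(3), OF lfamD(4)[OF F[OF f]]] lopD(3)[OF p, OF f]
      by (simp add: case_prod_unfold)
    fix g assume g: "L g"
    show "dcomp j \<sigma>' a' b \<sigma> (\<lambda>x. f x + g x) = (\<lambda>y. dcomp j \<sigma>' a' b \<sigma> f y + dcomp j \<sigma>' a' b \<sigma> g y)"
      unfolding dc[abs_def]
      using tprod_eval_add[OF phii_in form_space_H(3), OF lfamD(4)[OF F[OF f]] lfamD(4)[OF F[OF g]]] lopD(2)[OF p, OF f g]
      by (simp add: case_prod_unfold)
  qed
qed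

section \<open>Sweedler sums as forms in their own components; comparison of two duals\<close>

abbreviation "s1 \<equiv> pull (fst_act lm)"
abbreviation "s2 \<equiv> pull (snd_act (fst_act lm))"
abbreviation "s3of3 \<equiv> pull (snd_act (snd_act lm))"
abbreviation "s3 \<equiv> pull (snd_act (snd_act (fst_act lm)))"
abbreviation "s4of4 \<equiv> pull (snd_act (snd_act (snd_act lm)))"

lemma cact_regular3: "cact H3 [s1, s2, s3of3]"
  by (auto intro!: ract_pull comm_pull)

lemma cact_regular4: "cact H4 [s1, s2, s3, s4of4]"
  by (auto intro!: ract_pull comm_pull)

lemma dual_absorb:
  assumes "ract L j" "dual L j \<sigma> a b" "lop L L p" "L f"
  shows "\<Delta> h (\<lambda>(h1, h2). p (j h2 (a (\<sigma> h1 f))) x) = \<epsilon> h * p (a f) x"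
    and "\<Delta> h (\<lambda>(h1, h2). p (\<sigma> h2 (b (j h1 f))) x) = \<epsilon> h * p (b f) x"
proof -
  note d = dualD[OF assms(2)]
  have "lfam L H2 (\<lambda>(h1, h2). j h2 (a (\<sigma> h1 f)))"
    by (rule lfam_snoc2[OF rfam_lop(1)[OF d(1,2)] rfam_ract[OF assms(1)], OF assms(4)])
  from lfam_eval[OF this comult_in assms(3), of h]
  have "p (\<lambda>x. \<Delta> h (\<lambda>(h1, h2). j h2 (a (\<sigma> h1 f)) x)) x = \<Delta> h (\<lambda>(h1, h2). p (j h2 (a (\<sigma> h1 f))) x)"
    by (simp add: case_prod_unfold)
  then show "\<Delta> h (\<lambda>(h1, h2). p (j h2 (a (\<sigma> h1 f))) x) = \<epsilon> h * p (a f) x"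
    using lopD(3)[OF assms(3), OF lopD(1)[OF d(2), OF assms(4)]] by (simp add: d(6)[OF assms(4)] eps_def)
  have "lfam L H2 (\<lambda>(h1, h2). \<sigma> h2 (b (j h1 f)))"
    by (rule lfam_snoc2[OF rfam_lop(1)[OF rfam_ract[OF assms(1)] d(3)] d(1), OF assms(4)])
  from lfam_eval[OF this comult_in assms(3), of h]
  have "p (\<lambda>x. \<Delta> h (\<lambda>(h1, h2). \<sigma> h2 (b (j h1 f)) x)) x = \<Delta> h (\<lambda>(h1, h2). p (\<sigma> h2 (b (j h1 f))) x)"
    by (simp add: case_prod_unfold)
  then show "\<Delta> h (\<lambda>(h1, h2). p (\<sigma> h2 (b (j h1 f))) x) = \<epsilon> h * p (b f) x"
    using lopD(3)[OF assms(3), OF lopD(1)[OF d(3), OF assms(4)]] by (simp add: d(7)[OF assms(4)] eps_def)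
qed

text \<open>In elements, the comparison map is multiplication by the sum u of
  \<open>S' y1 * \<alpha>' * y2 * \<beta> * S y3\<close>, and the claim reads
  \<open>S' h * u = u * S h\<close>. Quasi-coassociativity distributes three components of h around
  those of \<open>\<phi>i\<close>: on one side \<alpha>' absorbs the first two, on the other \<beta>
  absorbs the last two.\<close>

lemma dcomp_intertwines:
  assumes "ract L j" "dual L j \<sigma> a b" "dual L j \<sigma>' a' b'" "L f"
  shows "dcomp j \<sigma>' a' b \<sigma> (\<sigma>' h f) = \<sigma> h (dcomp j \<sigma>' a' b \<sigma> f)"
proof
  fix x
  note d = dualD[OF assms(2)] and d' = dualD[OF assms(3)]
  note \<sigma> = rfamD[OF d(1)] and \<sigma>' = rfamD[OF d'(1)] and j = rrepD[OF assms(1)]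
  define G where "G = (\<lambda>(y1, y2, y3). \<sigma> y3 (b (j y2 (a' (\<sigma>' y1 f)))) x)"
  note F = lfam_dcomp[OF assms(1-3), OF assms(4)]
  have G: "H3 G" unfolding G_def by (rule lfam_case3[OF F])
  have Gap: "G (y1, y2, y3) = \<sigma> y3 (b (j y2 (a' (\<sigma>' y1 f)))) x" for y1 y2 y3 by (simp add: G_def)
  have Lw: "L (\<sigma>' y1 f)" "L (a' (\<sigma>' y1 f))" "L (j y2 (a' (\<sigma>' y1 f)))" "L (b (j y2 (a' (\<sigma>' y1 f))))"
    "L (\<sigma> y3 (b (j y2 (a' (\<sigma>' y1 f)))))" for y1 y2 y3
    by (intro \<sigma>(4) \<sigma>'(4) j(4) lopD(1)[OF d(3)] lopD(1)[OF d'(2)] assms(4))+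
  have absorb_left: "(s1 \<star> s2) h G = eps h G" for h
  proof
    fix m :: "'h \<times> 'h \<times> 'h"
    obtain m1 m2 m3 where m: "m = (m1, m2, m3)" by (cases m) auto
    have p: "lop L L (\<lambda>g. \<sigma> m3 (b (j m2 g)))"
      by (rule lop_comp[OF lop_comp[OF j(3) d(3)] \<sigma>(2)])
    have "(s1 \<star> s2) h G m = \<Delta> h (\<lambda>(h1, h2). \<sigma> m3 (b (j m2 (j h2 (a' (\<sigma>' h1 (\<sigma>' m1 f)))))) x)"
      using assms(4) Lw by (simp add: conv_apply pull_def m Gap lm_def d'(4) j(7) \<sigma>'(4) lopD(1)[OF d'(2)] lopD(1)[OF d(3)])
    also have "\<dots> = eps h G m"
      unfolding dual_absorb(1)[OF assms(1,3), OF p Lw(1)] by (simp add: eps_def m Gap)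
    finally show "(s1 \<star> s2) h G m = eps h G m" .
  qed
  define P where "P m = \<phi>i (\<lambda>y. G (y * m))" for m
  have PHI: "PHI \<phi>i s1 s2 s3of3 K m = \<phi>i (\<lambda>y. K (y * m))" for K :: "'h \<times> 'h \<times> 'h \<Rightarrow> 'k" and m
    by (cases m) (auto simp: PHI_apply pull_def lm_def intro!: arg_cong[of _ _ \<phi>i])
  have P': "PHI \<phi>i s1 s2 s3of3 G = P" by (simp add: fun_eq_iff PHI P_def)
  have P: "H3 P" unfolding P'[symmetric] by (rule PHI_closed[OF cact_regular3 phii_in, OF G])
  have c2: "cact H3 [s1 \<star> s2, s3of3]"
    using cact_regular3 by (simp add: conv_simps)
  \<comment> \<open>The word is regarded as a form in the components of \<open>\<phi>i\<close>.
    Strands 1 and 2 are absorbed at \<alpha>', which leaves h in the last place.\<close>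
  have 1: "(s1 \<star> (s2 \<star> s3of3)) h P = PHI \<phi>i s1 s2 s3of3 (s3of3 h G)"
    using quasi_coassoc_act(2)[OF cact_regular3, OF G, of h] absorb_conv(1)[OF c2, OF G, OF absorb_left] P' by simp
  have L: "dcomp j \<sigma>' a' b \<sigma> f = (\<lambda>x. \<phi>i (\<lambda>y. (\<lambda>(y1, y2, y3). \<sigma> y3 (b (j y2 (a' (\<sigma>' y1 f))))) y x))"
    by (simp add: dcomp_def case_prod_unfold)
  have "\<sigma> h (dcomp j \<sigma>' a' b \<sigma> f) x = \<phi>i (\<lambda>(y1, y2, y3). \<sigma> h (\<sigma> y3 (b (j y2 (a' (\<sigma>' y1 f))))) x)"
    unfolding L lfam_eval[OF F phii_in \<sigma>(2)] by (simp add: case_prod_unfold)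
  also have "\<dots> = PHI \<phi>i s1 s2 s3of3 (s3of3 h G) 1"
    unfolding PHI by (rule arg_cong[of _ _ \<phi>i]) (auto simp: pull_def lm_def Gap d(4) Lw)
  also have "\<dots> = (s1 \<star> (s2 \<star> s3of3)) h P 1"
    by (simp add: 1)
  also have "\<dots> = \<Delta> h (\<lambda>(h1, h'). \<Delta> h' (\<lambda>(h2, h3). P (h1, h2, h3)))"
    by (simp add: conv_apply one_prod_def pull_def lm_def)
  \<comment> \<open>On this side h2 and h3 multiply the components from the right and enclose
    \<beta>.\<close>
  also have "\<dots> = \<Delta> h (\<lambda>(h1, h'). \<epsilon> h' * P (h1, 1, 1))"
  proof -
    have "\<Delta> h' (\<lambda>(h2, h3). P (h1, h2, h3)) = \<epsilon> h' * P (h1, 1, 1)" for h1 h'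
    proof -
      have "\<Delta> h' (\<lambda>(h2, h3). P (h1, h2, h3)) = \<Delta> h' (\<lambda>k. \<phi>i (\<lambda>y. G (y * (h1, k))))"
        by (simp add: P_def case_prod_unfold)
      also have "\<dots> = \<phi>i (\<lambda>y. \<Delta> h' (\<lambda>k. G (y * (h1, k))))"
        by (intro tprod_Fubini[OF comult_in phii_in] form_space_H mult_stableD(1)[OF mult_stable_H(3), OF G])
          (use mult_stableD(2)[OF mult_stable_H(3), OF G] in \<open>simp add: mlin_form_def\<close>)
      also have "\<dots> = \<phi>i (\<lambda>y. \<epsilon> h' * G (y * (h1, 1, 1)))"
      proof (rule arg_cong[of _ _ \<phi>i], rule ext)
        fix y :: "'h \<times> 'h \<times> 'h"
        obtain y1 y2 y3 where y: "y = (y1, y2, y3)" by (cases y) auto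
        have l: "L (j y2 (a' (\<sigma>' (y1 * h1) f)))" by (rule Lw(3))
        have "\<Delta> h' (\<lambda>k. G (y * (h1, k))) =
            \<Delta> h' (\<lambda>(k1, k2). \<sigma> y3 (\<sigma> k2 (b (j k1 (j y2 (a' (\<sigma>' (y1 * h1) f)))))) x)"
          by (rule arg_cong[of _ _ "\<Delta> h'"])
            (use Lw in \<open>auto simp: y Gap d(4) j(7) lopD(1)[OF d(3)] j(4)\<close>)
        also have "\<dots> = \<epsilon> h' * G (y * (h1, 1, 1))"
          unfolding dual_absorb(2)[OF assms(1,2), OF \<sigma>(2) l] by (simp add: y Gap)
        finally show "\<Delta> h' (\<lambda>k. G (y * (h1, k))) = \<epsilon> h' * G (y * (h1, 1, 1))" .
      qed
      also have "\<dots> = \<epsilon> h' * P (h1, 1, 1)"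
        unfolding P_def using mult_stableD(1)[OF mult_stable_H(3), OF G]
        by (intro tprod_eval_scale[OF phii_in]) simp_all
      finally show ?thesis .
    qed
    then show ?thesis by simp
  qed
  also have "\<dots> = P (h, 1, 1)"
  proof -
    have P1: "H1 (\<lambda>h. P (h, 1, 1))" using P by (simp add: mlin_form_def)
    have e: "\<epsilon> h2 * P (h1, 1, 1) = P (scale (\<epsilon> h2) h1, 1, 1)" for h1 h2 using P1 by (simp add: H1_iff)
    have "H2 (\<lambda>(h1, h2). P (scale (\<epsilon> h2) h1, 1, 1))"
      unfolding e[symmetric] using P1 counit_linear by (simp add: mlin_form_def H1_iff algebra_simps)
    then show ?thesis
      using linear_form_tsum[OF comult_in vector_space_axioms P1, of "\<lambda>(h1, h2). scale (\<epsilon> h2) h1" h]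
      by (simp add: counit_right[unfolded case_prod_unfold] case_prod_unfold e)
  qed
  also have "\<dots> = dcomp j \<sigma>' a' b \<sigma> (\<sigma>' h f) x"
    unfolding P_def dcomp_def
    by (rule arg_cong[of _ _ \<phi>i]) (auto simp: Gap d'(4) assms(4))
  finally show "dcomp j \<sigma>' a' b \<sigma> (\<sigma>' h f) x = \<sigma> h (dcomp j \<sigma>' a' b \<sigma> f) x" by simp
qed

text \<open>At the argument 1 the strands merely insert elements into the slots of \<open>K\<close>.
  Absorption is therefore asked for elements in their slots, which covers elements that multiply the
  components of an inner tensor from the right.\<close>

lemma PHI_absorb_right_mult:
  assumes "H4 K" "T \<in> {\<phi>, \<phi>i}"
  shows "(\<And>h m1 m2. \<Delta> h (\<lambda>(u1, u2). K (m1, m2, u1, u2)) = \<epsilon> h * K (m1, m2, 1, 1)) \<Longrightarrow>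
      PHI T s1 s2 (s3 \<star> s4of4) K 1 = K 1"
    and "(\<And>h m3 m4. \<Delta> h (\<lambda>(u1, u2). K (u1, u2, m3, m4)) = \<epsilon> h * K (1, 1, m3, m4)) \<Longrightarrow>
      PHI T (s1 \<star> s2) s3 s4of4 K 1 = K 1"
proof -
  have c: "cact H4 [s1, s2]" "cact H4 [s3, s4of4]" using cact_regular4 by simp_all
  show "PHI T s1 s2 (s3 \<star> s4of4) K 1 = K 1"
    if "\<And>h m1 m2. \<Delta> h (\<lambda>(u1, u2). K (m1, m2, u1, u2)) = \<epsilon> h * K (m1, m2, 1, 1)"
  proof -
    have "PHI T s1 s2 (s3 \<star> s4of4) K 1 = PHI T s1 s2 eps K 1"
      by (simp add: PHI_apply conv_apply pull_def lm_def one_prod_def eps_def that)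
    also have "PHI T s1 s2 eps K = K" using PHI_eps_right[OF c(1), OF assms(1)] assms(2) by auto
    finally show ?thesis .
  qed
  show "PHI T (s1 \<star> s2) s3 s4of4 K 1 = K 1"
    if "\<And>h m3 m4. \<Delta> h (\<lambda>(u1, u2). K (u1, u2, m3, m4)) = \<epsilon> h * K (1, 1, m3, m4)"
  proof -
    have "PHI T (s1 \<star> s2) s3 s4of4 K 1 = PHI T eps s3 s4of4 K 1"
      by (simp add: PHI_apply conv_apply pull_def lm_def one_prod_def eps_def that)
    also have "PHI T eps s3 s4of4 K = K" using PHI_eps_left[OF c(2), OF assms(1)] assms(2) by auto
    finally show ?thesis .
  qed
qed

text \<open>In elements, \<open>\<beta>' * u = \<beta>\<close>. The word
  \<open>y1 * \<beta>' * S' y2 * \<alpha>' * y3 * \<beta> * S y4\<close> is evaluated on both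
  expressions for \<chi>. The three factors with a doubled strand are absorbed: 23 at \<alpha>', 34
  at \<beta>, 12 at \<beta>'. One side is then \<open>\<beta>' * u\<close>, and the other is \<beta>
  by the zigzag axiom of the primed dual.\<close>

lemma dcomp_coev:
  assumes "ract L j" "dual L j \<sigma> a b" "dual L j \<sigma>' a' b'" "L f"
  shows "dcomp j \<sigma>' a' b \<sigma> (b' f) = b f"
proof
  fix x
  note d = dualD[OF assms(2)] and d' = dualD[OF assms(3)]
  note \<sigma> = rfamD[OF d(1)] and \<sigma>' = rfamD[OF d'(1)] and j = rrepD[OF assms(1)]
  define G where "G = (\<lambda>(y1, y2, y3, y4). \<sigma> y4 (b (j y3 (a' (\<sigma>' y2 (b' (j y1 f)))))) x)"
  have Gap: "G (y1, y2, y3, y4) = \<sigma> y4 (b (j y3 (a' (\<sigma>' y2 (b' (j y1 f)))))) x" for y1 y2 y3 y4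
    by (simp add: G_def)
  have G: "H4 G"
    using lfamD(4)[OF lfam_snoc4[OF rfam_lop(1)[OF rfam_ract[OF assms(1)] d'(3)] rfam_lop(1)[OF d'(1,2)] rfam_lop(1)[OF rfam_ract[OF assms(1)] d(3)] d(1), OF assms(4)], of x]
    by (simp add: G_def case_prod_unfold)
  have Lw: "L (j y1 f)" "L (b' (j y1 f))" "L (\<sigma>' y2 (b' (j y1 f)))" "L (a' (\<sigma>' y2 (b' (j y1 f))))"
    "L (j y3 (a' (\<sigma>' y2 (b' (j y1 f)))))" "L (b (j y3 (a' (\<sigma>' y2 (b' (j y1 f))))))" for y1 y2 y3
    by (intro \<sigma>(4) \<sigma>'(4) j(4) lopD(1)[OF d(3)] lopD(1)[OF d'(2)] lopD(1)[OF d'(3)] assms(4))+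
  note c = cact_conv[OF cact_regular4]
  have absorb23: "(s2 \<star> s3) h G = eps h G" for h
  proof
    fix m :: "'h \<times> 'h \<times> 'h \<times> 'h"
    obtain m1 m2 m3 m4 where m: "m = (m1, m2, m3, m4)" by (cases m) auto
    have p: "lop L L (\<lambda>g. \<sigma> m4 (b (j m3 g)))"
      by (rule lop_comp[OF lop_comp[OF j(3) d(3)] \<sigma>(2)])
    have "(s2 \<star> s3) h G m = \<Delta> h (\<lambda>(h1, h2). \<sigma> m4 (b (j m3 (j h2 (a' (\<sigma>' h1 (\<sigma>' m2 (b' (j m1 f)))))))) x)"
      using assms(4) Lw by (simp add: conv_apply pull_def m Gap lm_def d'(4) j(7) \<sigma>'(4) lopD(1)[OF d'(2)] lopD(1)[OF d(3)])
    also have "\<dots> = eps h G m"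
      unfolding dual_absorb(1)[OF assms(1,3), OF p Lw(3)] by (simp add: eps_def m Gap)
    finally show "(s2 \<star> s3) h G m = eps h G m" .
  qed
  define K1 where "K1 = PHI \<phi>i s2 s3 s4of4 G"
  define K2 where "K2 = PHI \<phi> s1 s2 s3 G"
  have K: "H4 K1" "H4 K2" unfolding K1_def K2_def
    by (rule PHI_closed[OF c(5) phii_in, OF G] PHI_closed[OF c(4) assoc_in, OF G])+
  have K1: "K1 (m1, m) = \<phi>i (\<lambda>y. G (m1, y * m))" for m1 m
    unfolding K1_def by (cases m) (auto simp: PHI_apply pull_def lm_def intro!: arg_cong[of _ _ \<phi>i])
  have K2: "K2 (m1, m2, m3, m4) = \<phi> (\<lambda>y. (\<lambda>(a, b, c). G (a, b, c, m4)) (y * (m1, m2, m3)))" for m1 m2 m3 m4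
    unfolding K2_def by (auto simp: PHI_apply pull_def lm_def intro!: arg_cong[of _ _ \<phi>])
  have eq: "PHI \<phi> s1 s2 (s3 \<star> s4of4) K1 = PHI \<phi>i (s1 \<star> s2) s3 s4of4 K2"
    using CHI_alt[OF cact_regular4, OF G] PHI_absorb_form(2)[OF c(2), OF G _ absorb23, of \<phi>i]
    by (simp add: CHI_def K1_def K2_def)
  have R1: "\<Delta> h (\<lambda>(u1, u2). K1 (m1, m2, u1, u2)) = \<epsilon> h * K1 (m1, m2, 1, 1)" for h m1 m2
  proof -
    have G3: "H3 (\<lambda>y. G (m1, y))" using G by (simp add: mlin_form_def)
    have "\<Delta> h (\<lambda>(u1, u2). K1 (m1, m2, u1, u2)) = \<Delta> h (\<lambda>u. \<phi>i (\<lambda>y. G (m1, y * (m2, u))))"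
      by (simp add: K1 case_prod_unfold)
    also have "\<dots> = \<phi>i (\<lambda>y. \<Delta> h (\<lambda>u. G (m1, y * (m2, u))))"
        by (intro tprod_Fubini[OF comult_in phii_in] form_space_H mult_stableD(1)[OF mult_stable_H(3), OF G3])
          (use mult_stableD(2)[OF mult_stable_H(3), OF G3] in \<open>simp add: mlin_form_def\<close>)
    also have "\<dots> = \<phi>i (\<lambda>y. \<epsilon> h * G (m1, y * (m2, 1, 1)))"
    proof (rule arg_cong[of _ _ \<phi>i], rule ext)
      fix y :: "'h \<times> 'h \<times> 'h"
      obtain y1 y2 y3 where y: "y = (y1, y2, y3)" by (cases y) auto
      have "\<Delta> h (\<lambda>u. G (m1, y * (m2, u))) =
          \<Delta> h (\<lambda>(k1, k2). \<sigma> y3 (\<sigma> k2 (b (j k1 (j y2 (a' (\<sigma>' (y1 * m2) (b' (j m1 f)))))))) x)"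
        by (rule arg_cong[of _ _ "\<Delta> h"])
          (use Lw in \<open>auto simp: y Gap d(4) j(7) lopD(1)[OF d(3)] j(4)\<close>)
      also have "\<dots> = \<epsilon> h * G (m1, y * (m2, 1, 1))"
        unfolding dual_absorb(2)[OF assms(1,2), OF \<sigma>(2) Lw(5)] by (simp add: y Gap)
      finally show "\<Delta> h (\<lambda>u. G (m1, y * (m2, u))) = \<epsilon> h * G (m1, y * (m2, 1, 1))" .
    qed
    also have "\<dots> = \<epsilon> h * K1 (m1, m2, 1, 1)"
      unfolding K1 using mult_stableD(1)[OF mult_stable_H(3), OF G3]
      by (intro tprod_eval_scale[OF phii_in]) simp_all
    finally show ?thesis .
  qed
  have R2: "\<Delta> h (\<lambda>(u1, u2). K2 (u1, u2, m3, m4)) = \<epsilon> h * K2 (1, 1, m3, m4)" for h m3 m4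
  proof -
    let ?G = "\<lambda>(a, b, c). G (a, b, c, m4)"
    have G3: "H3 ?G" using G by (simp add: mlin_form_def)
    have "\<Delta> h (\<lambda>(u1, u2). K2 (u1, u2, m3, m4)) = \<Delta> h (\<lambda>u. \<phi> (\<lambda>y. ?G (y * (fst u, snd u, m3))))"
      by (simp add: K2 case_prod_unfold)
    also have "\<dots> = \<phi> (\<lambda>y. \<Delta> h (\<lambda>u. ?G (y * (fst u, snd u, m3))))"
        by (intro tprod_Fubini[OF comult_in assoc_in] form_space_H mult_stableD(1)[OF mult_stable_H(3), OF G3])
          (use mult_stableD(2)[OF mult_stable_H(3), OF G3] in \<open>simp add: mlin_form_def\<close>)
    also have "\<dots> = \<phi> (\<lambda>y. \<epsilon> h * ?G (y * (1, 1, m3)))"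
    proof (rule arg_cong[of _ _ \<phi>], rule ext)
      fix y :: "'h \<times> 'h \<times> 'h"
      obtain y1 y2 y3 where y: "y = (y1, y2, y3)" by (cases y) auto
      have p: "lop L L (\<lambda>g. \<sigma> m4 (b (j (y3 * m3) (a' (\<sigma>' y2 g)))))"
        by (rule lop_comp[OF lop_comp[OF lop_comp[OF lop_comp[OF \<sigma>'(2) d'(2)] j(3)] d(3)] \<sigma>(2)])
      have "\<Delta> h (\<lambda>u. ?G (y * (fst u, snd u, m3))) =
          \<Delta> h (\<lambda>(k1, k2). \<sigma> m4 (b (j (y3 * m3) (a' (\<sigma>' y2 (\<sigma>' k2 (b' (j k1 (j y1 f)))))))) x)"
        by (rule arg_cong[of _ _ "\<Delta> h"])
          (use Lw assms(4) in \<open>auto simp: y Gap d'(4) j(7) lopD(1)[OF d'(3)] j(4)\<close>)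
      also have "\<dots> = \<epsilon> h * ?G (y * (1, 1, m3))"
        unfolding dual_absorb(2)[OF assms(1,3), OF p Lw(1)] by (simp add: y Gap)
      finally show "\<Delta> h (\<lambda>u. ?G (y * (fst u, snd u, m3))) = \<epsilon> h * ?G (y * (1, 1, m3))" .
    qed
    also have "\<dots> = \<epsilon> h * K2 (1, 1, m3, m4)"
      unfolding K2 using mult_stableD(1)[OF mult_stable_H(3), OF G3]
      by (intro tprod_eval_scale[OF assoc_in]) simp_all
    finally show ?thesis .
  qed
  \<comment> \<open>The outer associators disappear at 1: the one over \<open>K1\<close> is absorbed
    at \<beta>, the one over \<open>K2\<close> at \<beta>'.\<close>
  have "K1 1 = K2 1"
    using PHI_absorb_right_mult(1)[OF K(1) _ R1, of \<phi>] PHI_absorb_right_mult(2)[OF K(2) _ R2, of \<phi>i] eq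
    by simp
  moreover have "K1 1 = dcomp j \<sigma>' a' b \<sigma> (b' f) x"
    unfolding dcomp_def one_prod_def K1
    by (rule arg_cong[of _ _ \<phi>i]) (auto simp: Gap j(6) assms(4))
  moreover have "K2 1 = b f x"
  proof -
    have F: "lfam L H3 (\<lambda>(x1, x2, x3). j x3 (a' (\<sigma>' x2 (b' (j x1 f)))))"
      by (rule lfam_snoc3[OF rfam_lop(1)[OF rfam_ract[OF assms(1)] d'(3)] rfam_lop(1)[OF d'(1,2)] rfam_ract[OF assms(1)], OF assms(4)])
    have "K2 1 = \<phi> (\<lambda>(x1, x2, x3). b (j x3 (a' (\<sigma>' x2 (b' (j x1 f))))) x)"
      unfolding one_prod_def K2
      by (rule arg_cong[of _ _ \<phi>]) (auto simp: Gap d(5) Lw)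
    also have "\<dots> = b (\<lambda>x. \<phi> (\<lambda>(x1, x2, x3). j x3 (a' (\<sigma>' x2 (b' (j x1 f)))) x)) x"
      using fun_cong[OF lfam_eval[OF F assoc_in d(3)], of x] by (simp add: case_prod_unfold)
    finally show ?thesis using d'(8)[OF assms(4)] by simp
  qed
  ultimately show "dcomp j \<sigma>' a' b \<sigma> (b' f) x = b f x" by simp
qed

text \<open>The second map turns \<open>\<sigma> y3\<close> into \<open>\<sigma>' y3\<close> by
  \<open>dcomp_intertwines\<close> and \<open>b\<close> into \<open>b'\<close> by
  \<open>dcomp_coev\<close>, so the composite is the zigzag of the primed dual.\<close>

lemma dcomp_inverse:
  assumes "ract L j" "dual L j \<sigma> a b" "dual L j \<sigma>' a' b'" "L f"
  shows "dcomp j \<sigma> a b' \<sigma>' (dcomp j \<sigma>' a' b \<sigma> f) = f"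
proof -
  note d = dualD[OF assms(2)] and d' = dualD[OF assms(3)]
  note \<sigma> = rfamD[OF d(1)] and \<sigma>' = rfamD[OF d'(1)] and j = rrepD[OF assms(1)]
  let ?v = "dcomp j \<sigma> a b' \<sigma>'"
  note F = lfam_dcomp[OF assms(1-3), OF assms(4)]
  have v: "lop L L ?v" by (rule lop_dcomp[OF assms(1,3,2)])
  have u: "dcomp j \<sigma>' a' b \<sigma> f = (\<lambda>x. \<phi>i (\<lambda>y. (\<lambda>(y1, y2, y3). \<sigma> y3 (b (j y2 (a' (\<sigma>' y1 f))))) y x))"
    by (simp add: dcomp_def case_prod_unfold)
  have Lw: "L (j y2 (a' (\<sigma>' y1 f)))" for y1 y2
    by (intro \<sigma>(4) \<sigma>'(4) j(4) lopD(1)[OF d'(2)] assms(4))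
  have "?v (\<sigma> y3 (b (j y2 (a' (\<sigma>' y1 f))))) = \<sigma>' y3 (b' (j y2 (a' (\<sigma>' y1 f))))" for y1 y2 y3
    unfolding dcomp_intertwines[OF assms(1,3,2), OF lopD(1)[OF d(3), OF Lw]] dcomp_coev[OF assms(1,3,2), OF Lw] ..
  then show ?thesis
    unfolding u lfam_eval[OF F phii_in v] using d'(9)[OF assms(4)] by (simp add: case_prod_unfold)
qed

section \<open>The twist f\<close>

definition lin :: "('h \<Rightarrow> 'h) \<Rightarrow> bool" where
  "lin E \<longleftrightarrow> (\<forall>a b. E (a + b) = E a + E b) \<and> (\<forall>c a. E (scale c a) = scale c (E a))"

lemma lin_simps:
  "lin (\<lambda>a. a)" "lin E \<Longrightarrow> lin (\<lambda>a. E a * c)" "lin E \<Longrightarrow> lin (\<lambda>a. c * E a)" "lin E \<Longrightarrow> lin (\<lambda>a. S (E a))"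
  by (simp_all add: lin_def distrib_left distrib_right scale_mult_left[symmetric] scale_mult_right[symmetric])

lemma H1_comp: "H1 f \<Longrightarrow> lin E \<Longrightarrow> H1 (\<lambda>a. f (E a))"
  by (simp add: H1_iff lin_def)

lemma mlin_form_case: "mlin_form s M (\<lambda>(a, x). F a x) \<longleftrightarrow> (\<forall>x. linear_form s (\<lambda>a. F a x)) \<and> (\<forall>a. M (F a))"
  by (simp add: mlin_form_def)

lemma H_args:
  "H2 f2 \<Longrightarrow> lin E \<Longrightarrow> H1 (\<lambda>a. f2 (E a, c))" "H2 f2 \<Longrightarrow> lin E \<Longrightarrow> H1 (\<lambda>a. f2 (c, E a))"
  "H3 f3 \<Longrightarrow> lin E \<Longrightarrow> H1 (\<lambda>a. f3 (E a, c, d))" "H3 f3 \<Longrightarrow> lin E \<Longrightarrow> H1 (\<lambda>a. f3 (c, E a, d))"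
  "H3 f3 \<Longrightarrow> lin E \<Longrightarrow> H1 (\<lambda>a. f3 (c, d, E a))"
  "H4 f4 \<Longrightarrow> lin E \<Longrightarrow> H1 (\<lambda>a. f4 (E a, c, d, b))" "H4 f4 \<Longrightarrow> lin E \<Longrightarrow> H1 (\<lambda>a. f4 (c, E a, d, b))"
  "H4 f4 \<Longrightarrow> lin E \<Longrightarrow> H1 (\<lambda>a. f4 (c, d, E a, b))" "H4 f4 \<Longrightarrow> lin E \<Longrightarrow> H1 (\<lambda>a. f4 (c, d, b, E a))"
  "H5 f5 \<Longrightarrow> lin E \<Longrightarrow> H1 (\<lambda>a. f5 (E a, c, d, b, e))" "H5 f5 \<Longrightarrow> lin E \<Longrightarrow> H1 (\<lambda>a. f5 (c, E a, d, b, e))"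
  "H5 f5 \<Longrightarrow> lin E \<Longrightarrow> H1 (\<lambda>a. f5 (c, d, E a, b, e))" "H5 f5 \<Longrightarrow> lin E \<Longrightarrow> H1 (\<lambda>a. f5 (c, d, b, E a, e))"
  "H5 f5 \<Longrightarrow> lin E \<Longrightarrow> H1 (\<lambda>a. f5 (c, d, b, e, E a))"
  unfolding mlin_form_def by (auto intro: H1_comp)

lemma H1_tprod:
  "T \<in> tprod H2 \<Longrightarrow> (\<And>u v. H1 (\<lambda>a. F a u v)) \<Longrightarrow> (\<And>a. H2 (\<lambda>(u, v). F a u v)) \<Longrightarrow> H1 (\<lambda>a. T (\<lambda>(u, v). F a u v))"
  "U \<in> tprod H3 \<Longrightarrow> (\<And>u v w. H1 (\<lambda>a. G a u v w)) \<Longrightarrow> (\<And>a. H3 (\<lambda>(u, v, w). G a u v w)) \<Longrightarrow>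
    H1 (\<lambda>a. U (\<lambda>(u, v, w). G a u v w))"
  "V \<in> tprod H4 \<Longrightarrow> (\<And>u v w x. H1 (\<lambda>a. K a u v w x)) \<Longrightarrow> (\<And>a. H4 (\<lambda>(u, v, w, x). K a u v w x)) \<Longrightarrow>
    H1 (\<lambda>a. V (\<lambda>(u, v, w, x). K a u v w x))"
  using form_space_eval[of T H2 H1 "\<lambda>a (u, v). F a u v"] form_space_eval[of U H3 H1 "\<lambda>a (u, v, w). G a u v w"]
    form_space_eval[of V H4 H1 "\<lambda>a (u, v, w, x). K a u v w x"]
  by (simp_all add: case_prod_unfold)

lemma H1_comult: "lin E \<Longrightarrow> H1 (\<lambda>a. \<Delta> (E a) F)"
  by (simp add: H1_iff lin_def comult_add comult_scale)

lemmas H2_args = H_args(1,2)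
lemmas H3_args = H_args(3,4,5)
lemmas H4_args = H_args(6,7,8,9)
lemmas H5_args = H_args(10,11,12,13,14)

lemma H1_scale: "H1 g \<Longrightarrow> g (scale c x) = c * g x"
  by (simp add: H1_iff)

lemmas lins = lin_simps mlin_form_case H1_comult
  H1_tprod(1)[OF comult_in] H1_tprod(2)[OF assoc_in] H1_tprod(2)[OF phii_in]

lemma tsum_case:
  "T \<in> tprod H2 \<Longrightarrow> H2 (\<lambda>(a, b). F a b f) \<Longrightarrow> tsum H2 T (\<lambda>(a, b). F a b) f = T (\<lambda>(a, b). F a b f)"
  "U \<in> tprod H3 \<Longrightarrow> H3 (\<lambda>(a, b, c). G a b c f) \<Longrightarrow> tsum H3 U (\<lambda>(a, b, c). G a b c) f = U (\<lambda>(a, b, c). G a b c f)"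
  "V \<in> tprod H4 \<Longrightarrow> H4 (\<lambda>(a, b, c, d). K a b c d f) \<Longrightarrow>
    tsum H4 V (\<lambda>(a, b, c, d). K a b c d) f = V (\<lambda>(a, b, c, d). K a b c d f)"
  by (subst tsum_apply; simp add: case_prod_unfold)+

lemma Fubini23:
  assumes "T \<in> tprod H2" "U \<in> tprod H3"
    "\<And>y1 y2 y3. H2 (\<lambda>(x1, x2). F x1 x2 y1 y2 y3)" "\<And>x1 x2. H3 (\<lambda>(y1, y2, y3). F x1 x2 y1 y2 y3)"
  shows "T (\<lambda>(x1, x2). U (\<lambda>(y1, y2, y3). F x1 x2 y1 y2 y3)) = U (\<lambda>(y1, y2, y3). T (\<lambda>(x1, x2). F x1 x2 y1 y2 y3))"
  using tprod_Fubini[OF assms(1,2) form_space_H(2,3), of "\<lambda>(x1, x2) (y1, y2, y3). F x1 x2 y1 y2 y3"] assms(3,4)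
  by (simp add: case_prod_unfold)

lemma Fubini22:
  assumes "T \<in> tprod H2" "U \<in> tprod H2"
    "\<And>y1 y2. H2 (\<lambda>(x1, x2). F x1 x2 y1 y2)" "\<And>x1 x2. H2 (\<lambda>(y1, y2). F x1 x2 y1 y2)"
  shows "T (\<lambda>(x1, x2). U (\<lambda>(y1, y2). F x1 x2 y1 y2)) = U (\<lambda>(y1, y2). T (\<lambda>(x1, x2). F x1 x2 y1 y2))"
  using tprod_Fubini[OF assms(1,2) form_space_H(2,2), of "\<lambda>(x1, x2) (y1, y2). F x1 x2 y1 y2"] assms(3,4)
  by (simp add: case_prod_unfold)

section \<open>The element \<chi> and the element a\<close>

lemma chi_in: "\<chi> \<in> tprod H4"
  unfolding \<chi>_def
  by (auto intro!: tmul_in_tprod tsum_in_tprod comult_in assoc_in phii_in pten_in_tprod split: prod.split)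

text \<open>Coherence speaks of bracketings, whereas the coaction and \<open>\<omega>\<close>
  involve \<chi> as an element; this is the bridge.\<close>

lemma CHI_tact:
  assumes "cact L [j1, j2, j3, j4]" "L f"
  shows "CHI j1 j2 j3 j4 f = tact \<chi> (rpair j1 (rpair j2 (rpair j3 j4))) f"
proof -
  let ?P = "rpair j1 (rpair j2 (rpair j3 j4))"
  let ?E = "tsum H3 \<phi> (\<lambda>(x1, x2, x3). pten H4 (x1, x2, x3, 1))"
  let ?B = "tsum H3 \<phi>i (\<lambda>(y1, y2, y3). tsum H2 (\<Delta> y1) (\<lambda>(u1, u2). pten H4 (u1, u2, y2, y3)))"
  have j: "ract L j1" "ract L j2" "ract L j3" "ract L j4" "comm L j1 j2" "comm L j1 j3" "comm L j1 j4"
    "comm L j2 j3" "comm L j2 j4" "comm L j3 j4"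
    using assms(1) by auto
  have P: "rrep L H4 ?P" by (rule rrep4) (use j in auto)
  have in4: "?E \<in> tprod H4" "?B \<in> tprod H4"
    by (auto intro!: tsum_in_tprod comult_in assoc_in phii_in pten_in_tprod split: prod.split)
  have E: "tact ?E ?P f = PHI \<phi> j1 j2 j3 f" if f: "L f" for f
    unfolding PHI_def
  proof (rule tact_tsum[where L = L, OF _ assoc_in f]; clarsimp?)
    show "rrep L H3 (rpair j1 (rpair j2 j3))" by (rule rrep3) (use j in auto)
    fix x1 x2 x3 x
    have "H4 (\<lambda>y. ?P y f x)" by (rule rrepD(5)[OF P, OF f])
    then show "pten H4 (x1, x2, x3, 1) (\<lambda>y. j1 (fst y) (j2 (fst (snd y)) (j3 (fst (snd (snd y))) (j4 (snd (snd (snd y))) f))) x)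
        = j1 x1 (j2 x2 (j3 x3 f)) x"
      by (simp add: pten_def rrepD(6)[OF j(4), OF f])
  qed
  have B: "tact ?B ?P f = PHI \<phi>i (conv j1 j2) j3 j4 f" if f: "L f" for f
    unfolding PHI_def
  proof (rule tact_tsum[where L = L, OF _ phii_in f]; clarsimp?)
    show "rrep L H3 (rpair (conv j1 j2) (rpair j3 j4))"
      by (intro rrep3 ract_conv comm_conv) (use j j(5-10)[THEN comm_sym] in auto)
    fix x1 x2 x3 x
    have G: "H4 (\<lambda>y. ?P y f x)" by (rule rrepD(5)[OF P, OF f])
    then have "H2 (\<lambda>u. ?P (fst u, snd u, x2, x3) f x)" by (simp add: mlin_form_def)
    then show "tsum H2 (\<Delta> x1) (\<lambda>(u1, u2). pten H4 (u1, u2, x2, x3))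
        (\<lambda>y. j1 (fst y) (j2 (fst (snd y)) (j3 (fst (snd (snd y))) (j4 (snd (snd (snd y))) f))) x)
        = conv j1 j2 x1 (j3 x2 (j4 x3 f)) x"
      unfolding conv_apply
      by (subst tsum_apply[OF comult_in]) (simp_all add: pten_def G[simplified] case_prod_unfold)
  qed
  have "L (PHI \<phi> j1 j2 j3 f)" by (rule PHI_closed[OF cact_conv(4)[OF assms(1)] assoc_in, OF assms(2)])
  then show ?thesis
    unfolding CHI_def \<chi>_def using in4 assms(2) by (simp add: tact_tmul[OF P] E B)
qed

lemma CHI_apply:
  assumes "cact L [j1, j2, j3, j4]" "L f"
  shows "CHI j1 j2 j3 j4 f x = \<chi> (\<lambda>(c1, c2, c3, c4). j1 c1 (j2 c2 (j3 c3 (j4 c4 f))) x)"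
  by (simp add: CHI_tact[OF assms] tact_def case_prod_unfold)

lemma aa_in: "aa \<in> tprod H2"
  unfolding aa_def
  by (auto intro!: tsum_in_tprod comult_in assoc_in phii_in pten_in_tprod split: prod.split)

text \<open>By \<open>aa_apply\<close>, the value of the element a at f is that of \<open>\<chi>\<close> at this form.\<close>

definition alpha_pairing :: "('h \<times> 'h \<Rightarrow> 'k) \<Rightarrow> 'h \<times> 'h \<times> 'h \<times> 'h \<Rightarrow> 'k" where
  "alpha_pairing f = (\<lambda>(c1, c2, c3, c4). f (S c2 * \<alpha> * c3, S c1 * \<alpha> * c4))"

lemma lop_alpha_pairing: "lop H2 H4 alpha_pairing"
proof -
  have "H4 (alpha_pairing f)" if f: "H2 f" for f
    unfolding alpha_pairing_def by (simp add: lins H2_args[OF f])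
  then show ?thesis by (auto simp: lop_def alpha_pairing_def)
qed

lemma H1_tsum:
  assumes "T \<in> tprod H2" "H1 g" "H2 (\<lambda>(a, b). g (F a b))"
  shows "T (\<lambda>(a, b). g (F a b)) = g (tsum H2 T (\<lambda>(a, b). F a b))"
  using linear_form_tsum[OF assms(1) vector_space_axioms assms(2), of "\<lambda>(a, b). F a b"] assms(3)
  by (simp add: case_prod_unfold)

lemma comult_alpha: "H1 g \<Longrightarrow> \<Delta> h (\<lambda>(h1, h2). g (S h1 * \<alpha> * h2)) = \<epsilon> h * g \<alpha>"
  by (subst H1_tsum[OF comult_in]) (simp_all add: lins H1_comp[of g] antipode_alpha H1_scale)

lemma comult_beta: "H1 g \<Longrightarrow> \<Delta> h (\<lambda>(h1, h2). g (h1 * \<beta> * S h2)) = \<epsilon> h * g \<beta>"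
  by (subst H1_tsum[OF comult_in]) (simp_all add: lins H1_comp[of g] antipode_beta H1_scale)

lemma H1_tsum3:
  assumes "T \<in> tprod H3" "H1 g" "H3 (\<lambda>(a, b, c). g (F a b c))"
  shows "T (\<lambda>(a, b, c). g (F a b c)) = g (tsum H3 T (\<lambda>(a, b, c). F a b c))"
  using linear_form_tsum[OF assms(1) vector_space_axioms assms(2), of "\<lambda>(a, b, c). F a b c"] assms(3)
  by (simp add: case_prod_unfold)

lemma assoc_zigzag: "H1 g \<Longrightarrow> \<phi> (\<lambda>(x1, x2, x3). g (x1 * \<beta> * S x2 * \<alpha> * x3)) = g 1"
  by (subst H1_tsum3[OF assoc_in]) (simp_all add: lins H1_comp[of g] assoc_antipode)

lemma assoc_inv_zigzag: "H1 g \<Longrightarrow> \<phi>i (\<lambda>(y1, y2, y3). g (S y1 * \<alpha> * y2 * \<beta> * S y3)) = g 1"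
  by (subst H1_tsum3[OF phii_in]) (simp_all add: lins H1_comp[of g] assoc_inv_antipode)

lemma alpha_pairing_absorb:
  assumes "H2 f"
  shows "(s2 \<star> s3) h (alpha_pairing f) = eps h (alpha_pairing f)" "(s1 \<star> s4of4) h (alpha_pairing f) = eps h (alpha_pairing f)"
proof -
  have "(s2 \<star> s3) h (alpha_pairing f) (c1, c2, c3, c4) = eps h (alpha_pairing f) (c1, c2, c3, c4)" for c1 c2 c3 c4
    using comult_alpha[of "\<lambda>z. f (S c2 * z * c3, S c1 * \<alpha> * c4)" h] assms
    by (simp add: conv_apply pull_def lm_def alpha_pairing_def eps_def antipode_mult mult.assoc lins H2_args[OF assms])
  then show "(s2 \<star> s3) h (alpha_pairing f) = eps h (alpha_pairing f)" by auto
  have "(s1 \<star> s4of4) h (alpha_pairing f) (c1, c2, c3, c4) = eps h (alpha_pairing f) (c1, c2, c3, c4)" for c1 c2 c3 c4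
    using comult_alpha[of "\<lambda>z. f (S c2 * \<alpha> * c3, S c1 * z * c4)" h] assms
    by (simp add: conv_apply pull_def lm_def alpha_pairing_def eps_def antipode_mult mult.assoc lins H2_args[OF assms])
  then show "(s1 \<star> s4of4) h (alpha_pairing f) = eps h (alpha_pairing f)" by auto
qed

text \<open>The formula for a contains the factors 1 \<otimes> \<phi>^-1 and (id \<otimes> id
  \<otimes> \<Delta>)(\<phi>) of \<chi>. The remaining factor (id \<otimes> \<Delta> \<otimes>
  id)(\<phi>^-1) is absorbed at the \<alpha> between strands 2 and 3. This a is Drinfeld's element
  \<gamma>.\<close>

lemma aa_apply:
  assumes "H2 f"
  shows "aa f = CHI s1 s2 s3 s4of4 (alpha_pairing f) 1"
proof -
  have alpha_pairing: "H4 (alpha_pairing f)" by (rule lopD(1)[OF lop_alpha_pairing, OF assms])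
  note c = cact_conv[OF cact_regular4]
  have "CHI s1 s2 s3 s4of4 (alpha_pairing f) = PHI \<phi> s1 s2 (s3 \<star> s4of4) (PHI \<phi>i s2 s3 s4of4 (alpha_pairing f))"
    unfolding CHI_alt[OF cact_regular4, OF alpha_pairing]
    using PHI_absorb_form(2)[OF c(2), OF alpha_pairing _ alpha_pairing_absorb(1)[OF assms], of \<phi>i] by simp
  then have "CHI s1 s2 s3 s4of4 (alpha_pairing f) 1 = \<phi> (\<lambda>(x1, x2, x3). \<Delta> x3 (\<lambda>(u1, u2). \<phi>i (\<lambda>(y1, y2, y3).
      f (S (y1 * x2) * \<alpha> * (y2 * u1), S x1 * \<alpha> * (y3 * u2)))))"
    by (simp add: PHI_apply conv_apply pull_def lm_def one_prod_def alpha_pairing_def)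
  also have "\<dots> = \<phi> (\<lambda>(x1, x2, x3). \<phi>i (\<lambda>(y1, y2, y3). \<Delta> x3 (\<lambda>(u1, u2).
      f (S (y1 * x2) * \<alpha> * (y2 * u1), S x1 * \<alpha> * (y3 * u2)))))"
  proof -
    have "\<Delta> x3 (\<lambda>(u1, u2). \<phi>i (\<lambda>(y1, y2, y3). f (S (y1 * x2) * \<alpha> * (y2 * u1), S x1 * \<alpha> * (y3 * u2)))) =
      \<phi>i (\<lambda>(y1, y2, y3). \<Delta> x3 (\<lambda>(u1, u2). f (S (y1 * x2) * \<alpha> * (y2 * u1), S x1 * \<alpha> * (y3 * u2))))" for x1 x2 x3
      by (rule Fubini23[OF comult_in phii_in]) (simp_all add: lins H2_args[OF assms])
    then show ?thesis by simp
  qed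
  also have "\<dots> = aa f"
    unfolding aa_def using assms
    by (simp add: tsum_case assoc_in phii_in comult_in lins H2_args[OF assms] pten_def mult.assoc)
  finally show ?thesis by simp
qed

definition rtrans :: "'h \<times> 'h \<Rightarrow> ('h \<times> 'h \<Rightarrow> 'k) \<Rightarrow> 'h \<times> 'h \<Rightarrow> 'k" where
  "rtrans z f = (\<lambda>n. f (n * z))"

text \<open>The strands: left multiplications on the factors of a tensor, followed in reverse order by the
  right multiplications by antipodes.\<close>

abbreviation "k1 \<equiv> pull (fst_act lm)"
abbreviation "k2 \<equiv> pull (snd_act lm)"
abbreviation "k3 \<equiv> pull (snd_act rm)"
abbreviation "k4 \<equiv> pull (fst_act rm)"

lemma lm_rm_comm: "lm g (rm h x) = rm h (lm g x)"
  by (simp add: lm_def rm_def mult.assoc)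

lemma cact_k: "cact H2 [k1, k2, k3, k4]"
  by (auto intro!: ract_pull comm_pull simp: lm_rm_comm)

lemma ract_k: "ract H2 k1" "ract H2 k2" "ract H2 k3" "ract H2 k4" "comm H2 k1 k2" "comm H2 k3 k4"
  using cact_k by simp_all

abbreviation "lreg \<equiv> rpair k1 k2"
abbreviation "diag \<equiv> k1 \<star> k2"

lemma lreg_rep: "rrep H2 H2 lreg"
  by (rule rrep2[OF ract_k(1,2,5)])

lemma diag_ract: "ract H2 diag"
  by (rule ract_conv[OF ract_k(1,2,5)])

lemma lreg_apply: "lreg e f n = f (e * n)"
  by (cases e; cases n) (simp add: pull_def lm_def)

lemma lop_lreg: "T \<in> tprod H2 \<Longrightarrow> lop H2 H2 (tact T lreg)"
  by (rule lop_tact[OF lreg_rep])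

lemma tact_lreg_apply: "tact T lreg f n = T (\<lambda>e. f (e * n))"
  by (simp add: tact_def lreg_apply del: rpair_apply)

text \<open>A second dual of the diagonal action, besides the one given by the antipode, consists of
  \<open>sigma_tw\<close>, \<open>alpha_tw\<close> and \<open>beta_tw\<close>; the last two are multiplications by the element a and
  by its counterpart \<open>delta_tw\<close> for \<open>\<beta>\<close>.\<close>

definition S_cop :: "'h \<Rightarrow> ('h \<times> 'h \<Rightarrow> 'k) \<Rightarrow> 'k" where
  "S_cop h = tsum H2 (\<Delta> h) (\<lambda>(u1, u2). pten H2 (S u2, S u1))"

lemma S_cop_in: "S_cop h \<in> tprod H2"
  unfolding S_cop_def by (auto intro!: tsum_in_tprod comult_in pten_in_tprod split: prod.split)

lemma S_cop_apply: "H2 f \<Longrightarrow> S_cop h f = \<Delta> h (\<lambda>(u1, u2). f (S u2, S u1))"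
  unfolding S_cop_def by (simp add: tsum_case comult_in pten_def lins H2_args)

definition sigma_tw :: "'h \<Rightarrow> ('h \<times> 'h \<Rightarrow> 'k) \<Rightarrow> 'h \<times> 'h \<Rightarrow> 'k" where
  "sigma_tw h = tact (S_cop h) lreg"

definition alpha_tw :: "('h \<times> 'h \<Rightarrow> 'k) \<Rightarrow> 'h \<times> 'h \<Rightarrow> 'k" where
  "alpha_tw = tact aa lreg"

text \<open>Drinfeld's element \<delta>: with t the inverse of \<chi>, that is (\<Delta> \<otimes>
  id \<otimes> id)(\<phi>)(\<phi>^-1 \<otimes> 1), it is the sum of the tensors with factors
  \<open>t1 * \<beta> * S t4\<close> and \<open>t2 * \<beta> * S t3\<close>.\<close>

definition delta_tw :: "('h \<times> 'h \<Rightarrow> 'k) \<Rightarrow> 'k" where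
  "delta_tw = tsum H3 \<phi>i (\<lambda>(y1, y2, y3). tsum H3 \<phi> (\<lambda>(x1, x2, x3). tsum H2 (\<Delta> x1) (\<lambda>(u1, u2).
     pten H2 (u1 * (y1 * \<beta>) * S x3, u2 * (y2 * \<beta> * S y3) * S x2))))"

definition beta_tw :: "('h \<times> 'h \<Rightarrow> 'k) \<Rightarrow> 'h \<times> 'h \<Rightarrow> 'k" where
  "beta_tw = tact delta_tw lreg"

lemma delta_tw_in: "delta_tw \<in> tprod H2"
  unfolding delta_tw_def
  by (auto intro!: tsum_in_tprod comult_in assoc_in phii_in pten_in_tprod split: prod.split)

lemma rtrans_lop: "lop H2 H2 (rtrans z)"
  using mult_stableD(1)[OF mult_stable_H(2)] by (auto simp: lop_def rtrans_def)

lemma delta_tw_apply: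
  assumes "H2 f"
  shows "delta_tw f = CHIi k1 k2 k3 k4 f (\<beta>, \<beta>)"
  unfolding delta_tw_def CHIi_def
  using assms
  by (simp add: PHI_apply conv_apply tsum_case assoc_in phii_in comult_in pten_def lins H2_args[OF assms]
      pull_def lm_def rm_def mult.assoc)

lemma sigma_tw_apply: "H2 f \<Longrightarrow> sigma_tw h f (p, q) = \<Delta> h (\<lambda>(u1, u2). f (S u2 * p, S u1 * q))"
  using mult_stableD(1)[OF mult_stable_H(2)] by (simp add: sigma_tw_def tact_lreg_apply S_cop_apply)

lemma conv_tact: "(a \<star> b) h = tact (\<Delta> h) (rpair a b)"
  by (simp add: conv_def)

definition eval_one :: "('h \<times> 'h \<times> 'h \<times> 'h \<Rightarrow> 'k) \<Rightarrow> 'h \<times> 'h \<Rightarrow> 'k" where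
  "eval_one K = (\<lambda>(p, q). K (1, 1, p, q))"

lemma lop_eval_one: "lop H4 H2 eval_one"
  by (auto simp: lop_def eval_one_def mlin_form_def)

lemma alpha_tw_apply:
  assumes "H2 f"
  shows "alpha_tw f = eval_one (CHI s1 s2 s3 s4of4 (alpha_pairing f))"
proof
  fix z :: "'h \<times> 'h"
  obtain p q where z: "z = (p, q)" by (cases z)
  have f: "H2 (\<lambda>e. f (e * z))" by (rule mult_stableD(1)[OF mult_stable_H(2), OF assms])
  have alpha_pairing: "H4 (alpha_pairing f)" "H4 (alpha_pairing (\<lambda>e. f (e * z)))" using lopD(1)[OF lop_alpha_pairing] assms f by blast+
  show "alpha_tw f z = eval_one (CHI s1 s2 s3 s4of4 (alpha_pairing f)) z"
    unfolding alpha_tw_def tact_lreg_apply aa_apply[OF f] eval_one_def CHI_apply[OF cact_regular4, OF alpha_pairing(1)]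
      CHI_apply[OF cact_regular4, OF alpha_pairing(2)]
    by (simp add: z pull_def lm_def alpha_pairing_def one_prod_def mult.assoc)
qed

definition rmult12 :: "'h \<Rightarrow> ('h \<times> 'h \<times> 'h \<times> 'h \<Rightarrow> 'k) \<Rightarrow> 'h \<times> 'h \<times> 'h \<times> 'h \<Rightarrow> 'k" where
  "rmult12 h K = (\<lambda>(c1, c2, c3, c4). \<Delta> h (\<lambda>(u1, u2). K (c1 * u1, c2 * u2, c3, c4)))"

lemma lop_rmult12: "lop H4 H4 (rmult12 h)"
proof -
  have 1: "H2 (\<lambda>(u1, u2). K (c1 * u1, c2 * u2, c3, c4))" if "H4 K" for K c1 c2 c3 c4
    by (simp add: lins H4_args[OF that])
  have "H4 (rmult12 h K)" if "H4 K" for K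
    unfolding rmult12_def by (simp add: lins H4_args[OF that])
  moreover have "rmult12 h (\<lambda>x. f x + g x) = (\<lambda>y. rmult12 h f y + rmult12 h g y)" if "H4 f" "H4 g" for f g
    using tprod_eval_add[OF comult_in form_space_H(2), OF 1[OF that(1)] 1[OF that(2)]]
    by (auto simp: rmult12_def case_prod_unfold)
  moreover have "rmult12 h (\<lambda>x. c * f x) = (\<lambda>y. c * rmult12 h f y)" if "H4 f" for f c
    using tprod_eval_scale[OF comult_in form_space_H(2), OF 1[OF that]]
    by (auto simp: rmult12_def case_prod_unfold)
  ultimately show ?thesis by (simp add: lop_def)
qed

text \<open>The antipode turns left multiplication of its values into right multiplication of its
  arguments, and the flip in \<open>S_cop\<close> matches the crossing of strands 1 and 2 in
  \<open>alpha_pairing\<close>.\<close>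

lemma alpha_pairing_sigma_tw: "H2 f \<Longrightarrow> alpha_pairing (sigma_tw h f) = rmult12 h (alpha_pairing f)"
  by (auto simp: alpha_pairing_def rmult12_def sigma_tw_apply antipode_mult mult.assoc)

lemma cact_conv_outer:
  assumes "cact L [a, b, c, d]"
  shows "cact L [a \<star> (b \<star> c), d]" "cact L [a, d]"
proof -
  have j: "ract L a" "ract L b" "ract L c" "ract L d" "comm L a b" "comm L a c" "comm L a d"
    "comm L b c" "comm L b d" "comm L c d" using assms by auto
  show "cact L [a \<star> (b \<star> c), d]" "cact L [a, d]"
    using j j(5-10)[THEN comm_sym] by (simp_all add: conv_simps)
qed

lemma conv_form_cong:
  assumes "cact L [a, b]" "cact L [a', b]" "\<And>h. a h f = a' h f" "L f"
  shows "(a \<star> b) h f = (a' \<star> b) h f"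
proof -
  have "comm L a b" "comm L a' b" using assms(1,2) by auto
  then have "a x (b y f) = a' x (b y f)" for x y
    using assms(3,4) by (simp add: comm_def)
  then show ?thesis by (intro ext) (simp add: conv_apply)
qed

text \<open>Since a is \<chi> paired with two copies of \<alpha>, the two components of h act on
  \<open>CHI\<close> of the pairing through the brackets 12 and 34. \<open>CHI_conv\<close> turns
  (12)(34) into (1(23))4 on the pairing itself, where \<alpha> absorbs 23 and then 14.\<close>

lemma twisted_alpha:
  assumes "H2 f"
  shows "(\<lambda>x. \<Delta> h (\<lambda>(h1, h2). diag h2 (alpha_tw (sigma_tw h1 f)) x)) = eps h (alpha_tw f)"
proof
  fix x :: "'h \<times> 'h"
  have alpha_pairing: "H4 (alpha_pairing f)" by (rule lopD(1)[OF lop_alpha_pairing, OF assms])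
  let ?C = "CHI s1 s2 s3 s4of4"
  have C: "H4 (?C (alpha_pairing f))" by (rule lopD(1)[OF lop_CHI[OF cact_regular4], OF alpha_pairing])
  note r = cact_regular4[unfolded cact_simps]
  have sf: "H2 (sigma_tw h1 f)" for h1 unfolding sigma_tw_def by (rule lopD(1)[OF lop_lreg[OF S_cop_in], OF assms])
  have 1: "alpha_tw (sigma_tw h1 f) = eval_one ((s1 \<star> s2) h1 (?C (alpha_pairing f)))" for h1
  proof -
    have "?C (rmult12 h1 (alpha_pairing f)) = rmult12 h1 (?C (alpha_pairing f))"
      by (rule CHI_intertwine(1)[OF cact_regular4 lop_rmult12, OF alpha_pairing, symmetric])
        (auto simp: rmult12_def pull_def lm_def mult.assoc)
    \<comment> \<open>The first two arguments are 1, where right and left multiplication by the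
      components of h agree.\<close>
    moreover have "eval_one (rmult12 h1 K) = eval_one ((s1 \<star> s2) h1 K)" for K
      by (auto simp: eval_one_def rmult12_def conv_apply pull_def lm_def)
    ultimately show ?thesis by (simp add: alpha_tw_apply[OF sf] alpha_pairing_sigma_tw[OF assms])
  qed
  have c: "ract H4 (s1 \<star> s2)" "ract H4 (s3 \<star> s4of4)" "comm H4 (s1 \<star> s2) (s3 \<star> s4of4)"
    using cact_conv(7)[OF cact_regular4] cact_regular4 comm_sym by (auto simp: conv_simps)
  have l: "H4 ((s1 \<star> s2) h1 (?C (alpha_pairing f)))" for h1 by (rule rrepD(4)[OF c(1), OF C])
  have 2: "diag h2 (eval_one K) = eval_one ((s3 \<star> s4of4) h2 K)" if "H4 K" for h2 K
    by (rule conv_intertwine[OF _ _ _ lop_eval_one, symmetric])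
      (use r that in \<open>auto simp: eval_one_def pull_def lm_def\<close>)
  have "\<Delta> h (\<lambda>(h1, h2). diag h2 (alpha_tw (sigma_tw h1 f)) x) =
      \<Delta> h (\<lambda>(h1, h2). eval_one ((s1 \<star> s2) h1 ((s3 \<star> s4of4) h2 (?C (alpha_pairing f)))) x)"
    unfolding 1 2[OF l] commD[OF c(3), OF C] ..
  also have "\<dots> = eval_one (((s1 \<star> s2) \<star> (s3 \<star> s4of4)) h (?C (alpha_pairing f))) x"
    by (rule conv_eval[OF c lop_eval_one, OF C, symmetric])
  also have "((s1 \<star> s2) \<star> (s3 \<star> s4of4)) h (?C (alpha_pairing f)) = ?C (((s1 \<star> (s2 \<star> s3)) \<star> s4of4) h (alpha_pairing f))"
    by (rule CHI_conv(1)[OF cact_regular4, OF alpha_pairing])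
  also have "((s1 \<star> (s2 \<star> s3)) \<star> s4of4) h (alpha_pairing f) = eps h (alpha_pairing f)"
  proof -
    have "((s1 \<star> (s2 \<star> s3)) \<star> s4of4) h (alpha_pairing f) = (s1 \<star> s4of4) h (alpha_pairing f)"
    proof (rule conv_form_cong[where L = H4])
      show "cact H4 [s1 \<star> (s2 \<star> s3), s4of4]" "cact H4 [s1, s4of4]"
        using cact_conv_outer[OF cact_regular4] by simp_all
      show "(s1 \<star> (s2 \<star> s3)) h (alpha_pairing f) = s1 h (alpha_pairing f)" for h
        by (rule absorb_conv(2)[OF cact_conv(6)[OF cact_regular4], OF alpha_pairing alpha_pairing_absorb(1)[OF assms]])
    qed (rule alpha_pairing)
    then show ?thesis using alpha_pairing_absorb(2)[OF assms] by simp
  qed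
  also have "?C (eps h (alpha_pairing f)) = eps h (?C (alpha_pairing f))"
    using lopD(3)[OF lop_CHI[OF cact_regular4], OF alpha_pairing] by (simp add: eps_def)
  also have "eval_one \<dots> x = eps h (alpha_tw f) x"
    using lopD(3)[OF lop_eval_one, OF C] by (simp add: eps_def alpha_tw_apply[OF assms])
  finally show "\<Delta> h (\<lambda>(h1, h2). diag h2 (alpha_tw (sigma_tw h1 f)) x) = eps h (alpha_tw f) x" .
qed

text \<open>Collects the antipodes of h as right multiplications next to the two copies of \<beta>,
  where they are the strands 3 and 4.\<close>

lemma sigma_tw_beta_tw:
  assumes "H2 f"
  shows "sigma_tw h (beta_tw f) z = CHIi k1 k2 k3 k4 ((k3 \<star> k4) h (rtrans z f)) (\<beta>, \<beta>)"
proof -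
  obtain p q where z: "z = (p, q)" by (cases z)
  note RTf = lopD(1)[OF rtrans_lop, OF assms]
  have b: "beta_tw f n = CHIi k1 k2 k3 k4 (rtrans n f) (\<beta>, \<beta>)" for n
    unfolding beta_tw_def tact_lreg_apply using delta_tw_apply[OF RTf, of n] by (simp add: rtrans_def)
  have "H2 (beta_tw f)" unfolding beta_tw_def by (rule lopD(1)[OF lop_lreg[OF delta_tw_in], OF assms])
  then have "sigma_tw h (beta_tw f) z = \<Delta> h (\<lambda>(u1, u2). CHIi k1 k2 k3 k4 (rtrans (S u2 * p, S u1 * q) f) (\<beta>, \<beta>))"
    by (simp add: z sigma_tw_apply b)
  also have "\<dots> = \<Delta> h (\<lambda>(u1, u2). CHIi k1 k2 k3 k4 (k3 u1 (k4 u2 (rtrans z f))) (\<beta>, \<beta>))"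
  proof -
    have "rtrans (S u2 * p, S u1 * q) f = k3 u1 (k4 u2 (rtrans z f))" for u1 u2
      by (auto simp: rtrans_def pull_def rm_def z mult.assoc)
    then show ?thesis by simp
  qed
  also have "\<dots> = CHIi k1 k2 k3 k4 ((k3 \<star> k4) h (rtrans z f)) (\<beta>, \<beta>)"
    by (rule conv_eval[OF ract_k(3,4,6) lop_CHIi[OF cact_k], OF RTf, symmetric])
  finally show ?thesis .
qed

lemma rtrans_diag: "H2 f \<Longrightarrow> rtrans z (diag h f) = diag h (rtrans z f)"
  by (rule conv_intertwine[OF ract_k(1,2,5) rtrans_lop])
    (auto simp: rtrans_def pull_def lm_def mult.assoc times_prod_def)

lemma beta_absorbs:
  "absorbs H2 (\<lambda>K. K (\<beta>, \<beta>)) (k2 \<star> k3)" "absorbs H2 (\<lambda>K. K (\<beta>, \<beta>)) (k1 \<star> k4)"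
proof -
  show "absorbs H2 (\<lambda>K. K (\<beta>, \<beta>)) (k2 \<star> k3)"
    unfolding absorbs_def
  proof (intro allI impI)
    fix h and f :: "'h \<times> 'h \<Rightarrow> 'k" assume f: "H2 f"
    have "H1 (\<lambda>x. f (\<beta>, x))" by (simp add: lins H2_args[OF f])
    from comult_beta[OF this, of h] show "(k2 \<star> k3) h f (\<beta>, \<beta>) = \<epsilon> h * f (\<beta>, \<beta>)"
      by (simp add: conv_apply pull_def lm_def rm_def mult.assoc)
  qed
  show "absorbs H2 (\<lambda>K. K (\<beta>, \<beta>)) (k1 \<star> k4)"
    unfolding absorbs_def
  proof (intro allI impI)
    fix h and f :: "'h \<times> 'h \<Rightarrow> 'k" assume f: "H2 f"
    have "H1 (\<lambda>x. f (x, \<beta>))" by (simp add: lins H2_args[OF f])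
    from comult_beta[OF this, of h] show "(k1 \<star> k4) h f (\<beta>, \<beta>) = \<epsilon> h * f (\<beta>, \<beta>)"
      by (simp add: conv_apply pull_def lm_def rm_def mult.assoc)
  qed
qed

lemma absorbs_conv_conv:
  assumes "cact L [a, b, c, d]" "lfun L N" "absorbs L N (b \<star> c)" "absorbs L N (a \<star> d)"
  shows "absorbs L N ((a \<star> (b \<star> c)) \<star> d)"
  unfolding absorbs_def
proof (intro allI impI)
  fix h f assume f: "L f"
  have j: "ract L a" "ract L d" "comm L a d" "ract L (a \<star> (b \<star> c))" "comm L (a \<star> (b \<star> c)) d" "cact L [a, b \<star> c]"
    using assms(1) cact_conv_outer[OF assms(1)] cact_conv(6)[OF assms(1)] by simp_all
  have p: "lop L (\<lambda>_. True) (\<lambda>f (_::unit). N f)" using assms(2) by (simp add: lfun_iff_lop)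
  have "N (((a \<star> (b \<star> c)) \<star> d) h f) = \<Delta> h (\<lambda>(u1, u2). N ((a \<star> (b \<star> c)) u1 (d u2 f)))"
    using conv_eval[OF j(4,2,5) p, OF f] by simp
  also have "\<dots> = \<Delta> h (\<lambda>(u1, u2). N (a u1 (d u2 f)))"
    using absorbs_conv(2)[OF j(6) assms(2), OF rrepD(4)[OF j(2), OF f] assms(3)] by simp
  also have "\<dots> = N ((a \<star> d) h f)"
    using conv_eval[OF j(1,2,3) p, OF f] by simp
  also have "\<dots> = \<epsilon> h * N f" by (rule absorbsD[OF assms(4), OF f])
  finally show "N (((a \<star> (b \<star> c)) \<star> d) h f) = \<epsilon> h * N f" .
qed

text \<open>The mirror image of \<open>twisted_alpha\<close>: pulled through \<open>CHIi\<close>,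
  the bracketing (12)(34) becomes (1(23))4 and is absorbed by evaluation at the two copies of
  \<beta>.\<close>

lemma twisted_beta:
  assumes "H2 f"
  shows "(\<lambda>x. \<Delta> h (\<lambda>(h1, h2). sigma_tw h2 (beta_tw (diag h1 f)) x)) = eps h (beta_tw f)"
proof
  fix z :: "'h \<times> 'h"
  have RTf: "H2 (rtrans z f)" by (rule lopD(1)[OF rtrans_lop, OF assms])
  note C = lop_CHIi[OF cact_k]
  have jf: "H2 (diag h1 f)" for h1 by (rule rrepD(4)[OF diag_ract, OF assms])
  have c: "ract H2 diag" "ract H2 (k3 \<star> k4)" "comm H2 diag (k3 \<star> k4)"
    using cact_conv(7)[OF cact_k] cact_k comm_sym by (auto simp: conv_simps)
  have "\<Delta> h (\<lambda>(h1, h2). sigma_tw h2 (beta_tw (diag h1 f)) z) =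
      \<Delta> h (\<lambda>(h1, h2). CHIi k1 k2 k3 k4 (diag h1 ((k3 \<star> k4) h2 (rtrans z f))) (\<beta>, \<beta>))"
    unfolding sigma_tw_beta_tw[OF jf] rtrans_diag[OF assms] commD[OF c(3), OF RTf] ..
  also have "\<dots> = CHIi k1 k2 k3 k4 ((diag \<star> (k3 \<star> k4)) h (rtrans z f)) (\<beta>, \<beta>)"
    by (rule conv_eval[OF c C, OF RTf, symmetric])
  also have "\<dots> = ((k1 \<star> (k2 \<star> k3)) \<star> k4) h (CHIi k1 k2 k3 k4 (rtrans z f)) (\<beta>, \<beta>)"
    unfolding CHI_conv(2)[OF cact_k, OF RTf] ..
  also have "\<dots> = \<epsilon> h * CHIi k1 k2 k3 k4 (rtrans z f) (\<beta>, \<beta>)"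
    by (rule absorbsD[OF absorbs_conv_conv[OF cact_k lfun_apply beta_absorbs], OF lopD(1)[OF C, OF RTf]])
  also have "\<dots> = eps h (beta_tw f) z"
    using delta_tw_apply[OF RTf] by (simp add: eps_def beta_tw_def tact_lreg_apply rtrans_def)
  finally show "\<Delta> h (\<lambda>(h1, h2). sigma_tw h2 (beta_tw (diag h1 f)) z) = eps h (beta_tw f) z" .
qed

text \<open>Linear dependence on the translating element is what allows a functional of the
  translated form to be exchanged with a tensor such as \<open>aa\<close>.\<close>

lemma lfam_rtrans:
  assumes "H2 f"
  shows "lfam H2 H2 (\<lambda>e. rtrans (e * z) f)"
  unfolding lfam_def
proof (intro conjI allI impI form_space_H)
  show "H2 (rtrans (y * z) f)" for y by (rule lopD(1)[OF rtrans_lop, OF assms])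
  obtain p q where z: "z = (p, q)" by (cases z)
  fix N :: "('h \<times> 'h \<Rightarrow> 'k) \<Rightarrow> 'k" assume N: "lfun H2 N"
  have L: "H2 (rtrans y f)" for y by (rule lopD(1)[OF rtrans_lop, OF assms])
  have A: "rtrans (a + b, c) f = (\<lambda>n. rtrans (a, c) f n + rtrans (b, c) f n)" "rtrans (scale k a, c) f = (\<lambda>n. k * rtrans (a, c) f n)"
    "rtrans (c, a + b) f = (\<lambda>n. rtrans (c, a) f n + rtrans (c, b) f n)" "rtrans (c, scale k a) f = (\<lambda>n. k * rtrans (c, a) f n)" for a b c k
    using assms by (auto simp: rtrans_def distrib_left scale_mult_right[symmetric] mlin_form_def H1_iff)
  show "H2 (\<lambda>e. N (rtrans (e * z) f))"
    using N L by (simp add: z mlin_form_def H1_iff distrib_right A scale_mult_left[symmetric] lfun_def)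
qed

lemma lfam_aa_rtrans:
  assumes "H2 f"
  shows "lfam H2 H2 (\<lambda>w n. aa (\<lambda>e. rtrans (e * (w * z)) f n))"
  unfolding lfam_def
proof (intro conjI allI impI form_space_H)
  show "H2 (\<lambda>n. aa (\<lambda>e. rtrans (e * (w * z)) f n))" for w
    by (rule lfam_closed[OF lfam_rtrans[OF assms] aa_in])
  fix N :: "('h \<times> 'h \<Rightarrow> 'k) \<Rightarrow> 'k" assume N: "lfun H2 N"
  have g: "H2 (\<lambda>e. N (rtrans e f))"
    using lfam_rtrans[OF assms, of 1] N by (simp add: lfam_def)
  have "H2 (alpha_tw (\<lambda>e. N (rtrans e f)))" unfolding alpha_tw_def by (rule lopD(1)[OF lop_lreg[OF aa_in], OF g])
  then have "H2 (\<lambda>w. alpha_tw (\<lambda>e. N (rtrans e f)) (w * z))" by (rule mult_stableD(1)[OF mult_stable_H(2)])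
  moreover have "N (\<lambda>n. aa (\<lambda>e. rtrans (e * v) f n)) = aa (\<lambda>e. N (rtrans (e * v) f))" for v
    using fun_cong[OF lfam_eval[OF lfam_rtrans[OF assms] aa_in N[unfolded lfun_iff_lop], of v]] by simp
  ultimately show "H2 (\<lambda>w. N (\<lambda>n. aa (\<lambda>e. rtrans (e * (w * z)) f n)))"
    by (simp add: alpha_tw_def tact_lreg_apply)
qed

lemma diag_apply: "diag h f n = \<Delta> h (\<lambda>e. f (e * n))"
  by (simp add: conv_tact tact_lreg_apply)

lemma alpha_tw_lop: "lop H2 H2 alpha_tw" and beta_tw_lop: "lop H2 H2 beta_tw" and sigma_tw_lop: "lop H2 H2 (sigma_tw h)"
  unfolding alpha_tw_def beta_tw_def sigma_tw_def by (intro lop_lreg aa_in delta_tw_in S_cop_in)+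

text \<open>The strands of the first zigzag identity, numbered as in \<open>zigzag_left\<close>.\<close>

abbreviation "z1 \<equiv> pull (fst_act lm)"
abbreviation "z2 \<equiv> pull (snd_act (fst_act lm))"
abbreviation "z3 \<equiv> pull (snd_act (fst_act rm))"
abbreviation "z4 \<equiv> pull (fst_act rm)"
abbreviation "z5 \<equiv> pull (snd_act (snd_act (fst_act lm)))"
abbreviation "z6 \<equiv> pull (snd_act (snd_act (snd_act lm)))"

lemma cact_z: "cact H4 [z1, z2, z3, z4, z5, z6]"
  by (auto intro!: ract_pull comm_pull simp: lm_rm_comm)

definition evl :: "('h \<times> 'h \<Rightarrow> 'k) \<Rightarrow> 'h \<times> 'h \<times> 'h \<times> 'h \<Rightarrow> 'k" where
  "evl f = (\<lambda>(n1, n2, n3, n4). f (n1 * \<alpha> * n3, n2 * \<alpha> * n4))"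

definition slice :: "'h \<times> 'h \<Rightarrow> ('h \<times> 'h \<times> 'h \<times> 'h \<Rightarrow> 'k) \<Rightarrow> 'h \<times> 'h \<Rightarrow> 'k" where
  "slice z K = (\<lambda>(n1, n2). K (n1, n2, z))"

lemma lop_slice: "lop H4 H2 (slice z)"
  by (cases z) (auto simp: lop_def slice_def mlin_form_def)

lemma evl_absorb:
  assumes "H2 f"
  shows "H4 (evl f)" "(z4 \<star> z5) h (evl f) = eps h (evl f)" "(z3 \<star> z6) h (evl f) = eps h (evl f)"
proof -
  show "H4 (evl f)" unfolding evl_def by (simp add: lins H2_args[OF assms])
  have "(z4 \<star> z5) h (evl f) (c1, c2, c3, c4) = eps h (evl f) (c1, c2, c3, c4)" for c1 c2 c3 c4
    using comult_alpha[of "\<lambda>z. f (c1 * z * c3, c2 * \<alpha> * c4)" h]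
    by (simp add: conv_apply pull_def lm_def rm_def evl_def eps_def mult.assoc lins H2_args[OF assms])
  then show "(z4 \<star> z5) h (evl f) = eps h (evl f)" by auto
  have "(z3 \<star> z6) h (evl f) (c1, c2, c3, c4) = eps h (evl f) (c1, c2, c3, c4)" for c1 c2 c3 c4
    using comult_alpha[of "\<lambda>z. f (c1 * \<alpha> * c3, c2 * z * c4)" h]
    by (simp add: conv_apply pull_def lm_def rm_def evl_def eps_def mult.assoc lins H2_args[OF assms])
  then show "(z3 \<star> z6) h (evl f) = eps h (evl f)" by auto
qed

lemma coev_absorbs:
  "absorbs H4 (\<lambda>K. K (\<beta>, \<beta>, z)) (z2 \<star> z3)" "absorbs H4 (\<lambda>K. K (\<beta>, \<beta>, z)) (z1 \<star> z4)"
proof -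
  have 1: "(z2 \<star> z3) h K (a, b, z) = (k2 \<star> k3) h (slice z K) (a, b)"
    "(z1 \<star> z4) h K (a, b, z) = (k1 \<star> k4) h (slice z K) (a, b)" for h K a b
    by (simp_all add: conv_apply pull_def slice_def)
  show "absorbs H4 (\<lambda>K. K (\<beta>, \<beta>, z)) (z2 \<star> z3)" "absorbs H4 (\<lambda>K. K (\<beta>, \<beta>, z)) (z1 \<star> z4)"
    unfolding absorbs_def 1
    using beta_absorbs lopD(1)[OF lop_slice, of _ z] by (auto simp: absorbs_def slice_def)
qed

lemma aa_chi: "H2 f \<Longrightarrow> aa f = \<chi> (\<lambda>(c1, c2, c3, c4). f (S c2 * \<alpha> * c3, S c1 * \<alpha> * c4))"
  using CHI_apply[OF cact_regular4, OF lopD(1)[OF lop_alpha_pairing], of f 1] aa_apply[of f]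
  by (simp add: pull_def lm_def alpha_pairing_def one_prod_def)

lemma CHI_evl:
  assumes "H2 f"
  shows "CHI z3 z4 z5 z6 (evl f) (n1, n2, z) = aa (\<lambda>e. f ((n1, n2) * (e * z)))"
proof -
  obtain p q where z: "z = (p, q)" by (cases z)
  have c: "cact H4 [z3, z4, z5, z6]" using cact_z by simp
  have "H2 (\<lambda>e. f ((n1, n2) * (e * z)))"
    using mult_stableD(1)[OF mult_stable_H(2), OF mult_stableD(2)[OF mult_stable_H(2), OF assms]] .
  then show ?thesis
    unfolding CHI_apply[OF c, OF evl_absorb(1)[OF assms]]
    by (simp add: aa_chi z pull_def lm_def rm_def evl_def mult.assoc)
qed

text \<open>The instance of \<open>zigzag_left\<close> in which the form joins two pairs of slots by
  \<alpha> and the functional inserts \<beta> into the first two. The other side of that identity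
  consists of two separate copies of \<open>x1 * \<beta> * S x2 * \<alpha> * x3 = 1\<close>, one in
  each factor.\<close>

lemma twisted_zigzag_left:
  assumes "H2 f"
  shows "(\<lambda>x. \<phi> (\<lambda>(x1, x2, x3). diag x3 (alpha_tw (sigma_tw x2 (beta_tw (diag x1 f)))) x)) = f"
proof
  fix z :: "'h \<times> 'h"
  obtain p q where z: "z = (p, q)" by (cases z)
  let ?e = "evl f" and ?N = "\<lambda>K :: 'h \<times> 'h \<times> 'h \<times> 'h \<Rightarrow> 'k. K (\<beta>, \<beta>, z)"
  note e = evl_absorb[OF assms]
  have jj: "ract H4 z1" "ract H4 z2" "ract H4 z3" "ract H4 z4" "ract H4 z5" "ract H4 z6"
    and jc: "comm H4 z1 z2" "comm H4 z1 z3" "comm H4 z1 z4" "comm H4 z1 z5" "comm H4 z1 z6"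
      "comm H4 z2 z3" "comm H4 z2 z4" "comm H4 z2 z5" "comm H4 z2 z6" "comm H4 z3 z4" "comm H4 z3 z5"
      "comm H4 z3 z6" "comm H4 z4 z5" "comm H4 z4 z6" "comm H4 z5 z6"
    using cact_z by simp_all
  note jjs = jj jc jc[THEN comm_sym] conv_simps
  have c: "cact H4 [z1, z2, z3, z4]" "cact H4 [z3, z4, z5, z6]" "cact H4 [z1 \<star> z2, z3 \<star> z4, z5 \<star> z6]"
    "cact H4 [z1, z4, z5]" "cact H4 [z2, z3, z6]"
    by (simp_all add: jjs)
  let ?M = "CHI z3 z4 z5 z6 ?e"
  have M: "H4 ?M" by (rule lopD(1)[OF lop_CHI[OF c(2)], OF e(1)])
  have r: "ract H4 (z1 \<star> z2)" "ract H4 (z3 \<star> z4)" "ract H4 (z5 \<star> z6)" using c(3) by auto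
  have M1: "H4 ((z5 \<star> z6) x ?M)" "H4 ((z3 \<star> z4) y ((z5 \<star> z6) x ?M))" "H4 ((z1 \<star> z2) w ((z3 \<star> z4) y ((z5 \<star> z6) x ?M)))" for x y w
    by (intro rrepD(4)[OF r(1)] rrepD(4)[OF r(2)] rrepD(4)[OF r(3)] M)+
  have fix_fst: "slice z ((z3 \<star> z4) h K) = (k3 \<star> k4) h (slice z K)" "slice z ((z1 \<star> z2) h K) = (k1 \<star> k2) h (slice z K)" for h K
    by (auto simp: slice_def conv_apply pull_def)
  have slC: "CHIi z1 z2 z3 z4 K (\<beta>, \<beta>, z) = CHIi k1 k2 k3 k4 (slice z K) (\<beta>, \<beta>)" if K: "H4 K" for K
  proof -
    have "slice z (CHIi z1 z2 z3 z4 K) = CHIi k1 k2 k3 k4 (slice z K)"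
      by (rule CHI_intertwine(2)[OF c(1) lop_slice, OF K]) (auto simp: slice_def pull_def)
    then show ?thesis by (simp add: slice_def fun_eq_iff)
  qed
  have main: "CHIi z1 z2 z3 z4 ((z1 \<star> z2) x1 ((z3 \<star> z4) x2 ((z5 \<star> z6) x3 ?M))) (\<beta>, \<beta>, z) =
      diag x3 (alpha_tw (sigma_tw x2 (beta_tw (diag x1 f)))) z" for x1 x2 x3
  proof -
    \<comment> \<open>Whatever is applied to the right translate of \<open>f\<close> is gathered in
      one linear functional, which then passes through \<open>aa\<close> and through the
      comultiplication of x3.\<close>
    define Q where "Q F = CHIi k1 k2 k3 k4 ((k1 \<star> k2) x1 ((k3 \<star> k4) x2 F)) (\<beta>, \<beta>)" for F
    have lk: "lop H2 H2 ((k3 \<star> k4) x2)" by (rule rrepD(3)[OF ract_conv[OF ract_k(3,4,6)]])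
    have Q: "lop H2 (\<lambda>_. True) (\<lambda>F (_::unit). Q F)"
      unfolding Q_def
      using lfun_lop[OF lop_comp[OF lop_comp[OF lk rrepD(3)[OF diag_ract]] lop_CHIi[OF cact_k]] lfun_apply]
      by (simp add: lfun_iff_lop)
    have jf: "H2 (diag x1 f)" by (rule rrepD(4)[OF diag_ract, OF assms])
    have cc: "comm H2 diag (k3 \<star> k4)"
      using cact_conv(7)[OF cact_k] cact_k comm_sym by (auto simp: conv_simps)
    have s: "sigma_tw x2 (beta_tw (diag x1 f)) n = Q (rtrans n f)" for n
      unfolding sigma_tw_beta_tw[OF jf] rtrans_diag[OF assms] Q_def
        commD[OF cc, OF lopD(1)[OF rtrans_lop, OF assms]] ..
    have aQ: "aa (\<lambda>e. Q (rtrans (e * w) f)) = Q (\<lambda>n. aa (\<lambda>e. rtrans (e * w) f n))" for w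
      using fun_cong[OF lfam_eval[OF lfam_rtrans[OF assms] aa_in Q, of w]] by simp
    have fam: "lfam H2 H2 (\<lambda>w n. aa (\<lambda>e. rtrans (e * (w * z)) f n))"
      by (rule lfam_aa_rtrans[OF assms])
    have "diag x3 (alpha_tw (sigma_tw x2 (beta_tw (diag x1 f)))) z = \<Delta> x3 (\<lambda>w. aa (\<lambda>e. Q (rtrans (e * (w * z)) f)))"
      by (simp only: diag_apply[of x3] alpha_tw_def tact_lreg_apply s)
    also have "\<dots> = Q (\<lambda>n. \<Delta> x3 (\<lambda>w. aa (\<lambda>e. rtrans (e * (w * z)) f n)))"
      unfolding aQ using fun_cong[OF lfam_eval[OF fam comult_in Q, of x3]] by simp
    also have "(\<lambda>n. \<Delta> x3 (\<lambda>w. aa (\<lambda>e. rtrans (e * (w * z)) f n))) = slice z ((z5 \<star> z6) x3 ?M)"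
      by (rule ext) (simp add: slice_def conv_apply z pull_def lm_def CHI_evl[OF assms] rtrans_def case_prod_unfold
          times_prod_def)
    also have "Q (slice z ((z5 \<star> z6) x3 ?M)) = CHIi z1 z2 z3 z4 ((z1 \<star> z2) x1 ((z3 \<star> z4) x2 ((z5 \<star> z6) x3 ?M))) (\<beta>, \<beta>, z)"
      unfolding slC[OF M1(3)] fix_fst Q_def ..
    finally show ?thesis by simp
  qed
  have "\<phi> (\<lambda>(x1, x2, x3). diag x3 (alpha_tw (sigma_tw x2 (beta_tw (diag x1 f)))) z) =
      CHIi z1 z2 z3 z4 (PHI \<phi> (z1 \<star> z2) (z3 \<star> z4) (z5 \<star> z6) ?M) (\<beta>, \<beta>, z)"
    unfolding PHI_eval[OF c(3) assoc_in lop_CHIi[OF c(1)], OF M] main ..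
  also have "\<dots> = PHI \<phi> z1 z4 z5 (PHI \<phi> z2 z3 z6 ?e) (\<beta>, \<beta>, z)"
    by (rule zigzag_left[OF cact_z, OF e(1) lfun_apply e(2,3) coev_absorbs])
  also have "\<dots> = f z"
  proof -
    have i: "PHI \<phi> z2 z3 z6 ?e (n1, \<beta>, n3, q) = f (n1 * \<alpha> * n3, q)" for n1 n3
      using assoc_zigzag[of "\<lambda>x. f (n1 * \<alpha> * n3, x * q)"]
      by (simp add: PHI_apply pull_def lm_def rm_def evl_def mult.assoc lins H2_args[OF assms])
    show ?thesis
      using assoc_zigzag[of "\<lambda>x. f (x * p, q)"]
      by (simp add: PHI_apply[of _ z1] pull_def lm_def rm_def i z mult.assoc lins H2_args[OF assms])
  qed
  finally show "\<phi> (\<lambda>(x1, x2, x3). diag x3 (alpha_tw (sigma_tw x2 (beta_tw (diag x1 f)))) z) = f z" .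
qed

text \<open>The strands of the second zigzag identity, numbered as in \<open>zigzag_right\<close>.\<close>

abbreviation "w1 \<equiv> pull (snd_act (snd_act (snd_act rm)))"
abbreviation "w2 \<equiv> pull (snd_act (snd_act (fst_act rm)))"
abbreviation "w3 \<equiv> pull (fst_act lm)"
abbreviation "w4 \<equiv> pull (snd_act (fst_act lm))"
abbreviation "w5 \<equiv> pull (snd_act (fst_act rm))"
abbreviation "w6 \<equiv> pull (fst_act rm)"

lemma cact_w: "cact H4 [w1, w2, w3, w4, w5, w6]"
  by (auto intro!: ract_pull comm_pull simp: lm_rm_comm)

definition evr :: "'h \<times> 'h \<Rightarrow> ('h \<times> 'h \<Rightarrow> 'k) \<Rightarrow> 'h \<times> 'h \<times> 'h \<times> 'h \<Rightarrow> 'k" where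
  "evr z f = (\<lambda>(n1, n2, n3, n4). f ((n3 * \<alpha> * n1, n4 * \<alpha> * n2) * z))"

lemma evr_absorb:
  assumes "H2 f"
  shows "H4 (evr z f)" "(w2 \<star> w3) h (evr z f) = eps h (evr z f)" "(w1 \<star> w4) h (evr z f) = eps h (evr z f)"
proof -
  obtain p q where z: "z = (p, q)" by (cases z)
  show "H4 (evr z f)" unfolding evr_def z by (simp add: lins H2_args[OF assms])
  have "(w2 \<star> w3) h (evr z f) (c1, c2, c3, c4) = eps h (evr z f) (c1, c2, c3, c4)" for c1 c2 c3 c4
    using comult_alpha[of "\<lambda>x. f (c3 * x * c1 * p, c4 * \<alpha> * c2 * q)" h]
    by (simp add: z conv_apply pull_def lm_def rm_def evr_def eps_def mult.assoc lins H2_args[OF assms])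
  then show "(w2 \<star> w3) h (evr z f) = eps h (evr z f)" by auto
  have "(w1 \<star> w4) h (evr z f) (c1, c2, c3, c4) = eps h (evr z f) (c1, c2, c3, c4)" for c1 c2 c3 c4
    using comult_alpha[of "\<lambda>x. f (c3 * \<alpha> * c1 * p, c4 * x * c2 * q)" h]
    by (simp add: z conv_apply pull_def lm_def rm_def evr_def eps_def mult.assoc lins H2_args[OF assms])
  then show "(w1 \<star> w4) h (evr z f) = eps h (evr z f)" by auto
qed

lemma coevr_absorbs:
  "absorbs H4 (\<lambda>K. K (\<beta>, \<beta>, 1)) (w4 \<star> w5)" "absorbs H4 (\<lambda>K. K (\<beta>, \<beta>, 1)) (w3 \<star> w6)"
  by (rule coev_absorbs)+

lemma CHI_evr:
  assumes "H2 f"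
  shows "CHI w1 w2 w3 w4 (evr z f) (n1, n2, n3, n4) = aa (\<lambda>e. f ((n3, n4) * (e * ((n1, n2) * z))))"
proof -
  obtain p q where z: "z = (p, q)" by (cases z)
  have c: "cact H4 [w1, w2, w3, w4]" using cact_w by simp
  have "H2 (\<lambda>e. f ((n3, n4) * (e * ((n1, n2) * z))))"
    using mult_stableD(1)[OF mult_stable_H(2), OF mult_stableD(2)[OF mult_stable_H(2), OF assms]] .
  then show ?thesis
    unfolding CHI_apply[OF c, OF evr_absorb(1)[OF assms]]
    by (simp add: aa_chi z pull_def lm_def rm_def evr_def mult.assoc)
qed

text \<open>The instance of \<open>zigzag_right\<close> for a form that contains the argument z, so
  that the functional can insert \<open>(\<beta>, \<beta>, 1)\<close>. What remains is the zigzag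
  axiom for \<open>\<phi>i\<close>, once in each factor.\<close>

lemma twisted_zigzag_right:
  assumes "H2 f"
  shows "(\<lambda>x. \<phi>i (\<lambda>(y1, y2, y3). sigma_tw y3 (beta_tw (diag y2 (alpha_tw (sigma_tw y1 f)))) x)) = f"
proof
  fix z :: "'h \<times> 'h"
  obtain p q where z: "z = (p, q)" by (cases z)
  let ?e = "evr z f" and ?N = "\<lambda>K :: 'h \<times> 'h \<times> 'h \<times> 'h \<Rightarrow> 'k. K (\<beta>, \<beta>, 1)"
  note e = evr_absorb[OF assms]
  have jj: "ract H4 w1" "ract H4 w2" "ract H4 w3" "ract H4 w4" "ract H4 w5" "ract H4 w6"
    and jc: "comm H4 w1 w2" "comm H4 w1 w3" "comm H4 w1 w4" "comm H4 w1 w5" "comm H4 w1 w6"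
      "comm H4 w2 w3" "comm H4 w2 w4" "comm H4 w2 w5" "comm H4 w2 w6" "comm H4 w3 w4" "comm H4 w3 w5"
      "comm H4 w3 w6" "comm H4 w4 w5" "comm H4 w4 w6" "comm H4 w5 w6"
    using cact_w by simp_all
  note jjs = jj jc jc[THEN comm_sym] conv_simps
  have c: "cact H4 [w3, w4, w5, w6]" "cact H4 [w1, w2, w3, w4]" "cact H4 [w1 \<star> w2, w3 \<star> w4, w5 \<star> w6]"
    "cact H4 [w1, w4, w5]" "cact H4 [w2, w3, w6]"
    by (simp_all add: jjs)
  let ?M = "CHI w1 w2 w3 w4 ?e"
  have M: "H4 ?M" by (rule lopD(1)[OF lop_CHI[OF c(2)], OF e(1)])
  have r: "ract H4 (w1 \<star> w2)" "ract H4 (w3 \<star> w4)" "ract H4 (w5 \<star> w6)"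
    "comm H4 (w1 \<star> w2) (w3 \<star> w4)" "comm H4 (w1 \<star> w2) (w5 \<star> w6)"
    using c(3) by auto
  have M1: "H4 ((w1 \<star> w2) x ?M)" "H4 ((w5 \<star> w6) x ?M)" "H4 ((w3 \<star> w4) y ((w5 \<star> w6) x ?M))"
    "H4 ((w1 \<star> w2) w ((w3 \<star> w4) y ((w5 \<star> w6) x ?M)))" for x y w
    by (intro rrepD(4)[OF r(1)] rrepD(4)[OF r(2)] rrepD(4)[OF r(3)] M)+
  have fix_fst: "slice 1 ((w3 \<star> w4) h K) = (k1 \<star> k2) h (slice 1 K)" "slice 1 ((w5 \<star> w6) h K) = (k3 \<star> k4) h (slice 1 K)" for h K
    by (auto simp: slice_def conv_apply pull_def)
  have slC: "CHIi w3 w4 w5 w6 K (\<beta>, \<beta>, 1) = CHIi k1 k2 k3 k4 (slice 1 K) (\<beta>, \<beta>)" if K: "H4 K" for K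
  proof -
    have "slice 1 (CHIi w3 w4 w5 w6 K) = CHIi k1 k2 k3 k4 (slice 1 K)"
      by (rule CHI_intertwine(2)[OF c(1) lop_slice, OF K]) (auto simp: slice_def pull_def)
    then show ?thesis by (simp add: slice_def fun_eq_iff)
  qed
  have main: "CHIi w3 w4 w5 w6 ((w1 \<star> w2) y1 ((w3 \<star> w4) y2 ((w5 \<star> w6) y3 ?M))) (\<beta>, \<beta>, 1) =
      sigma_tw y3 (beta_tw (diag y2 (alpha_tw (sigma_tw y1 f)))) z" for y1 y2 y3
  proof -
    have sf: "H2 (sigma_tw y1 f)" by (rule lopD(1)[OF sigma_tw_lop, OF assms])
    have af: "H2 (alpha_tw (sigma_tw y1 f))" by (rule lopD(1)[OF alpha_tw_lop, OF sf])
    have jf: "H2 (diag y2 (alpha_tw (sigma_tw y1 f)))" by (rule rrepD(4)[OF diag_ract, OF af])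
    have cc: "comm H2 diag (k3 \<star> k4)"
      using cact_conv(7)[OF cact_k] cact_k comm_sym by (auto simp: conv_simps)
    have "slice 1 ((w1 \<star> w2) y1 ?M) (n1, n2) = rtrans z (alpha_tw (sigma_tw y1 f)) (n1, n2)" for n1 n2
    proof -
      have "slice 1 ((w1 \<star> w2) y1 ?M) (n1, n2) =
          \<Delta> y1 (\<lambda>(t1, t2). aa (\<lambda>(e1, e2). f (S t2 * (e1 * (n1 * p)), S t1 * (e2 * (n2 * q)))))"
        by (simp add: slice_def conv_apply pull_def rm_def CHI_evr[OF assms] z one_prod_def case_prod_unfold times_prod_def)
      also have "\<dots> = aa (\<lambda>(e1, e2). \<Delta> y1 (\<lambda>(t1, t2). f (S t2 * (e1 * (n1 * p)), S t1 * (e2 * (n2 * q)))))"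
        by (rule Fubini22[OF comult_in aa_in]) (simp_all add: lins H2_args[OF assms])
      also have "\<dots> = rtrans z (alpha_tw (sigma_tw y1 f)) (n1, n2)"
        by (auto simp: rtrans_def alpha_tw_def tact_lreg_apply z sigma_tw_apply[OF assms] mult.assoc intro!: arg_cong[of _ _ aa])
      finally show ?thesis .
    qed
    then have eq: "slice 1 ((w1 \<star> w2) y1 ?M) = rtrans z (alpha_tw (sigma_tw y1 f))" by auto
    \<comment> \<open>The bracket 12 is moved innermost, where it has been identified with
      \<open>sigma_tw y1\<close> followed by a.\<close>
    have "(w1 \<star> w2) y1 ((w3 \<star> w4) y2 ((w5 \<star> w6) y3 ?M)) = (w3 \<star> w4) y2 ((w5 \<star> w6) y3 ((w1 \<star> w2) y1 ?M))"
      unfolding commD[OF r(4), OF M1(2)] commD[OF r(5), OF M] ..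
    then have "slice 1 ((w1 \<star> w2) y1 ((w3 \<star> w4) y2 ((w5 \<star> w6) y3 ?M))) = diag y2 ((k3 \<star> k4) y3 (rtrans z (alpha_tw (sigma_tw y1 f))))"
      by (simp add: fix_fst eq)
    then show ?thesis
      unfolding slC[OF M1(4)] sigma_tw_beta_tw[OF jf] rtrans_diag[OF af]
      using commD[OF cc, OF lopD(1)[OF rtrans_lop, OF af]] by simp
  qed
  have "\<phi>i (\<lambda>(y1, y2, y3). sigma_tw y3 (beta_tw (diag y2 (alpha_tw (sigma_tw y1 f)))) z) =
      CHIi w3 w4 w5 w6 (PHI \<phi>i (w1 \<star> w2) (w3 \<star> w4) (w5 \<star> w6) ?M) (\<beta>, \<beta>, 1)"
    unfolding PHI_eval[OF c(3) phii_in lop_CHIi[OF c(1)], OF M] main ..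
  also have "\<dots> = PHI \<phi>i w2 w3 w6 (PHI \<phi>i w1 w4 w5 ?e) (\<beta>, \<beta>, 1)"
    by (rule zigzag_right[OF cact_w, OF e(1) lfun_apply e(2,3) coevr_absorbs])
  also have "\<dots> = f z"
  proof -
    have i: "PHI \<phi>i w1 w4 w5 (evr (p, q) f) (n1, \<beta>, n3, 1) = f (n3 * \<alpha> * n1 * p, q)" for n1 n3
      using assoc_inv_zigzag[of "\<lambda>x. f (n3 * \<alpha> * n1 * p, x * q)"]
      by (simp add: PHI_apply pull_def lm_def rm_def evr_def z mult.assoc lins H2_args[OF assms])
    show ?thesis
      using assoc_inv_zigzag[of "\<lambda>x. f (x * p, q)"]
      by (simp add: PHI_apply[of _ w2] one_prod_def pull_def lm_def rm_def i z mult.assoc lins H2_args[OF assms])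
  qed
  finally show "\<phi>i (\<lambda>(y1, y2, y3). sigma_tw y3 (beta_tw (diag y2 (alpha_tw (sigma_tw y1 f)))) z) = f z" .
qed

lemma rfam_linI:
  assumes "form_space L" "\<And>h. lop L L (P h)" "\<And>f x. L f \<Longrightarrow> H1 (\<lambda>h. P h f x)"
  shows "rfam L P"
  unfolding rfam_def
proof (intro conjI allI impI)
  fix f N assume f: "L f" and N: "lfun L N"
  have "P (a + b) f = (\<lambda>x. P a f x + P b f x)" "P (scale c a) f = (\<lambda>x. c * P a f x)" for a b c
    using assms(3)[OF f] by (auto simp: H1_iff fun_eq_iff)
  then show "H1 (\<lambda>h. N (P h f))"
    using N f lopD(1)[OF assms(2), OF f] by (simp add: lfun_def H1_iff)
qed (use assms in auto)

lemma dual_antipode: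
  assumes "ract L j"
  shows "dual L j (\<lambda>h. j (S h)) (j \<alpha>) (j \<beta>)"
  unfolding dual_def
proof (intro conjI allI impI)
  note j = rrepD[OF assms]
  show "rfam L (\<lambda>h. j (S h))"
    by (rule rfam_linI[OF j(1,3)]) (use j(5) in \<open>simp add: H1_iff\<close>)
  show "lop L L (j \<alpha>)" "lop L L (j \<beta>)" by (rule j(3))+
  fix f assume f: "L f"
  have H: "H1 (\<lambda>h. j h f x)" for x by (rule j(5)[OF f])
  show "j (S 1) f = f" using j(6)[OF f] by (simp add: antipode_one)
  show "j (S (g * h)) f = j (S g) (j (S h) f)" for g h by (simp add: antipode_mult j(7)[OF f])
  show "(\<lambda>x. \<Delta> h (\<lambda>(h1, h2). j h2 (j \<alpha> (j (S h1) f)) x)) = eps h (j \<alpha> f)" for h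
    using comult_alpha[OF H, of h] by (simp add: eps_def j(4)[OF f] j(7)[OF f] flip: j(7))
  show "(\<lambda>x. \<Delta> h (\<lambda>(h1, h2). j (S h2) (j \<beta> (j h1 f)) x)) = eps h (j \<beta> f)" for h
    using comult_beta[OF H, of h] by (simp add: eps_def j(4)[OF f] j(7)[OF f] flip: j(7))
  show "(\<lambda>x. \<phi> (\<lambda>(x1, x2, x3). j x3 (j \<alpha> (j (S x2) (j \<beta> (j x1 f)))) x)) = f"
    using assoc_zigzag[OF H] by (simp add: j(6)[OF f] j(4)[OF f] j(7)[OF f] mult.assoc flip: j(7))
  show "(\<lambda>x. \<phi>i (\<lambda>(y1, y2, y3). j (S y3) (j \<beta> (j y2 (j \<alpha> (j (S y1) f)))) x)) = f"
    using assoc_inv_zigzag[OF H] by (simp add: j(6)[OF f] j(4)[OF f] j(7)[OF f] mult.assoc flip: j(7))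
qed

lemma dual_twisted: "dual H2 diag sigma_tw alpha_tw beta_tw"
  unfolding dual_def
proof (intro conjI allI impI)
  show "rfam H2 sigma_tw"
    by (rule rfam_linI[OF form_space_H(2) sigma_tw_lop], rename_tac f x, case_tac x)
      (simp add: sigma_tw_apply lins)
  fix f :: "'h \<times> 'h \<Rightarrow> 'k" assume f: "H2 f"
  have sf: "H2 (sigma_tw h f)" for h by (rule lopD(1)[OF sigma_tw_lop, OF f])
  have H: "H2 (\<lambda>(u1, u2). f (S u2 * p, S u1 * q))" for p q by (simp add: lins H2_args[OF f])
  show "sigma_tw (g * h) f = sigma_tw g (sigma_tw h f)" for g h
  proof
    fix z :: "'h \<times> 'h"
    obtain p q where z: "z = (p, q)" by (cases z)
    show "sigma_tw (g * h) f z = sigma_tw g (sigma_tw h f) z"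
      using tmul_apply[OF mult_stable_H(2) comult_in comult_in, OF H[of p q] form_space_H(2), of g h]
      by (simp add: z sigma_tw_apply f sf comult_mult case_prod_unfold times_prod_def antipode_mult mult.assoc)
  qed
  show "sigma_tw 1 f = f"
    using tone_apply[of H2, OF H] by (auto simp: sigma_tw_apply f comult_one one_prod_def antipode_one)
qed (use alpha_tw_lop beta_tw_lop twisted_alpha twisted_beta twisted_zigzag_left twisted_zigzag_right in auto)

section \<open>The twist f as a comparison map\<close>

abbreviation "twist_op \<equiv> dcomp diag sigma_tw alpha_tw (diag \<beta>) (\<lambda>h. diag (S h))"
abbreviation "twist_inv_op \<equiv> dcomp diag (\<lambda>h. diag (S h)) (diag \<alpha>) beta_tw sigma_tw"

lemma tact_lreg_one: "tact T lreg F 1 = T F"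
  by (simp add: tact_lreg_apply)

lemma tact_lreg_tmul:
  "T \<in> tprod H2 \<Longrightarrow> U \<in> tprod H2 \<Longrightarrow> H2 f \<Longrightarrow> tact (tmul H2 T U) lreg f = tact U lreg (tact T lreg f)"
  by (rule tact_tmul[OF lreg_rep mult_stable_H(2)])

lemma pR_in: "pR \<in> tprod H2"
  unfolding pR_def by (auto intro!: tsum_in_tprod phii_in pten_in_tprod split: prod.split)

lemma pR_apply: "H2 F \<Longrightarrow> pR F = \<phi>i (\<lambda>(y1, y2, y3). F (y1, y2 * \<beta> * S y3))"
  unfolding pR_def
  by (subst tsum_case(2)[OF phii_in]) (simp_all add: pten_def lins H2_args[of F])

lemma ff_in: "ff \<in> tprod H2"
  unfolding ff_def
  by (auto intro!: tsum_in_tprod tmul_in_tprod pR_in aa_in comult_in pten_in_tprod split: prod.split)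

text \<open>Read with the left factor first, the three factors in the definition of f act as
  \<open>sigma_tw p1\<close>, \<open>alpha_tw\<close> and \<open>diag p2\<close>. Inserting y1 and
  \<open>y2 * \<beta> * S y3\<close> for p1 and p2 gives the word of the comparison map.\<close>

lemma tact_ff:
  assumes f: "H2 f"
  shows "tact ff lreg f = twist_op f"
proof
  fix z
  note d = dualD[OF dual_twisted] and j = rrepD[OF diag_ract]
  have ff: "ff = tsum H2 pR (\<lambda>(p1, p2). tmul H2 (tmul H2 (S_cop p1) aa) (\<Delta> p2))"
    by (simp add: ff_def S_cop_def)
  have af: "H2 (alpha_tw (sigma_tw h f))" for h
    by (rule lopD(1)[OF alpha_tw_lop, OF lopD(1)[OF sigma_tw_lop, OF f]])
  have 1: "tmul H2 (tmul H2 (S_cop p1) aa) (\<Delta> p2) (\<lambda>e. lreg e f z) = diag p2 (alpha_tw (sigma_tw p1 f)) z" for p1 p2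
  proof -
    have "tact (tmul H2 (tmul H2 (S_cop p1) aa) (\<Delta> p2)) lreg f = diag p2 (alpha_tw (sigma_tw p1 f))"
      using f lopD(1)[OF sigma_tw_lop, OF f]
      by (simp add: tact_lreg_tmul tmul_in_tprod S_cop_in aa_in comult_in conv_tact alpha_tw_def sigma_tw_def)
    from fun_cong[OF this, of z] show ?thesis by (simp add: tact_def)
  qed
  have 2: "H2 (\<lambda>(p1, p2). diag p2 (alpha_tw (sigma_tw p1 f)) z)"
    using lfamD(4)[OF lfam_snoc2[OF rfam_lop(1)[OF d(1) alpha_tw_lop] rfam_ract[OF diag_ract], OF f], of z]
    by (simp add: case_prod_unfold)
  have "tact ff lreg f z = pR (\<lambda>(p1, p2). diag p2 (alpha_tw (sigma_tw p1 f)) z)"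
    unfolding tact_def ff using tsum_case(1)[OF pR_in, of "\<lambda>p1 p2. tmul H2 (tmul H2 (S_cop p1) aa) (\<Delta> p2)"] 1 2
    by simp
  also have "\<dots> = \<phi>i (\<lambda>(y1, y2, y3). diag (y2 * \<beta> * S y3) (alpha_tw (sigma_tw y1 f)) z)"
    by (simp add: pR_apply[OF 2])
  also have "\<dots> = twist_op f z"
    unfolding dcomp_def by (simp add: j(7)[OF j(4)[OF j(4)[OF af]]] j(7)[OF j(4)[OF af]] j(7)[OF af])
  finally show "tact ff lreg f z = twist_op f z" .
qed

text \<open>Multiplication by this element is the comparison map \<open>twist_inv_op\<close>, inverse to \<open>twist_op\<close>.\<close>

definition ff_inv :: "('h \<times> 'h \<Rightarrow> 'k) \<Rightarrow> 'k" where
  "ff_inv = tsum H3 \<phi>i (\<lambda>(y1, y2, y3). tmul H2 (tmul H2 (\<Delta> (S y1 * \<alpha> * y2)) delta_tw) (S_cop y3))"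

lemma ff_inv_in: "ff_inv \<in> tprod H2"
  unfolding ff_inv_def
  by (auto intro!: tsum_in_tprod tmul_in_tprod phii_in delta_tw_in comult_in S_cop_in split: prod.split)

lemma tact_ff_inv:
  assumes f: "H2 f"
  shows "tact ff_inv lreg f = twist_inv_op f"
proof
  fix z
  note j = rrepD[OF diag_ract]
  have 1: "tmul H2 (tmul H2 (\<Delta> (S y1 * \<alpha> * y2)) delta_tw) (S_cop y3) (\<lambda>e. lreg e f z) =
      sigma_tw y3 (beta_tw (diag y2 (diag \<alpha> (diag (S y1) f)))) z" for y1 y2 y3
  proof -
    have "tact (tmul H2 (tmul H2 (\<Delta> (S y1 * \<alpha> * y2)) delta_tw) (S_cop y3)) lreg f = sigma_tw y3 (beta_tw (diag (S y1 * \<alpha> * y2) f))"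
      using f j(4)[OF f]
      by (simp add: tact_lreg_tmul tmul_in_tprod S_cop_in delta_tw_in comult_in conv_tact beta_tw_def sigma_tw_def)
    then have "tact (tmul H2 (tmul H2 (\<Delta> (S y1 * \<alpha> * y2)) delta_tw) (S_cop y3)) lreg f =
        sigma_tw y3 (beta_tw (diag y2 (diag \<alpha> (diag (S y1) f))))"
      by (simp add: j(7)[OF f])
    from fun_cong[OF this, of z] show ?thesis by (simp add: tact_def)
  qed
  have 2: "H3 (\<lambda>(y1, y2, y3). sigma_tw y3 (beta_tw (diag y2 (diag \<alpha> (diag (S y1) f)))) z)"
    by (rule lfam_case3[OF lfam_dcomp[OF diag_ract dual_twisted dual_antipode[OF diag_ract], OF f]])
  show "tact ff_inv lreg f z = twist_inv_op f z"
    unfolding tact_def ff_inv_def dcomp_def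
    using tsum_case(2)[OF phii_in, of "\<lambda>y1 y2 y3. tmul H2 (tmul H2 (\<Delta> (S y1 * \<alpha> * y2)) delta_tw) (S_cop y3)"] 1 2
    by simp
qed

text \<open>The comparison maps in the two directions are mutually inverse, and a tensor is
  recovered from its action by evaluation at 1.\<close>

lemma ffi_eq: "ffi = ff_inv"
  unfolding ffi_def
proof (rule tinv_eqI[OF mult_stable_H(2) form_space_H(2) ff_in])
  note D0 = dual_antipode[OF diag_ract]
  have 1: "tmul H2 ff ff_inv F = F 1" "tmul H2 ff_inv ff F = F 1" if F: "H2 F" for F
  proof -
    have U: "H2 (twist_op F)" by (rule lopD(1)[OF lop_dcomp[OF diag_ract D0 dual_twisted], OF F])
    have V: "H2 (twist_inv_op F)" by (rule lopD(1)[OF lop_dcomp[OF diag_ract dual_twisted D0], OF F])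
    have "tmul H2 ff ff_inv F = tact (tmul H2 ff ff_inv) lreg F 1" by (simp only: tact_lreg_one)
    also have "\<dots> = F 1"
      unfolding tact_lreg_tmul[OF ff_in ff_inv_in, OF F] tact_ff[OF F] tact_ff_inv[OF U] dcomp_inverse[OF diag_ract D0 dual_twisted, OF F] ..
    finally show "tmul H2 ff ff_inv F = F 1" .
    have "tmul H2 ff_inv ff F = tact (tmul H2 ff_inv ff) lreg F 1" by (simp only: tact_lreg_one)
    also have "\<dots> = F 1"
      unfolding tact_lreg_tmul[OF ff_inv_in ff_in, OF F] tact_ff_inv[OF F] tact_ff[OF V] dcomp_inverse[OF diag_ract dual_twisted D0, OF F] ..
    finally show "tmul H2 ff_inv ff F = F 1" .
  qed
  have "tmul H2 ff ff_inv = tone H2" "tmul H2 ff_inv ff = tone H2"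
    by (rule tprod_ext[of _ H2]; simp add: tmul_in_tprod ff_inv_in ff_in tone_in_tprod 1 tone_apply)+
  then show "is_tinv H2 ff ff_inv" by (simp add: is_tinv_def ff_inv_in)
qed

lemma ffi_in: "ffi \<in> tprod H2"
  by (simp add: ffi_eq ff_inv_in)

text \<open>Evaluation of a form at \<open>\<Delta> a * ffi\<close>; see \<open>tcomult_apply\<close>.\<close>

definition tcomult :: "('h \<times> 'h \<Rightarrow> 'k) \<Rightarrow> 'h \<Rightarrow> 'k" where
  "tcomult F = (\<lambda>a. twist_inv_op (diag a F) 1)"

lemma tcomult_apply:
  assumes "H2 F"
  shows "tcomult F a = \<Delta> a (\<lambda>x. ffi (\<lambda>g. F (x * g)))"
proof -
  have "tcomult F a = tact (tmul H2 (\<Delta> a) ffi) lreg F 1"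
    unfolding tcomult_def tact_lreg_tmul[OF comult_in ffi_in, OF assms] unfolding ffi_eq
    using tact_ff_inv[OF rrepD(4)[OF diag_ract, OF assms], of a] by (simp only: conv_tact[of k1 k2 a])
  also have "\<dots> = \<Delta> a (\<lambda>x. ffi (\<lambda>g. F (x * g)))"
    unfolding tact_lreg_one by (rule tmul_apply[OF mult_stable_H(2) comult_in ffi_in assms form_space_H(2)])
  finally show ?thesis .
qed

lemma lop_twist_inv_op: "lop H2 H2 twist_inv_op"
  by (rule lop_dcomp[OF diag_ract dual_twisted dual_antipode[OF diag_ract]])

lemma lop_tcomult: "lop H2 H1 tcomult"
proof -
  have 1: "H1 (tcomult F)" if "H2 F" for F
    unfolding tcomult_def by (rule rrepD(9)[OF diag_ract, OF that lop_twist_inv_op])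
  have 2: "lop H2 H2 (\<lambda>F. twist_inv_op (diag a F))" for a
    by (rule lop_comp[OF rrepD(3)[OF diag_ract] lop_twist_inv_op])
  show ?thesis
    unfolding lop_def tcomult_def using 1[unfolded tcomult_def] lopD(2,3)[OF 2] by simp
qed

section \<open>Equivariance, value at \<beta> and counitality of the twisted
  comultiplication\<close>

abbreviation "lmul \<equiv> pull lm"
abbreviation "rmulS \<equiv> pull rm"

lemma cact_lmul_rmulS: "cact H1 [lmul, rmulS]"
  by (auto intro!: ract_pull comm_pull simp: lm_rm_comm)

lemma tcomult_left: "H2 F \<Longrightarrow> tcomult (diag h F) = lmul h (tcomult F)"
  using rrepD(7)[OF diag_ract, of F] by (simp add: tcomult_def pull_def lm_def)

text \<open>A comparison map intertwines the two antipode actions, which says that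
  \<open>\<Delta> (S h) * ffi\<close> equals ffi multiplied from the right by \<open>S h2\<close>
  and \<open>S h1\<close> in its factors.\<close>

lemma tcomult_right:
  assumes F: "H2 F"
  shows "tcomult ((k3 \<star> k4) h F) = rmulS h (tcomult F)"
proof
  fix a
  note j = rrepD[OF diag_ract]
  have G: "H2 (diag a F)" by (rule j(4)[OF F])
  have cc: "comm H2 diag (k3 \<star> k4)"
    using cact_conv(7)[OF cact_k] cact_k comm_sym by (auto simp: conv_simps)
  have V: "twist_inv_op ((k3 \<star> k4) h (diag a F)) = (k3 \<star> k4) h (twist_inv_op (diag a F))"
  proof (rule conv_intertwine[OF ract_k(3,4,6) lop_twist_inv_op, OF G])
    fix h' and f :: "'h \<times> 'h \<Rightarrow> 'k" assume f: "H2 f"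
    show "twist_inv_op (k3 h' f) = k3 h' (twist_inv_op f)"
      unfolding tact_ff_inv[OF f, symmetric] tact_ff_inv[OF rrepD(4)[OF ract_k(3), OF f], symmetric]
      by (rule ext) (simp add: tact_lreg_apply pull_def rm_def times_prod_def snd_act_def mult.assoc case_prod_unfold)
    show "twist_inv_op (k4 h' f) = k4 h' (twist_inv_op f)"
      unfolding tact_ff_inv[OF f, symmetric] tact_ff_inv[OF rrepD(4)[OF ract_k(4), OF f], symmetric]
      by (rule ext) (simp add: tact_lreg_apply pull_def rm_def times_prod_def fst_act_def mult.assoc case_prod_unfold)
  qed
  have VG: "H2 (twist_inv_op (diag a F))" by (rule lopD(1)[OF lop_twist_inv_op, OF G])
  have "tcomult ((k3 \<star> k4) h F) a = (k3 \<star> k4) h (twist_inv_op (diag a F)) 1"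
    by (simp add: tcomult_def commD[OF cc, OF F] V)
  \<comment> \<open>At the argument 1, multiplying by the antipodes from the right or from the left
    is the same.\<close>
  also have "\<dots> = sigma_tw h (twist_inv_op (diag a F)) 1"
    by (simp add: one_prod_def sigma_tw_apply[OF VG] conv_apply pull_def rm_def)
  also have "\<dots> = twist_inv_op (diag (S h) (diag a F)) 1"
    by (simp add: dcomp_intertwines[OF diag_ract dual_twisted dual_antipode[OF diag_ract], OF G])
  also have "\<dots> = rmulS h (tcomult F) a"
    by (simp add: tcomult_def pull_def rm_def j(7)[OF F])
  finally show "tcomult ((k3 \<star> k4) h F) a = rmulS h (tcomult F) a" .
qed

text \<open>A comparison map carries the \<beta> of one dual to that of the other; hence
  \<open>\<Delta> \<beta> * ffi\<close> is \<open>delta_tw\<close>.\<close>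

lemma tcomult_beta:
  assumes F: "H2 F"
  shows "tcomult F \<beta> = CHIi k1 k2 k3 k4 F (\<beta>, \<beta>)"
  using dcomp_coev[OF diag_ract dual_twisted dual_antipode[OF diag_ract], OF F] delta_tw_apply[OF F]
  by (simp add: tcomult_def beta_tw_def tact_lreg_one)

text \<open>H is generated by \<open>\<beta>\<close>: each element a is a sum of terms \<open>a * x1 * \<beta> * S y\<close>.\<close>

lemma eq_if_eq_at_beta:
  assumes "bij S" and p: "lop L H1 p" and q: "lop L H1 q" and J: "ract L J" and K: "ract L K"
    and "\<And>h F. L F \<Longrightarrow> p (J h F) = lmul h (p F)" "\<And>h F. L F \<Longrightarrow> p (K h F) = rmulS h (p F)"
    and "\<And>h F. L F \<Longrightarrow> q (J h F) = lmul h (q F)" "\<And>h F. L F \<Longrightarrow> q (K h F) = rmulS h (q F)"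
    and "\<And>F. L F \<Longrightarrow> p F \<beta> = q F \<beta>" and F: "L F"
  shows "p F = q F"
proof
  fix a
  have gen: "P F (x * \<beta> * S y) = P (J x (K y F)) \<beta>"
    if "\<And>h F. L F \<Longrightarrow> P (J h F) = lmul h (P F)" "\<And>h F. L F \<Longrightarrow> P (K h F) = rmulS h (P F)" for P x y
    using that F rrepD(4)[OF K, OF F] by (simp add: pull_def lm_def rm_def)
  have eq: "p F (x * \<beta> * S y) = q F (x * \<beta> * S y)" for x y
  proof -
    have "p F (x * \<beta> * S y) = p (J x (K y F)) \<beta>" by (rule gen) (rule assms(6,7), assumption)+
    moreover have "q F (x * \<beta> * S y) = q (J x (K y F)) \<beta>" by (rule gen) (rule assms(8,9), assumption)+
    ultimately show ?thesis
      using assms(10)[OF rrepD(4)[OF J, OF rrepD(4)[OF K, OF F]]] by simp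
  qed
  \<comment> \<open>Surjectivity of \<open>S\<close> enters here: \<open>\<alpha> * x3\<close> is an
    antipode, so everything to the right of \<beta> is the antipode of a single element.\<close>
  have exp: "g a = \<phi> (\<lambda>(x1, x2, x3). g (a * x1 * \<beta> * S (inv S (\<alpha> * x3) * x2)))" if "H1 g" for g
  proof -
    have "S (inv S z) = z" for z using assms(1) by (simp add: bij_is_surj surj_f_inv_f)
    moreover have "H1 (\<lambda>x. g (a * x))" using that by (simp add: lins H1_comp[of g])
    from assoc_zigzag[OF this] have "\<phi> (\<lambda>(x1, x2, x3). g (a * (x1 * \<beta> * S x2 * \<alpha> * x3))) = g a" by simp
    ultimately show ?thesis by (simp add: antipode_mult mult.assoc)
  qed
  show "p F a = q F a"
    unfolding exp[of "p F", OF lopD(1)[OF p, OF F]] exp[of "q F", OF lopD(1)[OF q, OF F]] eq ..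
qed

text \<open>Apply \<epsilon> to the antipode axiom for \<alpha> and use
  \<open>\<epsilon> \<alpha> = 1\<close>.\<close>

lemma eps_S: "\<epsilon> (S h) = \<epsilon> h"
proof -
  have "\<Delta> h (\<lambda>(h1, h2). \<epsilon> (S h1 * \<alpha> * h2)) = \<epsilon> h"
    using comult_alpha[OF counit_linear, of h] by (simp add: counit_alpha)
  moreover have "\<Delta> h (\<lambda>(h1, h2). \<epsilon> (S (scale (\<epsilon> h2) h1))) = \<epsilon> (S h)"
    using H1_tsum[OF comult_in, of "\<lambda>x. \<epsilon> (S x)" "\<lambda>h1 h2. scale (\<epsilon> h2) h1" h] counit_linear
    by (simp add: counit_right mlin_form_case H1_iff scale_left_distrib scale_right_distrib algebra_simps)
  ultimately show ?thesis
    using counit_linear by (simp add: counit_mult counit_alpha H1_iff mult.commute)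
qed

definition counit_fst :: "('h \<Rightarrow> 'k) \<Rightarrow> 'h \<times> 'h \<Rightarrow> 'k" where "counit_fst g = (\<lambda>(x, w). \<epsilon> x * g w)"
definition counit_snd :: "('h \<Rightarrow> 'k) \<Rightarrow> 'h \<times> 'h \<Rightarrow> 'k" where "counit_snd g = (\<lambda>(x, w). g x * \<epsilon> w)"

lemma lop_counit_fst: "lop H1 H2 counit_fst" and lop_counit_snd: "lop H1 H2 counit_snd"
proof -
  have H: "H2 (counit_fst g)" "H2 (counit_snd g)" if "H1 g" for g
    using that counit_linear by (simp_all add: counit_fst_def counit_snd_def mlin_form_case H1_iff distrib_left distrib_right)
  then show "lop H1 H2 counit_fst" "lop H1 H2 counit_snd"
    by (auto simp: lop_def counit_fst_def counit_snd_def distrib_left distrib_right)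
qed

lemma counit_left_form: "H1 g \<Longrightarrow> \<Delta> h (\<lambda>(u1, u2). \<epsilon> u1 * g u2) = g h"
  using H1_tsum[OF comult_in, of g "\<lambda>h1 h2. scale (\<epsilon> h1) h2" h] counit_linear
  by (simp add: counit_left mlin_form_case H1_iff distrib_left distrib_right mult.left_commute mult.assoc)

lemma counit_right_form: "H1 g \<Longrightarrow> \<Delta> h (\<lambda>(u1, u2). g u1 * \<epsilon> u2) = g h"
  using H1_tsum[OF comult_in, of g "\<lambda>h1 h2. scale (\<epsilon> h2) h1" h] counit_linear
  by (simp add: counit_right mlin_form_case H1_iff distrib_left distrib_right mult.left_commute mult.assoc mult.commute)

text \<open>On \<open>counit_fst g\<close> the strands 1 and 4, which belong to the first factor,
  act through \<epsilon>, and each of the two associators in \<open>CHI\<close> contains one of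
  them. For \<open>counit_snd g\<close> strands 2 and 3 play this part.\<close>

lemma CHI_counit:
  assumes g: "H1 g"
  shows "CHI k1 k2 k3 k4 (counit_fst g) = counit_fst g" "CHI k1 k2 k3 k4 (counit_snd g) = counit_snd g"
proof -
  have l: "H2 (counit_fst g)" and r: "H2 (counit_snd g)"
    by (rule lopD(1)[OF lop_counit_fst, OF g] lopD(1)[OF lop_counit_snd, OF g])+
  have e: "k1 h (counit_fst g) = eps h (counit_fst g)" "k4 h (counit_fst g) = eps h (counit_fst g)"
    "k2 h (counit_snd g) = eps h (counit_snd g)" "k3 h (counit_snd g) = eps h (counit_snd g)" for h
    by (auto simp: counit_fst_def counit_snd_def pull_def lm_def rm_def eps_def counit_mult eps_S fun_eq_iff)
  note c = cact_conv[OF cact_k]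
  have "PHI \<phi> k1 k2 k3 (counit_fst g) = counit_fst g"
    by (rule PHI_absorb_form(1)[OF c(4), OF l _ e(1)]) simp
  moreover have "PHI \<phi>i diag k3 k4 (counit_fst g) = counit_fst g"
    by (rule PHI_absorb_form(3)[OF c(1), OF l _ e(2)]) simp
  ultimately show "CHI k1 k2 k3 k4 (counit_fst g) = counit_fst g" by (simp add: CHI_def)
  have "PHI \<phi> k1 k2 k3 (counit_snd g) = counit_snd g"
    by (rule PHI_absorb_form(2)[OF c(4), OF r _ e(3)]) simp
  moreover have "PHI \<phi>i diag k3 k4 (counit_snd g) = counit_snd g"
    by (rule PHI_absorb_form(2)[OF c(1), OF r _ e(4)]) simp
  ultimately show "CHI k1 k2 k3 k4 (counit_snd g) = counit_snd g" by (simp add: CHI_def)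
qed

text \<open>Both sides are equivariant, so they are compared at \<beta>. There the value is given by
  \<open>CHIi\<close>, which fixes these forms, and \<open>\<epsilon> \<beta> = 1\<close>.\<close>

lemma tcomult_counit:
  assumes S: "bij S" and g: "H1 g"
  shows "tcomult (counit_fst g) = g" "tcomult (counit_snd g) = g"
proof -
  have ract_lmul_rmulS: "ract H1 lmul" "ract H1 rmulS" using cact_lmul_rmulS by auto
  have id: "lop H1 H1 (\<lambda>f. f)" by (simp add: lop_def)
  have H: "H1 (\<lambda>x. g (E x))" if "H1 g" "lin E" for g E by (rule H1_comp[OF that])
  have l: "diag h (counit_fst g) = counit_fst (lmul h g)" "(k3 \<star> k4) h (counit_fst g) = counit_fst (rmulS h g)"
    "diag h (counit_snd g) = counit_snd (lmul h g)" "(k3 \<star> k4) h (counit_snd g) = counit_snd (rmulS h g)" if g: "H1 g" for h g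
  proof -
    have sc: "\<Delta> h (\<lambda>(u1, u2). c * F u1 u2) = c * \<Delta> h (\<lambda>(u1, u2). F u1 u2)" if "H2 (\<lambda>(u1, u2). F u1 u2)" for c F
      using tprod_eval_scale[OF comult_in form_space_H(2), OF that] by (simp add: case_prod_unfold)
    have "H2 (\<lambda>(u1, u2). \<epsilon> u1 * g (u2 * w))" "H2 (\<lambda>(u1, u2). g (u1 * w) * \<epsilon> u2)"
      "H2 (\<lambda>(u1, u2). g (w * S u1) * \<epsilon> u2)" "H2 (\<lambda>(u1, u2). \<epsilon> u1 * g (w * S u2))" for w
      using g counit_linear H[OF g lin_simps(2)[OF lin_simps(1)], of w] H[OF g lin_simps(3)[OF lin_simps(4)[OF lin_simps(1)]], of w]
      by (simp_all add: mlin_form_case H1_iff distrib_left distrib_right)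
    note sc' = this[THEN sc]
    note cl = counit_left_form[OF H[OF g lin_simps(2)[OF lin_simps(1)]]]
      counit_left_form[OF H[OF g lin_simps(3)[OF lin_simps(4)[OF lin_simps(1)]]]]
      counit_right_form[OF H[OF g lin_simps(2)[OF lin_simps(1)]]]
      counit_right_form[OF H[OF g lin_simps(3)[OF lin_simps(4)[OF lin_simps(1)]]]]
    show "diag h (counit_fst g) = counit_fst (lmul h g)"
    proof (rule ext, clarify)
      fix x w
      have "diag h (counit_fst g) (x, w) = \<Delta> h (\<lambda>(u1, u2). \<epsilon> x * (\<epsilon> u1 * g (u2 * w)))"
        by (simp add: conv_apply pull_def lm_def counit_fst_def counit_mult mult.assoc mult.left_commute)
      then show "diag h (counit_fst g) (x, w) = counit_fst (lmul h g) (x, w)"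
        by (simp add: sc' cl counit_fst_def pull_def lm_def)
    qed
    show "(k3 \<star> k4) h (counit_fst g) = counit_fst (rmulS h g)"
    proof (rule ext, clarify)
      fix x w
      have "(k3 \<star> k4) h (counit_fst g) (x, w) = \<Delta> h (\<lambda>(u1, u2). \<epsilon> x * (g (w * S u1) * \<epsilon> u2))"
        by (simp add: conv_apply pull_def rm_def counit_fst_def counit_mult mult.assoc mult.left_commute mult.commute eps_S)
      then show "(k3 \<star> k4) h (counit_fst g) (x, w) = counit_fst (rmulS h g) (x, w)"
        by (simp add: sc' cl counit_fst_def pull_def rm_def)
    qed
    show "diag h (counit_snd g) = counit_snd (lmul h g)"
    proof (rule ext, clarify)
      fix x w
      have "diag h (counit_snd g) (x, w) = \<Delta> h (\<lambda>(u1, u2). \<epsilon> w * (g (u1 * x) * \<epsilon> u2))"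
        by (simp add: conv_apply pull_def lm_def counit_snd_def counit_mult mult.assoc mult.left_commute mult.commute)
      then show "diag h (counit_snd g) (x, w) = counit_snd (lmul h g) (x, w)"
        unfolding sc' cl by (simp add: counit_snd_def pull_def lm_def)
    qed
    show "(k3 \<star> k4) h (counit_snd g) = counit_snd (rmulS h g)"
    proof (rule ext, clarify)
      fix x w
      have "(k3 \<star> k4) h (counit_snd g) (x, w) = \<Delta> h (\<lambda>(u1, u2). \<epsilon> w * (\<epsilon> u1 * g (x * S u2)))"
        by (simp add: conv_apply pull_def rm_def counit_snd_def counit_mult mult.assoc mult.left_commute mult.commute eps_S)
      then show "(k3 \<star> k4) h (counit_snd g) (x, w) = counit_snd (rmulS h g) (x, w)"
        unfolding sc' cl by (simp add: counit_snd_def pull_def rm_def)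
    qed
  qed
  have CHIi: "CHIi k1 k2 k3 k4 (counit_fst g) = counit_fst g" "CHIi k1 k2 k3 k4 (counit_snd g) = counit_snd g" if "H1 g" for g
    using CHI_inverse(1)[OF cact_k] lopD(1)[OF lop_counit_fst, OF that] lopD(1)[OF lop_counit_snd, OF that] CHI_counit[OF that]
    by metis+
  have F: "H2 (counit_fst f)" "H2 (counit_snd f)" if "H1 f" for f
    by (rule lopD(1)[OF lop_counit_fst, OF that] lopD(1)[OF lop_counit_snd, OF that])+
  show "tcomult (counit_fst g) = g"
  proof (rule eq_if_eq_at_beta[OF S lop_comp[OF lop_counit_fst lop_tcomult] id ract_lmul_rmulS])
    fix h f assume f: "H1 f"
    show "tcomult (counit_fst (lmul h f)) = lmul h (tcomult (counit_fst f))" using tcomult_left[OF F(1)[OF f], of h] l(1)[OF f, of h] by simp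
    show "tcomult (counit_fst (rmulS h f)) = rmulS h (tcomult (counit_fst f))" using tcomult_right[OF F(1)[OF f], of h] l(2)[OF f, of h] by simp
    show "tcomult (counit_fst f) \<beta> = f \<beta>"
      unfolding tcomult_beta[OF F(1)[OF f]] CHIi(1)[OF f] by (simp add: counit_fst_def counit_beta)
  qed (rule refl refl g)+
  show "tcomult (counit_snd g) = g"
  proof (rule eq_if_eq_at_beta[OF S lop_comp[OF lop_counit_snd lop_tcomult] id ract_lmul_rmulS])
    fix h f assume f: "H1 f"
    show "tcomult (counit_snd (lmul h f)) = lmul h (tcomult (counit_snd f))" using tcomult_left[OF F(2)[OF f], of h] l(3)[OF f, of h] by simp
    show "tcomult (counit_snd (rmulS h f)) = rmulS h (tcomult (counit_snd f))" using tcomult_right[OF F(2)[OF f], of h] l(4)[OF f, of h] by simp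
    show "tcomult (counit_snd f) \<beta> = f \<beta>"
      unfolding tcomult_beta[OF F(2)[OF f]] CHIi(2)[OF f] by (simp add: counit_snd_def counit_beta)
  qed (rule refl refl g)+
qed

section \<open>The coaction through \<chi>\<close>

lemma chi_eval:
  assumes K: "H4 K"
  shows "\<chi> K = \<phi> (\<lambda>(x1, x2, x3). \<phi>i (\<lambda>(y1, y2, y3). \<Delta> y1 (\<lambda>(u1, u2). K (x1 * u1, x2 * u2, x3 * y2, y3))))"
proof -
  let ?E = "tsum H3 \<phi> (\<lambda>(x1, x2, x3). pten H4 (x1, x2, x3, 1))"
  let ?B = "tsum H3 \<phi>i (\<lambda>(y1, y2, y3). tsum H2 (\<Delta> y1) (\<lambda>(u1, u2). pten H4 (u1, u2, y2, y3)))"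
  have in4: "?E \<in> tprod H4" "?B \<in> tprod H4"
    by (auto intro!: tsum_in_tprod comult_in assoc_in phii_in pten_in_tprod split: prod.split)
  have E: "?E F = \<phi> (\<lambda>(x1, x2, x3). F (x1, x2, x3, 1))" if F: "H4 F" for F
    by (subst tsum_case(2)[OF assoc_in]) (simp_all add: pten_def lins H4_args[OF F] F)
  have B: "?B F = \<phi>i (\<lambda>(y1, y2, y3). \<Delta> y1 (\<lambda>(u1, u2). F (u1, u2, y2, y3)))" if F: "H4 F" for F
  proof -
    have "tsum H2 (\<Delta> y1) (\<lambda>(u1, u2). pten H4 (u1, u2, y2, y3)) F = \<Delta> y1 (\<lambda>(u1, u2). F (u1, u2, y2, y3))" for y1 y2 y3
      by (subst tsum_case(1)[OF comult_in]) (simp_all add: pten_def lins H4_args[OF F] F)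
    then show ?thesis
      by (subst tsum_case(2)[OF phii_in]) (simp_all add: lins H4_args[OF F])
  qed
  note st = mult_stableD[OF mult_stable_H(4), OF K]
  have "\<chi> K = ?E (\<lambda>a. ?B (\<lambda>b. K (a * b)))"
    unfolding \<chi>_def by (rule tmul_apply[OF mult_stable_H(4) in4 K form_space_H(4)])
  also have "\<dots> = \<phi> (\<lambda>(x1, x2, x3). ?B (\<lambda>b. K ((x1, x2, x3, 1) * b)))"
    by (rule E, rule form_space_eval[of ?B H4 H4 "\<lambda>a b. K (a * b)"]) (rule in4 form_space_H st)+
  also have "\<dots> = \<phi> (\<lambda>(x1, x2, x3). \<phi>i (\<lambda>(y1, y2, y3). \<Delta> y1 (\<lambda>(u1, u2). K (x1 * u1, x2 * u2, x3 * y2, y3))))"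
    unfolding B[OF st(2)] by simp
  finally show ?thesis .
qed

lemma A_coact_in: "A_coact a \<in> tprod H2"
  unfolding A_coact_def
  by (auto intro!: tsum_in_tprod comult_in assoc_in phii_in ffi_in pten_in_tprod split: prod.split)

text \<open>In the coaction the two factors of \<open>\<Delta> a * ffi\<close> stand between c1 and
  \<open>S c4\<close> and between c2 and \<open>S c3\<close>, where the c are the components of
  \<chi>. The coaction is thus the twisted comultiplication tested on a rebracketed form.\<close>

lemma A_coact_apply:
  assumes F: "H2 F"
  shows "A_coact a F = tcomult (CHI k1 k2 k3 k4 F) a"
proof -
  let ?P = "rpair k1 (rpair k2 (rpair k3 k4))"
  have P: "rrep H2 H4 ?P" by (rule rrep4) (use cact_k in auto)
  have H: "H4 (\<lambda>c. tcomult (?P c F) a)" by (rule rrepD(9)[OF P, OF F lop_tcomult])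
  note l = lins H1_tprod(1)[OF ffi_in] H2_args[OF F]
  have "tcomult (CHI k1 k2 k3 k4 F) a = \<chi> (\<lambda>c. tcomult (?P c F) a)"
    unfolding CHI_tact[OF cact_k, OF F] lop_tact_eval[OF P chi_in lop_tcomult, OF F] ..
  also have "\<dots> = \<phi> (\<lambda>(x1, x2, x3). \<phi>i (\<lambda>(y1, y2, y3). \<Delta> y1 (\<lambda>(u1, u2).
      tcomult (?P (x1 * u1, x2 * u2, x3 * y2, y3) F) a)))"
    by (rule chi_eval[OF H])
  also have "\<dots> = \<phi> (\<lambda>(x1, x2, x3). \<phi>i (\<lambda>(y1, y2, y3). \<Delta> y1 (\<lambda>(u1, u2). \<Delta> a (\<lambda>(a1, a2). ffi (\<lambda>(g1, g2).
      F (x1 * u1 * a1 * g1 * S y3, x2 * u2 * a2 * g2 * S (x3 * y2)))))))"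
  proof -
    have "tcomult (?P (c1, c2, c3, c4) F) a = \<Delta> a (\<lambda>(a1, a2). ffi (\<lambda>(g1, g2). F (c1 * a1 * g1 * S c4, c2 * a2 * g2 * S c3)))"
      for c1 c2 c3 c4
      unfolding tcomult_apply[OF rrepD(4)[OF P, OF F]]
      by (simp add: pull_def lm_def rm_def fst_act_def snd_act_def case_prod_unfold mult.assoc times_prod_def)
    then show ?thesis by simp
  qed
  also have "\<dots> = A_coact a F"
    unfolding A_coact_def
    by (simp add: tsum_case assoc_in phii_in comult_in ffi_in pten_def F l)
  finally show ?thesis by simp
qed

section \<open>The Yetter-Drinfeld module A\<close>

lemma A_act_form:
  assumes g: "H1 g"
  shows "g (A_act h a) = (lmul \<star> rmulS) h g a"
proof -
  have "H2 (\<lambda>(h1, h2). g (h1 * a * S h2))" by (simp add: lins H1_comp[OF g])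
  from H1_tsum[OF comult_in g this] show ?thesis
    by (simp add: A_act_def conv_apply pull_def lm_def rm_def mult.assoc)
qed

lemma ract_lmul_rmulS: "ract H1 lmul" "ract H1 rmulS" "comm H1 lmul rmulS"
  using cact_lmul_rmulS by auto

lemma ract_adjoint: "ract H1 (lmul \<star> rmulS)"
  by (rule ract_conv[OF ract_lmul_rmulS])

lemma form_eqI: "(\<And>g. H1 g \<Longrightarrow> g v = g w) \<Longrightarrow> v = w"
  by (rule linear_forms_separate[OF vector_space_axioms])

lemma A_act_lin: "lin E \<Longrightarrow> lin (\<lambda>a. A_act (E a) v)" "lin E \<Longrightarrow> lin (\<lambda>a. A_act h (E a))"
proof -
  have 1: "A_act (a + b) v = A_act a v + A_act b v" "A_act (scale c a) v = scale c (A_act a v)"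
    "A_act h (a + b) = A_act h a + A_act h b" "A_act h (scale c a) = scale c (A_act h a)" for a b c v h
    using rrepD(5)[OF ract_adjoint] rrepD(4)[OF ract_adjoint]
    by (auto intro!: form_eqI simp: A_act_form H1_iff)
  show "lin E \<Longrightarrow> lin (\<lambda>a. A_act (E a) v)" "lin E \<Longrightarrow> lin (\<lambda>a. A_act h (E a))"
    by (simp_all add: lin_def 1)
qed

lemma A_act_one: "A_act 1 v = v"
  by (rule form_eqI) (simp add: A_act_form rrepD(6)[OF ract_adjoint])

lemma A_act_mult: "A_act (g * h) v = A_act g (A_act h v)"
proof (rule form_eqI)
  fix f assume f: "H1 f"
  show "f (A_act (g * h) v) = f (A_act g (A_act h v))"
    using A_act_form[OF rrepD(4)[OF ract_adjoint, OF f]] by (simp add: A_act_form[OF f] rrepD(7)[OF ract_adjoint, OF f])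
qed

lemma tcomult_CHI_form: "H2 F \<Longrightarrow> H1 (tcomult (CHI k1 k2 k3 k4 F))"
  by (rule lopD(1)[OF lop_tcomult, OF lopD(1)[OF lop_CHI[OF cact_k]]])

lemma A_coact_linear: "A_coact (a + b) = A_coact a + A_coact b" "A_coact (scale c a) = tscale c (A_coact a)"
proof -
  show "A_coact (a + b) = A_coact a + A_coact b"
  proof
    fix F show "A_coact (a + b) F = (A_coact a + A_coact b) F"
      using tcomult_CHI_form[of F] A_coact_apply[of F] tprod_outside[OF A_coact_in, of F]
      by (cases "H2 F") (simp_all add: H1_iff)
  qed
  show "A_coact (scale c a) = tscale c (A_coact a)"
  proof
    fix F show "A_coact (scale c a) F = tscale c (A_coact a) F"
      using tcomult_CHI_form[of F] A_coact_apply[of F] tprod_outside[OF A_coact_in, of F]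
      by (cases "H2 F") (simp_all add: H1_iff fscale_def)
  qed
qed

lemma H1_A_coact: "lin E \<Longrightarrow> H1 (\<lambda>w. A_coact (E w) F)"
  by (simp add: H1_iff lin_def A_coact_linear fscale_def)

lemma lfun_A_coact: "lfun H2 (A_coact v)"
  by (rule lfun_tprod[OF A_coact_in form_space_H(2)])

text \<open>The adjoint action of h puts the bracketing (12)(34) on \<open>CHI F\<close>, and
  \<open>CHI_conv\<close> makes it (1(23))4 on F. This is the shape of the Yetter-Drinfeld
  condition: 1 and 4 surround the first component, and 23 is the action on the second.\<close>

lemma A_coact_act_conv:
  assumes F: "H2 F"
  shows "A_coact (A_act h v) F = A_coact v (((k1 \<star> (k2 \<star> k3)) \<star> k4) h F)"
proof -
  let ?C = "CHI k1 k2 k3 k4"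
  have C: "H2 (?C F)" by (rule lopD(1)[OF lop_CHI[OF cact_k], OF F])
  have r: "ract H2 (k1 \<star> (k2 \<star> k3))" "ract H2 k4" "comm H2 (k1 \<star> (k2 \<star> k3)) k4"
    and c: "ract H2 (k3 \<star> k4)" "comm H2 diag (k3 \<star> k4)"
    using cact_conv_outer[OF cact_k] cact_conv[OF cact_k] cact_k by (auto simp: conv_simps)
  have G: "H2 (((k1 \<star> (k2 \<star> k3)) \<star> k4) h F)" by (rule rrepD(4)[OF ract_conv[OF r], OF F])
  have "A_coact (A_act h v) F = (lmul \<star> rmulS) h (tcomult (?C F)) v"
    unfolding A_coact_apply[OF F] by (rule A_act_form[OF tcomult_CHI_form[OF F]])
  also have "\<dots> = tcomult ((diag \<star> (k3 \<star> k4)) h (?C F)) v"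
    using conv_intertwine[OF diag_ract c lop_tcomult, OF C tcomult_left tcomult_right, of h] by simp
  also have "\<dots> = A_coact v (((k1 \<star> (k2 \<star> k3)) \<star> k4) h F)"
    unfolding A_coact_apply[OF G] CHI_conv(1)[OF cact_k, OF F] ..
  finally show ?thesis .
qed

lemma A_coact_act:
  assumes F: "H2 F"
  shows "A_coact (A_act h v) F = \<Delta> h (\<lambda>(h1, h2). \<Delta> h1 (\<lambda>(u1, u2). A_coact v (\<lambda>(x, w). F (u1 * x * S h2, A_act u2 w))))"
proof -
  have r: "ract H2 (k1 \<star> (k2 \<star> k3))" "ract H2 (k2 \<star> k3)" "ract H2 k1" "ract H2 k4" "comm H2 (k1 \<star> (k2 \<star> k3)) k4"
    "comm H2 k1 (k2 \<star> k3)"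
    using cact_conv_outer[OF cact_k] cact_conv[OF cact_k] cact_k by auto
  have r4: "H2 (k4 h2 F)" for h2 by (rule rrepD(4)[OF r(4), OF F])
  have p: "lop H2 (\<lambda>_. True) (\<lambda>f (_::unit). A_coact v f)" using lfun_A_coact by (simp add: lfun_iff_lop)
  have "A_coact (A_act h v) F = A_coact v (((k1 \<star> (k2 \<star> k3)) \<star> k4) h F)"
    by (rule A_coact_act_conv[OF F])
  also have "\<dots> = \<Delta> h (\<lambda>(h1, h2). A_coact v ((k1 \<star> (k2 \<star> k3)) h1 (k4 h2 F)))"
    using conv_eval[OF r(1,4,5) p, OF F] by simp
  also have "\<dots> = \<Delta> h (\<lambda>(h1, h2). \<Delta> h1 (\<lambda>(u1, u2). A_coact v (k1 u1 ((k2 \<star> k3) u2 (k4 h2 F)))))"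
    using conv_eval[OF r(3,2,6) p, OF r4] by simp
  also have "\<dots> = \<Delta> h (\<lambda>(h1, h2). \<Delta> h1 (\<lambda>(u1, u2). A_coact v (\<lambda>(x, w). F (u1 * x * S h2, A_act u2 w))))"
  proof -
    have "k1 u1 ((k2 \<star> k3) u2 (k4 h2 F)) = (\<lambda>(x, w). F (u1 * x * S h2, A_act u2 w))" for u1 u2 h2
    proof (rule ext, clarify)
      fix x w
      have "H1 (\<lambda>w. F (u1 * x * S h2, w))" by (simp add: lins H2_args[OF F])
      from A_act_form[OF this] show "k1 u1 ((k2 \<star> k3) u2 (k4 h2 F)) (x, w) = F (u1 * x * S h2, A_act u2 w)"
        by (simp add: conv_apply pull_def lm_def rm_def)
    qed
    then show ?thesis by simp
  qed
  finally show ?thesis .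
qed

section \<open>Coassociativity of the twisted comultiplication\<close>

abbreviation "t1 \<equiv> pull (fst_act lm)"
abbreviation "t2 \<equiv> pull (snd_act (fst_act lm))"
abbreviation "t3 \<equiv> pull (snd_act (snd_act lm))"
abbreviation "t4 \<equiv> pull (snd_act (snd_act rm))"
abbreviation "t5 \<equiv> pull (snd_act (fst_act rm))"
abbreviation "t6 \<equiv> pull (fst_act rm)"

lemma cact_t: "cact H3 [t1, t2, t3, t4, t5, t6]"
  by (auto intro!: ract_pull comm_pull simp: lm_rm_comm)

lemma t_facts:
  "ract H3 t1" "ract H3 t2" "ract H3 t3" "ract H3 t4" "ract H3 t5" "ract H3 t6"
  "comm H3 t1 t2" "comm H3 t1 t3" "comm H3 t1 t4" "comm H3 t1 t5" "comm H3 t1 t6"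
  "comm H3 t2 t3" "comm H3 t2 t4" "comm H3 t2 t5" "comm H3 t2 t6" "comm H3 t3 t4" "comm H3 t3 t5"
  "comm H3 t3 t6" "comm H3 t4 t5" "comm H3 t4 t6" "comm H3 t5 t6"
  using cact_t by simp_all

lemmas t_simps = t_facts t_facts(7-21)[THEN comm_sym] conv_simps

definition tcomult_snd :: "('h \<times> 'h \<times> 'h \<Rightarrow> 'k) \<Rightarrow> 'h \<times> 'h \<Rightarrow> 'k" where
  "tcomult_snd F = (\<lambda>(x, w). tcomult (\<lambda>q. F (x, q)) w)"
definition tcomult_fst :: "('h \<times> 'h \<times> 'h \<Rightarrow> 'k) \<Rightarrow> 'h \<times> 'h \<Rightarrow> 'k" where
  "tcomult_fst F = (\<lambda>(x, w). tcomult (\<lambda>(p, q). F (p, q, w)) x)"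
definition fix_fst :: "'h \<Rightarrow> ('h \<times> 'h \<times> 'h \<Rightarrow> 'k) \<Rightarrow> 'h \<times> 'h \<Rightarrow> 'k" where
  "fix_fst x F = (\<lambda>q. F (x, q))"
definition fix_thd :: "'h \<Rightarrow> ('h \<times> 'h \<times> 'h \<Rightarrow> 'k) \<Rightarrow> 'h \<times> 'h \<Rightarrow> 'k" where
  "fix_thd w F = (\<lambda>(p, q). F (p, q, w))"

lemma lop_fix_fst: "lop H3 H2 (fix_fst x)" and lop_fix_thd: "lop H3 H2 (fix_thd x)"
  by (auto simp: lop_def fix_fst_def fix_thd_def mlin_form_def)

lemma tcomult_parts_apply: "tcomult_snd F (x, w) = tcomult (fix_fst x F) w" "tcomult_fst F (x, w) = tcomult (fix_thd w F) x"
  by (simp_all add: tcomult_snd_def tcomult_fst_def fix_fst_def fix_thd_def)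

lemma lop_tcomult_snd: "lop H3 H2 tcomult_snd"
proof -
  have p: "lop H3 H1 (\<lambda>F. tcomult (fix_fst x F))" for x by (rule lop_comp[OF lop_fix_fst lop_tcomult])
  have "H2 (tcomult_snd F)" if F: "H3 F" for F
  proof -
    have "tcomult (fix_fst (a + b) F) w = tcomult (fix_fst a F) w + tcomult (fix_fst b F) w" for a b w
    proof -
      have "fix_fst (a + b) F = (\<lambda>q. fix_fst a F q + fix_fst b F q)"
        using F by (auto simp: fix_fst_def mlin_form_def H1_iff)
      then show ?thesis using lopD(2)[OF lop_tcomult, OF lopD(1)[OF lop_fix_fst, OF F] lopD(1)[OF lop_fix_fst, OF F]] by simp
    qed
    moreover have "tcomult (fix_fst (scale c a) F) w = c * tcomult (fix_fst a F) w" for a c w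
    proof -
      have "fix_fst (scale c a) F = (\<lambda>q. c * fix_fst a F q)"
        using F by (auto simp: fix_fst_def mlin_form_def H1_iff)
      then show ?thesis using lopD(3)[OF lop_tcomult, OF lopD(1)[OF lop_fix_fst, OF F]] by simp
    qed
    ultimately show ?thesis
      using lopD(1)[OF p, OF F] by (simp add: mlin_form_def tcomult_parts_apply) (simp add: H1_iff)
  qed
  then show ?thesis
    using lopD(2,3)[OF p] by (auto simp: lop_def tcomult_parts_apply)
qed

lemma lop_tcomult_fst: "lop H3 H2 tcomult_fst"
proof -
  have p: "lop H3 H1 (\<lambda>F. tcomult (fix_thd x F))" for x by (rule lop_comp[OF lop_fix_thd lop_tcomult])
  have "H2 (tcomult_fst F)" if F: "H3 F" for F
  proof -
    have "tcomult (fix_thd (a + b) F) w = tcomult (fix_thd a F) w + tcomult (fix_thd b F) w" for a b w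
    proof -
      have "fix_thd (a + b) F = (\<lambda>q. fix_thd a F q + fix_thd b F q)"
        using F by (auto simp: fix_thd_def mlin_form_def H1_iff)
      then show ?thesis using lopD(2)[OF lop_tcomult, OF lopD(1)[OF lop_fix_thd, OF F] lopD(1)[OF lop_fix_thd, OF F]] by simp
    qed
    moreover have "tcomult (fix_thd (scale c a) F) w = c * tcomult (fix_thd a F) w" for a c w
    proof -
      have "fix_thd (scale c a) F = (\<lambda>q. c * fix_thd a F q)"
        using F by (auto simp: fix_thd_def mlin_form_def H1_iff)
      then show ?thesis using lopD(3)[OF lop_tcomult, OF lopD(1)[OF lop_fix_thd, OF F]] by simp
    qed
    ultimately show ?thesis
      using lopD(1)[OF p, OF F] by (simp add: mlin_form_def tcomult_parts_apply) (simp add: H1_iff)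
  qed
  then show ?thesis
    using lopD(2,3)[OF p] by (auto simp: lop_def tcomult_parts_apply)
qed

text \<open>Splitting a factor doubles its strands: here 2 comes from 23 and 3 from 45, and for the
  first factor 1 comes from 12 and 4 from 56. This is the source of the bracketings in
  \<open>CHI_coherence\<close>.\<close>

lemma tcomult_snd_intertwine:
  assumes F: "H3 F"
  shows "tcomult_snd (t1 h F) = k1 h (tcomult_snd F)" "tcomult_snd ((t2 \<star> t3) h F) = k2 h (tcomult_snd F)"
    "tcomult_snd ((t4 \<star> t5) h F) = k3 h (tcomult_snd F)" "tcomult_snd (t6 h F) = k4 h (tcomult_snd F)"
proof -
  have s: "H2 (fix_fst x F)" for x by (rule lopD(1)[OF lop_fix_fst, OF F])
  show "tcomult_snd (t1 h F) = k1 h (tcomult_snd F)" "tcomult_snd (t6 h F) = k4 h (tcomult_snd F)"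
    by (auto simp: tcomult_snd_def pull_def)
  have "fix_fst x ((t2 \<star> t3) h F) = diag h (fix_fst x F)" "fix_fst x ((t4 \<star> t5) h F) = (k3 \<star> k4) h (fix_fst x F)" for x
    by (auto simp: fix_fst_def conv_apply pull_def fun_eq_iff)
  then show "tcomult_snd ((t2 \<star> t3) h F) = k2 h (tcomult_snd F)" "tcomult_snd ((t4 \<star> t5) h F) = k3 h (tcomult_snd F)"
    by (intro ext; clarsimp simp: tcomult_parts_apply pull_def tcomult_left[OF s] tcomult_right[OF s])+
qed

lemma tcomult_fst_intertwine:
  assumes F: "H3 F"
  shows "tcomult_fst ((t1 \<star> t2) h F) = k1 h (tcomult_fst F)" "tcomult_fst (t3 h F) = k2 h (tcomult_fst F)"
    "tcomult_fst (t4 h F) = k3 h (tcomult_fst F)" "tcomult_fst ((t5 \<star> t6) h F) = k4 h (tcomult_fst F)"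
proof -
  have s: "H2 (fix_thd x F)" for x by (rule lopD(1)[OF lop_fix_thd, OF F])
  show "tcomult_fst (t3 h F) = k2 h (tcomult_fst F)" "tcomult_fst (t4 h F) = k3 h (tcomult_fst F)"
    by (auto simp: tcomult_fst_def pull_def)
  have "fix_thd x ((t1 \<star> t2) h F) = diag h (fix_thd x F)" "fix_thd x ((t5 \<star> t6) h F) = (k3 \<star> k4) h (fix_thd x F)" for x
    by (auto simp: fix_thd_def conv_apply pull_def fun_eq_iff)
  then show "tcomult_fst ((t1 \<star> t2) h F) = k1 h (tcomult_fst F)" "tcomult_fst ((t5 \<star> t6) h F) = k4 h (tcomult_fst F)"
    by (intro ext; clarsimp simp: tcomult_parts_apply pull_def tcomult_left[OF s] tcomult_right[OF s])+
qed

lemma cact_t_conv: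
  "cact H3 [t1, t2 \<star> t3, t4 \<star> t5, t6]" "cact H3 [t2, t3, t4, t5]" "cact H3 [t1 \<star> t2, t3, t4, t5 \<star> t6]"
  "cact H3 [t1, t2 \<star> (t3 \<star> t4), t5, t6]" "cact H3 [t1, t2, t5, t6]" "cact H3 [t1, t2, t3 \<star> t4]"
  "cact H3 [t1, t2, t3]" "cact H3 [t4, t5, t6]" "cact H3 [t1 \<star> (t2 \<star> (t3 \<star> t4)), t5, t6]" "cact H3 [t1 \<star> t2, t5, t6]"
  "cact H3 [t1, t2 \<star> (t3 \<star> t4), t5]" "cact H3 [t1, t2, t5]" "cact H3 [t2, t3 \<star> t4]"
  "cact H3 [t1, t2 \<star> (t3 \<star> t4)]" "cact H3 [t1, t2]"
  by (simp_all add: t_simps)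

lemma coherence_shifted:
  assumes F: "H3 F"
  shows "PHI \<phi> t1 t2 t3 (PHI \<phi>i t4 t5 t6 (CHI t1 (t2 \<star> t3) (t4 \<star> t5) t6 (CHI t2 t3 t4 t5 F))) =
    CHI (t1 \<star> t2) t3 t4 (t5 \<star> t6) (PHI \<phi> t1 t2 (t3 \<star> t4) (CHI t1 (t2 \<star> (t3 \<star> t4)) t5 t6 F))"
proof -
  note c = cact_t_conv
  define Y where "Y = CHI (t1 \<star> t2) t3 t4 (t5 \<star> t6) (PHI \<phi> t1 t2 (t3 \<star> t4) (CHI t1 (t2 \<star> (t3 \<star> t4)) t5 t6 F))"
  have Y: "H3 Y" unfolding Y_def
    by (rule lopD(1)[OF lop_CHI[OF c(3)], OF PHI_closed[OF c(6) assoc_in, OF lopD(1)[OF lop_CHI[OF c(4)], OF F]]])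
  have Y4: "H3 (PHI \<phi> t4 t5 t6 Y)" by (rule PHI_closed[OF c(8) assoc_in, OF Y])
  have cm: "PHI \<phi>i t4 t5 t6 (PHI \<phi>i t1 t2 t3 (PHI \<phi> t4 t5 t6 Y)) = PHI \<phi>i t1 t2 t3 (PHI \<phi>i t4 t5 t6 (PHI \<phi> t4 t5 t6 Y))"
    by (rule PHI_PHI_comm[OF c(8) phii_in c(7) phii_in, OF Y4]) (simp add: t_simps)
  show ?thesis
    unfolding CHI_coherence[OF cact_t, OF F] Y_def[symmetric] cm PHI_inverse(2)[OF c(8), OF Y]
    by (rule PHI_inverse(1)[OF c(7), OF Y])
qed

lemma beta3_absorbs: "absorbs H3 (\<lambda>K. K (\<beta>, \<beta>, \<beta>)) (t3 \<star> t4)"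
  unfolding absorbs_def
proof (intro allI impI)
  fix h and f :: "'h \<times> 'h \<times> 'h \<Rightarrow> 'k" assume f: "H3 f"
  have "H1 (\<lambda>x. f (\<beta>, \<beta>, x))" by (simp add: lins H3_args[OF f])
  from comult_beta[OF this, of h] show "(t3 \<star> t4) h f (\<beta>, \<beta>, \<beta>) = \<epsilon> h * f (\<beta>, \<beta>, \<beta>)"
    by (simp add: conv_apply pull_def lm_def rm_def mult.assoc)
qed

text \<open>Evaluation at three copies of \<beta> absorbs 34, and continues to do so after operators
  that commute with 34. Once 34 is deleted, \<open>CHI\<close> and \<open>CHIi\<close> in the
  strands 1, 2, 5, 6 cancel.\<close>

lemma beta3_cancel:
  assumes E: "H3 E"
  shows "CHIi t1 t2 t5 t6 (PHI \<phi> t1 t2 (t3 \<star> t4) (CHI t1 (t2 \<star> (t3 \<star> t4)) t5 t6 E)) (\<beta>, \<beta>, \<beta>) = E (\<beta>, \<beta>, \<beta>)"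
proof -
  note c = cact_t_conv
  let ?N = "\<lambda>K. CHIi t1 t2 t5 t6 K (\<beta>, \<beta>, \<beta>)"
  have N: "lfun H3 ?N" by (rule lfun_lop_apply[OF lop_CHIi[OF c(5)]])
  have r34: "ract H3 (t3 \<star> t4)" by (simp add: t_simps)
  have com: "comm H3 t1 (t3 \<star> t4)" "comm H3 t2 (t3 \<star> t4)" "comm H3 t5 (t3 \<star> t4)" "comm H3 t6 (t3 \<star> t4)"
    "comm H3 (t1 \<star> t2) (t3 \<star> t4)"
    by (simp_all add: t_simps)
  have Nab: "absorbs H3 ?N (t3 \<star> t4)"
  proof (rule absorbs_comp[OF beta3_absorbs])
    fix h f assume f: "H3 f"
    show "H3 (CHIi t1 t2 t5 t6 f)" by (rule lopD(1)[OF lop_CHIi[OF c(5)], OF f])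
    show "CHIi t1 t2 t5 t6 ((t3 \<star> t4) h f) = (t3 \<star> t4) h (CHIi t1 t2 t5 t6 f)"
      by (rule CHI_intertwine(2)[OF c(5) rrepD(3)[OF r34], OF f, symmetric])
        (simp_all add: commD[OF com(1)] commD[OF com(2)] commD[OF com(3)] commD[OF com(4)])
  qed
  define M where "M = CHI t1 (t2 \<star> (t3 \<star> t4)) t5 t6 E"
  have M: "H3 M" unfolding M_def by (rule lopD(1)[OF lop_CHI[OF c(4)], OF E])
  have 1: "?N (PHI \<phi> t1 t2 (t3 \<star> t4) M) = ?N M"
    by (rule PHI_absorb_functional(3)[OF c(6) N, OF M _ Nab]) simp
  define P1 where "P1 = PHI \<phi> t1 (t2 \<star> (t3 \<star> t4)) t5 E"
  have P1: "H3 P1" unfolding P1_def by (rule PHI_closed[OF c(11) assoc_in, OF E])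
  have 2: "?N M = ?N (PHI \<phi>i (t1 \<star> t2) t5 t6 P1)"
    unfolding M_def CHI_def P1_def[symmetric]
  proof (rule PHI_functional_cong[OF c(9) phii_in c(10) N, OF P1])
    fix h f assume f: "H3 f"
    have N1: "lfun H3 (\<lambda>K. ?N (t1 u K))" for u by (rule lfun_lop[OF rrepD(3)[OF t_facts(1)] N])
    have N1ab: "absorbs H3 (\<lambda>K. ?N (t1 u K)) (t3 \<star> t4)" for u
      by (rule absorbs_comp[OF Nab])
        (simp_all add: rrepD(4)[OF t_facts(1)] commD[OF com(1)])
    have r: "ract H3 (t2 \<star> (t3 \<star> t4))" "comm H3 t1 (t2 \<star> (t3 \<star> t4))" by (simp_all add: t_simps)
    have p: "lop H3 (\<lambda>_. True) (\<lambda>f (_::unit). ?N f)" using N by (simp add: lfun_iff_lop)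
    show "?N ((t1 \<star> (t2 \<star> (t3 \<star> t4))) h f) = ?N ((t1 \<star> t2) h f)"
      using conv_eval[OF t_facts(1) r p, OF f] conv_eval[OF t_facts(1,2,7) p, OF f]
        absorbs_conv(2)[OF c(13) N1, OF f N1ab] by simp
  qed (use c in simp_all)
  have 3: "?N (PHI \<phi>i (t1 \<star> t2) t5 t6 P1) = ?N (CHI t1 t2 t5 t6 E)"
  proof -
    let ?M = "\<lambda>K. ?N (PHI \<phi>i (t1 \<star> t2) t5 t6 K)"
    have N2: "lfun H3 ?M" by (rule lfun_lop[OF lop_PHI[OF c(10) phii_in] N])
    have N2ab: "absorbs H3 ?M (t3 \<star> t4)"
    proof (rule absorbs_comp[OF Nab])
      fix h f assume f: "H3 f"
      show "H3 (PHI \<phi>i (t1 \<star> t2) t5 t6 f)" by (rule PHI_closed[OF c(10) phii_in, OF f])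
      show "PHI \<phi>i (t1 \<star> t2) t5 t6 ((t3 \<star> t4) h f) = (t3 \<star> t4) h (PHI \<phi>i (t1 \<star> t2) t5 t6 f)"
        by (rule PHI_comm[OF c(10) phii_in, OF f r34 com(5,3,4), symmetric])
    qed
    show ?thesis
      unfolding P1_def CHI_def
      by (rule PHI_functional_cong[OF c(11) assoc_in c(12) N2, OF E])
        (use absorbs_conv(2)[OF c(13) N2, OF _ N2ab] c in simp_all)
  qed
  show ?thesis
    unfolding M_def[symmetric] 1 2 3 CHI_inverse(1)[OF c(5), OF E] ..
qed

lemma CHI_tcomult_parts:
  assumes F: "H3 F"
  shows "CHI k1 k2 k3 k4 (tcomult_snd F) = tcomult_snd (CHI t1 (t2 \<star> t3) (t4 \<star> t5) t6 F)"
    "CHIi k1 k2 k3 k4 (tcomult_snd F) = tcomult_snd (CHIi t1 (t2 \<star> t3) (t4 \<star> t5) t6 F)"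
    "CHI k1 k2 k3 k4 (tcomult_fst F) = tcomult_fst (CHI (t1 \<star> t2) t3 t4 (t5 \<star> t6) F)"
    "CHIi k1 k2 k3 k4 (tcomult_fst F) = tcomult_fst (CHIi (t1 \<star> t2) t3 t4 (t5 \<star> t6) F)"
  by (rule CHI_intertwine[OF cact_t_conv(1) lop_tcomult_snd, OF F, symmetric], (rule tcomult_snd_intertwine, assumption)+)+
    (rule CHI_intertwine[OF cact_t_conv(3) lop_tcomult_fst, OF F, symmetric], (rule tcomult_fst_intertwine, assumption)+)+

text \<open>Coassociativity holds up to \<phi> on the left and antipodes of the inverse of \<phi> on
  the right; these corrections make both sides equivariant for the same bracketings. At \<beta> both
  iterations unfold to the value of one form at three copies of \<beta>, which is where
  \<open>CHI_coherence\<close> enters.\<close>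

lemma tcomult_coassoc:
  assumes S: "bij S" and F: "H3 F"
  shows "tcomult (tcomult_fst (PHI \<phi> t1 t2 t3 (PHI \<phi>i t4 t5 t6 F))) = tcomult (tcomult_snd F)"
proof (rule eq_if_eq_at_beta[where L = H3 and p = "\<lambda>F. tcomult (tcomult_fst (PHI \<phi> t1 t2 t3 (PHI \<phi>i t4 t5 t6 F)))" and q = "\<lambda>F. tcomult (tcomult_snd F)"
      and J = "t1 \<star> (t2 \<star> t3)" and K = "(t4 \<star> t5) \<star> t6"])
  note c = cact_t_conv
  show "lop H3 H1 (\<lambda>F. tcomult (tcomult_fst (PHI \<phi> t1 t2 t3 (PHI \<phi>i t4 t5 t6 F))))"
    by (rule lop_comp[OF lop_comp[OF lop_comp[OF lop_PHI[OF c(8) phii_in] lop_PHI[OF c(7) assoc_in]] lop_tcomult_fst] lop_tcomult])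
  show "lop H3 H1 (\<lambda>F. tcomult (tcomult_snd F))" by (rule lop_comp[OF lop_tcomult_snd lop_tcomult])
  show J: "ract H3 (t1 \<star> (t2 \<star> t3))" and K: "ract H3 ((t4 \<star> t5) \<star> t6)" by (simp_all add: t_simps)
  fix h F assume F: "H3 F"
  have r: "ract H3 (t2 \<star> t3)" "comm H3 t1 (t2 \<star> t3)" "ract H3 (t4 \<star> t5)" "comm H3 (t4 \<star> t5) t6"
    "ract H3 (t1 \<star> t2)" "comm H3 (t1 \<star> t2) t3" "ract H3 (t5 \<star> t6)" "comm H3 t4 (t5 \<star> t6)"
    and J': "comm H3 t4 (t1 \<star> (t2 \<star> t3))" "comm H3 t5 (t1 \<star> (t2 \<star> t3))" "comm H3 t6 (t1 \<star> (t2 \<star> t3))"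
    and K': "comm H3 t1 (t4 \<star> (t5 \<star> t6))" "comm H3 t2 (t4 \<star> (t5 \<star> t6))" "comm H3 t3 (t4 \<star> (t5 \<star> t6))" "ract H3 (t4 \<star> (t5 \<star> t6))"
    by (simp_all add: t_simps)
  have F4: "H3 (PHI \<phi>i t4 t5 t6 F)" if "H3 F" for F by (rule PHI_closed[OF c(8) phii_in, OF that])
  have F1: "H3 (PHI \<phi> t1 t2 t3 F)" if "H3 F" for F by (rule PHI_closed[OF c(7) assoc_in, OF that])
  have G: "H2 (tcomult_fst F)" "H2 (tcomult_snd F)" if "H3 F" for F by (rule lopD(1)[OF lop_tcomult_fst, OF that] lopD(1)[OF lop_tcomult_snd, OF that])+
  have i1: "tcomult_snd ((t1 \<star> (t2 \<star> t3)) h F) = diag h (tcomult_snd F)" if "H3 F" for F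
    by (rule conv_intertwine[OF t_facts(1) r(1,2) lop_tcomult_snd, OF that]) (rule tcomult_snd_intertwine, assumption)+
  have i2: "tcomult_snd (((t4 \<star> t5) \<star> t6) h F) = (k3 \<star> k4) h (tcomult_snd F)" if "H3 F" for F
    by (rule conv_intertwine[OF r(3) t_facts(6) r(4) lop_tcomult_snd, OF that]) (rule tcomult_snd_intertwine, assumption)+
  have i3: "tcomult_fst (((t1 \<star> t2) \<star> t3) h F) = diag h (tcomult_fst F)" if "H3 F" for F
    by (rule conv_intertwine[OF r(5) t_facts(3) r(6) lop_tcomult_fst, OF that]) (rule tcomult_fst_intertwine, assumption)+
  have i4: "tcomult_fst ((t4 \<star> (t5 \<star> t6)) h F) = (k3 \<star> k4) h (tcomult_fst F)" if "H3 F" for F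
    by (rule conv_intertwine[OF t_facts(4) r(7,8) lop_tcomult_fst, OF that]) (rule tcomult_fst_intertwine, assumption)+
  show "tcomult (tcomult_snd ((t1 \<star> (t2 \<star> t3)) h F)) = lmul h (tcomult (tcomult_snd F))"
    using tcomult_left[OF G(2)[OF F], of h] i1[OF F] by simp
  show "tcomult (tcomult_snd (((t4 \<star> t5) \<star> t6) h F)) = rmulS h (tcomult (tcomult_snd F))"
    using tcomult_right[OF G(2)[OF F], of h] i2[OF F] by simp
  let ?F = "PHI \<phi> t1 t2 t3 (PHI \<phi>i t4 t5 t6 F)"
  have e1: "PHI \<phi> t1 t2 t3 (PHI \<phi>i t4 t5 t6 ((t1 \<star> (t2 \<star> t3)) h F)) = ((t1 \<star> t2) \<star> t3) h ?F"
    unfolding PHI_comm[OF c(8) phii_in, OF F J J', symmetric] quasi_coassoc_act(1)[OF c(7), OF F4[OF F]] ..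
  have e2: "PHI \<phi> t1 t2 t3 (PHI \<phi>i t4 t5 t6 (((t4 \<star> t5) \<star> t6) h F)) = (t4 \<star> (t5 \<star> t6)) h ?F"
    unfolding quasi_coassoc_act(2)[OF c(8), OF F, symmetric]
    by (rule PHI_comm[OF c(7) assoc_in, OF F4[OF F] K'(4,1,2,3), symmetric])
  show "tcomult (tcomult_fst (PHI \<phi> t1 t2 t3 (PHI \<phi>i t4 t5 t6 ((t1 \<star> (t2 \<star> t3)) h F)))) = lmul h (tcomult (tcomult_fst ?F))"
    unfolding e1 i3[OF F1[OF F4[OF F]]]
    by (rule tcomult_left[OF G(1)[OF F1[OF F4[OF F]]]])
  show "tcomult (tcomult_fst (PHI \<phi> t1 t2 t3 (PHI \<phi>i t4 t5 t6 (((t4 \<star> t5) \<star> t6) h F)))) = rmulS h (tcomult (tcomult_fst ?F))"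
    unfolding e2 i4[OF F1[OF F4[OF F]]]
    by (rule tcomult_right[OF G(1)[OF F1[OF F4[OF F]]]])
  \<comment> \<open>The form reached when the value at \<beta> is computed twice, first for the
    whole and then for the second factor.\<close>
  define E where "E = CHIi t2 t3 t4 t5 (CHIi t1 (t2 \<star> t3) (t4 \<star> t5) t6 F)"
  have R: "H3 (CHIi t1 (t2 \<star> t3) (t4 \<star> t5) t6 F)" by (rule lopD(1)[OF lop_CHIi[OF c(1)], OF F])
  have E: "H3 E" unfolding E_def by (rule lopD(1)[OF lop_CHIi[OF c(2)], OF R])
  have XE: "CHI t1 (t2 \<star> t3) (t4 \<star> t5) t6 (CHI t2 t3 t4 t5 E) = F"
    unfolding E_def CHI_inverse(2)[OF c(2), OF R] by (rule CHI_inverse(2)[OF c(1), OF F])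
  define Y where "Y = PHI \<phi> t1 t2 (t3 \<star> t4) (CHI t1 (t2 \<star> (t3 \<star> t4)) t5 t6 E)"
  have Y: "H3 Y" unfolding Y_def
    by (rule PHI_closed[OF c(6) assoc_in, OF lopD(1)[OF lop_CHI[OF c(4)], OF E]])
  have FY: "?F = CHI (t1 \<star> t2) t3 t4 (t5 \<star> t6) Y"
    using coherence_shifted[OF E] by (simp add: XE Y_def)
  have q: "tcomult (tcomult_snd F) \<beta> = E (\<beta>, \<beta>, \<beta>)"
  proof -
    have s: "H2 (fix_fst \<beta> (CHIi t1 (t2 \<star> t3) (t4 \<star> t5) t6 F))" by (rule lopD(1)[OF lop_fix_fst, OF R])
    have "tcomult (tcomult_snd F) \<beta> = CHIi k1 k2 k3 k4 (tcomult_snd F) (\<beta>, \<beta>)" by (rule tcomult_beta[OF G(2)[OF F]])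
    also have "\<dots> = tcomult (fix_fst \<beta> (CHIi t1 (t2 \<star> t3) (t4 \<star> t5) t6 F)) \<beta>"
      unfolding CHI_tcomult_parts(2)[OF F] tcomult_parts_apply ..
    also have "\<dots> = CHIi k1 k2 k3 k4 (fix_fst \<beta> (CHIi t1 (t2 \<star> t3) (t4 \<star> t5) t6 F)) (\<beta>, \<beta>)" by (rule tcomult_beta[OF s])
    also have "\<dots> = fix_fst \<beta> E (\<beta>, \<beta>)"
    proof -
      have "fix_fst \<beta> E = CHIi k1 k2 k3 k4 (fix_fst \<beta> (CHIi t1 (t2 \<star> t3) (t4 \<star> t5) t6 F))"
        unfolding E_def by (rule CHI_intertwine(2)[OF c(2) lop_fix_fst, OF R]) (auto simp: fix_fst_def pull_def)
      then show ?thesis by simp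
    qed
    finally show ?thesis by (simp add: fix_fst_def)
  qed
  \<comment> \<open>Here the first unfolding undoes \<open>CHI\<close> on 12, 3, 4, 56 and the
    second, in the first factor, involves 1, 2, 5, 6. Coherence supplies the former and
    \<open>beta3_cancel\<close> the latter.\<close>
  have p: "tcomult (tcomult_fst ?F) \<beta> = E (\<beta>, \<beta>, \<beta>)"
  proof -
    have F': "H3 ?F" by (rule F1[OF F4[OF F]])
    have Yc: "CHIi (t1 \<star> t2) t3 t4 (t5 \<star> t6) ?F = Y"
      unfolding FY by (rule CHI_inverse(1)[OF c(3), OF Y])
    have s: "H2 (fix_thd \<beta> Y)" by (rule lopD(1)[OF lop_fix_thd, OF Y])
    have "tcomult (tcomult_fst ?F) \<beta> = CHIi k1 k2 k3 k4 (tcomult_fst ?F) (\<beta>, \<beta>)" by (rule tcomult_beta[OF G(1)[OF F']])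
    also have "\<dots> = tcomult (fix_thd \<beta> Y) \<beta>"
      unfolding CHI_tcomult_parts(4)[OF F'] tcomult_parts_apply Yc ..
    also have "\<dots> = CHIi k1 k2 k3 k4 (fix_thd \<beta> Y) (\<beta>, \<beta>)" by (rule tcomult_beta[OF s])
    also have "\<dots> = fix_thd \<beta> (CHIi t1 t2 t5 t6 Y) (\<beta>, \<beta>)"
    proof -
      have "fix_thd \<beta> (CHIi t1 t2 t5 t6 Y) = CHIi k1 k2 k3 k4 (fix_thd \<beta> Y)"
        by (rule CHI_intertwine(2)[OF c(5) lop_fix_thd, OF Y]) (auto simp: fix_thd_def pull_def)
      then show ?thesis by simp
    qed
    also have "\<dots> = E (\<beta>, \<beta>, \<beta>)"
      using beta3_cancel[OF E] by (simp add: fix_thd_def Y_def)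
    finally show ?thesis .
  qed
  show "tcomult (tcomult_fst ?F) \<beta> = tcomult (tcomult_snd F) \<beta>" unfolding p q ..
qed (rule S, rule F)

section \<open>The element \<omega> and coassociativity of the coaction\<close>

lemma H5_simps: "form_space H5" "mult_stable H5"
  by (simp_all add: form_space_mlin_form vector_space_axioms mult_stable_mlin_form)

lemma adjoint_third_apply:
  assumes "H3 f"
  shows "(t3 \<star> t4) h f (p, q, w) = f (p, q, A_act h w)"
proof -
  have "H1 (\<lambda>w. f (p, q, w))" by (simp add: lins H3_args[OF assms])
  from A_act_form[OF this] show ?thesis by (simp add: conv_apply pull_def lm_def rm_def)
qed

text \<open>The part of \<open>\<omega>\<close> without the twist f, acting on forms in three variables.\<close>

definition coassoc_form :: "('h \<times> 'h \<times> 'h \<Rightarrow> 'k) \<Rightarrow> 'h \<times> 'h \<times> 'h \<Rightarrow> 'k" where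
  "coassoc_form f = PHI \<phi> t1 t2 (t3 \<star> t4) (CHI t1 (t2 \<star> (t3 \<star> t4)) t5 t6 f)"

lemma coassoc_form_closed: "H3 f \<Longrightarrow> H3 (coassoc_form f)"
  unfolding coassoc_form_def
  by (rule PHI_closed[OF cact_t_conv(6) assoc_in, OF lopD(1)[OF lop_CHI[OF cact_t_conv(4)]]])

lemma coassoc_form_apply:
  assumes f: "H3 f"
  shows "coassoc_form f (p, q, w) = \<chi> (\<lambda>(c1, c2, c3, c4). \<Delta> c2 (\<lambda>(u1, u2). \<phi> (\<lambda>(x1, x2, x3).
    f (c1 * x1 * p * S c4, u1 * x2 * q * S c3, A_act u2 (A_act x3 w)))))"
proof -
  note c = cact_t_conv
  let ?Q = "rpair t1 (rpair (t2 \<star> (t3 \<star> t4)) (rpair t5 t6))"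
  let ?p = "PHI \<phi> t1 t2 (t3 \<star> t4)"
  have Q: "rrep H3 H4 ?Q" by (rule rrep4) (use c(4) in auto)
  have p: "lop H3 H3 ?p" by (rule lop_PHI[OF c(6) assoc_in])
  have p1: "lop H3 H3 (\<lambda>g. ?p (t1 c1 g))" for c1 by (rule lop_comp[OF rrepD(3)[OF t_facts(1)] p])
  have r: "ract H3 (t3 \<star> t4)" "comm H3 t2 (t3 \<star> t4)" by (simp_all add: t_simps)
  have cl: "H3 g \<Longrightarrow> H3 (t1 h g)" "H3 g \<Longrightarrow> H3 (t2 h g)" "H3 g \<Longrightarrow> H3 ((t3 \<star> t4) h g)"
    "H3 g \<Longrightarrow> H3 (t5 h g)" "H3 g \<Longrightarrow> H3 (t6 h g)" for g h
    by (rule rrepD(4)[OF t_facts(1)] rrepD(4)[OF t_facts(2)] rrepD(4)[OF r(1)] rrepD(4)[OF t_facts(5)]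
        rrepD(4)[OF t_facts(6)], assumption)+
  have 1: "coassoc_form f (p, q, w) = \<chi> (\<lambda>(c1, c2, c3, c4). ?p (t1 c1 ((t2 \<star> (t3 \<star> t4)) c2 (t5 c3 (t6 c4 f)))) (p, q, w))"
    unfolding coassoc_form_def CHI_tact[OF c(4), OF f] lop_tact_eval[OF Q chi_in p, OF f]
    by (simp add: case_prod_unfold)
  have 2: "?p (t1 c1 ((t2 \<star> (t3 \<star> t4)) c2 (t5 c3 (t6 c4 f)))) (p, q, w) =
      \<Delta> c2 (\<lambda>(u1, u2). \<phi> (\<lambda>(x1, x2, x3).
        f (c1 * x1 * p * S c4, u1 * x2 * q * S c3, A_act u2 (A_act x3 w))))" for c1 c2 c3 c4
  proof -
    have g: "H3 (t5 c3 (t6 c4 f))" by (rule cl(4)[OF cl(5)[OF f]])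
    have g1: "H3 (t1 c1 (t2 u1 ((t3 \<star> t4) u2 (t5 c3 (t6 c4 f)))))" for u1 u2
      by (rule cl(1)[OF cl(2)[OF cl(3)[OF g]]])
    have "t1 x1 (t2 x2 ((t3 \<star> t4) x3 (t1 c1 (t2 u1 ((t3 \<star> t4) u2 (t5 c3 (t6 c4 f))))))) (p, q, w) =
       f (c1 * x1 * p * S c4, u1 * x2 * q * S c3, A_act u2 (A_act x3 w))" for x1 x2 x3 u1 u2
    proof -
      have "t1 x1 (t2 x2 ((t3 \<star> t4) x3 (t1 c1 (t2 u1 ((t3 \<star> t4) u2 (t5 c3 (t6 c4 f))))))) (p, q, w) =
        (t3 \<star> t4) x3 (t1 c1 (t2 u1 ((t3 \<star> t4) u2 (t5 c3 (t6 c4 f))))) (x1 * p, x2 * q, w)"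
        by (simp add: pull_def[of "fst_act lm"] pull_def[of "snd_act (fst_act lm)"] lm_def)
      also have "\<dots> = (t3 \<star> t4) u2 (t5 c3 (t6 c4 f)) (c1 * (x1 * p), u1 * (x2 * q), A_act x3 w)"
        unfolding adjoint_third_apply[OF g1]
        by (simp add: pull_def[of "fst_act lm"] pull_def[of "snd_act (fst_act lm)"] lm_def)
      also have "\<dots> = f (c1 * x1 * p * S c4, u1 * x2 * q * S c3, A_act u2 (A_act x3 w))"
        unfolding adjoint_third_apply[OF g] by (simp add: pull_def rm_def mult.assoc)
      finally show ?thesis .
    qed
    moreover have "?p (t1 c1 ((t2 \<star> (t3 \<star> t4)) c2 (t5 c3 (t6 c4 f)))) (p, q, w) =
        \<Delta> c2 (\<lambda>(u1, u2). ?p (t1 c1 (t2 u1 ((t3 \<star> t4) u2 (t5 c3 (t6 c4 f))))) (p, q, w))"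
      by (rule conv_eval[OF t_facts(2) r p1, OF g])
    ultimately show ?thesis
      by (simp only: PHI_apply)
  qed
  show ?thesis unfolding 1 2 ..
qed

text \<open>Each coaction is a twisted comultiplication after a \<open>CHI\<close>. Exchanging the
  comultiplications creates exactly the reassociations by which \<open>coherence_shifted\<close>
  exchanges the \<open>CHI\<close> operators. The second coaction has thereby become a
  comultiplication of the first component.\<close>

lemma A_coact_iterated:
  assumes S: "bij S" and f: "H3 f"
  shows "A_coact v (\<lambda>(x, w). A_coact w (\<lambda>(y, u). f (x, y, u))) = A_coact v (tcomult_fst (coassoc_form f))"
proof -
  note c = cact_t_conv
  define K where "K = CHI t2 t3 t4 t5 f"
  have K: "H3 K" unfolding K_def by (rule lopD(1)[OF lop_CHI[OF c(2)], OF f])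
  have "A_coact w (\<lambda>(y, u). f (x, y, u)) = tcomult_snd K (x, w)" for x w
  proof -
    have s: "H2 (fix_fst x f)" by (rule lopD(1)[OF lop_fix_fst, OF f])
    have eq: "(\<lambda>(y, u). f (x, y, u)) = fix_fst x f" by (auto simp: fix_fst_def)
    have "A_coact w (\<lambda>(y, u). f (x, y, u)) = tcomult (CHI k1 k2 k3 k4 (fix_fst x f)) w"
      unfolding eq by (rule A_coact_apply[OF s])
    also have "CHI k1 k2 k3 k4 (fix_fst x f) = fix_fst x K"
      unfolding K_def by (rule CHI_intertwine(1)[OF c(2) lop_fix_fst, OF f, symmetric]) (auto simp: fix_fst_def pull_def)
    finally show ?thesis unfolding tcomult_parts_apply .
  qed
  then have "(\<lambda>(x, w). A_coact w (\<lambda>(y, u). f (x, y, u))) = tcomult_snd K" by (intro ext) (simp only: split_paired_all prod.case)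
  then have "A_coact v (\<lambda>(x, w). A_coact w (\<lambda>(y, u). f (x, y, u))) = A_coact v (tcomult_snd K)" by (rule arg_cong)
  also have "\<dots> = tcomult (tcomult_snd (CHI t1 (t2 \<star> t3) (t4 \<star> t5) t6 K)) v"
    unfolding A_coact_apply[OF lopD(1)[OF lop_tcomult_snd, OF K]] CHI_tcomult_parts(1)[OF K] ..
  also have "\<dots> = tcomult (tcomult_fst (CHI (t1 \<star> t2) t3 t4 (t5 \<star> t6) (coassoc_form f))) v"
    unfolding tcomult_coassoc[OF S lopD(1)[OF lop_CHI[OF c(1)], OF K], symmetric]
    unfolding K_def coherence_shifted[OF f] coassoc_form_def ..
  also have "\<dots> = A_coact v (tcomult_fst (coassoc_form f))"
    unfolding A_coact_apply[OF lopD(1)[OF lop_tcomult_fst, OF coassoc_form_closed[OF f]]] CHI_tcomult_parts(3)[OF coassoc_form_closed[OF f]] ..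
  finally show ?thesis .
qed

lemma tsum_case5: "T \<in> tprod H5 \<Longrightarrow> H5 (\<lambda>(a, b, c, d, e). F a b c d e f) \<Longrightarrow>
    tsum H5 T (\<lambda>(a, b, c, d, e). F a b c d e) f = T (\<lambda>(a, b, c, d, e). F a b c d e f)"
  by (subst tsum_apply; simp add: case_prod_unfold)

lemma H1_tprod5: "T \<in> tprod H5 \<Longrightarrow> (\<And>u v w x y. H1 (\<lambda>a. F a u v w x y)) \<Longrightarrow>
    (\<And>a. H5 (\<lambda>(u, v, w, x, y). F a u v w x y)) \<Longrightarrow> H1 (\<lambda>a. T (\<lambda>(u, v, w, x, y). F a u v w x y))"
  using form_space_eval[of T H5 H1 "\<lambda>a (u, v, w, x, y). F a u v w x y"]
  by (simp_all add: case_prod_unfold)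

lemma omega_factors:
  "tsum H2 ffi (\<lambda>(g1, g2). pten H5 (1, 1, 1, g2, g1)) \<in> tprod H5"
  "tsum H4 \<chi> (\<lambda>(c1, c2, c3, c4). tsum H2 (\<Delta> c2) (\<lambda>(u1, u2). pten H5 (c1, u1, u2, S c3, S c4))) \<in> tprod H5"
  "tsum H3 \<phi> (\<lambda>(x1, x2, x3). pten H5 (x1, x2, x3, 1, 1)) \<in> tprod H5"
  by (auto intro!: tsum_in_tprod comult_in assoc_in ffi_in chi_in pten_in_tprod split: prod.split)

lemma omega_in: "\<omega> \<in> tprod H5"
  unfolding \<omega>_def by (intro tmul_in_tprod omega_factors)

lemma omega_eval:
  assumes K: "H5 K"
  shows "\<omega> K = ffi (\<lambda>(g1, g2). \<chi> (\<lambda>(c1, c2, c3, c4). \<Delta> c2 (\<lambda>(u1, u2). \<phi> (\<lambda>(x1, x2, x3).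
    K (c1 * x1, u1 * x2, u2 * x3, g2 * S c3, g1 * S c4)))))"
proof -
  let ?A = "tsum H2 ffi (\<lambda>(g1, g2). pten H5 (1, 1, 1, g2, g1))"
  let ?B = "tsum H4 \<chi> (\<lambda>(c1, c2, c3, c4). tsum H2 (\<Delta> c2) (\<lambda>(u1, u2). pten H5 (c1, u1, u2, S c3, S c4)))"
  let ?C = "tsum H3 \<phi> (\<lambda>(x1, x2, x3). pten H5 (x1, x2, x3, 1, 1))"
  have A: "?A F = ffi (\<lambda>(g1, g2). F (1, 1, 1, g2, g1))" if F: "H5 F" for F
    by (subst tsum_case(1)[OF ffi_in]) (simp_all add: pten_def lins H5_args[OF F] F)
  have C: "?C F = \<phi> (\<lambda>(x1, x2, x3). F (x1, x2, x3, 1, 1))" if F: "H5 F" for F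
    by (subst tsum_case(2)[OF assoc_in]) (simp_all add: pten_def lins H5_args[OF F] F)
  have B: "?B F = \<chi> (\<lambda>(c1, c2, c3, c4). \<Delta> c2 (\<lambda>(u1, u2). F (c1, u1, u2, S c3, S c4)))" if F: "H5 F" for F
  proof -
    have "tsum H2 (\<Delta> c2) (\<lambda>(u1, u2). pten H5 (c1, u1, u2, S c3, S c4)) F = \<Delta> c2 (\<lambda>(u1, u2). F (c1, u1, u2, S c3, S c4))"
      for c1 c2 c3 c4
      by (subst tsum_case(1)[OF comult_in]) (simp_all add: pten_def lins H5_args[OF F] F)
    then show ?thesis
      by (subst tsum_case(3)[OF chi_in]) (simp_all add: lins H5_args[OF F])
  qed
  note st = mult_stableD[OF H5_simps(2)]
  note ev = tmul_apply[OF H5_simps(2)]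
  have K1: "H5 (\<lambda>m. ?C (\<lambda>t. K (m * t)))"
    by (rule form_space_eval[of ?C H5 H5 "\<lambda>m t. K (m * t)"]) (rule omega_factors H5_simps st[OF K])+
  have K2: "H5 (\<lambda>a. ?B (\<lambda>b. ?C (\<lambda>t. K (a * b * t))))"
    by (rule form_space_eval[of ?B H5 H5 "\<lambda>a b. ?C (\<lambda>t. K (a * b * t))"])
      (rule omega_factors H5_simps st(1)[OF K1] st(2)[OF K1])+
  have "\<omega> K = tmul H5 ?A ?B (\<lambda>m. ?C (\<lambda>t. K (m * t)))"
    unfolding \<omega>_def by (rule ev[OF tmul_in_tprod[OF omega_factors(1,2)] omega_factors(3) K H5_simps(1)])
  also have "\<dots> = ?A (\<lambda>a. ?B (\<lambda>b. ?C (\<lambda>t. K (a * b * t))))"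
    by (rule ev[OF omega_factors(1,2) K1 H5_simps(1)])
  also have "\<dots> = ffi (\<lambda>(g1, g2). ?B (\<lambda>b. ?C (\<lambda>t. K ((1, 1, 1, g2, g1) * b * t))))"
    by (rule A[OF K2])
  also have "\<dots> = ffi (\<lambda>(g1, g2). \<chi> (\<lambda>(c1, c2, c3, c4). \<Delta> c2 (\<lambda>(u1, u2).
      ?C (\<lambda>t. K ((1, 1, 1, g2, g1) * (c1, u1, u2, S c3, S c4) * t)))))"
    unfolding B[OF st(2)[OF K1]] ..
  also have "\<dots> = ffi (\<lambda>(g1, g2). \<chi> (\<lambda>(c1, c2, c3, c4). \<Delta> c2 (\<lambda>(u1, u2). \<phi> (\<lambda>(x1, x2, x3).
    K (c1 * x1, u1 * x2, u2 * x3, g2 * S c3, g1 * S c4)))))"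
    unfolding C[OF st(2)[OF K]] by simp
  finally show ?thesis .
qed

text \<open>The twisted comultiplication of the first component contributes
  \<open>\<Delta> x\<close> and the inverse twist, and the latter completes
  \<open>coassoc_form\<close> to the action of \<omega>.\<close>

lemma A_coact_coassoc:
  assumes S: "bij S" and f: "H3 f"
  shows "A_coact v (\<lambda>(x, w). A_coact w (\<lambda>(y, u). f (x, y, u))) =
    A_coact v (\<lambda>(x, w). \<Delta> x (\<lambda>(x1, x2). \<omega> (\<lambda>(o1, o2, o3, o4, o5). f (o1 * x1 * o5, o2 * x2 * o4, A_act o3 w))))"
proof -
  have "tcomult_fst (coassoc_form f) (x, w) = \<Delta> x (\<lambda>(x1, x2). \<omega> (\<lambda>(o1, o2, o3, o4, o5). f (o1 * x1 * o5, o2 * x2 * o4, A_act o3 w)))"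
    for x w
  proof -
    have K: "H5 (\<lambda>(o1, o2, o3, o4, o5). f (o1 * x1 * o5, o2 * x2 * o4, A_act o3 w))" for x1 x2
      by (simp add: lins A_act_lin H3_args[OF f])
    have "tcomult_fst (coassoc_form f) (x, w) = \<Delta> x (\<lambda>(x1, x2). ffi (\<lambda>(g1, g2). coassoc_form f (x1 * g1, x2 * g2, w)))"
      unfolding tcomult_parts_apply tcomult_apply[OF lopD(1)[OF lop_fix_thd, OF coassoc_form_closed[OF f]]]
      by (simp add: fix_thd_def case_prod_unfold times_prod_def)
    also have "\<dots> = \<Delta> x (\<lambda>(x1, x2). \<omega> (\<lambda>(o1, o2, o3, o4, o5). f (o1 * x1 * o5, o2 * x2 * o4, A_act o3 w)))"
      unfolding omega_eval[OF K] by (simp add: coassoc_form_apply[OF f] A_act_mult mult.assoc)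
    finally show ?thesis .
  qed
  then have "tcomult_fst (coassoc_form f) = (\<lambda>(x, w). \<Delta> x (\<lambda>(x1, x2). \<omega> (\<lambda>(o1, o2, o3, o4, o5). f (o1 * x1 * o5, o2 * x2 * o4, A_act o3 w))))"
    by auto
  then show ?thesis unfolding A_coact_iterated[OF S f] by simp
qed

lemma lin_iff: "lin E \<longleftrightarrow> Vector_Spaces.linear scale scale E"
  by (simp add: lin_def Vector_Spaces.linear_iff vector_space_axioms)

text \<open>The first identity is the counit axiom of a Yetter-Drinfeld module. The second, special
  to A, is what lets an endomorphism be recovered from its composite with \<epsilon>.\<close>

lemma A_coact_counit_form:
  assumes "bij S" "H1 g"
  shows "A_coact a (counit_fst g) = g a" "A_coact a (counit_snd g) = g a"
  using A_coact_apply[OF lopD(1)[OF lop_counit_fst, OF assms(2)], of a] A_coact_apply[OF lopD(1)[OF lop_counit_snd, OF assms(2)], of a]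
    CHI_counit[OF assms(2)] tcomult_counit[OF assms] by simp_all

lemma yd_module_A:
  assumes S: "bij S"
  shows "yd_module scale \<Delta> \<epsilon> \<phi> S \<alpha> \<beta> scale A_act A_coact"
proof (intro yd_module.intro yd_module_axioms.intro)
  show "quasi_hopf_algebra scale \<Delta> \<epsilon> \<phi> S \<alpha> \<beta>" "vector_space scale" by unfold_locales
  show "Vector_Spaces.linear scale scale (\<lambda>h. A_act h v)" "Vector_Spaces.linear scale scale (A_act h)" for v h
    using A_act_lin(1)[OF lin_simps(1), of v] A_act_lin(2)[OF lin_simps(1), of h] by (simp_all add: lin_iff)
  show "A_act 1 v = v" "A_act (g * h) v = A_act g (A_act h v)" for g h v
    by (rule A_act_one A_act_mult)+
  show "A_coact v \<in> tprod H2" for v by (rule A_coact_in)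
  show "Vector_Spaces.linear scale tscale A_coact"
    by (simp add: Vector_Spaces.linear_iff vector_space_axioms vector_space_fscale vector_space_mult A_coact_linear)
  show "tsum H2 (A_coact v) (\<lambda>(x, w). scale (\<epsilon> x) w) = v" for v
  proof (rule form_eqI)
    fix g assume g: "H1 g"
    have F: "counit_fst g = (\<lambda>(x, w). g (scale (\<epsilon> x) w))" using g by (auto simp: counit_fst_def H1_iff)
    show "g (tsum H2 (A_coact v) (\<lambda>(x, w). scale (\<epsilon> x) w)) = g v"
      using H1_tsum[OF A_coact_in g, of "\<lambda>x w. scale (\<epsilon> x) w" v] lopD(1)[OF lop_counit_fst, OF g]
        A_coact_counit_form(1)[OF S g, of v]
      unfolding F by simp
  qed
  show "A_coact (A_act h v) = tsum H2 (\<Delta> h) (\<lambda>(h1, h2). tsum H2 (\<Delta> h1) (\<lambda>(u1, u2).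
      tsum H2 (A_coact v) (\<lambda>(x, w). pten H2 (u1 * x * S h2, A_act u2 w))))" (is "_ = ?R") for h v
  proof (rule tprod_ext[of _ H2])
    show "A_coact (A_act h v) \<in> tprod H2" by (rule A_coact_in)
    show "?R \<in> tprod H2"
      by (auto intro!: tsum_in_tprod comult_in A_coact_in pten_in_tprod split: prod.split)
    fix F assume F: "H2 F"
    note l = lins A_act_lin H2_args[OF F] H1_tprod(1)[OF A_coact_in]
    show "A_coact (A_act h v) F = ?R F"
      unfolding A_coact_act[OF F]
      by (simp add: tsum_case comult_in A_coact_in pten_def F l)
  qed
  show "tsum H2 (A_coact v) (\<lambda>(x, w). tsum H2 (A_coact w) (\<lambda>(y, u). pten H3 (x, y, u))) =
      tsum H2 (A_coact v) (\<lambda>(x, w). tsum H2 (\<Delta> x) (\<lambda>(x1, x2). tsum H5 \<omega> (\<lambda>(o1, o2, o3, o4, o5).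
        pten H3 (o1 * x1 * o5, o2 * x2 * o4, A_act o3 w))))" (is "?L = ?R") for v
  proof (rule tprod_ext[of _ H3])
    show "?L \<in> tprod H3" "?R \<in> tprod H3"
      by (auto intro!: tsum_in_tprod comult_in A_coact_in omega_in pten_in_tprod split: prod.split)
    fix f assume f: "H3 f"
    note l = lins A_act_lin H3_args[OF f] H1_tprod(1)[OF A_coact_in] H1_A_coact H1_tprod5[OF omega_in]
    have "?L f = A_coact v (\<lambda>(x, w). A_coact w (\<lambda>(y, u). f (x, y, u)))"
      by (simp add: tsum_case A_coact_in pten_def f l)
    also have "\<dots> = A_coact v (\<lambda>(x, w). \<Delta> x (\<lambda>(x1, x2). \<omega> (\<lambda>(o1, o2, o3, o4, o5). f (o1 * x1 * o5, o2 * x2 * o4, A_act o3 w))))"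
      by (rule A_coact_coassoc[OF S f])
    also have "\<dots> = ?R f"
      by (simp add: tsum_case tsum_case5 A_coact_in comult_in omega_in pten_def f l)
    finally show "?L f = ?R f" .
  qed
qed

section \<open>The algebra CF and the endomorphisms of A\<close>

definition yd_end :: "('h \<Rightarrow> 'k) \<Rightarrow> 'h \<Rightarrow> 'h" where
  "yd_end \<xi> a = tsum H2 (A_coact a) (\<lambda>(x, w). scale (\<xi> w) x)"

abbreviation "EndA \<equiv> yd_homs scale A_act A_coact scale A_act A_coact"

lemma CF_iff: "\<xi> \<in> CF \<longleftrightarrow> H1 \<xi> \<and> (\<forall>h v. \<xi> (A_act h v) = \<epsilon> h * \<xi> v)"
  by (simp add: CF_def module_homs_def triv_act_def linear_form_def)

lemma EndA_iff: "f \<in> EndA \<longleftrightarrow> lin f \<and> (\<forall>h v. f (A_act h v) = A_act h (f v)) \<and>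
    (\<forall>v F. H2 F \<longrightarrow> A_coact (f v) F = A_coact v (\<lambda>(x, u). F (x, f u)))"
proof (cases "lin f")
  case True
  have "A_coact (f v) = tsum H2 (A_coact v) (\<lambda>(x, u). pten H2 (x, f u)) \<longleftrightarrow>
      (\<forall>F. H2 F \<longrightarrow> A_coact (f v) F = A_coact v (\<lambda>(x, u). F (x, f u)))" for v
  proof -
    let ?R = "tsum H2 (A_coact v) (\<lambda>(x, u). pten H2 (x, f u))"
    have in2: "?R \<in> tprod H2"
      by (auto intro!: tsum_in_tprod A_coact_in pten_in_tprod split: prod.split)
    have "?R F = A_coact v (\<lambda>(x, u). F (x, f u))" if F: "H2 F" for F
      by (subst tsum_case(1)[OF A_coact_in]) (simp_all add: pten_def lins H2_args[OF F] True F)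
    then show ?thesis using tprod_ext[OF A_coact_in in2, of "f v"] by auto
  qed
  then show ?thesis using True by (auto simp: yd_homs_def module_homs_def lin_iff)
next
  case False
  then show ?thesis by (simp add: yd_homs_def module_homs_def lin_iff)
qed

lemma H2_prod: "H1 f \<Longrightarrow> H1 g \<Longrightarrow> H2 (\<lambda>(x, w). g w * f x)"
  by (simp add: mlin_form_case H1_iff distrib_left distrib_right)

lemma yd_end_form:
  assumes "H1 g" "H1 \<xi>"
  shows "g (yd_end \<xi> a) = A_coact a (\<lambda>(x, w). \<xi> w * g x)"
  using H1_tsum[OF A_coact_in assms(1), of "\<lambda>x w. scale (\<xi> w) x" a] H2_prod[OF assms] assms(1)
  by (simp add: yd_end_def H1_iff)

lemma lin_yd_end: "H1 \<xi> \<Longrightarrow> lin (yd_end \<xi>)"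
  unfolding lin_def
proof (intro conjI allI)
  assume \<xi>: "H1 \<xi>"
  show "yd_end \<xi> (a + b) = yd_end \<xi> a + yd_end \<xi> b" for a b
  proof (rule form_eqI)
    fix g assume g: "H1 g"
    then show "g (yd_end \<xi> (a + b)) = g (yd_end \<xi> a + yd_end \<xi> b)"
      using yd_end_form[OF g \<xi>] by (simp add: A_coact_linear H1_iff)
  qed
  show "yd_end \<xi> (scale c a) = scale c (yd_end \<xi> a)" for c a
  proof (rule form_eqI)
    fix g assume g: "H1 g"
    then show "g (yd_end \<xi> (scale c a)) = g (scale c (yd_end \<xi> a))"
      using yd_end_form[OF g \<xi>] by (simp add: A_coact_linear fscale_def H1_iff)
  qed
qed

text \<open>The two arguments in the product of CF are the components of the coaction; pairing the
  second with \<zeta> first leaves \<open>yd_end \<zeta> a\<close>.\<close>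

lemma star_apply:
  assumes \<xi>: "H1 \<xi>" and \<zeta>: "H1 \<zeta>"
  shows "star \<xi> \<zeta> a = \<xi> (yd_end \<zeta> a)"
proof -
  let ?F = "\<lambda>(x, w). \<zeta> w * \<xi> x"
  have F: "H2 ?F" by (rule H2_prod[OF \<xi> \<zeta>])
  note l = lins H1_tprod(1)[OF ffi_in] H2_args[OF F, simplified]
  have "star \<xi> \<zeta> a = A_coact a ?F"
    unfolding star_def A_coact_def
    by (simp add: tsum_case tsum_scalar assoc_in phii_in comult_in ffi_in pten_def F l mult.commute[of "\<xi> _"])
  then show ?thesis unfolding yd_end_form[OF \<xi> \<zeta>] .
qed

text \<open>H-linearity of \<xi> means that it absorbs the adjoint action 23 on the second
  component. The bracketing (1(23))4 then reduces to 14, the adjoint action on the first.\<close>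

lemma yd_end_act:
  assumes "\<xi> \<in> CF"
  shows "yd_end \<xi> (A_act h v) = A_act h (yd_end \<xi> v)"
proof (rule form_eqI)
  have \<xi>: "H1 \<xi>" and inv: "\<xi> (A_act h v) = \<epsilon> h * \<xi> v" for h v using assms by (auto simp: CF_iff)
  define Q :: "('h \<Rightarrow> 'k) \<Rightarrow> 'h \<times> 'h \<Rightarrow> 'k" where "Q = (\<lambda>g (x, w). \<xi> w * g x)"
  have Q: "lop H1 H2 Q"
    using H2_prod[OF _ \<xi>] by (auto simp: lop_def Q_def distrib_left)
  fix g assume g: "H1 g"
  have Qg: "H2 (Q g)" by (rule lopD(1)[OF Q, OF g])
  have c: "cact H2 [k1, k2 \<star> k3]" "cact H2 [k1 \<star> (k2 \<star> k3), k4]" "cact H2 [k1, k4]"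
    using cact_conv_outer[OF cact_k] cact_conv[OF cact_k] cact_k by auto
  have e: "(k2 \<star> k3) h (Q g) = eps h (Q g)" for h
  proof (rule ext, clarify)
    fix x w
    have "H1 (\<lambda>w. \<xi> w * g x)" using \<xi> by (simp add: H1_iff distrib_right)
    from A_act_form[OF this, of h w] show "(k2 \<star> k3) h (Q g) (x, w) = eps h (Q g) (x, w)"
      by (simp add: conv_apply pull_def lm_def rm_def Q_def eps_def inv mult.assoc[symmetric])
  qed
  have "g (yd_end \<xi> (A_act h v)) = A_coact (A_act h v) (Q g)"
    unfolding yd_end_form[OF g \<xi>] Q_def ..
  also have "\<dots> = A_coact v (((k1 \<star> (k2 \<star> k3)) \<star> k4) h (Q g))" by (rule A_coact_act_conv[OF Qg])
  finally have 1: "g (yd_end \<xi> (A_act h v)) = A_coact v (((k1 \<star> (k2 \<star> k3)) \<star> k4) h (Q g))" .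
  have 2: "((k1 \<star> (k2 \<star> k3)) \<star> k4) h (Q g) = (k1 \<star> k4) h (Q g)"
  proof (rule conv_form_cong[OF c(2,3), OF _ Qg])
    show "(k1 \<star> (k2 \<star> k3)) h (Q g) = k1 h (Q g)" for h
      by (rule absorb_conv(2)[OF c(1), OF Qg]) (rule e)
  qed
  have 3: "Q ((lmul \<star> rmulS) h g) = (k1 \<star> k4) h (Q g)"
    by (rule conv_intertwine[OF ract_lmul_rmulS Q, OF g]) (auto simp: Q_def pull_def)
  have 4: "g (A_act h (yd_end \<xi> v)) = A_coact v (Q ((lmul \<star> rmulS) h g))"
    unfolding A_act_form[OF g] yd_end_form[OF rrepD(4)[OF ract_adjoint, OF g] \<xi>] Q_def ..
  show "g (yd_end \<xi> (A_act h v)) = g (A_act h (yd_end \<xi> v))"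
    unfolding 1 2 3 4 ..
qed

text \<open>Coassociativity with \<xi> in the third slot: \<xi> absorbs 34, so the extra \<phi> in
  \<open>coassoc_form\<close> disappears and the remaining \<open>CHI\<close> in 1, 2, 5, 6 belongs
  to the coaction of the first component.\<close>

lemma yd_end_coact:
  assumes S: "bij S" and "\<xi> \<in> CF" and F: "H2 F"
  shows "A_coact (yd_end \<xi> v) F = A_coact v (\<lambda>(x, u). F (x, yd_end \<xi> u))"
proof -
  have \<xi>: "H1 \<xi>" and inv: "\<xi> (A_act h v) = \<epsilon> h * \<xi> v" for h v using assms by (auto simp: CF_iff)
  note c = cact_t_conv
  define Q :: "('h \<times> 'h \<Rightarrow> 'k) \<Rightarrow> 'h \<times> 'h \<times> 'h \<Rightarrow> 'k" where "Q = (\<lambda>K (x, y, u). \<xi> u * K (x, y))"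
  have Q: "lop H2 H3 Q"
    using \<xi> by (auto simp: lop_def Q_def distrib_left distrib_right mlin_form_def H1_iff)
  have e: "(t3 \<star> t4) h (Q K) = eps h (Q K)" if K: "H2 K" for K h
  proof (rule ext, clarify)
    fix x y u show "(t3 \<star> t4) h (Q K) (x, y, u) = eps h (Q K) (x, y, u)"
      unfolding adjoint_third_apply[OF lopD(1)[OF Q, OF K]] by (simp add: Q_def eps_def inv)
  qed
  have f: "H3 (Q F)" by (rule lopD(1)[OF Q, OF F])
  define C where "C = CHI k1 k2 k3 k4 F"
  have C: "H2 C" unfolding C_def by (rule lopD(1)[OF lop_CHI[OF cact_k], OF F])
  have "CHI t1 (t2 \<star> (t3 \<star> t4)) t5 t6 (Q F) = Q C"
    unfolding C_def
  proof (rule CHI_intertwine(1)[OF cact_k Q, OF F, symmetric])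
    fix h K assume K: "H2 K"
    have "(t2 \<star> (t3 \<star> t4)) h (Q K) = t2 h (Q K)"
      by (rule absorb_conv(2)[OF c(13), OF lopD(1)[OF Q, OF K] e[OF K]])
    then show "Q (k2 h K) = (t2 \<star> (t3 \<star> t4)) h (Q K)" by (auto simp: Q_def pull_def)
  qed (auto simp: Q_def pull_def)
  then have Y: "coassoc_form (Q F) = Q C"
    unfolding coassoc_form_def using PHI_absorb_form(3)[OF c(6), OF lopD(1)[OF Q, OF C] _ e[OF C], of \<phi>] by simp
  have G: "tcomult_fst (coassoc_form (Q F)) = (\<lambda>(x, w). \<xi> w * A_coact x F)"
  proof (rule ext, clarify)
    fix x w
    have "fix_thd w (Q C) = (\<lambda>p. \<xi> w * C p)" by (auto simp: fix_thd_def Q_def)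
    then show "tcomult_fst (coassoc_form (Q F)) (x, w) = \<xi> w * A_coact x F"
      using lopD(3)[OF lop_tcomult, OF C] A_coact_apply[OF F] by (simp add: Y tcomult_parts_apply C_def)
  qed
  have "A_coact (yd_end \<xi> v) F = A_coact v (\<lambda>(x, w). \<xi> w * A_coact x F)"
    by (rule yd_end_form[OF H1_A_coact[OF lin_simps(1)] \<xi>])
  also have "\<dots> = A_coact v (\<lambda>(x, w). A_coact w (\<lambda>(y, u). Q F (x, y, u)))"
    unfolding A_coact_iterated[OF S f] G ..
  also have "\<dots> = A_coact v (\<lambda>(x, u). F (x, yd_end \<xi> u))"
  proof -
    have "H1 (\<lambda>y. F (x, y))" for x by (simp add: lins H2_args[OF F])
    from yd_end_form[OF this \<xi>] show ?thesis by (simp add: Q_def)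
  qed
  finally show ?thesis .
qed

lemma yd_end_in: "bij S \<Longrightarrow> \<xi> \<in> CF \<Longrightarrow> yd_end \<xi> \<in> EndA"
  unfolding EndA_iff using yd_end_act yd_end_coact lin_yd_end by (simp add: CF_iff)

lemma counit_A_act: "\<epsilon> (A_act h v) = \<epsilon> h * \<epsilon> v"
proof -
  have "\<epsilon> (A_act h v) = \<Delta> h (\<lambda>(u1, u2). \<epsilon> u1 * (\<epsilon> v * \<epsilon> u2))"
    unfolding A_act_form[OF counit_linear]
    by (simp add: conv_apply pull_def lm_def rm_def counit_mult eps_S mult.assoc)
  also have "\<dots> = \<epsilon> v * \<epsilon> h"
    using counit_left_form[of "\<lambda>x. \<epsilon> v * \<epsilon> x" h] counit_linear by (simp add: H1_iff distrib_left)
  finally show ?thesis by simp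
qed

lemma counit_comp_in:
  assumes "f \<in> EndA"
  shows "\<epsilon> \<circ> f \<in> CF"
  using assms counit_linear by (auto simp: EndA_iff CF_iff counit_A_act H1_iff lin_def)

lemma counit_yd_end:
  assumes "bij S" "H1 \<xi>"
  shows "\<epsilon> \<circ> yd_end \<xi> = \<xi>"
proof
  fix a show "(\<epsilon> \<circ> yd_end \<xi>) a = \<xi> a"
    using A_coact_counit_form(1)[OF assms, of a]
    by (simp add: yd_end_form[OF counit_linear assms(2)] counit_fst_def mult.commute)
qed

text \<open>As f preserves coactions, contracting the coaction of a with \<epsilon> after f amounts
  to contracting the coaction of \<open>f a\<close> with \<epsilon>, which gives \<open>f a\<close>
  back.\<close>

lemma yd_end_counit:
  assumes S: "bij S" and f: "f \<in> EndA"
  shows "yd_end (\<epsilon> \<circ> f) = f"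
proof
  fix a
  show "yd_end (\<epsilon> \<circ> f) a = f a"
  proof (rule form_eqI)
    fix g assume g: "H1 g"
    have \<xi>: "H1 (\<epsilon> \<circ> f)" using counit_comp_in[OF f] by (simp add: CF_iff)
    have "g (yd_end (\<epsilon> \<circ> f) a) = A_coact a (\<lambda>(x, u). counit_snd g (x, f u))"
      unfolding yd_end_form[OF g \<xi>] by (simp add: counit_snd_def mult.commute)
    also have "\<dots> = A_coact (f a) (counit_snd g)" using f lopD(1)[OF lop_counit_snd, OF g] by (simp add: EndA_iff)
    also have "\<dots> = g (f a)" by (rule A_coact_counit_form(2)[OF S g])
    finally show "g (yd_end (\<epsilon> \<circ> f) a) = g (f a)" .
  qed
qed

lemma EndA_comp: "f \<in> EndA \<Longrightarrow> g \<in> EndA \<Longrightarrow> f \<circ> g \<in> EndA"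
proof -
  assume f: "f \<in> EndA" and g: "g \<in> EndA"
  have "A_coact (f (g v)) F = A_coact v (\<lambda>(x, u). F (x, f (g u)))" if F: "H2 F" for v F
  proof -
    have "H2 (\<lambda>(x, u). F (x, f u))" using f by (simp add: EndA_iff lins H2_args[OF F])
    then show ?thesis using f g F by (simp add: EndA_iff)
  qed
  then show ?thesis using f g by (simp add: EndA_iff lin_def)
qed

lemma counit_in: "\<epsilon> \<in> CF"
  by (simp add: CF_iff counit_linear counit_A_act)

lemma star_eq: "bij S \<Longrightarrow> \<xi> \<in> CF \<Longrightarrow> \<zeta> \<in> CF \<Longrightarrow> star \<xi> \<zeta> = \<epsilon> \<circ> (yd_end \<xi> \<circ> yd_end \<zeta>)"
  using star_apply[of \<xi> \<zeta>] counit_yd_end[of \<xi>] by (simp add: CF_iff fun_eq_iff)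

section \<open>The two algebras and their isomorphism\<close>

lemma id_in: "id \<in> EndA"
  by (simp add: EndA_iff lin_def)

lemma EndA_add:
  assumes f: "f \<in> EndA" and g: "g \<in> EndA"
  shows "f + g \<in> EndA"
  unfolding EndA_iff
proof (intro conjI allI impI)
  show "lin (f + g)" using f g by (simp add: EndA_iff lin_def algebra_simps scale_right_distrib)
  show "(f + g) (A_act h v) = A_act h ((f + g) v)" for h v
    using f g A_act_lin(2)[OF lin_simps(1), of h] by (simp add: EndA_iff lin_def)
  fix v F assume F: "H2 F"
  have F': "H2 (\<lambda>(x, u). F (x, f u))" "H2 (\<lambda>(x, u). F (x, g u))"
    using f g by (simp_all add: EndA_iff lins H2_args[OF F])
  have "A_coact ((f + g) v) F = A_coact v (\<lambda>(x, u). F (x, f u)) + A_coact v (\<lambda>(x, u). F (x, g u))"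
    using f g F by (simp add: EndA_iff A_coact_linear)
  also have "\<dots> = A_coact v (\<lambda>(x, u). F (x, (f + g) u))"
    using tprod_eval_add[OF A_coact_in form_space_H(2), OF F', of v] H2_args(2)[OF F lin_simps(1)]
    by (simp add: case_prod_unfold H1_iff)
  finally show "A_coact ((f + g) v) F = A_coact v (\<lambda>(x, u). F (x, (f + g) u))" .
qed

lemma EndA_scale:
  assumes f: "f \<in> EndA"
  shows "fscale scale c f \<in> EndA"
  unfolding EndA_iff
proof (intro conjI allI impI)
  show "lin (fscale scale c f)"
    using f by (simp add: EndA_iff lin_def fscale_def scale_right_distrib scale_left_commute)
  show "fscale scale c f (A_act h v) = A_act h (fscale scale c f v)" for h v
    using f A_act_lin(2)[OF lin_simps(1), of h] by (simp add: EndA_iff lin_def fscale_def)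
  fix v F assume F: "H2 F"
  have F': "H2 (\<lambda>(x, u). F (x, f u))" using f by (simp add: EndA_iff lins H2_args[OF F])
  have "A_coact (fscale scale c f v) F = c * A_coact v (\<lambda>(x, u). F (x, f u))"
    using f F by (simp add: EndA_iff A_coact_linear fscale_def)
  also have "\<dots> = A_coact v (\<lambda>(x, u). F (x, fscale scale c f u))"
    using tprod_eval_scale[OF A_coact_in form_space_H(2), OF F', of v c] H2_args(2)[OF F lin_simps(1)]
    by (simp add: case_prod_unfold H1_iff fscale_def)
  finally show "A_coact (fscale scale c f v) F = A_coact v (\<lambda>(x, u). F (x, fscale scale c f u))" .
qed

lemma EndA_lin: "f \<in> EndA \<Longrightarrow> lin f"
  by (simp add: EndA_iff)

lemma algebra_on_EndA: "algebra_on (fscale scale) EndA (\<circ>) id"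
proof -
  interpret F: vector_space "fscale scale"
    by (rule vector_space_fscale[OF vector_space_axioms])
  \<comment> \<open>Zero is obtained as the multiple of the identity by 0.\<close>
  have "0 \<in> EndA" using EndA_scale[OF id_in, of 0] by simp
  then have "F.subspace EndA" by (simp add: F.subspace_def EndA_add EndA_scale)
  then show ?thesis
    by unfold_locales (auto simp: EndA_comp id_in fun_eq_iff fscale_def lin_def dest: EndA_lin)
qed

lemma bij_betw_yd_end: "bij S \<Longrightarrow> bij_betw yd_end CF EndA"
  by (rule bij_betw_byWitness[where f' = "\<lambda>f. \<epsilon> \<circ> f"])
    (auto simp: yd_end_in counit_comp_in yd_end_counit counit_yd_end CF_iff[THEN iffD1])

lemma yd_end_add: "yd_end (\<xi> + \<zeta>) = yd_end \<xi> + yd_end \<zeta>" if "H1 \<xi>" "H1 \<zeta>"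
proof (intro ext form_eqI)
  fix a g assume g: "H1 g"
  have "H1 (\<xi> + \<zeta>)" using that by (simp add: H1_iff algebra_simps)
  then show "g (yd_end (\<xi> + \<zeta>) a) = g ((yd_end \<xi> + yd_end \<zeta>) a)"
    using tprod_eval_add[OF A_coact_in form_space_H(2), OF H2_prod[OF g that(1)] H2_prod[OF g that(2)], of a] g
    by (simp add: yd_end_form that H1_iff[of g] case_prod_unfold distrib_right)
qed

lemma yd_end_scale: "yd_end (tscale c \<xi>) = fscale scale c (yd_end \<xi>)" if "H1 \<xi>"
proof (intro ext form_eqI)
  fix a g assume g: "H1 g"
  have "H1 (tscale c \<xi>)" using that by (simp add: H1_iff fscale_def algebra_simps)
  then show "g (yd_end (tscale c \<xi>) a) = g (fscale scale c (yd_end \<xi>) a)"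
    using tprod_eval_scale[OF A_coact_in form_space_H(2), OF H2_prod[OF g that], of a c] g
    by (simp add: yd_end_form that H1_iff[of g] case_prod_unfold fscale_def mult.assoc)
qed

lemma star_in: "bij S \<Longrightarrow> \<xi> \<in> CF \<Longrightarrow> \<zeta> \<in> CF \<Longrightarrow> star \<xi> \<zeta> \<in> CF"
  unfolding star_eq by (intro counit_comp_in EndA_comp yd_end_in)

lemma yd_end_star: "bij S \<Longrightarrow> \<xi> \<in> CF \<Longrightarrow> \<zeta> \<in> CF \<Longrightarrow> yd_end (star \<xi> \<zeta>) = yd_end \<xi> \<circ> yd_end \<zeta>"
  unfolding star_eq by (intro yd_end_counit EndA_comp yd_end_in)

lemma yd_end_unit: "bij S \<Longrightarrow> yd_end \<epsilon> = id"
  using yd_end_counit[OF _ id_in] by simp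

lemma algebra_iso_yd_end:
  "bij S \<Longrightarrow> algebra_iso tscale CF star \<epsilon> (fscale scale) EndA (\<circ>) id yd_end"
  unfolding algebra_iso_def
  by (auto simp: bij_betw_yd_end yd_end_add yd_end_scale yd_end_star yd_end_unit CF_iff[THEN iffD1])

text \<open>All axioms are transported along the injective map \<open>yd_end\<close>: associativity
  of the product is that of composition, and \<epsilon> is the unit because it corresponds to the
  identity.\<close>

lemma algebra_on_CF:
  assumes S: "bij S"
  shows "algebra_on tscale CF star \<epsilon>"
proof -
  interpret F: vector_space "tscale :: 'k \<Rightarrow> ('h \<Rightarrow> 'k) \<Rightarrow> 'h \<Rightarrow> 'k"
    by (rule vector_space_fscale[OF vector_space_mult])
  interpret E: algebra_on "fscale scale" EndA "(\<circ>)" id by (rule algebra_on_EndA)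
  have sub: "F.subspace CF"
    unfolding F.subspace_def by (auto simp: CF_iff H1_iff fscale_def algebra_simps)
  have H: "H1 \<xi>" if "\<xi> \<in> CF" for \<xi> using that by (simp add: CF_iff)
  note cl = F.subspace_add[OF sub] F.subspace_scale[OF sub] star_in[OF S] counit_in
  note hom = yd_end_in[OF S] yd_end_star[OF S] yd_end_unit[OF S] yd_end_add[OF H H] yd_end_scale[OF H]
  have eqI: "\<xi> = \<zeta>" if "yd_end \<xi> = yd_end \<zeta>" "\<xi> \<in> CF" "\<zeta> \<in> CF" for \<xi> \<zeta>
    using bij_betw_imp_inj_on[OF bij_betw_yd_end[OF S]] that by (auto dest: inj_onD)
  show ?thesis
    by unfold_locales
      (rule sub cl | assumption |
        (rule eqI, simp_all add: hom cl E.mult_add_left E.mult_add_right E.mult_scale_left E.mult_scale_right o_assoc))+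
qed

end

theorem theorem5p7:
  fixes scale :: "'k::field \<Rightarrow> 'h::ring_1 \<Rightarrow> 'h"
    and \<Delta> :: "'h \<Rightarrow> (('h \<times> 'h \<Rightarrow> 'k) \<Rightarrow> 'k)"
    and \<epsilon> :: "'h \<Rightarrow> 'k"
    and \<phi> :: "('h \<times> 'h \<times> 'h \<Rightarrow> 'k) \<Rightarrow> 'k"
    and S :: "'h \<Rightarrow> 'h"
    and \<alpha> \<beta> :: 'h
  defines "act \<equiv> quasi_hopf_data.A_act scale \<Delta> S"
    and "coact \<equiv> quasi_hopf_data.A_coact scale \<Delta> \<phi> S \<alpha> \<beta>"
  defines "CF \<equiv> quasi_hopf_data.CF scale \<Delta> \<epsilon> S"
    and "star \<equiv> quasi_hopf_data.star scale \<Delta> \<phi> S \<alpha> \<beta>"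
    and "EndA \<equiv> quasi_hopf_data.yd_homs scale scale act coact scale act coact"
  assumes "quasi_hopf_algebra scale \<Delta> \<epsilon> \<phi> S \<alpha> \<beta>"
    and "bij S"
  shows "yd_module scale \<Delta> \<epsilon> \<phi> S \<alpha> \<beta> scale act coact \<and>
    (\<exists>e. algebra_on tscale CF star e \<and>
      algebra_on (fscale scale) EndA (\<circ>) id \<and>
      (\<exists>\<Phi>. algebra_iso tscale CF star e (fscale scale) EndA (\<circ>) id \<Phi>))"
proof -
  interpret quasi_hopf_algebra scale \<Delta> \<epsilon> \<phi> S \<alpha> \<beta> by fact
  show ?thesis
    unfolding assms(1-5)
    using yd_module_A algebra_on_CF algebra_on_EndA algebra_iso_yd_end \<open>bij S\<close> by blast
qed

end
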